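(* Given an arbitrary $f\in L^2(\mathbb{R}^n)$ the following hold: (a) $\mathrm{G}_{m,\mathrm H}f(x)\le\mathcal{G}_{m,\mathrm H}f(x)$ for every $x\in\mathbb{R}^n$ and all $m\in\mathbb{N}_0$. (b) Given $m\in\mathbb{N}$, $\|\mathcal{S}_{m,\mathrm H}f\|_{L^p(w)}\lesssim\|\mathcal{S}_{\mathrm H}f\|_{L^p(w)}$ for all $w\in A_\infty$ and $0<p<\infty$. (c) Given $m\in\mathbb{N}$, $\|\mathcal{G}_{m,\mathrm H}f\|_{L^p(w)}\lesssim\|\mathcal{S}_{\mathrm H}f\|_{L^p(w)}$ for all $w\in A_\infty$ and $0<p<\infty$.
   Context: Operator. Let $A$ be an $n\times n$ matrix of complex-valued $L^\infty$ coefficients on $\mathbb{R}^n$ that is elliptic: there are $0<\lambda\le\Lambda<\infty$ with $\lambda|\xi|^2\le \mathrm{Re}\,A(x)\xi\cdot\bar\xi$ and $|A(x)\xi\cdot\bar\zeta|\le\Lambda|\xi||\zeta|$ for all $\xi,\zeta\in\mathbb{C}^n$ and a.e. $x\in\mathbb{R}^n$ (where $\xi\cdot\zeta=\sum_i\xi_i\zeta_i$). Let $Lf=-\mathrm{div}(A\nabla f)$, understood in the weak sense as the maximal-accretive operator on $L^2(\mathbb{R}^n)$ defined by the associated sesquilinear form. $-L$ generates a $C^0$-semigroup of contractions $\{e^{-tL}\}_{t>0}$ on $L^2(\mathbb{R}^n)$ (the Heat semigroup). Square functions. $\Gamma(x)=\{(y,t)\in\mathbb{R}^n\times(0,\infty):|x-y|<t\}$;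 $\nabla_y$ is the gradient in $y\in\mathbb{R}^n$ and $\nabla_{y,t}$ the full gradient in $(y,t)$. For $m\in\mathbb{N}=\{1,2,\dots\}$, $$\mathcal{S}_{m,\mathrm H}f(x)=\Big(\iint_{\Gamma(x)}|(t^2L)^me^{-t^2L}f(y)|^2\frac{dy\,dt}{t^{n+1}}\Big)^{1/2},$$ and for $m\in\mathbb{N}_0=\mathbb{N}\cup\{0\}$, $$\mathrm{G}_{m,\mathrm H}f(x)=\Big(\iint_{\Gamma(x)}|t\nabla_y(t^2L)^me^{-t^2L}f(y)|^2\frac{dy\,dt}{t^{n+1}}\Big)^{1/2},\qquad \mathcal{G}_{m,\mathrm H}f(x)=\Big(\iint_{\Gamma(x)}|t\nabla_{y,t}(t^2L)^me^{-t^2L}f(y)|^2\frac{dy\,dt}{t^{n+1}}\Big)^{1/2}.$$ Write $\mathcal{S}_{\mathrm H}=\mathcal{S}_{1,\mathrm H}$. Weights. A weight is a positive locally integrable function on $\mathbb{R}^n$; $A_p$ ($1\le p<\infty$) are the usual Muckenhoupt classes (defined with balls), and $A_\infty=\bigcup_{1\le p<\infty}A_p$. $\|g\|_{L^p(w)}=(\int_{\mathbb{R}^n}|g|^pw\,dx)^{1/p}$. The notation $X\lesssim Y$ means $X\le CY$ with a finite constant $C$ independent of $f$ (it may depend on $n$, $m$, $p$, $w$ and $L$). *)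

theory Defs
  imports "HOL-Analysis.Analysis"
begin

section \<open>Square-integrable functions, weak gradients and the Sobolev space\<close>

text \<open>
  Elements of function spaces are represented by actual functions, not by classes modulo equality
  almost everywhere; objects that are only determined up to null sets appear as relations, or as
  representatives picked by the choice operator, and are used only in ways that do not depend on
  the representative.
\<close>

definition L2 :: "(real^'n \<Rightarrow> 'b::real_normed_vector) set" where
  "L2 = {f. f \<in> borel_measurable lebesgue \<and> integrable lebesgue (\<lambda>x. (norm (f x))\<^sup>2)}"

definition L2_norm :: "(real^'n \<Rightarrow> 'b::real_normed_vector) \<Rightarrow> real" where
  "L2_norm f = sqrt (LINT x|lebesgue. (norm (f x))\<^sup>2)"

definition partial_deriv :: "'n \<Rightarrow> (real^'n \<Rightarrow> real) \<Rightarrow> real^'n \<Rightarrow> real" where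
  "partial_deriv i \<phi> x = frechet_derivative \<phi> (at x) (axis i 1)"

primrec C_k :: "nat \<Rightarrow> (real^'n \<Rightarrow> real) \<Rightarrow> bool" where
  "C_k 0 \<phi> \<longleftrightarrow> continuous_on UNIV \<phi>"
| "C_k (Suc k) \<phi> \<longleftrightarrow> (\<forall>x. \<phi> differentiable (at x)) \<and> (\<forall>i. C_k k (partial_deriv i \<phi>))"

definition test_functions :: "(real^'n \<Rightarrow> real) set" where
  "test_functions = {\<phi>. (\<forall>k. C_k k \<phi>) \<and> compact (closure {x. \<phi> x \<noteq> 0})}"

definition has_weak_gradient :: "(real^'n \<Rightarrow> complex) \<Rightarrow> (real^'n \<Rightarrow> complex^'n) \<Rightarrow> bool" where
  "has_weak_gradient u g \<longleftrightarrow> u \<in> L2 \<and> g \<in> L2 \<and>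
     (\<forall>\<phi>\<in>test_functions. \<forall>i.
        (LINT x|lebesgue. u x * complex_of_real (partial_deriv i \<phi> x)) =
        - (LINT x|lebesgue. g x $ i * complex_of_real (\<phi> x)))"

definition W12 :: "(real^'n \<Rightarrow> complex) set" where
  "W12 = {u. \<exists>g. has_weak_gradient u g}"

definition weak_gradient :: "(real^'n \<Rightarrow> complex) \<Rightarrow> real^'n \<Rightarrow> complex^'n" where
  "weak_gradient u = (SOME g. has_weak_gradient u g)"


section \<open>Elliptic operators in divergence form\<close>

definition cdot :: "complex^'n \<Rightarrow> complex^'n \<Rightarrow> complex"  (infixl "\<cdot>\<^sub>c" 70) where
  "\<xi> \<cdot>\<^sub>c \<zeta> = (\<Sum>i\<in>UNIV. \<xi> $ i * \<zeta> $ i)"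

definition vec_cnj :: "complex^'n \<Rightarrow> complex^'n" where
  "vec_cnj \<xi> = (\<chi> i. cnj (\<xi> $ i))"

text \<open>Essential boundedness of the coefficients is contained in the upper bound.\<close>

definition elliptic :: "(real^'n \<Rightarrow> complex^'n^'n) \<Rightarrow> bool" where
  "elliptic A \<longleftrightarrow> (\<forall>i j. (\<lambda>x. A x $ i $ j) \<in> borel_measurable lebesgue) \<and>
     (\<exists>l M::real. 0 < l \<and> l \<le> M \<and>
        (AE x in lebesgue. \<forall>\<xi> \<zeta>.
           l * (norm \<xi>)\<^sup>2 \<le> Re ((A x *v \<xi>) \<cdot>\<^sub>c vec_cnj \<xi>) \<and>
           cmod ((A x *v \<xi>) \<cdot>\<^sub>c vec_cnj \<zeta>) \<le> M * norm \<xi> * norm \<zeta>))"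

definition sesquilinear_form ::
  "(real^'n \<Rightarrow> complex^'n^'n) \<Rightarrow> (real^'n \<Rightarrow> complex) \<Rightarrow> (real^'n \<Rightarrow> complex) \<Rightarrow> complex" where
  "sesquilinear_form A u v =
     (LINT x|lebesgue. (A x *v weak_gradient u x) \<cdot>\<^sub>c vec_cnj (weak_gradient v x))"

text \<open>
  The graph of the operator associated with the form, whose form domain is \<open>W12\<close>:
  \<open>div_op_graph A u g\<close> says that \<open>u\<close> lies in the domain of \<open>L\<close> and that \<open>L u = g\<close>.
\<close>

definition div_op_graph ::
  "(real^'n \<Rightarrow> complex^'n^'n) \<Rightarrow> (real^'n \<Rightarrow> complex) \<Rightarrow> (real^'n \<Rightarrow> complex) \<Rightarrow> bool" where
  "div_op_graph A u g \<longleftrightarrow> u \<in> W12 \<and> g \<in> L2 \<and>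
     (\<forall>v\<in>W12. sesquilinear_form A u v = (LINT x|lebesgue. g x * cnj (v x)))"

definition div_op :: "(real^'n \<Rightarrow> complex^'n^'n) \<Rightarrow> (real^'n \<Rightarrow> complex) \<Rightarrow> real^'n \<Rightarrow> complex" where
  "div_op A u = (SOME g. div_op_graph A u g)"


section \<open>The heat semigroup\<close>

definition C0_contraction_semigroup ::
  "(real \<Rightarrow> (real^'n \<Rightarrow> complex) \<Rightarrow> real^'n \<Rightarrow> complex) \<Rightarrow> bool" where
  "C0_contraction_semigroup T \<longleftrightarrow>
     (\<forall>t\<ge>0. \<forall>f\<in>L2. T t f \<in> L2 \<and> L2_norm (T t f) \<le> L2_norm f) \<and>
     (\<forall>t\<ge>0. \<forall>f\<in>L2. \<forall>g\<in>L2. \<forall>a b.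
        AE x in lebesgue. T t (\<lambda>y. a * f y + b * g y) x = a * T t f x + b * T t g x) \<and>
     (\<forall>f\<in>L2. AE x in lebesgue. T 0 f x = f x) \<and>
     (\<forall>s\<ge>0. \<forall>t\<ge>0. \<forall>f\<in>L2. AE x in lebesgue. T (s + t) f x = T s (T t f) x) \<and>
     (\<forall>f\<in>L2. ((\<lambda>t. L2_norm (\<lambda>x. T t f x - f x)) \<longlongrightarrow> 0) (at_right 0))"

text \<open>
  \<open>T t\<close> is \<open>e\<^sup>-\<^sup>t\<^sup>L\<close>: the infinitesimal generator of \<open>T\<close>, including its domain, is \<open>-L\<close>.
  This determines each \<open>T t f\<close> up to a null set.
\<close>

definition heat_semigroup ::
  "(real^'n \<Rightarrow> complex^'n^'n) \<Rightarrow> (real \<Rightarrow> (real^'n \<Rightarrow> complex) \<Rightarrow> real^'n \<Rightarrow> complex) \<Rightarrow> bool" where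
  "heat_semigroup A T \<longleftrightarrow> C0_contraction_semigroup T \<and>
     (\<forall>u\<in>L2. \<forall>g\<in>L2. div_op_graph A u g \<longleftrightarrow>
        ((\<lambda>t. L2_norm (\<lambda>x. (T t u x - u x) /\<^sub>R t + g x)) \<longlongrightarrow> 0) (at_right 0))"

text \<open>The function \<open>(t\<^sup>2 L)\<^sup>m e\<^sup>-\<^sup>s\<^sup>L f\<close> with \<open>s = t\<^sup>2\<close>.\<close>

definition heat_family ::
  "(real^'n \<Rightarrow> complex^'n^'n) \<Rightarrow> (real \<Rightarrow> (real^'n \<Rightarrow> complex) \<Rightarrow> real^'n \<Rightarrow> complex) \<Rightarrow> nat
     \<Rightarrow> (real^'n \<Rightarrow> complex) \<Rightarrow> real \<Rightarrow> real^'n \<Rightarrow> complex" where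
  "heat_family A T m f t = ((\<lambda>u y. t\<^sup>2 *\<^sub>R div_op A u y) ^^ m) (T (t\<^sup>2) f)"

text \<open>The derivative in \<open>t\<close> of a family of functions is taken in the norm of \<open>L\<^sup>2\<close>.\<close>

definition has_time_deriv ::
  "(real \<Rightarrow> real^'n \<Rightarrow> complex) \<Rightarrow> (real^'n \<Rightarrow> complex) \<Rightarrow> real \<Rightarrow> bool" where
  "has_time_deriv u v t \<longleftrightarrow> v \<in> L2 \<and>
     ((\<lambda>h. L2_norm (\<lambda>y. (u (t + h) y - u t y) /\<^sub>R h - v y)) \<longlongrightarrow> 0) (at 0)"

definition time_deriv :: "(real \<Rightarrow> real^'n \<Rightarrow> complex) \<Rightarrow> real \<Rightarrow> real^'n \<Rightarrow> complex" where
  "time_deriv u t = (SOME v. has_time_deriv u v t)"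

definition full_gradient ::
  "(real \<Rightarrow> real^'n \<Rightarrow> complex) \<Rightarrow> real \<Rightarrow> real^'n \<Rightarrow> (complex^'n) \<times> complex" where
  "full_gradient u t y = (weak_gradient (u t) y, time_deriv u t y)"


section \<open>Conical square functions\<close>

text \<open>Only used with a positive exponent.\<close>

definition ennreal_powr :: "ennreal \<Rightarrow> real \<Rightarrow> ennreal" where
  "ennreal_powr x a = (if x = \<infinity> then \<infinity> else ennreal (enn2real x powr a))"

definition cone :: "real^'n \<Rightarrow> ((real^'n) \<times> real) set" where
  "cone x = {(y, t). 0 < t \<and> norm (x - y) < t}"

text \<open>
  The integral over the cone is written as an iterated integral, first in \<open>y\<close> and then in \<open>t\<close>:
  for fixed \<open>t\<close> the integrand is determined up to a null set in \<open>y\<close>, so the inner integral does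
  not depend on the choice of representatives, whereas an arbitrary choice for each \<open>t\<close> need not be
  jointly measurable. The value may be infinite.
\<close>

definition conical :: "(real \<Rightarrow> real^'n \<Rightarrow> 'b::real_normed_vector) \<Rightarrow> real^'n \<Rightarrow> ennreal" where
  "conical F x = ennreal_powr
     (\<integral>\<^sup>+t\<in>{0<..}. (\<integral>\<^sup>+y\<in>{y. (y, t) \<in> cone x}.
        ennreal ((norm (F t y))\<^sup>2 / t ^ (CARD('n) + 1)) \<partial>lebesgue) \<partial>lebesgue) (1/2)"

definition S_H ::
  "(real^'n \<Rightarrow> complex^'n^'n) \<Rightarrow> (real \<Rightarrow> (real^'n \<Rightarrow> complex) \<Rightarrow> real^'n \<Rightarrow> complex) \<Rightarrow> nat
     \<Rightarrow> (real^'n \<Rightarrow> complex) \<Rightarrow> real^'n \<Rightarrow> ennreal" where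
  "S_H A T m f = conical (heat_family A T m f)"

definition G_H ::
  "(real^'n \<Rightarrow> complex^'n^'n) \<Rightarrow> (real \<Rightarrow> (real^'n \<Rightarrow> complex) \<Rightarrow> real^'n \<Rightarrow> complex) \<Rightarrow> nat
     \<Rightarrow> (real^'n \<Rightarrow> complex) \<Rightarrow> real^'n \<Rightarrow> ennreal" where
  "G_H A T m f = conical (\<lambda>t y. t *\<^sub>R weak_gradient (heat_family A T m f t) y)"

definition G_full_H ::
  "(real^'n \<Rightarrow> complex^'n^'n) \<Rightarrow> (real \<Rightarrow> (real^'n \<Rightarrow> complex) \<Rightarrow> real^'n \<Rightarrow> complex) \<Rightarrow> nat
     \<Rightarrow> (real^'n \<Rightarrow> complex) \<Rightarrow> real^'n \<Rightarrow> ennreal" where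
  "G_full_H A T m f = conical (\<lambda>t y. t *\<^sub>R full_gradient (heat_family A T m f) t y)"


section \<open>Muckenhoupt weights\<close>

definition weight :: "(real^'n \<Rightarrow> real) \<Rightarrow> bool" where
  "weight w \<longleftrightarrow> (AE x in lebesgue. 0 < w x) \<and> (\<forall>K. compact K \<longrightarrow> w absolutely_integrable_on K)"

text \<open>
  Averages of nonnegative functions, possibly infinite. Using the Bochner integral instead would
  turn non-integrable negative powers of a weight into functions of average zero.
\<close>

definition average :: "(real^'n) set \<Rightarrow> (real^'n \<Rightarrow> real) \<Rightarrow> ennreal" where
  "average B g = (\<integral>\<^sup>+x\<in>B. ennreal (g x) \<partial>lebesgue) / emeasure lebesgue B"

definition A_p :: "real \<Rightarrow> (real^'n \<Rightarrow> real) set" where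
  "A_p p = {w. weight w \<and> (\<exists>C::real. \<forall>z r. 0 < r \<longrightarrow>
     (if p = 1
      then (AE x in lebesgue. x \<in> ball z r \<longrightarrow> average (ball z r) w \<le> ennreal (C * w x))
      else average (ball z r) w
             * ennreal_powr (average (ball z r) (\<lambda>x. w x powr (- 1 / (p - 1)))) (p - 1)
           \<le> ennreal C))}"

definition A_infinity :: "(real^'n \<Rightarrow> real) set" where
  "A_infinity = (\<Union>p\<in>{1..}. A_p p)"

definition weighted_norm :: "real \<Rightarrow> (real^'n \<Rightarrow> real) \<Rightarrow> (real^'n \<Rightarrow> ennreal) \<Rightarrow> ennreal" where
  "weighted_norm p w g =
     ennreal_powr (\<integral>\<^sup>+x. ennreal_powr (g x) p * ennreal (w x) \<partial>lebesgue) (1 / p)"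

end

theory Submission imports Defs "HOL-Library.Nat_Bijection"
begin

text \<open>The data give no pointwise control: \<open>T\<close> is known only through its
  generator, \<open>heat_family\<close> chooses representatives separately for each t, and no kernel
  bounds are assumed. So each family is turned into a continuous path in a Hilbert space of classes,
  and smoothing, differentiability in time and continuity of the gradient are derived from
  ellipticity alone. A real inner product suffices, because every energy identity uses only the real
  part of the form. Since the families are not known to be jointly measurable in (y, t),
  measurability is established only for their integrals over balls, as functions of centre and time.
  The step from level m to m + 1 avoids the time derivative of the gradient: the equation of level m
  turns the local norm of level m + 1 into a product of the two gradients, and the gradient of level
  m + 1 is absorbed by its own energy inequality. Squares of square functions are compared, so the
  norm in L^p(w) becomes an integral of the power q = p/2. Any q > 0 occurs, which forces three
  arguments for the change of aperture: q < 1, q = 1 and q > 1.\<close>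

text \<open>
  Put \<open>u\<^sub>m(t) = L\<^sup>m e\<^bsup>-t\<^sup>2L\<^esup> f\<close>. Then \<open>u\<^sub>m' = -2t u\<^sub>m\<^sub>+\<^sub>1\<close>, and testing the weak equation for \<open>u\<^sub>m\<close> and \<open>u\<^sub>m\<^sub>+\<^sub>1\<close> against
  these functions cut off in a ball of radius \<open>r\<close> gives a parabolic Caccioppoli inequality: the energies
  \<open>r\<^sup>4 \<bar>u\<^sub>m\<^sub>+\<^sub>1\<bar>\<^sup>2 + r\<^sup>2 \<bar>\<nabla>u\<^sub>m\<bar>\<^sup>2\<close>, integrated over \<open>t\<close> in \<open>[r, 2r]\<close> and over the ball, are controlled by \<open>\<bar>u\<^sub>m\<bar>\<^sup>2\<close> integrated
  over \<open>[r/2, 2r]\<close> and a larger ball. Summing over dyadic \<open>r\<close> bounds the square functions of level \<open>m + 1\<close>,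
  and the gradient ones of level \<open>m\<close>, pointwise by the square function of level \<open>m\<close> over a cone of larger
  aperture. A weight in \<open>A\<^sub>\<infinity>\<close> is doubling, and for a doubling measure the \<open>L\<^sup>p\<close> norms of conical square
  functions of different apertures are comparable for every \<open>p > 0\<close>; induction on \<open>m\<close> descends to level 1.
\<close>



section \<open>The Hilbert space of classes of square-integrable functions\<close>

lemma L2_measurable: "f \<in> L2 \<Longrightarrow> f \<in> borel_measurable lebesgue"
  by (simp add: L2_def)

lemma L2_integrable: "f \<in> L2 \<Longrightarrow> integrable lebesgue (\<lambda>x. (norm (f x))\<^sup>2)"
  by (simp add: L2_def)

lemma L2_cong_AE:
  fixes f g :: "real^'n \<Rightarrow> 'b::euclidean_space"
  assumes f: "f \<in> L2" and ae: "AE x in lebesgue. f x = g x"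
  shows "g \<in> L2"
proof -
  have g: "g \<in> borel_measurable lebesgue"
    using borel_measurable_AE[OF _ ae] f by (simp add: L2_def)
  have "integrable lebesgue (\<lambda>x. (norm (f x))\<^sup>2) = integrable lebesgue (\<lambda>x. (norm (g x))\<^sup>2)"
    using f g by (intro integrable_cong_AE eventually_mono[OF ae]) (auto simp: L2_def)
  then show ?thesis using f g by (simp add: L2_def)
qed

lemma L2_bound:
  fixes f :: "real^'n \<Rightarrow> 'b::euclidean_space" and g :: "real^'n \<Rightarrow> 'c::euclidean_space"
  assumes f: "f \<in> L2" and g: "g \<in> borel_measurable lebesgue"
    and b: "AE x in lebesgue. norm (g x) \<le> K * norm (f x)"
  shows "g \<in> L2"
proof -
  have "integrable lebesgue (\<lambda>x. K\<^sup>2 * (norm (f x))\<^sup>2)"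
    using L2_integrable[OF f] by simp
  moreover have "AE x in lebesgue. norm ((norm (g x))\<^sup>2) \<le> norm (K\<^sup>2 * (norm (f x))\<^sup>2)"
    using b
  proof eventually_elim
    case (elim x)
    then have "(norm (g x))\<^sup>2 \<le> (K * norm (f x))\<^sup>2" by (intro power_mono) auto
    then show ?case by (simp add: power_mult_distrib)
  qed
  ultimately have "integrable lebesgue (\<lambda>x. (norm (g x))\<^sup>2)"
    by (intro Bochner_Integration.integrable_bound[OF \<open>integrable lebesgue (\<lambda>x. K\<^sup>2 * (norm (f x))\<^sup>2)\<close>])
       (use g in auto)
  then show ?thesis using g by (simp add: L2_def)
qed

lemma L2_zero [simp]: "(\<lambda>_. 0) \<in> L2"
  by (simp add: L2_def)

lemma L2_add:
  fixes f g :: "real^'n \<Rightarrow> 'b::euclidean_space"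
  assumes f: "f \<in> L2" and g: "g \<in> L2"
  shows "(\<lambda>x. f x + g x) \<in> L2"
proof -
  note [measurable] = L2_measurable[OF f] L2_measurable[OF g]
  have "integrable lebesgue (\<lambda>x. 2 * (norm (f x))\<^sup>2 + 2 * (norm (g x))\<^sup>2)"
    using L2_integrable[OF f] L2_integrable[OF g] by simp
  moreover have "(norm (f x + g x))\<^sup>2 \<le> 2 * (norm (f x))\<^sup>2 + 2 * (norm (g x))\<^sup>2" for x
  proof -
    have "(norm (f x + g x))\<^sup>2 \<le> (norm (f x) + norm (g x))\<^sup>2"
      by (intro power_mono norm_triangle_ineq) auto
    also have "\<dots> \<le> 2 * (norm (f x))\<^sup>2 + 2 * (norm (g x))\<^sup>2"
      using sum_squares_bound[of "norm (f x)" "norm (g x)"] by (simp add: power2_sum)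
    finally show ?thesis .
  qed
  ultimately have "integrable lebesgue (\<lambda>x. (norm (f x + g x))\<^sup>2)"
    by (intro Bochner_Integration.integrable_bound[OF \<open>integrable lebesgue (\<lambda>x. 2 * (norm (f x))\<^sup>2 + 2 * (norm (g x))\<^sup>2)\<close>])
       auto
  then show ?thesis by (simp add: L2_def)
qed

lemma L2_scaleR:
  fixes f :: "real^'n \<Rightarrow> 'b::euclidean_space"
  assumes f: "f \<in> L2" shows "(\<lambda>x. c *\<^sub>R f x) \<in> L2"
proof -
  note [measurable] = L2_measurable[OF f]
  show ?thesis by (rule L2_bound[OF f, of _ "\<bar>c\<bar>"]) auto
qed

lemma L2_minus:
  fixes f :: "real^'n \<Rightarrow> 'b::euclidean_space"
  assumes f: "f \<in> L2" shows "(\<lambda>x. - f x) \<in> L2"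
  using L2_scaleR[OF f, of "-1"] by simp

lemma L2_diff:
  fixes f g :: "real^'n \<Rightarrow> 'b::euclidean_space"
  assumes f: "f \<in> L2" and g: "g \<in> L2"
  shows "(\<lambda>x. f x - g x) \<in> L2"
  using L2_add[OF f L2_minus[OF g]] by simp

lemma L2_integrable_norm_mult:
  fixes f :: "real^'n \<Rightarrow> 'b::euclidean_space" and g :: "real^'n \<Rightarrow> 'c::euclidean_space"
  assumes f: "f \<in> L2" and g: "g \<in> L2"
  shows "integrable lebesgue (\<lambda>x. norm (f x) * norm (g x))"
proof -
  note [measurable] = L2_measurable[OF f] L2_measurable[OF g]
  have "a * b \<le> a\<^sup>2 + b\<^sup>2" if "0 \<le> a" "0 \<le> b" for a b :: real
    using sum_squares_bound[of a b] mult_nonneg_nonneg[OF that] by simp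
  then show ?thesis
    by (intro Bochner_Integration.integrable_bound[OF
          Bochner_Integration.integrable_add[OF L2_integrable[OF f] L2_integrable[OF g]]]) auto
qed

lemma L2_integrable_inner:
  fixes f g :: "real^'n \<Rightarrow> 'b::euclidean_space"
  assumes f: "f \<in> L2" and g: "g \<in> L2"
  shows "integrable lebesgue (\<lambda>x. f x \<bullet> g x)"
proof -
  note [measurable] = L2_measurable[OF f] L2_measurable[OF g]
  show ?thesis
    by (rule Bochner_Integration.integrable_bound[OF L2_integrable_norm_mult[OF f g]])
       (auto simp: Cauchy_Schwarz_ineq2)
qed

text \<open>As a type with instances \<open>real_inner\<close> and \<open>banach\<close>, the
  classes give access to vector derivatives, integrals and completeness for time-dependent families.
  The value type is a parameter so that functions and their gradients are covered at once. The inner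
  product is real; for complex values it is the real part of the usual one.\<close>

typedef (overloaded) ('n::finite, 'b::euclidean_space) l2 =
  "{S :: (real^'n \<Rightarrow> 'b) set. \<exists>f\<in>L2. S = {g \<in> L2. AE x in lebesgue. f x = g x}}"
  using L2_zero by blast

definition cls :: "(real^'n \<Rightarrow> 'b::euclidean_space) \<Rightarrow> ('n, 'b) l2" where
  "cls f = Abs_l2 {g \<in> L2. AE x in lebesgue. f x = g x}"

definition rep :: "('n::finite, 'b::euclidean_space) l2 \<Rightarrow> real^'n \<Rightarrow> 'b" where
  "rep U = (SOME f. f \<in> Rep_l2 U)"

lemma Rep_cls: "f \<in> L2 \<Longrightarrow> Rep_l2 (cls f) = {g \<in> L2. AE x in lebesgue. f x = g x}"
  unfolding cls_def by (rule Abs_l2_inverse) auto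

lemma rep_in_Rep: "rep U \<in> Rep_l2 U"
proof -
  obtain f where "f \<in> L2" "Rep_l2 U = {g \<in> L2. AE x in lebesgue. f x = g x}"
    using Rep_l2[of U] by auto
  then have "f \<in> Rep_l2 U" by simp
  then show ?thesis unfolding rep_def by (metis someI)
qed

lemma rep_L2 [simp]: "rep U \<in> L2"
  using rep_in_Rep[of U] Rep_l2[of U] by auto

lemma cls_eq_iff:
  fixes f g :: "real^'n \<Rightarrow> 'b::euclidean_space"
  assumes f: "f \<in> L2" and g: "g \<in> L2"
  shows "cls f = cls g \<longleftrightarrow> (AE x in lebesgue. f x = g x)"
proof
  assume "cls f = cls g"
  then have "Rep_l2 (cls f) = Rep_l2 (cls g)" by simp
  then show "AE x in lebesgue. f x = g x"
    using f g by (auto simp: Rep_cls)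
next
  assume fg: "AE x in lebesgue. f x = g x"
  have "(AE x in lebesgue. f x = h x) \<longleftrightarrow> (AE x in lebesgue. g x = h x)" for h :: "real^'n \<Rightarrow> 'b"
  proof
    assume "AE x in lebesgue. f x = h x"
    with fg show "AE x in lebesgue. g x = h x" by eventually_elim simp
  next
    assume "AE x in lebesgue. g x = h x"
    with fg show "AE x in lebesgue. f x = h x" by eventually_elim simp
  qed
  then show "cls f = cls g" by (simp add: cls_def)
qed

lemma rep_cls: "f \<in> L2 \<Longrightarrow> AE x in lebesgue. rep (cls f) x = f x"
proof -
  assume "f \<in> L2"
  then have "AE x in lebesgue. f x = rep (cls f) x"
    using rep_in_Rep[of "cls f"] by (simp add: Rep_cls)
  then show ?thesis by eventually_elim simp
qed

lemma cls_rep [simp]: "cls (rep U) = U"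
proof -
  obtain f where f: "f \<in> L2" "Rep_l2 U = {g \<in> L2. AE x in lebesgue. f x = g x}"
    using Rep_l2[of U] by auto
  then have U: "U = cls f" by (simp add: cls_def Rep_l2_inverse flip: f(2))
  then show ?thesis using rep_cls[OF f(1)] f(1) cls_eq_iff[of "rep U" f] by simp
qed

lemma rep_measurable [measurable]: "rep U \<in> borel_measurable lebesgue"
  by (rule L2_measurable) simp

lemma l2_eq_iff: "U = V \<longleftrightarrow> (AE x in lebesgue. rep U x = rep V x)"
  using cls_eq_iff[of "rep U" "rep V"] by simp

lemma cls_eqI: "f \<in> L2 \<Longrightarrow> AE x in lebesgue. f x = g x \<Longrightarrow> cls f = cls g"
  using L2_cong_AE cls_eq_iff by blast

instantiation l2 :: (finite, euclidean_space) real_vector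
begin

definition "0 = cls (\<lambda>_. 0)"
definition "U + V = cls (\<lambda>x. rep U x + rep V x)"
definition "- U = cls (\<lambda>x. - rep U x)"
definition "U - V = cls (\<lambda>x. rep U x - rep V x)"
definition "c *\<^sub>R (U :: ('a, 'b) l2) = cls (\<lambda>x. c *\<^sub>R rep U x)"

lemma rep_zero: "AE x in lebesgue. rep (0 :: ('a, 'b) l2) x = 0"
  unfolding zero_l2_def by (rule rep_cls) simp

lemma rep_add: "AE x in lebesgue. rep (U + V :: ('a, 'b) l2) x = rep U x + rep V x"
  unfolding plus_l2_def by (rule rep_cls) (simp add: L2_add)

lemma rep_minus: "AE x in lebesgue. rep (- U :: ('a, 'b) l2) x = - rep U x"
  unfolding uminus_l2_def by (rule rep_cls) (simp add: L2_minus)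

lemma rep_diff: "AE x in lebesgue. rep (U - V :: ('a, 'b) l2) x = rep U x - rep V x"
  unfolding minus_l2_def by (rule rep_cls) (simp add: L2_diff)

lemma rep_scaleR: "AE x in lebesgue. rep (c *\<^sub>R U :: ('a, 'b) l2) x = c *\<^sub>R rep U x"
  unfolding scaleR_l2_def by (rule rep_cls) (simp add: L2_scaleR)

instance
proof
  fix U V W :: "('a, 'b) l2" and a b :: real
  show "U + V + W = U + (V + W)"
    unfolding l2_eq_iff using rep_add[of "U + V" W] rep_add[of U V] rep_add[of V W] rep_add[of U "V + W"]
    by eventually_elim simp
  show "U + V = V + U"
    unfolding l2_eq_iff using rep_add[of U V] rep_add[of V U] by eventually_elim simp
  show "0 + U = U"
    unfolding l2_eq_iff using rep_add[of 0 U] rep_zero by eventually_elim simp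
  show "- U + U = 0"
    unfolding l2_eq_iff using rep_add[of "-U" U] rep_minus[of U] rep_zero by eventually_elim simp
  show "U - V = U + - V"
    unfolding l2_eq_iff using rep_diff[of U V] rep_add[of U "-V"] rep_minus[of V]
    by eventually_elim simp
  show "a *\<^sub>R (U + V) = a *\<^sub>R U + a *\<^sub>R V"
    unfolding l2_eq_iff using rep_scaleR[of a "U + V"] rep_add[of U V] rep_scaleR[of a U]
      rep_scaleR[of a V] rep_add[of "a *\<^sub>R U" "a *\<^sub>R V"]
    by eventually_elim (simp add: scaleR_add_right)
  show "(a + b) *\<^sub>R U = a *\<^sub>R U + b *\<^sub>R U"
    unfolding l2_eq_iff using rep_scaleR[of "a + b" U] rep_scaleR[of a U]
      rep_scaleR[of b U] rep_add[of "a *\<^sub>R U" "b *\<^sub>R U"]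
    by eventually_elim (simp add: scaleR_add_left)
  show "a *\<^sub>R b *\<^sub>R U = (a * b) *\<^sub>R U"
    unfolding l2_eq_iff using rep_scaleR[of a "b *\<^sub>R U"] rep_scaleR[of b U] rep_scaleR[of "a * b" U]
    by eventually_elim simp
  show "1 *\<^sub>R U = U"
    unfolding l2_eq_iff using rep_scaleR[of 1 U] by eventually_elim simp
qed

end

instantiation l2 :: (finite, euclidean_space) real_inner
begin

definition "(U :: ('a, 'b) l2) \<bullet> V = (LINT x|lebesgue. rep U x \<bullet> rep V x)"
definition "norm (U :: ('a, 'b) l2) = sqrt (U \<bullet> U)"
definition "sgn (U :: ('a, 'b) l2) = U /\<^sub>R norm U"
definition "dist (U :: ('a, 'b) l2) V = norm (U - V)"
definition "uniformity = (INF e\<in>{0 <..}. principal {(x :: ('a, 'b) l2, y). dist x y < e})"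
definition "open (S :: ('a, 'b) l2 set) = (\<forall>x\<in>S. \<forall>\<^sub>F (x', y) in uniformity. x' = x \<longrightarrow> y \<in> S)"

instance
proof
  fix U V W :: "('a, 'b) l2" and a :: real
  show "U \<bullet> V = V \<bullet> U"
    by (simp add: inner_l2_def inner_commute)
  show "(U + V) \<bullet> W = U \<bullet> W + V \<bullet> W"
  proof -
    have "(U + V) \<bullet> W = (LINT x|lebesgue. rep U x \<bullet> rep W x + rep V x \<bullet> rep W x)"
      unfolding inner_l2_def
      by (intro integral_cong_AE eventually_mono[OF rep_add[of U V]]) (auto simp: inner_add_left)
    then show ?thesis by (simp add: inner_l2_def L2_integrable_inner)
  qed
  show "(a *\<^sub>R U) \<bullet> V = a * (U \<bullet> V)"
  proof -
    have "(a *\<^sub>R U) \<bullet> V = (LINT x|lebesgue. a * (rep U x \<bullet> rep V x))"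
      unfolding inner_l2_def
      by (intro integral_cong_AE eventually_mono[OF rep_scaleR[of a U]]) auto
    then show ?thesis by (simp add: inner_l2_def)
  qed
  show "0 \<le> U \<bullet> U" by (simp add: inner_l2_def)
  show "(U \<bullet> U = 0) = (U = 0)"
  proof -
    have "(U \<bullet> U = 0) = (AE x in lebesgue. rep U x \<bullet> rep U x = 0)"
      unfolding inner_l2_def by (intro integral_nonneg_eq_0_iff_AE L2_integrable_inner) auto
    also have "\<dots> = (AE x in lebesgue. rep U x = rep 0 x)"
    proof
      assume "AE x in lebesgue. rep U x \<bullet> rep U x = 0"
      with rep_zero show "AE x in lebesgue. rep U x = rep 0 x" by eventually_elim simp
    next
      assume "AE x in lebesgue. rep U x = rep 0 x"
      with rep_zero show "AE x in lebesgue. rep U x \<bullet> rep U x = 0" by eventually_elim simp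
    qed
    finally show ?thesis by (simp add: l2_eq_iff)
  qed
qed (simp_all add: norm_l2_def sgn_l2_def dist_l2_def uniformity_l2_def open_l2_def)

end

lemma inner_cls:
  assumes "f \<in> L2" "g \<in> L2" shows "cls f \<bullet> cls g = (LINT x|lebesgue. f x \<bullet> g x)"
proof -
  have "AE x in lebesgue. rep (cls f) x \<bullet> rep (cls g) x = f x \<bullet> g x"
    using rep_cls[OF assms(1)] rep_cls[OF assms(2)] by eventually_elim simp
  then show ?thesis
    unfolding inner_l2_def using assms
    by (intro integral_cong_AE borel_measurable_inner) (auto simp: L2_measurable)
qed

lemma norm_l2_eq: "norm U = L2_norm (rep U)"
  by (simp add: norm_l2_def inner_l2_def L2_norm_def power2_norm_eq_inner)

lemma norm_l2_sq: "(norm U)\<^sup>2 = (LINT x|lebesgue. (norm (rep U x))\<^sup>2)"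
  by (simp add: norm_l2_eq L2_norm_def)

lemma norm_cls: "f \<in> L2 \<Longrightarrow> norm (cls f) = L2_norm f"
  by (simp add: norm_l2_def inner_cls L2_norm_def power2_norm_eq_inner)

lemma cls_add:
  assumes "f \<in> L2" "g \<in> L2" shows "cls f + cls g = cls (\<lambda>x. f x + g x)"
  unfolding l2_eq_iff using rep_add[of "cls f" "cls g"] assms[THEN rep_cls] rep_cls[OF L2_add[OF assms]]
  by eventually_elim simp

lemma cls_diff:
  assumes "f \<in> L2" "g \<in> L2" shows "cls f - cls g = cls (\<lambda>x. f x - g x)"
  unfolding l2_eq_iff using rep_diff[of "cls f" "cls g"] assms[THEN rep_cls] rep_cls[OF L2_diff[OF assms]]
  by eventually_elim simp

lemma cls_scaleR:
  assumes "f \<in> L2" shows "c *\<^sub>R cls f = cls (\<lambda>x. c *\<^sub>R f x)"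
  unfolding l2_eq_iff using rep_scaleR[of c "cls f"] assms[THEN rep_cls] rep_cls[OF L2_scaleR[OF assms, of c]]
  by eventually_elim simp

lemma nn_integral_rep: "(\<integral>\<^sup>+x. ennreal ((norm (rep U x))\<^sup>2) \<partial>lebesgue) = ennreal ((norm U)\<^sup>2)"
  unfolding norm_l2_sq by (rule nn_integral_eq_integral) (auto intro: L2_integrable)

lemma L2I_nn_integral:
  fixes f :: "real^'n \<Rightarrow> 'b::euclidean_space"
  assumes "f \<in> borel_measurable lebesgue"
    "(\<integral>\<^sup>+x. ennreal ((norm (f x))\<^sup>2) \<partial>lebesgue) < \<infinity>"
  shows "f \<in> L2"
  using assms by (auto simp: L2_def intro!: integrableI_bounded)

text \<open>Riesz--Fischer: along a sequence whose steps have norm at most \<open>4\<^sup>-\<^sup>k\<close>, the series of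
  \<open>2\<^sup>k\<close> times the squared steps is integrable, hence finite almost everywhere, and this forces pointwise
  convergence.\<close>

lemma l2_fast_Cauchy_convergent:
  fixes X :: "nat \<Rightarrow> ('n::finite, 'b::euclidean_space) l2"
  assumes X: "\<And>j k. k \<le> j \<Longrightarrow> norm (X j - X k) \<le> (1/4) ^ k"
  shows "convergent X"
proof -
  define d where "d k x = rep (X (Suc k)) x - rep (X k) x" for k x
  have dm [measurable]: "d k \<in> borel_measurable lebesgue" for k
    unfolding d_def by measurable
  have dn: "(\<integral>\<^sup>+x. ennreal ((norm (d k x))\<^sup>2) \<partial>lebesgue) \<le> ennreal ((1/16) ^ k)" for k
  proof -
    have "(\<integral>\<^sup>+x. ennreal ((norm (d k x))\<^sup>2) \<partial>lebesgue)
        = (\<integral>\<^sup>+x. ennreal ((norm (rep (X (Suc k) - X k) x))\<^sup>2) \<partial>lebesgue)"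
      by (intro nn_integral_cong_AE eventually_mono[OF rep_diff[of "X (Suc k)" "X k"]]) (simp add: d_def)
    also have "\<dots> = ennreal ((norm (X (Suc k) - X k))\<^sup>2)" by (rule nn_integral_rep)
    also have "\<dots> \<le> ennreal (((1/4) ^ k)\<^sup>2)"
      by (intro ennreal_leI power_mono X) auto
    also have "((1/4) ^ k)\<^sup>2 = (1/16 :: real) ^ k"
      by (simp add: power2_eq_square flip: power_mult_distrib)
    finally show ?thesis .
  qed
  have "(\<integral>\<^sup>+x. (\<Sum>k. ennreal (2 ^ k * (norm (d k x))\<^sup>2)) \<partial>lebesgue)
      = (\<Sum>k. \<integral>\<^sup>+x. ennreal (2 ^ k * (norm (d k x))\<^sup>2) \<partial>lebesgue)"
    by (rule nn_integral_suminf) measurable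
  also have "\<dots> \<le> (\<Sum>k. ennreal ((1/8) ^ k))"
  proof (rule suminf_le)
    fix k
    have "(\<integral>\<^sup>+x. ennreal (2 ^ k * (norm (d k x))\<^sup>2) \<partial>lebesgue)
        = ennreal (2 ^ k) * (\<integral>\<^sup>+x. ennreal ((norm (d k x))\<^sup>2) \<partial>lebesgue)"
      by (subst nn_integral_cmult[symmetric]) (auto simp: ennreal_mult)
    also have "\<dots> \<le> ennreal (2 ^ k) * ennreal ((1/16) ^ k)"
      by (intro mult_left_mono dn) auto
    also have "\<dots> = ennreal ((1/8) ^ k)"
      by (subst ennreal_mult[symmetric]) (auto simp flip: power_mult_distrib)
    finally show "(\<integral>\<^sup>+x. ennreal (2 ^ k * (norm (d k x))\<^sup>2) \<partial>lebesgue) \<le> ennreal ((1/8) ^ k)" .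
  qed auto
  also have "\<dots> = ennreal (\<Sum>k. (1/8) ^ k)"
    by (intro suminf_ennreal2 summable_geometric) auto
  also have "\<dots> < \<infinity>" by simp
  finally have "AE x in lebesgue. (\<Sum>k. ennreal (2 ^ k * (norm (d k x))\<^sup>2)) \<noteq> \<infinity>"
    by (intro nn_integral_noteq_infinite) auto
  then have conv: "AE x in lebesgue. convergent (\<lambda>k. rep (X k) x)"
  proof eventually_elim
    case (elim x)
    have s: "summable (\<lambda>k. 2 ^ k * (norm (d k x))\<^sup>2)"
      using elim by (intro summable_suminf_not_top) auto
    have "summable (\<lambda>k. d k x)"
    proof (rule summable_comparison_test)
      show "summable (\<lambda>k. 2 ^ k * (norm (d k x))\<^sup>2 + (1/2) ^ k)"
        using s by (intro summable_add summable_geometric) auto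
      have "norm (d k x) \<le> 2 ^ k * (norm (d k x))\<^sup>2 + (1/2) ^ k" for k
      \<comment> \<open>A step longer than 2^-k satisfies 1 < 2^k |d|, hence |d| is below 2^k |d|^2,
        which is summable; the shorter steps are dominated by a geometric series.\<close>
      proof (cases "norm (d k x) \<le> (1/2) ^ k")
        case False
        then have "1 \<le> 2 ^ k * norm (d k x)"
          by (simp add: power_divide field_simps)
        then have "norm (d k x) * 1 \<le> norm (d k x) * (2 ^ k * norm (d k x))"
          by (intro mult_left_mono) auto
        then have "norm (d k x) \<le> 2 ^ k * (norm (d k x))\<^sup>2"
          by (simp add: power2_eq_square algebra_simps)
        moreover have "(0::real) \<le> (1/2) ^ k" by simp
        ultimately show ?thesis by linarith
      qed (simp add: add_increasing)
      then show "\<exists>N. \<forall>k\<ge>N. norm (d k x) \<le> 2 ^ k * (norm (d k x))\<^sup>2 + (1/2) ^ k" by blast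
    qed
    then have "convergent (\<lambda>n. \<Sum>k<n. d k x)"
      by (simp add: summable_iff_convergent)
    then have "convergent (\<lambda>n. (\<Sum>k<n. d k x) + rep (X 0) x)"
      by (intro convergent_add convergent_const)
    moreover have "(\<Sum>k<n. d k x) + rep (X 0) x = rep (X n) x" for n
      using sum_lessThan_telescope[of "\<lambda>k. rep (X k) x" n] by (simp add: d_def)
    ultimately show ?case by simp
  qed
  define f where "f x = lim (\<lambda>k. rep (X k) x)" for x
  have fm [measurable]: "f \<in> borel_measurable lebesgue"
    unfolding f_def by measurable
  have lim: "AE x in lebesgue. (\<lambda>k. rep (X k) x) \<longlonglongrightarrow> f x"
    using conv by eventually_elim (simp add: f_def convergent_LIMSEQ_iff)
  have bound: "(\<integral>\<^sup>+x. ennreal ((norm (f x - rep (X k) x))\<^sup>2) \<partial>lebesgue) \<le> ennreal ((1/16) ^ k)" for k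
  proof -
    have "(\<integral>\<^sup>+x. ennreal ((norm (f x - rep (X k) x))\<^sup>2) \<partial>lebesgue)
        = (\<integral>\<^sup>+x. liminf (\<lambda>j. ennreal ((norm (rep (X j) x - rep (X k) x))\<^sup>2)) \<partial>lebesgue)"
      using lim
    proof (intro nn_integral_cong_AE, eventually_elim)
      case (elim x)
      have "(\<lambda>j. ennreal ((norm (rep (X j) x - rep (X k) x))\<^sup>2)) \<longlonglongrightarrow> ennreal ((norm (f x - rep (X k) x))\<^sup>2)"
        by (intro tendsto_intros elim)
      from lim_imp_Liminf[OF trivial_limit_sequentially this] show ?case by simp
    qed
    also have "\<dots> \<le> liminf (\<lambda>j. \<integral>\<^sup>+x. ennreal ((norm (rep (X j) x - rep (X k) x))\<^sup>2) \<partial>lebesgue)"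
      by (rule nn_integral_liminf) measurable
    also have "\<dots> \<le> ennreal ((1/16) ^ k)"
    proof (rule Liminf_le)
      show "\<forall>\<^sub>F j in sequentially. (\<integral>\<^sup>+x. ennreal ((norm (rep (X j) x - rep (X k) x))\<^sup>2) \<partial>lebesgue)
          \<le> ennreal ((1/16) ^ k)"
        using eventually_ge_at_top[of k]
      proof eventually_elim
        case (elim j)
        have "(\<integral>\<^sup>+x. ennreal ((norm (rep (X j) x - rep (X k) x))\<^sup>2) \<partial>lebesgue)
            = (\<integral>\<^sup>+x. ennreal ((norm (rep (X j - X k) x))\<^sup>2) \<partial>lebesgue)"
          by (intro nn_integral_cong_AE eventually_mono[OF rep_diff[of "X j" "X k"]]) simp
        also have "\<dots> = ennreal ((norm (X j - X k))\<^sup>2)" by (rule nn_integral_rep)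
        also have "\<dots> \<le> ennreal (((1/4) ^ k)\<^sup>2)"
          using elim by (intro ennreal_leI power_mono X) auto
        also have "((1/4) ^ k)\<^sup>2 = (1/16 :: real) ^ k"
          by (simp add: power2_eq_square flip: power_mult_distrib)
        finally show ?case .
      qed
    qed auto
    finally show ?thesis .
  qed
  have "(\<lambda>x. f x - rep (X 0) x) \<in> L2"
    using bound[of 0] by (intro L2I_nn_integral) (auto intro: le_less_trans)
  from L2_add[OF this rep_L2[of "X 0"]] have fL: "f \<in> L2" by simp
  have "norm (cls f - X k) \<le> (1/4) ^ k" for k
  proof -
    have "AE x in lebesgue. rep (cls f - X k) x = f x - rep (X k) x"
      using rep_diff[of "cls f" "X k"] rep_cls[OF fL] by eventually_elim simp
    then have "ennreal ((norm (cls f - X k))\<^sup>2) = (\<integral>\<^sup>+x. ennreal ((norm (f x - rep (X k) x))\<^sup>2) \<partial>lebesgue)"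
      unfolding nn_integral_rep[symmetric] by (intro nn_integral_cong_AE) (elim eventually_mono, simp)
    also have "\<dots> \<le> ennreal ((1/16) ^ k)" by (rule bound)
    finally have "(norm (cls f - X k))\<^sup>2 \<le> (1/16) ^ k" by simp
    also have "\<dots> = ((1/4) ^ k)\<^sup>2"
      by (simp add: power2_eq_square flip: power_mult_distrib)
    finally show ?thesis by (rule power2_le_imp_le) simp
  qed
  then have "(\<lambda>k. cls f - X k) \<longlonglongrightarrow> 0"
    by (intro Lim_null_comparison[OF _ LIMSEQ_realpow_zero[of "1/4"]]) auto
  then have "X \<longlonglongrightarrow> cls f"
    using tendsto_diff[of "\<lambda>_. cls f" "cls f" sequentially "\<lambda>k. cls f - X k" 0] by simp
  then show ?thesis by (rule convergentI)
qed

instance l2 :: (finite, euclidean_space) banach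
proof
  fix X :: "nat \<Rightarrow> ('a, 'b) l2"
  assume C: "Cauchy X"
  have "\<exists>N. \<forall>i\<ge>N. \<forall>j\<ge>N. norm (X i - X j) < (1/4) ^ k" for k
    using C unfolding Cauchy_iff by (metis zero_less_power zero_less_divide_1_iff zero_less_numeral)
  then obtain N where N: "\<And>k i j. i \<ge> N k \<Longrightarrow> j \<ge> N k \<Longrightarrow> norm (X i - X j) < (1/4) ^ k"
    by metis
  \<comment> \<open>The sum dominates \<open>N k\<close> and the summand k makes the index strictly
    increasing, without monotonicity of N.\<close>
  define r where "r k = (\<Sum>i\<le>k. N i) + k" for k
  have r: "strict_mono r" "r k \<ge> N k" for k
    by (auto simp: r_def strict_mono_Suc_iff intro!: trans_le_add1 member_le_sum)
  have "convergent (X \<circ> r)"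
  proof (rule l2_fast_Cauchy_convergent)
    fix j k :: nat assume "k \<le> j"
    then have "r j \<ge> r k" using r(1) by (simp add: strict_mono_less_eq)
    then show "norm ((X \<circ> r) j - (X \<circ> r) k) \<le> (1/4) ^ k"
      using N[of k "r j" "r k"] r(2)[of k] by simp
  qed
  then obtain L where "(X \<circ> r) \<longlonglongrightarrow> L" by (auto simp: convergent_def)
  then have "X \<longlonglongrightarrow> L" using Cauchy_converges_subseq[OF C r(1)] by blast
  then show "convergent X" by (rule convergentI)
qed



section \<open>Contraction semigroups on Hilbert spaces\<close>

lemma has_vector_derivative_within_quotient:
  fixes f :: "real \<Rightarrow> 'a::real_normed_vector"
  shows "(f has_vector_derivative D) (at t within A) \<longleftrightarrow>
    ((\<lambda>s. (f s - f t) /\<^sub>R (s - t)) \<longlongrightarrow> D) (at t within A)"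
proof -
  have "(f has_vector_derivative D) (at t within A) \<longleftrightarrow>
      ((\<lambda>s. norm (f s - f t - (s - t) *\<^sub>R D) / norm (s - t)) \<longlongrightarrow> 0) (at t within A)"
    by (simp add: has_vector_derivative_def has_derivative_iff_norm bounded_linear_scaleR_left)
  also have "\<dots> \<longleftrightarrow> ((\<lambda>s. norm ((f s - f t) /\<^sub>R (s - t) - D)) \<longlongrightarrow> 0) (at t within A)"
  proof (rule filterlim_cong[OF refl refl])
    have "norm (f s - f t - (s - t) *\<^sub>R D) / norm (s - t) = norm ((f s - f t) /\<^sub>R (s - t) - D)"
      if "s \<noteq> t" for s
    proof -
      have "(f s - f t) /\<^sub>R (s - t) - D = (f s - f t - (s - t) *\<^sub>R D) /\<^sub>R (s - t)"
        using that by (simp add: scaleR_diff_right)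
      then show ?thesis by (simp add: divide_inverse_commute)
    qed
    then show "\<forall>\<^sub>F s in at t within A. norm (f s - f t - (s - t) *\<^sub>R D) / norm (s - t)
        = norm ((f s - f t) /\<^sub>R (s - t) - D)"
      by (auto simp: eventually_at_filter)
  qed
  also have "\<dots> \<longleftrightarrow> ((\<lambda>s. (f s - f t) /\<^sub>R (s - t)) \<longlongrightarrow> D) (at t within A)"
    by (simp add: tendsto_norm_zero_iff LIM_zero_iff)
  finally show ?thesis .
qed

lemma has_vector_derivative_difference_quotient:
  fixes f :: "real \<Rightarrow> 'a::real_normed_vector"
  shows "(f has_vector_derivative D) (at t) \<longleftrightarrow> ((\<lambda>h. (f (t + h) - f t) /\<^sub>R h) \<longlongrightarrow> D) (at 0)"
  unfolding has_vector_derivative_within_quotient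
  using LIM_offset_zero_iff[of t "\<lambda>s. (f s - f t) /\<^sub>R (s - t)" D] by simp

lemma filterlim_abs_at_right_0: "filterlim (\<lambda>h::real. \<bar>h\<bar>) (at_right 0) (at 0)"
proof -
  have "((\<lambda>h::real. \<bar>h\<bar>) \<longlongrightarrow> 0) (at 0)" by (intro tendsto_eq_intros) auto
  then show ?thesis by (auto simp: filterlim_at eventually_at_filter)
qed

locale contraction_semigroup =
  fixes S :: "real \<Rightarrow> 'h::{real_inner, banach} \<Rightarrow> 'h"
  assumes lin: "0 \<le> t \<Longrightarrow> linear (S t)"
    and contr: "0 \<le> t \<Longrightarrow> norm (S t x) \<le> norm x"
    and S0: "S 0 x = x"
    and S_add: "0 \<le> s \<Longrightarrow> 0 \<le> t \<Longrightarrow> S (s + t) x = S s (S t x)"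
    and cont0: "((\<lambda>t. S t x) \<longlongrightarrow> x) (at_right 0)"
begin

text \<open>The generator is kept as a graph: it is unbounded, so membership in the domain and the
  value are stated together.\<close>

definition gen :: "'h \<Rightarrow> 'h \<Rightarrow> bool" where
  "gen x y \<longleftrightarrow> ((\<lambda>t. (S t x - x) /\<^sub>R t) \<longlongrightarrow> y) (at_right 0)"

lemma blin: "0 \<le> t \<Longrightarrow> bounded_linear (S t)"
  using lin contr by (auto simp: bounded_linear_def bounded_linear_axioms_def linear_linear intro!: exI[of _ 1])

lemma S_diff: "0 \<le> t \<Longrightarrow> S t (x - y) = S t x - S t y"
  by (rule linear_diff[OF lin])

lemma S_scaleR: "0 \<le> t \<Longrightarrow> S t (c *\<^sub>R x) = c *\<^sub>R S t x"
  by (rule linear_scale[OF lin])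

text \<open>The semigroup at the smaller of the two times factors out and contracts. This turns
  continuity at 0 from the right into two-sided continuity at every time.\<close>

lemma norm_S_diff:
  assumes "0 \<le> s" "0 \<le> t"
  shows "norm (S t x - S s x) \<le> norm (S \<bar>t - s\<bar> x - x)"
proof -
  have *: "norm (S t x - S s x) \<le> norm (S (t - s) x - x)" if "0 \<le> s" "s \<le> t" for s t
  proof -
    have "S t x - S s x = S s (S (t - s) x - x)"
      using that S_add[of s "t - s" x] by (simp add: S_diff)
    then show ?thesis using contr[of s] that by simp
  qed
  show ?thesis
  proof (cases "s \<le> t")
    case True then show ?thesis using *[of s t] assms by simp
  next
    case False then show ?thesis using *[of t s] assms by (simp add: norm_minus_commute)
  qed
qed

lemma continuous_S: "continuous_on {0..} (\<lambda>t. S t x)"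
  unfolding continuous_on_def
proof (intro ballI)
  fix s :: real assume s: "s \<in> {0..}"
  have *: "((\<lambda>t. S \<bar>t - s\<bar> x - x) \<longlongrightarrow> 0) (at s within {0..})"
  proof -
    have "((\<lambda>h. S \<bar>h\<bar> x - x) \<longlongrightarrow> 0) (at 0)"
      using filterlim_compose[OF cont0 filterlim_abs_at_right_0] by (simp add: LIM_zero)
    then have "((\<lambda>t. S \<bar>t - s\<bar> x - x) \<longlongrightarrow> 0) (at s)"
      by (subst (asm) LIM_offset_zero_iff[where a = s and f = "\<lambda>t. S \<bar>t - s\<bar> x - x", simplified, symmetric]) auto
    then show ?thesis by (rule tendsto_within_subset) auto
  qed
  have "((\<lambda>t. S t x - S s x) \<longlongrightarrow> 0) (at s within {0..})"
    by (rule Lim_null_comparison[OF _ tendsto_norm_zero[OF *]])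
       (use s in \<open>auto simp: eventually_at_filter intro!: always_eventually norm_S_diff\<close>)
  then show "((\<lambda>t. S t x) \<longlongrightarrow> S s x) (at s within {0..})"
    by (simp add: LIM_zero_iff)
qed

lemma gen_unique: "gen x y \<Longrightarrow> gen x z \<Longrightarrow> y = z"
  unfolding gen_def by (rule tendsto_unique[rotated]) auto

lemma gen_diff: "gen x x' \<Longrightarrow> gen y y' \<Longrightarrow> gen (x - y) (x' - y')"
proof -
  assume *: "gen x x'" "gen y y'"
  have "((\<lambda>t. (S t x - x) /\<^sub>R t - (S t y - y) /\<^sub>R t) \<longlongrightarrow> x' - y') (at_right 0)"
    using * unfolding gen_def by (rule tendsto_diff)
  then show ?thesis unfolding gen_def
    by (rule Lim_transform_eventually) (auto simp: eventually_at_filter S_diff algebra_simps)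
qed

lemma gen_scaleR: "gen x x' \<Longrightarrow> gen (c *\<^sub>R x) (c *\<^sub>R x')"
proof -
  assume "gen x x'"
  then have "((\<lambda>t. c *\<^sub>R ((S t x - x) /\<^sub>R t)) \<longlongrightarrow> c *\<^sub>R x') (at_right 0)"
    unfolding gen_def by (intro tendsto_intros)
  then show ?thesis unfolding gen_def
    by (rule Lim_transform_eventually) (auto simp: eventually_at_filter S_scaleR algebra_simps)
qed

lemma gen_S: "0 \<le> t \<Longrightarrow> gen x y \<Longrightarrow> gen (S t x) (S t y)"
proof -
  assume t: "0 \<le> t" and "gen x y"
  then have "((\<lambda>s. S t ((S s x - x) /\<^sub>R s)) \<longlongrightarrow> S t y) (at_right 0)"
    unfolding gen_def by (intro bounded_linear.tendsto[OF blin])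
  then show ?thesis unfolding gen_def
  proof (rule Lim_transform_eventually)
    have "S t (S s x) = S s (S t x)" if "0 < s" for s
      using that t S_add[of s t x] S_add[of t s x] by (simp add: add.commute)
    then show "\<forall>\<^sub>F s in at_right 0. S t ((S s x - x) /\<^sub>R s) = (S s (S t x) - S t x) /\<^sub>R s"
      using t by (auto simp: eventually_at_filter S_scaleR S_diff)
  qed
qed

text \<open>The generator provides only a one-sided quotient at 0. For either sign of h the quotient
  at t is S at the earlier of the times t and t + h, applied to the quotient of step |h|;
  contraction and strong continuity then give the two-sided limit.\<close>

lemma has_vector_derivative_S:
  assumes g: "gen x y" and t: "0 < t"
  shows "((\<lambda>t. S t x) has_vector_derivative S t y) (at t)"
  unfolding has_vector_derivative_difference_quotient
proof -
  define q where "q h = (S h x - x) /\<^sub>R h" for h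
  define m where "m h = min t (t + h)" for h :: real
  have q: "(q \<longlongrightarrow> y) (at_right 0)" using g unfolding gen_def q_def[abs_def] .
  have mt: "(m \<longlongrightarrow> t) (at 0)"
    unfolding m_def by (intro tendsto_eq_intros) auto
  have m0: "\<forall>\<^sub>F h in at 0. 0 < m h"
    by (rule order_tendstoD(1)[OF mt t])
  have "((\<lambda>h. norm (q \<bar>h\<bar> - y) + norm (S (m h) y - S t y)) \<longlongrightarrow> norm (y - y) + norm (S t y - S t y)) (at 0)"
  proof (intro tendsto_intros)
    show "((\<lambda>h. q \<bar>h\<bar>) \<longlongrightarrow> y) (at 0)"
      by (rule filterlim_compose[OF q filterlim_abs_at_right_0])
    show "((\<lambda>h. S (m h) y) \<longlongrightarrow> S t y) (at 0)"
      using t by (intro continuous_on_tendsto_compose[OF continuous_S mt] eventually_mono[OF m0]) auto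
  qed
  then have lim: "((\<lambda>h. norm (q \<bar>h\<bar> - y) + norm (S (m h) y - S t y)) \<longlongrightarrow> 0) (at 0)" by simp
  have "((\<lambda>h. (S (t + h) x - S t x) /\<^sub>R h - S t y) \<longlongrightarrow> 0) (at 0)"
  proof (rule Lim_null_comparison[OF _ lim])
    have *: "(S (t + h) x - S t x) /\<^sub>R h = S (m h) (q \<bar>h\<bar>)" if h: "h \<noteq> 0" "0 < m h" for h
    proof (cases "0 < h")
      case True
      then show ?thesis using t S_add[of t h x] by (simp add: m_def q_def S_scaleR S_diff)
    next
      case False
      then have "S t x = S (t + h) (S (- h) x)"
        using S_add[of "t + h" "- h" x] h by (simp add: m_def)
      then show ?thesis using h False
        by (simp add: m_def q_def S_scaleR S_diff scaleR_diff_right)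
    qed
    show "\<forall>\<^sub>F h in at 0. norm ((S (t + h) x - S t x) /\<^sub>R h - S t y) \<le> norm (q \<bar>h\<bar> - y) + norm (S (m h) y - S t y)"
      using m0 eventually_neq_at_within[of 0 0 UNIV]
    proof eventually_elim
      case (elim h)
      have "S (m h) (q \<bar>h\<bar>) - S t y = S (m h) (q \<bar>h\<bar> - y) + (S (m h) y - S t y)"
        using elim by (simp add: S_diff)
      also have "norm \<dots> \<le> norm (S (m h) (q \<bar>h\<bar> - y)) + norm (S (m h) y - S t y)"
        by (rule norm_triangle_ineq)
      also have "norm (S (m h) (q \<bar>h\<bar> - y)) \<le> norm (q \<bar>h\<bar> - y)"
        using elim by (intro contr) auto
      finally show ?case using * elim by simp
    qed
  qed
  then show "((\<lambda>h. (S (t + h) x - S t x) /\<^sub>R h) \<longlongrightarrow> S t y) (at 0)"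
    by (simp add: LIM_zero_iff)
qed

text \<open>S at time tau shifts the interval of integration by tau, so in the difference quotient
  only the two end pieces survive.\<close>

lemma gen_integral:
  assumes h: "0 < h"
  shows "gen (integral {0..h} (\<lambda>s. S s x)) (S h x - x)"
proof -
  define I where "I a = integral {0..a} (\<lambda>s. S s x)" for a
  have cont: "continuous_on {a..b} (\<lambda>s. S s x)" if "0 \<le> a" for a b
    by (rule continuous_on_subset[OF continuous_S]) (use that in auto)
  have int: "(\<lambda>s. S s x) integrable_on {a..b}" if "0 \<le> a" for a b
    by (rule integrable_continuous_real[OF cont[OF that]])
  have deriv: "((\<lambda>\<tau>. (I (a + \<tau>) - I a) /\<^sub>R \<tau>) \<longlongrightarrow> S a x) (at_right 0)" if a: "0 \<le> a" for a
  proof -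
    have "(I has_vector_derivative S a x) (at a within {0..a+1})"
      unfolding I_def by (rule integral_has_vector_derivative[OF cont]) (use a in auto)
    then have "(I has_vector_derivative S a x) (at a within {a..a+1})"
      by (rule has_vector_derivative_within_subset) (use a in auto)
    then have "((\<lambda>y. (I y - I a) /\<^sub>R (y - a)) \<longlongrightarrow> S a x) (at a within {a..a+1})"
      by (simp add: has_vector_derivative_within_quotient)
    then have "((\<lambda>y. (I y - I a) /\<^sub>R (y - a)) \<longlongrightarrow> S a x) (at_right a)"
      by (simp add: at_within_Icc_at_right)
    then show ?thesis
      by (simp add: filterlim_at_right_to_0[of _ _ a] add.commute)
  qed
  have *: "S \<tau> (I h) - I h = (I (h + \<tau>) - I h) - (I \<tau> - I 0)" if \<tau>: "0 < \<tau>" for \<tau>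
  proof -
    have "S \<tau> (I h) = integral {0..h} (\<lambda>s. S \<tau> (S s x))"
      using integral_linear[OF int[of 0 h] blin[of \<tau>]] \<tau> by (simp add: I_def o_def)
    also have "\<dots> = integral {0..h} ((\<lambda>s. S s x) \<circ> (+) \<tau>)"
      by (rule integral_cong) (use \<tau> in \<open>auto simp: S_add\<close>)
    also have "\<dots> = integral {0+\<tau>..h+\<tau>} (\<lambda>s. S s x)"
      by (rule integral_shift_Icc_real)
    also have "\<dots> = I (h + \<tau>) - I \<tau>"
      using Henstock_Kurzweil_Integration.integral_combine[OF _ _ int[of 0 "h + \<tau>"], of \<tau>] \<tau> h
      by (simp add: I_def algebra_simps)
    finally show ?thesis by (simp add: I_def)
  qed
  then have *: "S \<tau> (I h) = I (h + \<tau>) - (I \<tau> - I 0)" if "0 < \<tau>" for \<tau>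
    using that by (simp add: algebra_simps)
  have "((\<lambda>\<tau>. (I (h + \<tau>) - I h) /\<^sub>R \<tau> - (I (0 + \<tau>) - I 0) /\<^sub>R \<tau>) \<longlongrightarrow> S h x - S 0 x) (at_right 0)"
    using h by (intro tendsto_diff deriv) auto
  then show ?thesis
    unfolding gen_def I_def[symmetric] S0
    by (rule Lim_transform_eventually)
       (auto simp: eventually_at_filter * scaleR_diff_right intro!: always_eventually)
qed

lemma average_tendsto: "((\<lambda>h. integral {0..h} (\<lambda>s. S s x) /\<^sub>R h) \<longlongrightarrow> x) (at_right 0)"
proof -
  have "((\<lambda>u. integral {0..u} (\<lambda>s. S s x)) has_vector_derivative S 0 x) (at 0 within {0..1})"
    by (rule integral_has_vector_derivative) (auto intro: continuous_on_subset[OF continuous_S])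
  then have "((\<lambda>y. integral {0..y} (\<lambda>s. S s x) /\<^sub>R y) \<longlongrightarrow> x) (at 0 within {0..1})"
    by (simp add: has_vector_derivative_within_quotient S0)
  then show ?thesis by (simp add: at_within_Icc_at_right)
qed

text \<open>z is the time average of \<open>S s x\<close> over [0, h] and y = (S h x - x) / h. If x
  lies in the domain, then so does y; applying the lemma twice therefore reaches the domain of the
  square of the generator.\<close>

lemma dense_domain:
  assumes "0 < e"
  obtains z y where "gen z y" "norm (z - x) < e"
    "\<And>v. gen x v \<Longrightarrow> \<exists>w. gen y w"
proof -
  have "\<forall>\<^sub>F h in at_right 0. norm (integral {0..h} (\<lambda>s. S s x) /\<^sub>R h - x) < e"
    using tendstoD[OF average_tendsto assms] by (simp add: dist_norm)
  then obtain h where h: "0 < h" "norm (integral {0..h} (\<lambda>s. S s x) /\<^sub>R h - x) < e"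
    unfolding eventually_at_right_field by (metis dense)
  show ?thesis
  proof (rule that)
    show "gen (integral {0..h} (\<lambda>s. S s x) /\<^sub>R h) ((S h x - x) /\<^sub>R h)"
      by (intro gen_scaleR gen_integral h)
    show "\<exists>w. gen ((S h x - x) /\<^sub>R h) w" if "gen x v" for v
      using gen_scaleR[OF gen_diff[OF gen_S[OF less_imp_le[OF h(1)] that] that]] by blast
  qed (rule h)
qed

lemma dense_domain2:
  assumes "0 < e"
  obtains z y w where "gen z y" "gen y w" "norm (z - x) < e"
proof -
  obtain z1 y1 where 1: "gen z1 y1" "norm (z1 - x) < e/2"
    using dense_domain[of "e/2" x] assms by (metis half_gt_zero)
  obtain z y where 2: "gen z y" "norm (z - z1) < e/2" and 3: "\<And>v. gen z1 v \<Longrightarrow> \<exists>w. gen y w"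
    using dense_domain[of "e/2" z1] assms by (metis half_gt_zero)
  have "norm (z - x) < e"
    using norm_triangle_ineq[of "z - z1" "z1 - x"] 1(2) 2(2) by simp
  then show ?thesis using that 2(1) 3[OF 1(1)] by blast
qed

text \<open>The mean value inequality for S s (X n) - s y, whose derivative is S s (Y n) - y, bounds
  the error of the quotient by |Y n - y| plus the oscillation of S s y for s up to t. First n tends
  to infinity at fixed t, then t tends to 0.\<close>

lemma gen_closed:
  assumes g: "\<And>n. gen (X n) (Y n)" and X: "X \<longlonglongrightarrow> x" and Y: "Y \<longlonglongrightarrow> y"
  shows "gen x y"
proof -
  have main: "norm ((S t x - x) /\<^sub>R t - y) \<le> e"
    if t: "0 < t" and e: "\<And>s. 0 < s \<Longrightarrow> s < t \<Longrightarrow> norm (S s y - y) \<le> e" for t e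
  proof -
    have "norm ((S t (X n) - X n) /\<^sub>R t - y) \<le> norm (Y n - y) + e" for n
    proof -
      have "\<exists>s\<in>{0<..<t}. norm ((S t (X n) - t *\<^sub>R y) - (S 0 (X n) - 0 *\<^sub>R y))
          \<le> norm ((t - 0) *\<^sub>R (S s (Y n) - y))"
      proof (rule mvt_general[OF t])
        show "continuous_on {0..t} (\<lambda>s. S s (X n) - s *\<^sub>R y)"
          by (intro continuous_intros continuous_on_subset[OF continuous_S]) auto
        fix s assume "0 < s" "s < t"
        then have "((\<lambda>s. S s (X n) - s *\<^sub>R y) has_vector_derivative S s (Y n) - 1 *\<^sub>R y) (at s)"
          by (intro has_vector_derivative_diff has_vector_derivative_S g
              has_vector_derivative_scaleR[where g = "\<lambda>_. y" and g' = 0, simplified]) auto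
        then show "((\<lambda>s. S s (X n) - s *\<^sub>R y) has_derivative (\<lambda>h. h *\<^sub>R (S s (Y n) - y))) (at s)"
          by (simp add: has_vector_derivative_def)
      qed
      moreover have "S t (X n) - t *\<^sub>R y - X n = S t (X n) - X n - t *\<^sub>R y"
        by (simp add: algebra_simps)
      ultimately obtain s where s: "0 < s" "s < t"
        and b: "norm (S t (X n) - X n - t *\<^sub>R y) \<le> t * norm (S s (Y n) - y)"
        using t by (auto simp: S0)
      have eq: "(S t (X n) - X n) /\<^sub>R t - y = (S t (X n) - X n - t *\<^sub>R y) /\<^sub>R t"
        using t by (simp add: scaleR_diff_right)
      have "norm ((S t (X n) - X n) /\<^sub>R t - y) = norm (S t (X n) - X n - t *\<^sub>R y) / t"
        unfolding eq norm_scaleR using t by (simp add: divide_inverse mult.commute)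
      also have "\<dots> \<le> norm (S s (Y n) - y)"
        using b t by (simp add: pos_divide_le_eq mult.commute)
      also have "S s (Y n) - y = S s (Y n - y) + (S s y - y)"
        using s by (simp add: S_diff)
      also have "norm \<dots> \<le> norm (S s (Y n - y)) + norm (S s y - y)"
        by (rule norm_triangle_ineq)
      also have "\<dots> \<le> norm (Y n - y) + e"
        using s by (intro add_mono contr e) auto
      finally show ?thesis .
    qed
    moreover have "(\<lambda>n. norm ((S t (X n) - X n) /\<^sub>R t - y)) \<longlonglongrightarrow> norm ((S t x - x) /\<^sub>R t - y)"
      using t by (intro tendsto_intros X bounded_linear.tendsto[OF blin]) auto
    moreover have "(\<lambda>n. norm (Y n - y) + e) \<longlonglongrightarrow> norm (y - y) + e"
      by (intro tendsto_intros Y)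
    ultimately show ?thesis
      using LIMSEQ_le[of _ _ _ "norm (y - y) + e"] by fastforce
  qed
  show ?thesis unfolding gen_def
  proof (rule tendstoI)
    fix e :: real assume e: "0 < e"
    have "\<forall>\<^sub>F s in at_right 0. norm (S s y - y) < e / 2"
      using tendstoD[OF cont0[of y], of "e/2"] e by (simp add: dist_norm)
    then obtain b where b: "0 < b" "\<And>s. 0 < s \<Longrightarrow> s < b \<Longrightarrow> norm (S s y - y) < e / 2"
      unfolding eventually_at_right_field by auto
    have "norm ((S t x - x) /\<^sub>R t - y) < e" if "0 < t" "t < b" for t
    proof -
      have "norm ((S t x - x) /\<^sub>R t - y) \<le> e / 2"
        by (rule main) (use that b in \<open>auto intro!: less_imp_le\<close>)
      then show ?thesis using e by simp
    qed
    then show "\<forall>\<^sub>F t in at_right 0. dist ((S t x - x) /\<^sub>R t) y < e"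
      unfolding eventually_at_right_field dist_norm using b(1) by blast
  qed
qed

end

text \<open>The generator is \<open>-L\<close>, and \<open>L\<close> is accretive through the form \<open>b\<close> of a gradient \<open>D\<close>.\<close>

locale form_semigroup = contraction_semigroup S
  for S :: "real \<Rightarrow> 'h::{real_inner, banach} \<Rightarrow> 'h" +
  fixes V :: "'h set" and D :: "'h \<Rightarrow> 'g::real_inner" and b :: "'g \<Rightarrow> 'g \<Rightarrow> real"
    and l M :: real
  assumes l_pos: "0 < l" and M_nonneg: "0 \<le> M"
    and coercive: "l * (norm \<xi>)\<^sup>2 \<le> b \<xi> \<xi>"
    and b_bound: "\<bar>b \<xi> \<zeta>\<bar> \<le> M * norm \<xi> * norm \<zeta>"
    and gen_form: "gen u (- g) \<Longrightarrow> u \<in> V \<and> (\<forall>v\<in>V. b (D u) (D v) = g \<bullet> v)"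
    and D_diff: "u \<in> V \<Longrightarrow> v \<in> V \<Longrightarrow> D (u - v) = D u - D v"
begin

lemma gen_form': "gen u g \<Longrightarrow> u \<in> V \<and> (\<forall>v\<in>V. b (D u) (D v) = - (g \<bullet> v))"
  using gen_form[of u "- g"] by simp

text \<open>Analyticity: \<open>(M\<^sup>2 / (4 l\<^sup>2)) \<bar>u\<bar>\<^sup>2 + t\<^sup>2 \<bar>u'\<bar>\<^sup>2\<close> is nonincreasing along the flow.\<close>

lemma analytic_bound:
  assumes g1: "gen f f1" and g2: "gen f1 f2" and t: "0 < t"
  shows "t * norm (S t f1) \<le> M / (2 * l) * norm f"
proof -
  define K where "K = M / (2 * l)"
  define \<Phi> where "\<Phi> s = K\<^sup>2 * (S s f \<bullet> S s f) + s\<^sup>2 * (S s f1 \<bullet> S s f1)" for s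
  have decr: "\<Phi> t \<le> \<Phi> 0"
  proof (rule DERIV_nonpos_imp_decreasing_open[OF less_imp_le[OF t]])
    show "continuous_on {0..t} \<Phi>"
      unfolding \<Phi>_def by (intro continuous_intros continuous_on_subset[OF continuous_S]) auto
    fix s assume s: "0 < s" "s < t"
    have d: "((\<lambda>s. S s f) has_vector_derivative S s f1) (at s)"
      "((\<lambda>s. S s f1) has_vector_derivative S s f2) (at s)"
      using s by (auto intro: has_vector_derivative_S g1 g2)
    have d1: "((\<lambda>s. S s f \<bullet> S s f) has_real_derivative 2 * (S s f \<bullet> S s f1)) (at s)"
      using bounded_bilinear.has_vector_derivative[OF bounded_bilinear_inner d(1) d(1)]
      by (simp add: has_real_derivative_iff_has_vector_derivative inner_commute)
    have d2: "((\<lambda>s. S s f1 \<bullet> S s f1) has_real_derivative 2 * (S s f1 \<bullet> S s f2)) (at s)"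
      using bounded_bilinear.has_vector_derivative[OF bounded_bilinear_inner d(2) d(2)]
      by (simp add: has_real_derivative_iff_has_vector_derivative inner_commute)
    have "(\<Phi> has_real_derivative K\<^sup>2 * (2 * (S s f \<bullet> S s f1)) +
       (2 * s * (S s f1 \<bullet> S s f1) + s\<^sup>2 * (2 * (S s f1 \<bullet> S s f2)))) (at s)"
      unfolding \<Phi>_def by (rule derivative_eq_intros d1 d2 refl | simp)+
    moreover have "K\<^sup>2 * (2 * (S s f \<bullet> S s f1)) +
       (2 * s * (S s f1 \<bullet> S s f1) + s\<^sup>2 * (2 * (S s f1 \<bullet> S s f2))) \<le> 0"
    proof -
      let ?u = "S s f" and ?v = "S s f1" and ?w = "S s f2"
      have gu: "gen ?u ?v" and gv: "gen ?v ?w" using s by (auto intro: gen_S g1 g2)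
      define X where "X = norm (D ?u)"
      define Y where "Y = norm (D ?v)"
      have V: "?u \<in> V" "?v \<in> V" using gen_form'[OF gu] gen_form'[OF gv] by auto
      have 1: "?u \<bullet> ?v \<le> - l * X\<^sup>2"
        using gen_form'[OF gu] V coercive[of "D ?u"] by (simp add: inner_commute X_def)
      have 2: "?v \<bullet> ?w \<le> - l * Y\<^sup>2"
        using gen_form'[OF gv] V coercive[of "D ?v"] by (simp add: inner_commute Y_def)
      have 3: "?v \<bullet> ?v \<le> M * X * Y"
      proof -
        have "b (D ?u) (D ?v) = - (?v \<bullet> ?v)" using gen_form'[OF gu] V by auto
        then show ?thesis using b_bound[of "D ?u" "D ?v"] by (simp add: X_def Y_def)
      qed
      have "K\<^sup>2 * (2 * (?u \<bullet> ?v)) + (2 * s * (?v \<bullet> ?v) + s\<^sup>2 * (2 * (?v \<bullet> ?w)))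
          \<le> K\<^sup>2 * (2 * (- l * X\<^sup>2)) + (2 * s * (M * X * Y) + s\<^sup>2 * (2 * (- l * Y\<^sup>2)))"
        using 1 2 3 s by (intro add_mono mult_left_mono) auto
      \<comment> \<open>The choice K = M / (2 l) makes the cross term 2 s M X Y complete the square
        exactly.\<close>
      also have "\<dots> = - (2 * l) * (K * X - s * Y)\<^sup>2"
      proof -
        have "M = 2 * l * K" using l_pos by (simp add: K_def)
        then show ?thesis by (simp add: power2_eq_square algebra_simps)
      qed
      also have "\<dots> \<le> 0" using l_pos by (simp add: mult_nonpos_nonneg)
      finally show ?thesis .
    qed
    ultimately show "\<exists>y. (\<Phi> has_real_derivative y) (at s) \<and> y \<le> 0" by blast
  qed
  have "(t * norm (S t f1))\<^sup>2 \<le> \<Phi> t"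
    by (simp add: \<Phi>_def power_mult_distrib power2_norm_eq_inner)
  also have "\<dots> \<le> (K * norm f)\<^sup>2"
    using decr by (simp add: \<Phi>_def S0 power_mult_distrib power2_norm_eq_inner)
  finally have *: "(t * norm (S t f1))\<^sup>2 \<le> (K * norm f)\<^sup>2" .
  have "0 \<le> K * norm f" using l_pos M_nonneg by (simp add: K_def)
  then show ?thesis using * power2_le_imp_le by (auto simp: K_def)
qed

text \<open>\<open>analytic_bound\<close> holds on the domain of the square of the generator, which
  is dense, with a constant independent of the vector. Along approximations X n of f the images S t
  (Y n) are therefore Cauchy, and closedness identifies their limit.\<close>

lemma smoothing:
  assumes t: "0 < t"
  shows "\<exists>g. gen (S t f) g"
proof -
  have "\<exists>z y. (\<exists>w. gen z y \<and> gen y w) \<and> norm (z - f) < 1 / Suc n" for n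
    using dense_domain2[of "1 / Suc n" f] by (metis of_nat_0_less_iff zero_less_Suc zero_less_divide_1_iff)
  then obtain X Y where XY: "\<And>n. \<exists>w. gen (X n) (Y n) \<and> gen (Y n) w" "\<And>n. norm (X n - f) < 1 / Suc n"
    by metis
  have "(\<lambda>n. X n - f) \<longlonglongrightarrow> 0"
    by (rule Lim_null_comparison[OF _ LIMSEQ_Suc[OF lim_1_over_n]])
       (use XY(2) in \<open>auto intro!: always_eventually less_imp_le\<close>)
  then have X: "X \<longlonglongrightarrow> f" by (simp add: LIM_zero_iff)
  define C where "C = M / (2 * l) / t"
  have bd: "norm (S t (Y m) - S t (Y n)) \<le> C * norm (X m - X n)" for m n
  proof -
    obtain v w where "gen (Y m) v" "gen (Y n) w" using XY(1) by blast
    then have "gen (X m - X n) (Y m - Y n)" "gen (Y m - Y n) (v - w)"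
      using XY(1) by (auto intro!: gen_diff)
    from analytic_bound[OF this t] have "norm (S t (Y m) - S t (Y n)) * t \<le> M / (2 * l) * norm (X m - X n)"
      using t by (simp add: S_diff mult.commute)
    then have "norm (S t (Y m) - S t (Y n)) \<le> M / (2 * l) * norm (X m - X n) / t"
      using t by (simp only: pos_le_divide_eq)
    then show ?thesis by (simp add: C_def)
  qed
  have C0: "0 \<le> C" using l_pos M_nonneg t by (simp add: C_def)
  have "Cauchy (\<lambda>n. S t (Y n))"
  proof (rule CauchyI)
    fix e :: real assume e: "0 < e"
    obtain N where N: "\<And>m n. m \<ge> N \<Longrightarrow> n \<ge> N \<Longrightarrow> norm (X m - X n) < e / (C + 1)"
      using LIMSEQ_imp_Cauchy[OF X] e C0 unfolding Cauchy_iff by (metis add_nonneg_pos divide_pos_pos zero_less_one)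
    have "norm (S t (Y m) - S t (Y n)) < e" if "m \<ge> N" "n \<ge> N" for m n
    proof -
      have "norm (S t (Y m) - S t (Y n)) \<le> C * (e / (C + 1))"
        using bd[of m n] mult_left_mono[OF less_imp_le[OF N[OF that]] C0] by linarith
      also have "\<dots> < e" using e C0 by (simp add: field_simps)
      finally show ?thesis .
    qed
    then show "\<exists>N. \<forall>m\<ge>N. \<forall>n\<ge>N. norm (S t (Y m) - S t (Y n)) < e" by blast
  qed
  then obtain g where Y: "(\<lambda>n. S t (Y n)) \<longlonglongrightarrow> g"
    by (auto simp: Cauchy_convergent_iff convergent_def)
  have "gen (S t f) g"
  proof (rule gen_closed[OF _ _ Y])
    show "gen (S t (X n)) (S t (Y n))" for n
      using XY(1) t by (auto intro: gen_S)
    show "(\<lambda>n. S t (X n)) \<longlonglongrightarrow> S t f"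
      using t by (intro bounded_linear.tendsto[OF blin] X) auto
  qed
  then show ?thesis ..
qed

section \<open>Powers of the operator along the semigroup\<close>

definition Lop :: "'h \<Rightarrow> 'h" where
  "Lop x = - (THE y. gen x y)"

lemma Lop_eq: "gen x y \<Longrightarrow> Lop x = - y"
  unfolding Lop_def using gen_unique by (metis (mono_tags, lifting) the_equality)

text \<open>This is L^k exp(-t L) f. The operator acts after the semigroup, because f itself need
  not lie in its domain.\<close>

primrec flow :: "'h \<Rightarrow> nat \<Rightarrow> real \<Rightarrow> 'h" where
  "flow f 0 t = S t f"
| "flow f (Suc k) t = Lop (flow f k t)"

text \<open>The two claims need a joint induction. The shift formula at level k + 1 holds because
  the generator commutes with S; it writes the flow at s as S (s/2) of the flow at s/2, and
  \<open>smoothing\<close> then puts it into the domain once more.\<close>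

lemma flow_shift_gen:
  assumes "0 < s"
  shows "(\<forall>t\<ge>s. flow f k t = S (t - s) (flow f k s)) \<and> gen (flow f k s) (- flow f (Suc k) s)"
  using assms
proof (induction k arbitrary: s)
  case 0
  obtain g where g: "gen (S s f) g" using smoothing[OF 0] by blast
  show ?case
  proof (intro conjI allI impI)
    show "flow f 0 t = S (t - s) (flow f 0 s)" if "s \<le> t" for t
      using S_add[of "t - s" s f] 0 that by simp
    show "gen (flow f 0 s) (- flow f (Suc 0) s)"
      using g Lop_eq[OF g] by simp
  qed
next
  case (Suc k)
  have g: "gen (flow f k s) (- flow f (Suc k) s)" if "0 < s" for s
    using Suc.IH[OF that] by blast
  have shift: "flow f (Suc k) t = S (t - s) (flow f (Suc k) s)" if st: "0 < s" "s \<le> t" for s t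
  proof -
    have eq: "flow f k t = S (t - s) (flow f k s)"
      using Suc.IH[OF st(1)] st(2) by blast
    have "gen (flow f k t) (S (t - s) (- flow f (Suc k) s))"
      unfolding eq using st(2) by (intro gen_S g[OF st(1)]) simp
    from Lop_eq[OF this] show ?thesis
      using st by (simp add: linear_neg[OF lin] del: flow.simps(2)) simp
  qed
  have eq: "flow f (Suc k) s = S (s/2) (flow f (Suc k) (s/2))"
    using shift[of "s/2" s] Suc.prems by (simp del: flow.simps)
  obtain g where g: "gen (flow f (Suc k) s) g"
    unfolding eq using smoothing[of "s/2" "flow f (Suc k) (s/2)"] Suc.prems by auto
  then have "gen (flow f (Suc k) s) (- flow f (Suc (Suc k)) s)"
    using Lop_eq[OF g] by simp
  then show ?case using shift Suc.prems by blast
qed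

lemma flow_shift: "0 < s \<Longrightarrow> s \<le> t \<Longrightarrow> flow f k t = S (t - s) (flow f k s)"
  using flow_shift_gen by blast

lemma gen_flow: "0 < s \<Longrightarrow> gen (flow f k s) (- flow f (Suc k) s)"
  using flow_shift_gen by blast

lemma flow_form:
  assumes "0 < t"
  shows "flow f k t \<in> V" and "v \<in> V \<Longrightarrow> b (D (flow f k t)) (D v) = flow f (Suc k) t \<bullet> v"
  using gen_form[OF gen_flow[OF assms, of f k]] by auto

text \<open>Restarting the semigroup at time t/2, where the flow already lies in the domain, reduces
  this to \<open>has_vector_derivative_S\<close>.\<close>

lemma has_vector_derivative_flow:
  assumes t: "0 < t"
  shows "(flow f k has_vector_derivative - flow f (Suc k) t) (at t)"
proof -
  have "((\<lambda>s. S s (flow f k (t/2))) \<circ> (\<lambda>s. s - t/2) has_vector_derivative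
      1 *\<^sub>R S (t/2) (- flow f (Suc k) (t/2))) (at t)"
    using t by (intro vector_diff_chain_at)
      (auto intro!: derivative_eq_intros has_vector_derivative_S gen_flow simp del: flow.simps)
  then have d: "((\<lambda>s. S s (flow f k (t/2))) \<circ> (\<lambda>s. s - t/2) has_vector_derivative
      S (t/2) (- flow f (Suc k) (t/2))) (at t)" by simp
  have eq: "S (t/2) (- flow f (Suc k) (t/2)) = - flow f (Suc k) t"
  proof -
    have "flow f (Suc k) t = S (t - t/2) (flow f (Suc k) (t/2))"
      by (rule flow_shift) (use t in auto)
    also have "t - t/2 = t/2" by simp
    finally show ?thesis using t by (simp add: linear_neg[OF lin] del: flow.simps)
  qed
  show ?thesis
  proof (rule has_vector_derivative_transform_within_open[OF d[unfolded eq]])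
    show "open {t/2<..}" "t \<in> {t/2<..}" using t by auto
    fix y assume "y \<in> {t/2<..}"
    then have "flow f k y = S (y - t/2) (flow f k (t/2))"
      using t by (intro flow_shift) auto
    then show "((\<lambda>s. S s (flow f k (t/2))) \<circ> (\<lambda>s. s - t/2)) y = flow f k y" by simp
  qed
qed

lemma continuous_flow: "continuous_on {0<..} (flow f k)"
  by (auto intro!: continuous_at_imp_continuous_on has_vector_derivative_continuous
      has_vector_derivative_flow simp del: flow.simps)

text \<open>The gradient is not controlled by the Hilbert norm, but the weak equation and coercivity
  bound l |D w|^2 by |w'| |w|, where w and w' are the differences of two values of the flow at
  levels k and k + 1. Both differences tend to 0.\<close>

lemma continuous_D_flow: "continuous_on {0<..} (\<lambda>t. D (flow f k t))"
  unfolding continuous_on_def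
proof (intro ballI)
  fix s :: real assume "s \<in> {0<..}"
  then have s: "0 < s" by simp
  have bd: "norm (D (flow f k t) - D (flow f k s))
      \<le> sqrt (norm (flow f (Suc k) t - flow f (Suc k) s) * norm (flow f k t - flow f k s) / l)"
    if t: "0 < t" for t
  proof (rule real_le_rsqrt)
    define w where "w = flow f k t - flow f k s"
    define w' where "w' = flow f (Suc k) t - flow f (Suc k) s"
    have "gen w (- w')"
      using gen_diff[OF gen_flow[OF t, of f k] gen_flow[OF s, of f k]] by (simp add: w_def w'_def)
    then have w: "w \<in> V" "b (D w) (D w) = w' \<bullet> w" using gen_form by auto
    have Dw: "D w = D (flow f k t) - D (flow f k s)"
      unfolding w_def by (intro D_diff flow_form s t)
    have "l * (norm (D w))\<^sup>2 \<le> norm w' * norm w"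
      using coercive[of "D w"] w(2) norm_cauchy_schwarz[of w' w] by simp
    then show "(norm (D (flow f k t) - D (flow f k s)))\<^sup>2
        \<le> norm (flow f (Suc k) t - flow f (Suc k) s) * norm (flow f k t - flow f k s) / l"
      using l_pos by (simp add: Dw field_simps del: flow.simps flip: w_def w'_def)
  qed
  have c: "((\<lambda>t. flow f j t) \<longlongrightarrow> flow f j s) (at s within {0<..})" for j
    using continuous_flow[of f j] s by (auto simp: continuous_on_def)
  have "((\<lambda>t. sqrt (norm (flow f (Suc k) t - flow f (Suc k) s) * norm (flow f k t - flow f k s) / l))
      \<longlongrightarrow> sqrt (norm (flow f (Suc k) s - flow f (Suc k) s) * norm (flow f k s - flow f k s) / l)) (at s within {0<..})"
    using l_pos by (intro tendsto_intros c) auto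
  then have "((\<lambda>t. sqrt (norm (flow f (Suc k) t - flow f (Suc k) s) * norm (flow f k t - flow f k s) / l))
      \<longlongrightarrow> 0) (at s within {0<..})" by simp
  then have "((\<lambda>t. D (flow f k t) - D (flow f k s)) \<longlongrightarrow> 0) (at s within {0<..})"
    by (rule Lim_null_comparison[rotated])
       (auto simp: eventually_at_filter simp del: flow.simps intro!: always_eventually bd)
  then show "((\<lambda>t. D (flow f k t)) \<longlongrightarrow> D (flow f k s)) (at s within {0<..})"
    by (simp add: LIM_zero_iff)
qed

end



section \<open>Test functions and weak gradients\<close>

lemma partial_derivI: "(\<phi> has_derivative \<phi>') (at x) \<Longrightarrow> partial_deriv i \<phi> x = \<phi>' (axis i 1)"
  unfolding partial_deriv_def by (metis frechet_derivative_at)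

lemma C_k_Suc_imp: "C_k (Suc k) \<phi> \<Longrightarrow> C_k k \<phi>"
proof (induction k arbitrary: \<phi>)
  case 0
  then show ?case
    by (auto intro!: continuous_at_imp_continuous_on differentiable_imp_continuous_within)
next
  case (Suc k)
  then show ?case by (metis C_k.simps(2))
qed

lemma C_k_const: "C_k k (\<lambda>_ :: real^'n. c)"
proof (induction k arbitrary: c)
  case (Suc k)
  have "partial_deriv i (\<lambda>_ :: real^'n. c) = (\<lambda>_. 0)" for i
    by (rule ext, subst partial_derivI[OF has_derivative_const]) simp
  then show ?case using Suc by simp
qed simp

lemma C_k_add: "C_k k \<phi> \<Longrightarrow> C_k k \<psi> \<Longrightarrow> C_k k (\<lambda>x. \<phi> x + \<psi> x)"
proof (induction k arbitrary: \<phi> \<psi>)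
  case (Suc k)
  have d: "\<phi> differentiable at x" "\<psi> differentiable at x" for x using Suc.prems by auto
  have "partial_deriv i (\<lambda>x. \<phi> x + \<psi> x) = (\<lambda>x. partial_deriv i \<phi> x + partial_deriv i \<psi> x)" for i
    using d by (intro ext, subst partial_derivI[OF has_derivative_add[OF
          frechet_derivative_works[THEN iffD1] frechet_derivative_works[THEN iffD1]]]) (auto simp: partial_deriv_def)
  then show ?case using Suc by auto
qed (auto intro: continuous_intros)

lemma partial_deriv_mult:
  assumes "\<phi> differentiable at x" "\<psi> differentiable at x"
  shows "partial_deriv i (\<lambda>x. \<phi> x * \<psi> x) x = \<phi> x * partial_deriv i \<psi> x + partial_deriv i \<phi> x * \<psi> x"
  by (subst partial_derivI[OF has_derivative_mult[OF frechet_derivative_works[THEN iffD1] frechet_derivative_works[THEN iffD1]]])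
     (use assms in \<open>auto simp: partial_deriv_def\<close>)

lemma C_k_mult: "C_k k \<phi> \<Longrightarrow> C_k k \<psi> \<Longrightarrow> C_k k (\<lambda>x. \<phi> x * \<psi> x)"
proof (induction k arbitrary: \<phi> \<psi>)
  case (Suc k)
  have d: "\<phi> differentiable at x" "\<psi> differentiable at x" for x using Suc.prems by auto
  have "partial_deriv i (\<lambda>x. \<phi> x * \<psi> x) = (\<lambda>x. \<phi> x * partial_deriv i \<psi> x + partial_deriv i \<phi> x * \<psi> x)" for i
    using d by (intro ext partial_deriv_mult)
  moreover have "C_k k \<phi>" "C_k k \<psi>" using Suc.prems C_k_Suc_imp by auto
  ultimately show ?case using Suc by (auto intro!: C_k_add)
qed (auto intro: continuous_intros)

lemma C_k_prod: "(\<And>i. i \<in> I \<Longrightarrow> C_k k (f i)) \<Longrightarrow> C_k k (\<lambda>x. \<Prod>i\<in>I. f i x)"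
  by (induction I rule: infinite_finite_induct) (auto intro: C_k_const C_k_mult)

text \<open>A family containing the classical exp(-1/x) and closed under differentiation
  (\<open>flat_deriv\<close>); smoothness then follows by induction over the order with the
  polynomial kept general.\<close>

definition flat :: "real poly \<Rightarrow> real \<Rightarrow> real" where
  "flat p x = (if 0 < x then poly p (1 / x) * exp (- (1 / x)) else 0)"

lemma poly_div_exp_tendsto_0: "((\<lambda>x. poly p x / exp x) \<longlongrightarrow> 0) at_top" for p :: "real poly"
proof -
  have "((\<lambda>x. \<Sum>i\<le>degree p. coeff p i * (x ^ i / exp x)) \<longlongrightarrow> (\<Sum>i\<le>degree p. coeff p i * 0)) at_top"
    by (intro tendsto_intros tendsto_power_div_exp_0)
  then show ?thesis by (simp add: poly_altdef sum_divide_distrib)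
qed

lemma flat_deriv: "(flat p has_real_derivative flat ([:0, 0, 1:] * (p - pderiv p)) x) (at x)"
proof -
  consider "0 < x" | "x < 0" | "x = 0" by linarith
  then show ?thesis
  proof cases
    case 1
    have "((\<lambda>x. poly p (1 / x) * exp (- (1 / x))) has_real_derivative
        poly ([:0, 0, 1:] * (p - pderiv p)) (1 / x) * exp (- (1 / x))) (at x)"
      using 1 by (auto intro!: derivative_eq_intros DERIV_chain2[OF poly_DERIV]
          simp: field_simps power2_eq_square)
    then have "(flat p has_real_derivative poly ([:0, 0, 1:] * (p - pderiv p)) (1 / x) * exp (- (1 / x))) (at x)"
      by (rule has_field_derivative_transform_within_open[of _ _ _ "{0<..}"]) (use 1 in \<open>auto simp: flat_def\<close>)
    then show ?thesis using 1 by (simp add: flat_def)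
  next
    case 2
    have "(flat p has_real_derivative 0) (at x)"
      by (rule has_field_derivative_transform_within_open[of "\<lambda>_. 0" _ _ "{..<0}"]) (use 2 in \<open>auto simp: flat_def\<close>)
    then show ?thesis using 2 by (simp add: flat_def)
  next
    case 3
    \<comment> \<open>The division by h in the difference quotient is one more factor 1/h, hence
      \<open>pCons 0 p\<close>.\<close>
    have "((\<lambda>h. poly (pCons 0 p) (inverse h) / exp (inverse h)) \<longlongrightarrow> 0) (at_right 0)"
      by (rule filterlim_compose[OF poly_div_exp_tendsto_0 filterlim_inverse_at_top_right])
    then have "((\<lambda>h. flat p h / h) \<longlongrightarrow> 0) (at_right 0)"
      by (rule Lim_transform_eventually)
         (auto simp: eventually_at_filter flat_def exp_minus field_simps intro!: always_eventually)
    moreover have "((\<lambda>h. flat p h / h) \<longlongrightarrow> 0) (at_left 0)"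
      by (rule Lim_transform_eventually[OF tendsto_const])
         (auto simp: eventually_at_filter flat_def intro!: always_eventually)
    ultimately have "((\<lambda>h. flat p h / h) \<longlongrightarrow> 0) (at 0)"
      by (simp add: filterlim_split_at)
    then show ?thesis using 3 by (simp add: has_field_derivative_iff flat_def)
  qed
qed

text \<open>The factor c serves the induction: each partial derivative has the same shape with
  another constant and another polynomial.\<close>

lemma C_k_flat: "C_k k (\<lambda>x :: real^'n. c * flat p (a * (x $ i) + b))"
proof (induction k arbitrary: c p)
  have hd: "((\<lambda>x :: real^'n. c * flat p (a * (x $ i) + b)) has_derivative
      (\<lambda>h. c * (flat ([:0, 0, 1:] * (p - pderiv p)) (a * (x $ i) + b) * (a * (h $ i))))) (at x)" for x c p
  proof -
    have "((\<lambda>x :: real^'n. a * (x $ i) + b) has_derivative (\<lambda>h. a * (h $ i))) (at x)"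
      by (auto intro!: derivative_eq_intros bounded_linear_imp_has_derivative bounded_linear_vec_nth)
    from has_derivative_compose[OF this flat_deriv[unfolded has_field_derivative_def]]
    show ?thesis by (intro has_derivative_mult_right)
  qed
  {
    case 0
    show ?case using hd by (auto intro!: continuous_at_imp_continuous_on has_derivative_continuous)
  next
    case (Suc k)
    have "partial_deriv j (\<lambda>x :: real^'n. c * flat p (a * (x $ i) + b)) =
       (\<lambda>x. (c * a * (axis j 1 :: real^'n) $ i) * flat ([:0, 0, 1:] * (p - pderiv p)) (a * (x $ i) + b))" for j
      by (rule ext, subst partial_derivI[OF hd]) simp
    moreover have "(\<lambda>x :: real^'n. c * flat p (a * (x $ i) + b)) differentiable at x" for x
      using hd by (auto simp: differentiable_def)
    ultimately show ?case using Suc by simp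
  }
qed

definition smooth :: "(real^'n \<Rightarrow> real) \<Rightarrow> bool" where
  "smooth \<phi> \<longleftrightarrow> (\<forall>k. C_k k \<phi>)"

lemma smooth_differentiable: "smooth \<phi> \<Longrightarrow> \<phi> differentiable at x"
  unfolding smooth_def by (metis C_k.simps(2))

lemma smooth_partial_deriv: "smooth \<phi> \<Longrightarrow> smooth (partial_deriv i \<phi>)"
  unfolding smooth_def by (metis C_k.simps(2))

lemma smooth_continuous: "smooth \<phi> \<Longrightarrow> continuous_on UNIV \<phi>"
  unfolding smooth_def by (metis C_k.simps(1))

lemma smooth_mult: "smooth \<phi> \<Longrightarrow> smooth \<psi> \<Longrightarrow> smooth (\<lambda>x. \<phi> x * \<psi> x)"
  by (simp add: smooth_def C_k_mult)

lemma test_functions_iff: "\<phi> \<in> test_functions \<longleftrightarrow> smooth \<phi> \<and> compact (closure {x. \<phi> x \<noteq> 0})"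
  by (simp add: test_functions_def smooth_def)

lemma test_functionsI:
  assumes "smooth \<phi>" "compact K" "\<And>x. x \<notin> K \<Longrightarrow> \<phi> x = 0"
  shows "\<phi> \<in> test_functions"
proof -
  have "closure {x. \<phi> x \<noteq> 0} \<subseteq> K"
    using assms by (intro closure_minimal compact_imp_closed) auto
  then have "compact (closure {x. \<phi> x \<noteq> 0})"
    using compact_Int_closed[OF assms(2), of "closure {x. \<phi> x \<noteq> 0}"] by (simp add: inf.absorb2)
  then show ?thesis using assms by (simp add: test_functions_iff)
qed

lemma test_functions_mult: "smooth \<psi> \<Longrightarrow> \<phi> \<in> test_functions \<Longrightarrow> (\<lambda>x. \<psi> x * \<phi> x) \<in> test_functions"
  by (rule test_functionsI[of _ "closure {x. \<phi> x \<noteq> 0}"])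
     (use closure_subset[of "{x. \<phi> x \<noteq> 0}"] in \<open>auto simp: test_functions_iff smooth_mult\<close>)

lemma test_functions_partial_deriv:
  assumes "\<phi> \<in> test_functions" shows "partial_deriv i \<phi> \<in> test_functions"
proof (rule test_functionsI)
  show "smooth (partial_deriv i \<phi>)" "compact (closure {x. \<phi> x \<noteq> 0})"
    using assms by (auto simp: test_functions_iff smooth_partial_deriv)
  fix x assume x: "x \<notin> closure {x. \<phi> x \<noteq> 0}"
  have "(\<phi> has_derivative (\<lambda>_. 0)) (at x)"
    by (rule has_derivative_transform_within_open[of "\<lambda>_. 0" _ _ _ "- closure {x. \<phi> x \<noteq> 0}"])
       (use x closure_subset[of "{x. \<phi> x \<noteq> 0}"] in auto)
  then show "partial_deriv i \<phi> x = 0" by (simp add: partial_derivI)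
qed

lemma test_functions_bounded:
  assumes "\<phi> \<in> test_functions" obtains B where "0 \<le> B" "\<And>x. \<bar>\<phi> x\<bar> \<le> B"
proof -
  have "compact (\<phi> ` closure {x. \<phi> x \<noteq> 0})"
    using assms by (intro compact_continuous_image continuous_on_subset[OF smooth_continuous])
      (auto simp: test_functions_iff)
  then obtain B where B: "0 < B" "\<And>x. x \<in> closure {x. \<phi> x \<noteq> 0} \<Longrightarrow> \<bar>\<phi> x\<bar> \<le> B"
    by (metis compact_imp_bounded bounded_pos imageI real_norm_def)
  have "\<bar>\<phi> x\<bar> \<le> B" for x
    using B closure_subset[of "{x. \<phi> x \<noteq> 0}"] by (cases "\<phi> x = 0") auto
  then show ?thesis using that B by (meson less_imp_le)
qed

lemma smooth_measurable: "smooth \<phi> \<Longrightarrow> \<phi> \<in> borel_measurable lebesgue"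
  using borel_measurable_continuous_onI[OF smooth_continuous, of \<phi>] by (simp add: measurable_completion)

lemma test_functions_L2: "\<phi> \<in> test_functions \<Longrightarrow> (\<lambda>x. complex_of_real (\<phi> x)) \<in> L2"
proof -
  assume t: "\<phi> \<in> test_functions"
  let ?K = "closure {x. \<phi> x \<noteq> 0}"
  have "integrable lborel (\<lambda>x. indicator ?K x *\<^sub>R (\<phi> x)\<^sup>2)"
    using t by (intro borel_integrable_compact continuous_intros continuous_on_subset[OF smooth_continuous])
      (auto simp: test_functions_iff)
  also have "(\<lambda>x. indicator ?K x *\<^sub>R (\<phi> x)\<^sup>2) = (\<lambda>x. (\<phi> x)\<^sup>2)"
    using closure_subset[of "{x. \<phi> x \<noteq> 0}"] by (auto simp: indicator_def fun_eq_iff)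
  finally have "integrable lebesgue (\<lambda>x. (\<phi> x)\<^sup>2)"
    by (subst integrable_completion) (auto dest: borel_measurable_integrable)
  moreover have "\<phi> \<in> borel_measurable lebesgue"
    using t by (simp add: test_functions_iff smooth_measurable)
  ultimately show ?thesis by (simp add: L2_def)
qed

lemma L2_mult_integrable:
  fixes u v :: "real^'n \<Rightarrow> complex"
  assumes "u \<in> L2" "v \<in> L2" shows "integrable lebesgue (\<lambda>x. u x * v x)"
proof -
  note [measurable] = assms[THEN L2_measurable]
  show ?thesis
    by (rule Bochner_Integration.integrable_bound[OF L2_integrable_norm_mult[OF assms]])
       (auto simp: norm_mult)
qed

lemma L2_nth:
  fixes g :: "real^'n \<Rightarrow> complex^'m"
  assumes "g \<in> L2" shows "(\<lambda>x. g x $ i) \<in> L2"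
proof -
  note [measurable] = assms[THEN L2_measurable]
  have [measurable]: "(\<lambda>x :: complex^'m. x $ i) \<in> borel_measurable borel"
    by (intro borel_measurable_continuous_onI continuous_intros)
  show ?thesis
    by (rule L2_bound[OF assms, of _ 1]) (auto simp: Finite_Cartesian_Product.norm_nth_le)
qed

text \<open>The indicator of a box is the bounded pointwise limit of test functions. They are
  products over the faces of exp(-1 / (m s)), with s the distance to the face: this tends to 1
  inside as m grows, and the product vanishes outside for every m.\<close>

lemma null_test_imp_null_boxes:
  fixes h :: "real^'n \<Rightarrow> complex"
  assumes h: "h \<in> L2"
    and null: "\<And>\<phi>. \<phi> \<in> test_functions \<Longrightarrow> (LINT x|lebesgue. h x * complex_of_real (\<phi> x)) = 0"
  shows "integrable lebesgue (\<lambda>x. indicator (box a b) x *\<^sub>R h x)"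
    and "(LINT x|lebesgue. indicator (box a b) x *\<^sub>R h x) = 0"
proof -
  note [measurable] = h[THEN L2_measurable]
  have "(\<lambda>x. indicator (box a b) x :: complex) \<in> L2"
  proof -
    have "(\<lambda>x. (norm (indicator (box a b) x :: complex))\<^sup>2) = (indicator (box a b) :: _ \<Rightarrow> real)"
      by (auto simp: indicator_def)
    moreover have "(\<lambda>x. indicator (box a b) x :: complex) \<in> borel_measurable lebesgue"
      by (intro borel_measurable_indicator) auto
    moreover have "integrable lebesgue (indicator (box a b) :: _ \<Rightarrow> real)"
      using emeasure_lborel_box_finite[of a b] by (intro integrable_real_indicator) auto
    ultimately show ?thesis
      unfolding L2_def by simp
  qed
  from L2_mult_integrable[OF this h]
  show int: "integrable lebesgue (\<lambda>x. indicator (box a b) x *\<^sub>R h x)"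
    by (rule Bochner_Integration.integrable_cong[THEN iffD1, rotated 2]) (auto simp: indicator_def)
  define \<phi> where "\<phi> m x = (\<Prod>i\<in>UNIV. (1 * flat 1 (real m * (x $ i) + - (real m * a $ i))) *
      (1 * flat 1 (- real m * (x $ i) + real m * b $ i)))" for m and x :: "real^'n"
  have f01: "0 \<le> flat 1 y" "flat 1 y \<le> 1" for y by (auto simp: flat_def)
  have \<phi>0: "\<phi> m x = 0" if "x \<notin> box a b" for m x
  proof -
    obtain i where "x $ i \<le> a $ i \<or> b $ i \<le> x $ i"
      using \<open>x \<notin> box a b\<close> by (auto simp: mem_box_cart not_less)
    then have "flat 1 (real m * (x $ i) + - (real m * a $ i)) = 0 \<or> flat 1 (- real m * (x $ i) + real m * b $ i) = 0"
      using mult_left_mono[of "x $ i" "a $ i" "real m"] mult_left_mono[of "b $ i" "x $ i" "real m"]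
      by (auto simp: flat_def not_less)
    then show ?thesis unfolding \<phi>_def by (intro prod_zero) auto
  qed
  have \<phi>01: "0 \<le> \<phi> m x" "\<phi> m x \<le> 1" for m x
    unfolding \<phi>_def by (simp_all add: prod_nonneg prod_le_1 mult_le_one f01)
  have \<phi>t: "\<phi> m \<in> test_functions" for m
  proof (rule test_functionsI[of _ "cbox a b"])
    show "smooth (\<phi> m)" unfolding smooth_def \<phi>_def
      by (intro allI C_k_prod C_k_mult C_k_flat)
    show "\<phi> m x = 0" if "x \<notin> cbox a b" for x
      using that box_subset_cbox[of a b] by (intro \<phi>0) auto
  qed auto
  have lim: "(\<lambda>m. \<phi> m x) \<longlonglongrightarrow> indicator (box a b) x" for x
  proof (cases "x \<in> box a b")
    case False then show ?thesis by (simp add: \<phi>0)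
  next
    case True
    have fl: "(\<lambda>m. flat 1 (real m * c)) \<longlonglongrightarrow> 1" if "0 < c" for c :: real
    proof -
      have "(\<lambda>m. exp (- (1 / c / real m))) \<longlonglongrightarrow> exp (- 0)"
        by (intro tendsto_intros lim_const_over_n)
      then have "(\<lambda>m. exp (- (1 / c / real m))) \<longlonglongrightarrow> 1" by simp
      then show ?thesis
        by (rule Lim_transform_eventually)
           (use that in \<open>auto simp: flat_def mult.commute intro!: eventually_mono[OF eventually_gt_at_top[of 0]]\<close>)
    qed
    have "(\<lambda>m. \<phi> m x) \<longlonglongrightarrow> (\<Prod>i\<in>(UNIV :: 'n set). 1 * 1)"
      unfolding \<phi>_def
    proof (intro tendsto_prod tendsto_mult)
      fix i
      have ab: "a $ i < x $ i" "x $ i < b $ i" using True by (auto simp: mem_box_cart)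
      show "(\<lambda>m. 1 * flat 1 (real m * (x $ i) + - (real m * a $ i))) \<longlonglongrightarrow> 1"
        using fl[of "x $ i - a $ i"] ab by (simp add: algebra_simps)
      show "(\<lambda>m. 1 * flat 1 (- real m * (x $ i) + real m * b $ i)) \<longlonglongrightarrow> 1"
        using fl[of "b $ i - x $ i"] ab by (simp add: algebra_simps)
    qed
    then show ?thesis using True by simp
  qed
  have [measurable]: "\<phi> m \<in> borel_measurable lebesgue" for m
    using \<phi>t smooth_measurable by (auto simp: test_functions_iff)
  have "(\<lambda>m. LINT x|lebesgue. h x * complex_of_real (\<phi> m x)) \<longlonglongrightarrow> (LINT x|lebesgue. indicator (box a b) x *\<^sub>R h x)"
  proof (rule integral_dominated_convergence[where w = "\<lambda>x. norm (indicator (box a b) x *\<^sub>R h x)"])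
    show "integrable lebesgue (\<lambda>x. norm (indicator (box a b) x *\<^sub>R h x))"
      by (rule integrable_norm[OF int])
    show "AE x in lebesgue. (\<lambda>m. h x * complex_of_real (\<phi> m x)) \<longlonglongrightarrow> indicator (box a b) x *\<^sub>R h x"
    proof (rule AE_I2)
      fix x
      have "(\<lambda>m. h x * complex_of_real (\<phi> m x)) \<longlonglongrightarrow> h x * complex_of_real (indicator (box a b) x)"
        by (intro tendsto_intros lim)
      then show "(\<lambda>m. h x * complex_of_real (\<phi> m x)) \<longlonglongrightarrow> indicator (box a b) x *\<^sub>R h x"
        by (simp add: scaleR_conv_of_real mult.commute)
    qed
    show "AE x in lebesgue. norm (h x * complex_of_real (\<phi> m x)) \<le> norm (indicator (box a b) x *\<^sub>R h x)" for m
    proof (rule AE_I2)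
      fix x
      show "norm (h x * complex_of_real (\<phi> m x)) \<le> norm (indicator (box a b) x *\<^sub>R h x)"
        using \<phi>01[of m x] \<phi>0[of x m] by (cases "x \<in> box a b") (auto simp: norm_mult mult_left_le)
    qed
    show "(\<lambda>x. indicator (box a b) x *\<^sub>R h x) \<in> borel_measurable lebesgue"
      by (rule borel_measurable_integrable[OF int])
    show "(\<lambda>x. h x * complex_of_real (\<phi> m x)) \<in> borel_measurable lebesgue" for m
      by measurable
  qed
  then show "(LINT x|lebesgue. indicator (box a b) x *\<^sub>R h x) = 0"
    unfolding null[OF \<phi>t] by (simp add: LIMSEQ_const_iff)
qed

lemma sigma_finite_lebesgue: "sigma_finite_measure (lebesgue :: 'a::euclidean_space measure)"
proof
  obtain A :: "'a set set" where A: "countable A" "A \<subseteq> sets lborel" "\<Union>A = space lborel"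
      "\<And>a. a \<in> A \<Longrightarrow> emeasure lborel a \<noteq> \<infinity>"
    using lborel.sigma_finite_countable by metis
  moreover have "emeasure lebesgue a = emeasure lborel a" if "a \<in> A" for a
    using that A(2) by (auto simp: emeasure_completion main_part_sets subsetD)
  ultimately show "\<exists>A. countable A \<and> A \<subseteq> sets lebesgue \<and> \<Union>A = space lebesgue \<and>
      (\<forall>a\<in>A. emeasure (lebesgue :: 'a measure) a \<noteq> \<infinity>)"
    by (intro exI[of _ A]) auto
qed

text \<open>Boxes are stable under intersection and generate the Borel sets, so vanishing integrals
  spread to all Borel sets and, up to null sets, to all Lebesgue sets. The function is first
  restricted to a cube Q, because it is only square-integrable while the step to complements needs
  integrability on the whole space.\<close>

lemma null_test_imp_AE_zero:
  fixes h :: "real^'n \<Rightarrow> complex"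
  assumes h: "h \<in> L2"
    and null: "\<And>\<phi>. \<phi> \<in> test_functions \<Longrightarrow> (LINT x|lebesgue. h x * complex_of_real (\<phi> x)) = 0"
  shows "AE x in lebesgue. h x = 0"
proof -
  note boxes = null_test_imp_null_boxes[OF assms]
  have "AE x in lebesgue. indicator (box (- (real N *\<^sub>R One)) (real N *\<^sub>R One)) x *\<^sub>R h x = 0" for N :: nat
  proof -
    define Q where "Q = box (- (real N *\<^sub>R One)) (real N *\<^sub>R (One :: real^'n))"
    define f where "f x = indicator Q x *\<^sub>R h x" for x
    have int: "integrable lebesgue f" unfolding f_def Q_def by (rule boxes)
    have sint: "set_integrable lebesgue A f" if "A \<in> sets lebesgue" for A
      unfolding set_integrable_def by (rule integrable_mult_indicator[OF that int])
    have borel0: "set_lebesgue_integral lebesgue A f = 0" if "A \<in> sets borel" for A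
    proof -
      have G: "Int_stable (range (\<lambda>(a, b). box a b :: (real^'n) set))"
        by (auto simp: Int_stable_def box_Int_box)
      have bs: "sets borel = sigma_sets UNIV (range (\<lambda>(a, b). box a b :: (real^'n) set))"
        by (subst borel_eq_box) simp
      have sub: "range (\<lambda>(a, b). box a b :: (real^'n) set) \<subseteq> Pow UNIV" by simp
      have AG: "A \<in> sigma_sets UNIV (range (\<lambda>(a, b). box a b :: (real^'n) set))"
        using that bs by simp
      from G sub AG show ?thesis
      proof (induction rule: sigma_sets_induct_disjoint)
        case (basic A)
        then obtain a b where A: "A = box a b" by auto
        obtain c d where cd: "A \<inter> Q = box c d" unfolding A Q_def by (auto simp: box_Int_box)
        have "set_lebesgue_integral lebesgue A f = (LINT x|lebesgue. indicator (A \<inter> Q) x *\<^sub>R h x)"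
          unfolding set_lebesgue_integral_def f_def by (simp add: indicator_inter_arith)
        then show ?case unfolding cd by (simp add: boxes)
      next
        case empty
        show ?case by (simp add: set_lebesgue_integral_def)
      next
        case (compl A)
        then have A: "A \<in> sets lebesgue" by (simp flip: bs)
        have "set_lebesgue_integral lebesgue UNIV f = 0"
          unfolding set_lebesgue_integral_def f_def Q_def by (simp add: boxes)
        moreover have "set_lebesgue_integral lebesgue (A \<union> (UNIV - A)) f =
            set_lebesgue_integral lebesgue A f + set_lebesgue_integral lebesgue (UNIV - A) f"
          using A by (intro set_integral_Un sint) (auto intro: Compl_in_sets_lebesgue)
        moreover have "A \<union> (UNIV - A) = UNIV" by auto
        ultimately show ?case using compl by simp
      next
        case (union A)
        then have A: "A i \<in> sets lebesgue" for i by (auto simp flip: bs)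
        have "set_lebesgue_integral lebesgue (\<Union>i. A i) f = (\<Sum>i. set_lebesgue_integral lebesgue (A i) f)"
          using union A by (intro lebesgue_integral_countable_add sint) (auto simp: disjoint_family_on_def)
        then show ?case using union by simp
      qed
    qed
    have "set_lebesgue_integral lebesgue A f = 0" if A: "A \<in> sets lebesgue" for A
    proof -
      obtain S K K' where A': "A = S \<union> K" "K \<subseteq> K'" "K' \<in> null_sets lborel" "S \<in> sets lborel"
        using sets_completionE[OF A] by metis
      have "AE x in lebesgue. x \<notin> K'"
        using A'(3) by (intro AE_not_in) (simp add: null_sets_completionI)
      then have "AE x in lebesgue. indicator A x *\<^sub>R f x = indicator S x *\<^sub>R f x"
        by eventually_elim (use A' in \<open>auto simp: indicator_def\<close>)
      moreover have "f \<in> borel_measurable lebesgue" using int by (rule borel_measurable_integrable)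
      ultimately have "set_lebesgue_integral lebesgue A f = set_lebesgue_integral lebesgue S f"
        unfolding set_lebesgue_integral_def using A A'(4)
        by (intro integral_cong_AE borel_measurable_scaleR borel_measurable_indicator) auto
      then show ?thesis using borel0[of S] A'(4) by simp
    qed
    from sigma_finite_measure.density_zero[OF sigma_finite_lebesgue int this] show ?thesis by (simp add: f_def Q_def)
  qed
  then have "AE x in lebesgue. \<forall>N. indicator (box (- (real N *\<^sub>R One)) (real N *\<^sub>R One)) x *\<^sub>R h x = 0"
    by (subst AE_all_countable) blast
  then show ?thesis
  proof eventually_elim
    case (elim x)
    have "x \<in> (\<Union>i::nat. box (- (real i *\<^sub>R One)) (real i *\<^sub>R One))" using UN_box_eq_UNIV by auto
    then obtain N :: nat where "x \<in> box (- (real N *\<^sub>R One)) (real N *\<^sub>R One)" by auto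
    then show ?case using spec[OF elim, of N] by simp
  qed
qed

section \<open>Weak gradients: uniqueness and the product rule\<close>

lemma weak_gradient_integrable:
  assumes "has_weak_gradient u g" "\<phi> \<in> test_functions"
  shows "integrable lebesgue (\<lambda>x. u x * complex_of_real (\<phi> x))"
    "integrable lebesgue (\<lambda>x. g x $ i * complex_of_real (\<phi> x))"
  using assms by (auto simp: has_weak_gradient_def intro!: L2_mult_integrable L2_nth test_functions_L2)

lemma has_weak_gradient_diff:
  fixes u v :: "real^'n \<Rightarrow> complex"
  assumes u: "has_weak_gradient u g" and v: "has_weak_gradient v h"
  shows "has_weak_gradient (\<lambda>x. u x - v x) (\<lambda>x. g x - h x)"
  unfolding has_weak_gradient_def
proof (intro conjI ballI allI)
  fix \<phi> :: "real^'n \<Rightarrow> real" and i assume \<phi>: "\<phi> \<in> test_functions"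
  note \<phi>' = test_functions_partial_deriv[OF \<phi>, of i]
  show "(LINT x|lebesgue. (u x - v x) * complex_of_real (partial_deriv i \<phi> x)) =
      - (LINT x|lebesgue. (g x - h x) $ i * complex_of_real (\<phi> x))"
    using \<phi> u v weak_gradient_integrable[OF u \<phi>] weak_gradient_integrable[OF v \<phi>]
      weak_gradient_integrable(1)[OF u \<phi>'] weak_gradient_integrable(1)[OF v \<phi>']
    by (simp add: left_diff_distrib has_weak_gradient_def)
qed (use u v in \<open>auto simp: has_weak_gradient_def intro: L2_diff\<close>)

lemma has_weak_gradient_scaleR:
  fixes u :: "real^'n \<Rightarrow> complex"
  assumes u: "has_weak_gradient u g"
  shows "has_weak_gradient (\<lambda>x. c *\<^sub>R u x) (\<lambda>x. c *\<^sub>R g x)"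
  using u by (auto simp: has_weak_gradient_def intro!: L2_scaleR)

lemma has_weak_gradient_cong:
  fixes u v :: "real^'n \<Rightarrow> complex"
  assumes u: "has_weak_gradient u g" and v: "AE x in lebesgue. u x = v x"
  shows "has_weak_gradient v g"
  unfolding has_weak_gradient_def
proof (intro conjI ballI allI)
  show vL: "v \<in> L2" and "g \<in> L2"
    using u L2_cong_AE[OF _ v] by (auto simp: has_weak_gradient_def)
  fix \<phi> :: "real^'n \<Rightarrow> real" and i assume \<phi>: "\<phi> \<in> test_functions"
  note \<phi>' = test_functions_partial_deriv[OF \<phi>, of i]
  have "(LINT x|lebesgue. v x * complex_of_real (partial_deriv i \<phi> x)) =
      (LINT x|lebesgue. u x * complex_of_real (partial_deriv i \<phi> x))"
  proof (rule integral_cong_AE)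
    show "(\<lambda>x. v x * complex_of_real (partial_deriv i \<phi> x)) \<in> borel_measurable lebesgue"
      using L2_mult_integrable[OF vL test_functions_L2[OF \<phi>']] by (rule borel_measurable_integrable)
    show "(\<lambda>x. u x * complex_of_real (partial_deriv i \<phi> x)) \<in> borel_measurable lebesgue"
      using weak_gradient_integrable(1)[OF u \<phi>'] by (rule borel_measurable_integrable)
    show "AE x in lebesgue. v x * complex_of_real (partial_deriv i \<phi> x) = u x * complex_of_real (partial_deriv i \<phi> x)"
      using v by eventually_elim simp
  qed
  then show "(LINT x|lebesgue. v x * complex_of_real (partial_deriv i \<phi> x)) =
      - (LINT x|lebesgue. g x $ i * complex_of_real (\<phi> x))"
    using u \<phi> by (simp add: has_weak_gradient_def)
qed

lemma has_weak_gradient_unique: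
  fixes u :: "real^'n \<Rightarrow> complex"
  assumes u: "has_weak_gradient u g" and v: "has_weak_gradient u h"
  shows "AE x in lebesgue. g x = h x"
proof -
  have "AE x in lebesgue. g x $ i - h x $ i = 0" for i
  proof (rule null_test_imp_AE_zero)
    show "(\<lambda>x. g x $ i - h x $ i) \<in> L2"
      using u v by (auto simp: has_weak_gradient_def intro!: L2_diff L2_nth)
    fix \<phi> :: "real^'n \<Rightarrow> real" assume \<phi>: "\<phi> \<in> test_functions"
    then show "(LINT x|lebesgue. (g x $ i - h x $ i) * complex_of_real (\<phi> x)) = 0"
      using u v weak_gradient_integrable[OF u \<phi>] weak_gradient_integrable[OF v \<phi>]
      by (simp add: left_diff_distrib has_weak_gradient_def)
  qed
  then have "AE x in lebesgue. \<forall>i\<in>UNIV. g x $ i - h x $ i = 0"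
    by (subst AE_finite_all) auto
  then show ?thesis by eventually_elim (simp add: vec_eq_iff)
qed

text \<open>u is tested against the derivative of psi phi, which is again a test function; the term
  containing the derivative of psi moves to the other side.\<close>

lemma has_weak_gradient_mult:
  fixes u :: "real^'n \<Rightarrow> complex"
  assumes u: "has_weak_gradient u g" and \<psi>: "\<psi> \<in> test_functions"
  shows "has_weak_gradient (\<lambda>x. \<psi> x *\<^sub>R u x) (\<lambda>x. \<psi> x *\<^sub>R g x + (\<chi> i. partial_deriv i \<psi> x *\<^sub>R u x))"
  unfolding has_weak_gradient_def
proof (intro conjI ballI allI)
  have uL: "u \<in> L2" and gL: "g \<in> L2" using u by (auto simp: has_weak_gradient_def)
  note [measurable] = L2_measurable[OF uL] L2_measurable[OF gL]
  have \<psi>s: "smooth \<psi>" using \<psi> by (simp add: test_functions_iff)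
  have [measurable]: "\<psi> \<in> borel_measurable lebesgue" "partial_deriv i \<psi> \<in> borel_measurable lebesgue" for i
    using \<psi>s by (auto intro: smooth_measurable smooth_partial_deriv)
  have mulL: "(\<lambda>x. \<phi> x *\<^sub>R f x) \<in> L2"
    if \<phi>: "\<phi> \<in> test_functions" and f: "f \<in> L2" for \<phi> :: "real^'n \<Rightarrow> real" and f :: "real^'n \<Rightarrow> 'c::euclidean_space"
  proof -
    obtain B where B: "\<And>x. \<bar>\<phi> x\<bar> \<le> B" using test_functions_bounded[OF \<phi>] by metis
    have [measurable]: "\<phi> \<in> borel_measurable lebesgue" "f \<in> borel_measurable lebesgue"
      using \<phi> f by (auto simp: test_functions_iff intro: smooth_measurable L2_measurable)
    show ?thesis
      by (rule L2_bound[OF f, of _ B]) (auto intro!: mult_right_mono B)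
  qed
  show "(\<lambda>x. \<psi> x *\<^sub>R u x) \<in> L2" by (rule mulL[OF \<psi> uL])
  have "(\<lambda>x. \<Sum>i\<in>UNIV. axis i (partial_deriv i \<psi> x *\<^sub>R u x)) \<in> L2"
  proof -
    have "(\<lambda>x. \<Sum>i\<in>I. axis i (partial_deriv i \<psi> x *\<^sub>R u x)) \<in> L2" for I :: "'n set"
    proof (induction I rule: infinite_finite_induct)
      case (insert i I)
      have [measurable]: "(\<lambda>z :: complex. axis i z :: complex^'n) \<in> borel_measurable borel"
        unfolding axis_def
      proof (intro borel_measurable_continuous_onI continuous_on_vec_lambda)
        show "continuous_on UNIV (\<lambda>z :: complex. if j = i then z else 0)" for j
          by (cases "j = i") auto
      qed
      have [simp]: "norm (axis i z :: complex^'n) = norm z" for z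
        by (simp add: norm_eq_sqrt_inner inner_axis_axis)
      have "(\<lambda>x. axis i (partial_deriv i \<psi> x *\<^sub>R u x) :: complex^'n) \<in> L2"
        by (rule L2_bound[OF mulL[OF test_functions_partial_deriv[OF \<psi>, of i] uL], of _ 1]) auto
      then show ?case using insert by (auto intro!: L2_add)
    qed auto
    then show ?thesis .
  qed
  also have "(\<lambda>x. \<Sum>i\<in>UNIV. axis i (partial_deriv i \<psi> x *\<^sub>R u x)) = (\<lambda>x. \<chi> i. partial_deriv i \<psi> x *\<^sub>R u x)"
    by (auto simp: vec_eq_iff axis_def sum.delta fun_eq_iff if_distrib cong: if_cong)
  finally show "(\<lambda>x. \<psi> x *\<^sub>R g x + (\<chi> i. partial_deriv i \<psi> x *\<^sub>R u x)) \<in> L2"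
    by (intro L2_add mulL[OF \<psi> gL])
  fix \<phi> :: "real^'n \<Rightarrow> real" and i assume \<phi>: "\<phi> \<in> test_functions"
  then have \<phi>s: "smooth \<phi>" by (simp add: test_functions_iff)
  have 1: "(\<lambda>x. \<psi> x * \<phi> x) \<in> test_functions" by (rule test_functions_mult[OF \<psi>s \<phi>])
  have 2: "(\<lambda>x. partial_deriv i \<psi> x * \<phi> x) \<in> test_functions"
    by (rule test_functions_mult[OF smooth_partial_deriv[OF \<psi>s] \<phi>])
  have pd: "partial_deriv i (\<lambda>x. \<psi> x * \<phi> x) x = \<psi> x * partial_deriv i \<phi> x + partial_deriv i \<psi> x * \<phi> x" for x
    by (intro partial_deriv_mult smooth_differentiable \<psi>s \<phi>s)
  have "(LINT x|lebesgue. (\<psi> x *\<^sub>R u x) * complex_of_real (partial_deriv i \<phi> x)) =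
      (LINT x|lebesgue. u x * complex_of_real (partial_deriv i (\<lambda>x. \<psi> x * \<phi> x) x) -
         u x * complex_of_real (partial_deriv i \<psi> x * \<phi> x))"
    unfolding pd by (simp add: algebra_simps scaleR_conv_of_real)
  also have "\<dots> = (LINT x|lebesgue. u x * complex_of_real (partial_deriv i (\<lambda>x. \<psi> x * \<phi> x) x)) -
         (LINT x|lebesgue. u x * complex_of_real (partial_deriv i \<psi> x * \<phi> x))"
    by (rule Bochner_Integration.integral_diff weak_gradient_integrable[OF u] test_functions_partial_deriv 1 2)+
  also have "(LINT x|lebesgue. u x * complex_of_real (partial_deriv i (\<lambda>x. \<psi> x * \<phi> x) x)) =
      - (LINT x|lebesgue. g x $ i * complex_of_real (\<psi> x * \<phi> x))"
    using u 1 by (simp add: has_weak_gradient_def)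
  also have "- (LINT x|lebesgue. g x $ i * complex_of_real (\<psi> x * \<phi> x)) -
       (LINT x|lebesgue. u x * complex_of_real (partial_deriv i \<psi> x * \<phi> x)) =
      - (LINT x|lebesgue. g x $ i * complex_of_real (\<psi> x * \<phi> x) + u x * complex_of_real (partial_deriv i \<psi> x * \<phi> x))"
    by (subst Bochner_Integration.integral_add[OF weak_gradient_integrable(2)[OF u 1] weak_gradient_integrable(1)[OF u 2]]) simp
  also have "(LINT x|lebesgue. g x $ i * complex_of_real (\<psi> x * \<phi> x) + u x * complex_of_real (partial_deriv i \<psi> x * \<phi> x)) =
     (LINT x|lebesgue. (\<psi> x *\<^sub>R g x + (\<chi> i. partial_deriv i \<psi> x *\<^sub>R u x)) $ i * complex_of_real (\<phi> x))"
    by (rule Bochner_Integration.integral_cong) (simp_all add: scaleR_conv_of_real[where 'a = complex] distrib_left distrib_right mult_ac)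
  finally show "(LINT x|lebesgue. (\<psi> x *\<^sub>R u x) * complex_of_real (partial_deriv i \<phi> x)) =
     - (LINT x|lebesgue. (\<psi> x *\<^sub>R g x + (\<chi> i. partial_deriv i \<psi> x *\<^sub>R u x)) $ i * complex_of_real (\<phi> x))" .
qed

lemma has_weak_gradient_weak_gradient: "u \<in> W12 \<Longrightarrow> has_weak_gradient u (weak_gradient u)"
  unfolding W12_def weak_gradient_def by (auto intro: someI[of "has_weak_gradient u"])



section \<open>Pointwise multiplication on classes\<close>

lemma borel_measurable_vec_complex:
  fixes f :: "'a \<Rightarrow> complex^'n"
  assumes "\<And>i. (\<lambda>x. f x $ i) \<in> borel_measurable N"
  shows "f \<in> borel_measurable N"
proof -
  have ax: "(\<lambda>z :: complex. axis i z :: complex^'n) \<in> borel_measurable borel" for i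
    unfolding axis_def
  proof (intro borel_measurable_continuous_onI continuous_on_vec_lambda)
    show "continuous_on UNIV (\<lambda>z :: complex. if j = i then z else 0)" for j
      by (cases "j = i") auto
  qed
  have "(\<lambda>x. \<Sum>i\<in>UNIV. axis i (f x $ i)) \<in> borel_measurable N"
    by (intro borel_measurable_sum measurable_compose[OF assms ax])
  also have "(\<lambda>x. \<Sum>i\<in>UNIV. axis i (f x $ i)) = f"
    by (auto simp: vec_eq_iff axis_def sum.delta fun_eq_iff if_distrib cong: if_cong)
  finally show ?thesis .
qed

definition bounded_meas :: "(real^'n \<Rightarrow> real) \<Rightarrow> bool" where
  "bounded_meas \<phi> \<longleftrightarrow> \<phi> \<in> borel_measurable lebesgue \<and> (\<exists>B. \<forall>x. \<bar>\<phi> x\<bar> \<le> B)"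

lemma bounded_meas_mult:
  assumes "bounded_meas \<phi>" "bounded_meas \<psi>" shows "bounded_meas (\<lambda>x. \<phi> x * \<psi> x)"
proof -
  obtain B C where BC: "\<And>x. \<bar>\<phi> x\<bar> \<le> B" "\<And>x. \<bar>\<psi> x\<bar> \<le> C" using assms by (auto simp: bounded_meas_def)
  have "\<bar>\<phi> x * \<psi> x\<bar> \<le> B * C" for x
    unfolding abs_mult using BC(1)[of x] BC(2)[of x] by (intro mult_mono) auto
  then show ?thesis using assms by (auto simp: bounded_meas_def)
qed

lemma bounded_meas_power: "bounded_meas \<phi> \<Longrightarrow> bounded_meas (\<lambda>x. \<phi> x ^ k)"
proof (induction k)
  case 0
  show ?case by (auto simp: bounded_meas_def intro!: exI[of _ 1])
next
  case (Suc k)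
  then show ?case using bounded_meas_mult[of \<phi> "\<lambda>x. \<phi> x ^ k"] by simp
qed

lemma test_functions_bounded_meas: "\<phi> \<in> test_functions \<Longrightarrow> bounded_meas \<phi>"
  unfolding bounded_meas_def using test_functions_bounded
  by (metis smooth_measurable test_functions_iff)

definition cut :: "(real^'n \<Rightarrow> real) \<Rightarrow> ('n::finite, 'b::euclidean_space) l2 \<Rightarrow> ('n, 'b) l2" where
  "cut \<phi> U = cls (\<lambda>x. \<phi> x *\<^sub>R rep U x)"

lemma L2_cut:
  assumes "bounded_meas \<phi>" "f \<in> L2"
  shows "(\<lambda>x. \<phi> x *\<^sub>R (f x :: 'b::euclidean_space)) \<in> L2"
proof -
  obtain B where B: "\<And>x. \<bar>\<phi> x\<bar> \<le> B" using assms by (auto simp: bounded_meas_def)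
  have [measurable]: "\<phi> \<in> borel_measurable lebesgue" "f \<in> borel_measurable lebesgue"
    using assms by (auto simp: bounded_meas_def L2_measurable)
  show ?thesis by (rule L2_bound[OF assms(2), of _ B]) (auto intro!: mult_right_mono B)
qed

lemma rep_cut: "bounded_meas \<phi> \<Longrightarrow> AE x in lebesgue. rep (cut \<phi> U) x = \<phi> x *\<^sub>R rep U x"
  unfolding cut_def by (rule rep_cls) (simp add: L2_cut)

lemma cut_cut:
  assumes "bounded_meas \<phi>" "bounded_meas \<psi>" shows "cut \<phi> (cut \<psi> U) = cut (\<lambda>x. \<phi> x * \<psi> x) U"
  unfolding l2_eq_iff using rep_cut[OF assms(1), of "cut \<psi> U"] rep_cut[OF assms(2), of U]
    rep_cut[OF bounded_meas_mult[OF assms], of U]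
  by eventually_elim simp

lemma norm_cut_sq:
  assumes "bounded_meas \<phi>"
  shows "(norm (cut \<phi> U))\<^sup>2 = (LINT x|lebesgue. (\<phi> x)\<^sup>2 * (norm (rep U x))\<^sup>2)"
    and "integrable lebesgue (\<lambda>x. (\<phi> x)\<^sup>2 * (norm (rep U x))\<^sup>2)"
proof -
  have *: "(norm (\<phi> x *\<^sub>R rep U x))\<^sup>2 = (\<phi> x)\<^sup>2 * (norm (rep U x))\<^sup>2" for x
    by (simp add: power_mult_distrib)
  show "(norm (cut \<phi> U))\<^sup>2 = (LINT x|lebesgue. (\<phi> x)\<^sup>2 * (norm (rep U x))\<^sup>2)"
    unfolding cut_def norm_cls[OF L2_cut[OF assms rep_L2]] L2_norm_def * by simp
  show "integrable lebesgue (\<lambda>x. (\<phi> x)\<^sup>2 * (norm (rep U x))\<^sup>2)"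
    using L2_integrable[OF L2_cut[OF assms rep_L2[of U]]] unfolding * .
qed

lemma norm_cut_mono:
  assumes "bounded_meas \<phi>" "bounded_meas \<psi>" "\<And>x. \<bar>\<phi> x\<bar> \<le> c * \<bar>\<psi> x\<bar>" "0 \<le> c"
  shows "norm (cut \<phi> U) \<le> c * norm (cut \<psi> U)"
proof (rule power2_le_imp_le)
  have "(norm (cut \<phi> U))\<^sup>2 \<le> (LINT x|lebesgue. c\<^sup>2 * ((\<psi> x)\<^sup>2 * (norm (rep U x))\<^sup>2))"
    unfolding norm_cut_sq[OF assms(1)]
  proof (rule integral_mono)
    show "(\<phi> x)\<^sup>2 * (norm (rep U x))\<^sup>2 \<le> c\<^sup>2 * ((\<psi> x)\<^sup>2 * (norm (rep U x))\<^sup>2)" for x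
    proof -
      have "\<bar>\<phi> x\<bar>\<^sup>2 \<le> (c * \<bar>\<psi> x\<bar>)\<^sup>2" by (intro power_mono assms) auto
      then have "(\<phi> x)\<^sup>2 \<le> c\<^sup>2 * (\<psi> x)\<^sup>2" by (simp add: power_mult_distrib)
      from mult_right_mono[OF this, of "(norm (rep U x))\<^sup>2"] show ?thesis by (simp add: mult.assoc)
    qed
  qed (use norm_cut_sq(2)[OF assms(1), of U] norm_cut_sq(2)[OF assms(2), of U] in auto)
  also have "\<dots> = (c * norm (cut \<psi> U))\<^sup>2"
    by (simp add: power_mult_distrib norm_cut_sq[OF assms(2)])
  finally show "(norm (cut \<phi> U))\<^sup>2 \<le> (c * norm (cut \<psi> U))\<^sup>2" .
qed (use assms in auto)

lemma bounded_linear_cut: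
  assumes "bounded_meas \<phi>"
  shows "bounded_linear (cut \<phi> :: ('n::finite, 'b::euclidean_space) l2 \<Rightarrow> _)"
proof -
  obtain B where B: "\<And>x. \<bar>\<phi> x\<bar> \<le> B" using assms by (auto simp: bounded_meas_def)
  have 1: "cut \<phi> (U + V) = cut \<phi> U + cut \<phi> V" for U V :: "('n, 'b) l2"
    unfolding l2_eq_iff using rep_cut[OF assms, of "U + V"] rep_add[of U V] rep_cut[OF assms, of U]
      rep_cut[OF assms, of V] rep_add[of "cut \<phi> U" "cut \<phi> V"]
    by eventually_elim (simp add: scaleR_add_right)
  have 2: "cut \<phi> (r *\<^sub>R U) = r *\<^sub>R cut \<phi> U" for r and U :: "('n, 'b) l2"
    unfolding l2_eq_iff using rep_cut[OF assms, of "r *\<^sub>R U"] rep_scaleR[of r U] rep_cut[OF assms, of U]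
      rep_scaleR[of r "cut \<phi> U"]
    by eventually_elim simp
  have one: "bounded_meas (\<lambda>_ :: real^'n. 1)" by (auto simp: bounded_meas_def)
  have c1: "cut (\<lambda>_. 1) U = U" for U :: "('n, 'b) l2" by (simp add: cut_def)
  have "norm (cut \<phi> U) \<le> norm U * \<bar>B\<bar>" for U :: "('n, 'b) l2"
  proof -
    have "\<bar>\<phi> x\<bar> \<le> \<bar>B\<bar> * \<bar>1\<bar>" for x using B[of x] by simp
    from norm_cut_mono[OF assms one this, of U] show ?thesis by (simp add: c1 mult.commute)
  qed
  with 1 2 show ?thesis
    by (auto simp: bounded_linear_def bounded_linear_axioms_def intro!: linearI)
qed

lemma inner_cut:
  assumes "bounded_meas \<phi>" shows "cut \<phi> U \<bullet> V = U \<bullet> cut \<phi> V"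
proof -
  have "cut \<phi> U \<bullet> V = cls (\<lambda>x. \<phi> x *\<^sub>R rep U x) \<bullet> cls (rep V)" by (simp add: cut_def)
  also have "\<dots> = (LINT x|lebesgue. rep U x \<bullet> (\<phi> x *\<^sub>R rep V x))"
    by (subst inner_cls) (auto intro: L2_cut assms)
  also have "\<dots> = cls (rep U) \<bullet> cls (\<lambda>x. \<phi> x *\<^sub>R rep V x)"
    by (subst inner_cls) (auto intro: L2_cut assms)
  finally show ?thesis by (simp add: cut_def)
qed

section \<open>The Sobolev space as a subspace of classes\<close>

definition form_domain :: "('n::finite, complex) l2 set" where
  "form_domain = {U. rep U \<in> W12}"

definition grad :: "('n::finite, complex) l2 \<Rightarrow> ('n, complex^'n) l2" where
  "grad U = cls (weak_gradient (rep U))"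

lemma weak_gradient_L2: "u \<in> W12 \<Longrightarrow> weak_gradient u \<in> L2"
  using has_weak_gradient_weak_gradient by (auto simp: has_weak_gradient_def)

text \<open>Uniqueness of weak gradients makes \<open>grad\<close> independent both of the
  representative and of the choice inside \<open>weak_gradient\<close>.\<close>

lemma grad_eqI:
  assumes "has_weak_gradient u g" "U = cls u"
  shows "U \<in> form_domain" "grad U = cls g"
proof -
  have uL: "u \<in> L2" and gL: "g \<in> L2" using assms(1) by (auto simp: has_weak_gradient_def)
  have "AE x in lebesgue. u x = rep U x" using rep_cls[OF uL] assms(2) by (auto elim: eventually_mono)
  from has_weak_gradient_cong[OF assms(1) this] have r: "has_weak_gradient (rep U) g" .
  then show "U \<in> form_domain" by (auto simp: form_domain_def W12_def)
  then have w: "has_weak_gradient (rep U) (weak_gradient (rep U))"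
    by (simp add: form_domain_def has_weak_gradient_weak_gradient)
  then have "weak_gradient (rep U) \<in> L2" by (simp add: has_weak_gradient_def)
  from cls_eq_iff[OF this gL] show "grad U = cls g"
    unfolding grad_def using has_weak_gradient_unique[OF w r] by simp
qed

lemma grad_cls:
  assumes "u \<in> W12" shows "cls u \<in> form_domain" "grad (cls u) = cls (weak_gradient u)"
  using grad_eqI[OF has_weak_gradient_weak_gradient[OF assms] refl] by auto

lemma form_domain_cong: "cls u \<in> form_domain \<Longrightarrow> u \<in> L2 \<Longrightarrow> u \<in> W12"
  using has_weak_gradient_cong[OF _ rep_cls[of u]] by (auto simp: form_domain_def W12_def)

lemma has_weak_gradient_rep:
  assumes "U \<in> form_domain" shows "has_weak_gradient (rep U) (rep (grad U))"
proof -
  have W: "rep U \<in> W12" using assms by (simp add: form_domain_def)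
  have g: "has_weak_gradient (rep U) (weak_gradient (rep U))"
    by (rule has_weak_gradient_weak_gradient[OF W])
  have "AE x in lebesgue. rep (grad U) x = weak_gradient (rep U) x"
    unfolding grad_def by (rule rep_cls) (rule weak_gradient_L2[OF W])
  then have ae: "AE x in lebesgue. weak_gradient (rep U) x = rep (grad U) x" by eventually_elim simp
  have "(LINT x|lebesgue. rep (grad U) x $ i * complex_of_real (\<phi> x)) =
      (LINT x|lebesgue. weak_gradient (rep U) x $ i * complex_of_real (\<phi> x))"
    if "\<phi> \<in> test_functions" for i \<phi>
  proof (rule integral_cong_AE)
    show "(\<lambda>x. rep (grad U) x $ i * complex_of_real (\<phi> x)) \<in> borel_measurable lebesgue"
      using L2_mult_integrable[OF L2_nth[OF rep_L2] test_functions_L2[OF that]] by (rule borel_measurable_integrable)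
    show "(\<lambda>x. weak_gradient (rep U) x $ i * complex_of_real (\<phi> x)) \<in> borel_measurable lebesgue"
      using weak_gradient_integrable(2)[OF g that] by (rule borel_measurable_integrable)
    show "AE x in lebesgue. rep (grad U) x $ i * complex_of_real (\<phi> x) =
        weak_gradient (rep U) x $ i * complex_of_real (\<phi> x)"
      using ae by eventually_elim simp
  qed
  then show ?thesis using g by (simp add: has_weak_gradient_def)
qed

lemma grad_diff:
  assumes "U \<in> form_domain" "V \<in> form_domain"
  shows "U - V \<in> form_domain" "grad (U - V) = grad U - grad V"
  using grad_eqI[OF has_weak_gradient_diff[OF assms[THEN has_weak_gradient_rep]], of "U - V"]
  by (auto simp: minus_l2_def)

lemma grad_scaleR:
  assumes "U \<in> form_domain"
  shows "c *\<^sub>R U \<in> form_domain" "grad (c *\<^sub>R U) = c *\<^sub>R grad U"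
  using grad_eqI[OF has_weak_gradient_scaleR[OF has_weak_gradient_rep[OF assms]], of "c *\<^sub>R U" c]
  by (auto simp: scaleR_l2_def)

text \<open>The lower-order term U times the gradient of psi in the product rule for psi U.\<close>

definition tensor_grad :: "(real^'n \<Rightarrow> real) \<Rightarrow> ('n::finite, complex) l2 \<Rightarrow> ('n, complex^'n) l2" where
  "tensor_grad \<psi> U = cls (\<lambda>x. \<chi> i. partial_deriv i \<psi> x *\<^sub>R rep U x)"

lemma norm_tensor: "norm ((\<chi> i. a i *\<^sub>R z) :: complex^'n) = sqrt (\<Sum>i\<in>UNIV. (a i)\<^sup>2) * norm z"
  by (simp add: norm_vec_def L2_set_def power_mult_distrib real_sqrt_mult flip: sum_distrib_right)

lemma L2_tensor:
  fixes f :: "real^'n \<Rightarrow> complex"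
  assumes \<psi>: "\<psi> \<in> test_functions" and f: "f \<in> L2"
  shows "(\<lambda>x. (\<chi> i. partial_deriv i \<psi> x *\<^sub>R f x) :: complex^'n) \<in> L2"
proof -
  have "\<exists>B. \<forall>x. \<bar>partial_deriv i \<psi> x\<bar> \<le> B" for i
    using test_functions_bounded_meas[OF test_functions_partial_deriv[OF \<psi>, of i]]
    by (auto simp: bounded_meas_def)
  then obtain B where B: "\<And>i x. \<bar>partial_deriv i \<psi> x\<bar> \<le> B i" by metis
  have [measurable]: "partial_deriv i \<psi> \<in> borel_measurable lebesgue" for i
    using \<psi> by (auto simp: test_functions_iff intro: smooth_measurable smooth_partial_deriv)
  have [measurable]: "f \<in> borel_measurable lebesgue" using f by (rule L2_measurable)
  show ?thesis
  proof (rule L2_bound[OF f])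
    show "(\<lambda>x. (\<chi> i. partial_deriv i \<psi> x *\<^sub>R f x) :: complex^'n) \<in> borel_measurable lebesgue"
      by (rule borel_measurable_vec_complex) simp
    show "AE x in lebesgue. norm ((\<chi> i. partial_deriv i \<psi> x *\<^sub>R f x) :: complex^'n)
        \<le> sqrt (\<Sum>i\<in>UNIV. (B i)\<^sup>2) * norm (f x)"
      unfolding norm_tensor
      by (intro AE_I2 mult_right_mono real_sqrt_le_mono sum_mono)
         (auto simp: abs_le_square_iff[symmetric] intro: order_trans[OF B])
  qed
qed

lemma grad_cut:
  assumes U: "U \<in> form_domain" and \<psi>: "\<psi> \<in> test_functions"
  shows "cut \<psi> U \<in> form_domain" "grad (cut \<psi> U) = cut \<psi> (grad U) + tensor_grad \<psi> U"
proof -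
  note * = grad_eqI[OF has_weak_gradient_mult[OF has_weak_gradient_rep[OF U] \<psi>], of "cut \<psi> U"]
  show "cut \<psi> U \<in> form_domain" using * by (simp add: cut_def)
  show "grad (cut \<psi> U) = cut \<psi> (grad U) + tensor_grad \<psi> U"
    using * cls_add[OF L2_cut[OF test_functions_bounded_meas[OF \<psi>] rep_L2[of "grad U"]] L2_tensor[OF \<psi> rep_L2[of U]]]
    by (simp add: cut_def tensor_grad_def)
qed

lemma L2_cnj:
  fixes f :: "real^'n \<Rightarrow> complex"
  assumes "f \<in> L2" shows "(\<lambda>x. cnj (f x)) \<in> L2"
proof -
  have "(\<lambda>x. cnj (f x)) \<in> borel_measurable lebesgue"
    by (intro measurable_compose[OF L2_measurable[OF assms]] borel_measurable_continuous_onI continuous_intros)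
  then show ?thesis by (intro L2_bound[OF assms, of _ 1]) auto
qed

section \<open>The heat semigroup on classes\<close>

locale heat =
  fixes A :: "real^'n \<Rightarrow> complex^'n^'n" and T :: "real \<Rightarrow> (real^'n \<Rightarrow> complex) \<Rightarrow> real^'n \<Rightarrow> complex"
    and l M :: real
  assumes A_meas: "(\<lambda>x. A x $ i $ j) \<in> borel_measurable lebesgue"
    and l_M: "0 < l" "l \<le> M"
    and A_bounds: "AE x in lebesgue. \<forall>\<xi> \<zeta>.
           l * (norm \<xi>)\<^sup>2 \<le> Re ((A x *v \<xi>) \<cdot>\<^sub>c vec_cnj \<xi>) \<and>
           cmod ((A x *v \<xi>) \<cdot>\<^sub>c vec_cnj \<zeta>) \<le> M * norm \<xi> * norm \<zeta>"
    and heat: "heat_semigroup A T"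

lemma heat_exists:
  assumes "elliptic A" "heat_semigroup A T" obtains l M where "heat A T l M"
  using assms unfolding elliptic_def heat_def by blast

text \<open>The link between the complex form and the real Hilbert space structure: only real parts
  are used from here on.\<close>

lemma Re_cdot: "Re (\<xi> \<cdot>\<^sub>c vec_cnj \<zeta>) = \<xi> \<bullet> \<zeta>"
  by (simp add: cdot_def vec_cnj_def inner_vec_def inner_complex_def)

context heat
begin

lemma A_coercive: "AE x in lebesgue. \<forall>\<xi>. l * (norm \<xi>)\<^sup>2 \<le> (A x *v \<xi>) \<bullet> \<xi>"
  using A_bounds by eventually_elim (metis Re_cdot)

lemma A_bound: "AE x in lebesgue. \<forall>\<xi>. norm (A x *v \<xi>) \<le> M * norm \<xi>"
  using A_bounds
proof (eventually_elim, intro allI)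
  fix x \<xi>
  assume *: "\<forall>\<xi> \<zeta>. l * (norm \<xi>)\<^sup>2 \<le> Re ((A x *v \<xi>) \<cdot>\<^sub>c vec_cnj \<xi>) \<and>
           cmod ((A x *v \<xi>) \<cdot>\<^sub>c vec_cnj \<zeta>) \<le> M * norm \<xi> * norm \<zeta>"
  \<comment> \<open>Taking zeta = A x xi in the bound of the form yields the bound on the operator
    norm.\<close>
  define v where "v = A x *v \<xi>"
  have "v \<bullet> v \<le> cmod (v \<cdot>\<^sub>c vec_cnj v)"
    unfolding Re_cdot[symmetric] by (rule complex_Re_le_cmod)
  also have "\<dots> \<le> M * norm \<xi> * norm v" using * by (simp add: v_def)
  finally have "norm v * norm v \<le> (M * norm \<xi>) * norm v" by (simp add: power2_norm_eq_inner flip: power2_eq_square)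
  then show "norm v \<le> M * norm \<xi>"
    using l_M by (cases "v = 0") auto
qed

definition mulA :: "('n, complex^'n) l2 \<Rightarrow> ('n, complex^'n) l2" where
  "mulA \<Xi> = cls (\<lambda>x. A x *v rep \<Xi> x)"

lemma L2_mulA:
  fixes f :: "real^'n \<Rightarrow> complex^'n"
  assumes f: "f \<in> L2" shows "(\<lambda>x. A x *v f x) \<in> L2"
proof (rule L2_bound[OF f])
  have [measurable]: "(\<lambda>x. f x $ i) \<in> borel_measurable lebesgue" for i
    using L2_nth[OF f] by (rule L2_measurable)
  note [measurable] = A_meas
  show "(\<lambda>x. A x *v f x) \<in> borel_measurable lebesgue"
    by (rule borel_measurable_vec_complex) (simp add: matrix_vector_mult_def)
  show "AE x in lebesgue. norm (A x *v f x) \<le> M * norm (f x)"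
    using A_bound by eventually_elim simp
qed

lemma rep_mulA: "AE x in lebesgue. rep (mulA \<Xi>) x = A x *v rep \<Xi> x"
  unfolding mulA_def by (rule rep_cls) (simp add: L2_mulA)

text \<open>The real part of the form. It acts on arbitrary square-integrable fields and not just on
  gradients, so that gradients multiplied by powers of a cutoff can be inserted.\<close>

definition bform :: "('n, complex^'n) l2 \<Rightarrow> ('n, complex^'n) l2 \<Rightarrow> real" where
  "bform \<Xi> Z = mulA \<Xi> \<bullet> Z"

lemma bform_eq: "bform \<Xi> Z = (LINT x|lebesgue. (A x *v rep \<Xi> x) \<bullet> rep Z x)"
proof -
  have "bform \<Xi> Z = cls (\<lambda>x. A x *v rep \<Xi> x) \<bullet> cls (rep Z)" by (simp add: bform_def mulA_def)
  then show ?thesis by (simp add: inner_cls L2_mulA del: cls_rep)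
qed

lemma bform_cls:
  assumes "f \<in> L2" "g \<in> L2" shows "bform (cls f) (cls g) = (LINT x|lebesgue. (A x *v f x) \<bullet> g x)"
proof -
  have "mulA (cls f) = cls (\<lambda>x. A x *v f x)"
    unfolding l2_eq_iff using rep_mulA[of "cls f"] rep_cls[OF assms(1)] rep_cls[OF L2_mulA[OF assms(1)]]
    by eventually_elim simp
  then show ?thesis by (simp add: bform_def inner_cls L2_mulA assms)
qed

lemma bform_coercive: "l * (norm \<Xi>)\<^sup>2 \<le> bform \<Xi> \<Xi>"
proof -
  have "l * (norm \<Xi>)\<^sup>2 = (LINT x|lebesgue. l * (norm (rep \<Xi> x))\<^sup>2)"
    by (simp add: norm_l2_sq)
  also have "\<dots> \<le> (LINT x|lebesgue. (A x *v rep \<Xi> x) \<bullet> rep \<Xi> x)"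
    using A_coercive by (intro integral_mono_AE L2_integrable_inner L2_mulA rep_L2)
      (auto intro: L2_integrable elim: eventually_mono)
  finally show ?thesis by (simp add: bform_eq)
qed

lemma norm_mulA: "norm (mulA \<Xi>) \<le> M * norm \<Xi>"
proof (rule power2_le_imp_le)
  have "(norm (mulA \<Xi>))\<^sup>2 = (LINT x|lebesgue. (norm (A x *v rep \<Xi> x))\<^sup>2)"
    by (simp add: mulA_def norm_cls L2_mulA L2_norm_def)
  also have "\<dots> \<le> (LINT x|lebesgue. M\<^sup>2 * (norm (rep \<Xi> x))\<^sup>2)"
  proof (rule integral_mono_AE)
    show "AE x in lebesgue. (norm (A x *v rep \<Xi> x))\<^sup>2 \<le> M\<^sup>2 * (norm (rep \<Xi> x))\<^sup>2"
      using A_bound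
    proof eventually_elim
      case (elim x)
      then have "(norm (A x *v rep \<Xi> x))\<^sup>2 \<le> (M * norm (rep \<Xi> x))\<^sup>2" by (intro power_mono) auto
      then show ?case by (simp add: power_mult_distrib)
    qed
  qed (auto intro: L2_integrable[OF L2_mulA] L2_integrable)
  finally show "(norm (mulA \<Xi>))\<^sup>2 \<le> (M * norm \<Xi>)\<^sup>2"
    by (simp add: power_mult_distrib norm_l2_sq)
qed (use l_M in auto)

lemma bform_bound: "\<bar>bform \<Xi> Z\<bar> \<le> M * norm \<Xi> * norm Z"
proof -
  have "\<bar>bform \<Xi> Z\<bar> \<le> norm (mulA \<Xi>) * norm Z"
    unfolding bform_def by (rule Cauchy_Schwarz_ineq2)
  also have "\<dots> \<le> M * norm \<Xi> * norm Z" by (intro mult_right_mono norm_mulA) auto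
  finally show ?thesis .
qed

lemma bform_add_right: "bform \<Xi> (Z + Z') = bform \<Xi> Z + bform \<Xi> Z'"
  by (simp add: bform_def inner_add_right)

lemma matrix_vector_scaleR: "(B :: complex^'n^'n) *v (c *\<^sub>R \<xi>) = c *\<^sub>R (B *v \<xi>)"
  by (simp add: vec_eq_iff matrix_vector_mult_def scaleR_sum_right)

lemma bform_cut: "bounded_meas \<phi> \<Longrightarrow> bform \<Xi> (cut \<phi> Z) = bform (cut \<phi> \<Xi>) Z"
proof -
  assume \<phi>: "bounded_meas \<phi>"
  have "mulA (cut \<phi> \<Xi>) = cut \<phi> (mulA \<Xi>)"
    unfolding l2_eq_iff using rep_mulA[of "cut \<phi> \<Xi>"] rep_cut[OF \<phi>, of \<Xi>] rep_cut[OF \<phi>, of "mulA \<Xi>"] rep_mulA[of \<Xi>]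
    by eventually_elim (simp add: matrix_vector_scaleR)
  then show ?thesis by (simp add: bform_def inner_cut[OF \<phi>])
qed

lemma Re_sesquilinear_form:
  assumes "u \<in> W12" "v \<in> W12"
  shows "Re (sesquilinear_form A u v) = bform (grad (cls u)) (grad (cls v))"
proof -
  note L = weak_gradient_L2[OF assms(1)] weak_gradient_L2[OF assms(2)]
  have "integrable lebesgue (\<lambda>x. (A x *v weak_gradient u x) \<cdot>\<^sub>c vec_cnj (weak_gradient v x))"
    unfolding cdot_def
  proof (intro Bochner_Integration.integrable_sum)
    fix i
    show "integrable lebesgue (\<lambda>x. (A x *v weak_gradient u x) $ i * vec_cnj (weak_gradient v x) $ i)"
      unfolding vec_cnj_def by (auto intro!: L2_mult_integrable L2_cnj L2_nth L2_mulA L)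
  qed
  then have "Re (sesquilinear_form A u v) =
      (LINT x|lebesgue. Re ((A x *v weak_gradient u x) \<cdot>\<^sub>c vec_cnj (weak_gradient v x)))"
    unfolding sesquilinear_form_def by simp
  then show ?thesis using assms by (simp add: Re_cdot grad_cls bform_cls L)
qed

section \<open>The semigroup induced on classes\<close>

definition sg :: "real \<Rightarrow> ('n, complex) l2 \<Rightarrow> ('n, complex) l2" where
  "sg t U = cls (T t (rep U))"

lemma C0: "C0_contraction_semigroup T"
  using heat by (simp add: heat_semigroup_def)

lemmas C0_facts = C0[unfolded C0_contraction_semigroup_def]

lemma T_L2: "0 \<le> t \<Longrightarrow> f \<in> L2 \<Longrightarrow> T t f \<in> L2"
  using C0_facts[THEN conjunct1] by blast

lemma T_contr: "0 \<le> t \<Longrightarrow> f \<in> L2 \<Longrightarrow> L2_norm (T t f) \<le> L2_norm f"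
  using C0_facts[THEN conjunct1] by blast

lemma T_linear: "0 \<le> t \<Longrightarrow> f \<in> L2 \<Longrightarrow> g \<in> L2 \<Longrightarrow>
    AE x in lebesgue. T t (\<lambda>y. a * f y + b * g y) x = a * T t f x + b * T t g x"
  using C0_facts[THEN conjunct2, THEN conjunct1, rule_format] .

lemma T_0: "f \<in> L2 \<Longrightarrow> AE x in lebesgue. T 0 f x = f x"
  using C0_facts[THEN conjunct2, THEN conjunct2, THEN conjunct1, rule_format] .

lemma T_plus: "0 \<le> s \<Longrightarrow> 0 \<le> t \<Longrightarrow> f \<in> L2 \<Longrightarrow> AE x in lebesgue. T (s + t) f x = T s (T t f) x"
  using C0_facts[THEN conjunct2, THEN conjunct2, THEN conjunct2, THEN conjunct1, rule_format] .

lemma T_tendsto: "f \<in> L2 \<Longrightarrow> ((\<lambda>t. L2_norm (\<lambda>x. T t f x - f x)) \<longlongrightarrow> 0) (at_right 0)"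
  using C0_facts[THEN conjunct2, THEN conjunct2, THEN conjunct2, THEN conjunct2, rule_format] .

text \<open>\<open>T\<close> acts on functions, so respecting equality almost everywhere has to be
  proved: f - g has norm 0, contraction gives T t (f - g) norm 0, and linearity almost everywhere
  splits it. The combination 1 f + (-1) g has the shape required by the linearity axiom.\<close>

lemma cls_T:
  assumes t: "0 \<le> t" and f: "f \<in> L2" and g: "g \<in> L2" and ae: "AE x in lebesgue. f x = g x"
  shows "cls (T t f) = cls (T t g)"
proof -
  let ?h = "\<lambda>y. 1 * f y + (-1) * g y"
  have h: "?h \<in> L2" using L2_diff[OF f g] by simp
  have "AE x in lebesgue. ?h x = 0" using ae by eventually_elim simp
  then have "cls ?h = 0" using cls_eq_iff[OF h L2_zero] by (simp add: zero_l2_def)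
  then have "L2_norm ?h = 0" using norm_cls[OF h] by simp
  then have "norm (cls (T t ?h)) = 0"
    using T_contr[OF t h] norm_cls[OF T_L2[OF t h]] norm_ge_zero[of "cls (T t ?h)"] by simp
  then have "cls (T t ?h) = cls (\<lambda>_. 0)" by (simp add: zero_l2_def)
  then have "AE x in lebesgue. T t ?h x = 0" using cls_eq_iff[OF T_L2[OF t h] L2_zero] by simp
  with T_linear[OF t f g, of 1 "-1"] have "AE x in lebesgue. T t f x = T t g x"
    by eventually_elim simp
  then show ?thesis using cls_eq_iff[OF T_L2[OF t f] T_L2[OF t g]] by simp
qed

lemma sg_cls: "0 \<le> t \<Longrightarrow> f \<in> L2 \<Longrightarrow> sg t (cls f) = cls (T t f)"
  unfolding sg_def by (rule cls_T) (auto intro: rep_cls)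

lemma sg_add:
  assumes t: "0 \<le> t" shows "sg t (U + V) = sg t U + sg t V"
proof -
  have L: "(\<lambda>y. rep U y + rep V y) \<in> L2" by (rule L2_add[OF rep_L2 rep_L2])
  have ae: "AE x in lebesgue. T t (\<lambda>y. rep U y + rep V y) x = T t (rep U) x + T t (rep V) x"
    using T_linear[OF t rep_L2 rep_L2, of 1 U 1 V] by simp
  have "sg t (U + V) = cls (T t (\<lambda>y. rep U y + rep V y))"
    unfolding plus_l2_def by (rule sg_cls[OF t L])
  also have "\<dots> = cls (\<lambda>x. T t (rep U) x + T t (rep V) x)"
    by (rule cls_eqI[OF T_L2[OF t L] ae])
  also have "\<dots> = sg t U + sg t V"
    unfolding sg_def by (rule cls_add[symmetric]; rule T_L2[OF t rep_L2])
  finally show ?thesis .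
qed

lemma sg_scaleR:
  assumes t: "0 \<le> t" shows "sg t (c *\<^sub>R U) = c *\<^sub>R sg t U"
proof -
  have L: "(\<lambda>y. c *\<^sub>R rep U y) \<in> L2" by (rule L2_scaleR[OF rep_L2])
  have ae: "AE x in lebesgue. T t (\<lambda>y. c *\<^sub>R rep U y) x = c *\<^sub>R T t (rep U) x"
    using T_linear[OF t rep_L2 rep_L2, of "of_real c" U 0 U] by (simp add: scaleR_conv_of_real)
  have "sg t (c *\<^sub>R U) = cls (T t (\<lambda>y. c *\<^sub>R rep U y))"
    unfolding scaleR_l2_def by (rule sg_cls[OF t L])
  also have "\<dots> = cls (\<lambda>x. c *\<^sub>R T t (rep U) x)"
    by (rule cls_eqI[OF T_L2[OF t L] ae])
  also have "\<dots> = c *\<^sub>R sg t U"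
    unfolding sg_def by (rule cls_scaleR[symmetric]) (rule T_L2[OF t rep_L2])
  finally show ?thesis .
qed

lemma sg_0: "sg 0 U = U"
  using cls_eqI[OF T_L2[OF order_refl rep_L2] T_0[OF rep_L2[of U]]] by (simp add: sg_def)

lemma sg_plus:
  assumes "0 \<le> s" "0 \<le> t" shows "sg (s + t) U = sg s (sg t U)"
proof -
  have "sg (s + t) U = cls (T s (T t (rep U)))"
    unfolding sg_def[of "s + t"] using assms by (intro cls_eqI T_L2 T_plus) auto
  also have "\<dots> = sg s (cls (T t (rep U)))"
    using assms by (intro sg_cls[symmetric] T_L2) auto
  finally show ?thesis by (simp only: sg_def[of t])
qed

lemma sg_tendsto: "((\<lambda>t. sg t U) \<longlongrightarrow> U) (at_right 0)"
  proof -
    note T_tendsto[OF rep_L2[of U]]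
    moreover have "\<forall>\<^sub>F t in at_right 0. L2_norm (\<lambda>x. T t (rep U) x - rep U x) = norm (sg t U - U)"
    proof -
      have "L2_norm (\<lambda>x. T t (rep U) x - rep U x) = norm (sg t U - U)" if "0 < t" for t
      proof -
        have "sg t U - U = cls (T t (rep U)) - cls (rep U)" by (simp add: sg_def)
        also have "\<dots> = cls (\<lambda>x. T t (rep U) x - rep U x)"
          using that by (intro cls_diff T_L2 rep_L2) auto
        finally show ?thesis using that by (simp add: norm_cls L2_diff T_L2)
      qed
      then show ?thesis by (auto simp: eventually_at_filter)
    qed
    ultimately have "((\<lambda>t. norm (sg t U - U)) \<longlongrightarrow> 0) (at_right 0)"
      by (rule Lim_transform_eventually)
    then show ?thesis by (simp add: tendsto_norm_zero_iff LIM_zero_iff)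
  qed

lemma sg_contr: "0 \<le> t \<Longrightarrow> norm (sg t U) \<le> norm U"
  using T_contr[OF _ rep_L2, of t U] norm_l2_eq[of U] by (simp add: sg_def norm_cls T_L2)

sublocale contraction_semigroup sg
  by unfold_locales (fact sg_add sg_scaleR sg_contr sg_0 sg_plus sg_tendsto)+

text \<open>Translates the hypothesis that the generator of \<open>T\<close> is -L to classes,
  domain included; this is the source of the minus sign.\<close>

lemma gen_iff:
  assumes u: "u \<in> L2" and g: "g \<in> L2"
  shows "gen (cls u) (- cls g) \<longleftrightarrow> div_op_graph A u g"
proof -
  have "div_op_graph A u g \<longleftrightarrow> ((\<lambda>t. L2_norm (\<lambda>x. (T t u x - u x) /\<^sub>R t + g x)) \<longlongrightarrow> 0) (at_right 0)"
    using heat[unfolded heat_semigroup_def, THEN conjunct2, rule_format, OF u g] .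
  also have "\<dots> \<longleftrightarrow> ((\<lambda>t. norm ((sg t (cls u) - cls u) /\<^sub>R t - (- cls g))) \<longlongrightarrow> 0) (at_right 0)"
  proof (rule filterlim_cong[OF refl refl])
    have "L2_norm (\<lambda>x. (T t u x - u x) /\<^sub>R t + g x) = norm ((sg t (cls u) - cls u) /\<^sub>R t - (- cls g))"
      if "0 < t" for t
    proof -
      have t: "0 \<le> t" using that by simp
      have "(sg t (cls u) - cls u) /\<^sub>R t - (- cls g) = cls (\<lambda>x. (T t u x - u x) /\<^sub>R t + g x)"
        by (simp add: sg_cls[OF t u] cls_diff cls_scaleR cls_add L2_diff L2_scaleR T_L2[OF t u] u g)
      then show ?thesis
        by (simp add: norm_cls L2_diff L2_scaleR L2_add T_L2[OF t u] u g)
    qed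
    then show "\<forall>\<^sub>F t in at_right 0. L2_norm (\<lambda>x. (T t u x - u x) /\<^sub>R t + g x) =
        norm ((sg t (cls u) - cls u) /\<^sub>R t - (- cls g))"
      by (auto simp: eventually_at_filter)
  qed
  also have "\<dots> \<longleftrightarrow> gen (cls u) (- cls g)"
    unfolding gen_def tendsto_norm_zero_iff LIM_zero_iff ..
  finally show ?thesis ..
qed

sublocale form_semigroup sg form_domain grad bform l M
proof
  show "0 < l" "0 \<le> M" using l_M by auto
  show "l * (norm \<xi>)\<^sup>2 \<le> bform \<xi> \<xi>" for \<xi> by (rule bform_coercive)
  show "\<bar>bform \<xi> \<zeta>\<bar> \<le> M * norm \<xi> * norm \<zeta>" for \<xi> \<zeta> by (rule bform_bound)
  show "grad (u - v) = grad u - grad v" if "u \<in> form_domain" "v \<in> form_domain" for u v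
    using grad_diff that by blast
  show "U \<in> form_domain \<and> (\<forall>V\<in>form_domain. bform (grad U) (grad V) = G \<bullet> V)" if "gen U (- G)" for U G
  proof -
    have d: "div_op_graph A (rep U) (rep G)" using gen_iff[of "rep U" "rep G"] that by simp
    then have W: "rep U \<in> W12" by (simp add: div_op_graph_def)
    have "bform (grad U) (grad V) = G \<bullet> V" if V: "V \<in> form_domain" for V
    proof -
      have VW: "rep V \<in> W12" using V by (simp add: form_domain_def)
      have int: "integrable lebesgue (\<lambda>x. rep G x * cnj (rep V x))"
        by (intro L2_mult_integrable L2_cnj) auto
      have "bform (grad U) (grad V) = Re (sesquilinear_form A (rep U) (rep V))"
        using Re_sesquilinear_form[OF W VW] by simp
      also have "sesquilinear_form A (rep U) (rep V) = (LINT x|lebesgue. rep G x * cnj (rep V x))"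
        using d VW by (simp add: div_op_graph_def)
      also have "Re \<dots> = (LINT x|lebesgue. Re (rep G x * cnj (rep V x)))"
        by (rule integral_Re[OF int, symmetric])
      also have "\<dots> = G \<bullet> V" by (simp add: inner_l2_def inner_complex_def)
      finally show ?thesis .
    qed
    then show ?thesis using W by (simp add: form_domain_def)
  qed
qed

text \<open>The choice in \<open>div_op\<close> does no harm: smoothing shows that some value of L
  exists, and \<open>gen_unique\<close> fixes its class. Each application of t^2 L contributes the
  factor t^2.\<close>

lemma heat_family_flow:
  assumes f: "f \<in> L2" and t: "0 < t"
  shows "heat_family A T m f t \<in> L2 \<and> cls (heat_family A T m f t) = t ^ (2 * m) *\<^sub>R flow (cls f) m (t\<^sup>2)"
proof (induction m)
  case 0
  show ?case using f t by (simp add: heat_family_def sg_cls T_L2)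
next
  case (Suc m)
  define u where "u = heat_family A T m f t"
  define G where "G = t ^ (2 * m) *\<^sub>R flow (cls f) (Suc m) (t\<^sup>2)"
  have u: "u \<in> L2" "cls u = t ^ (2 * m) *\<^sub>R flow (cls f) m (t\<^sup>2)" using Suc by (auto simp: u_def)
  have g: "gen (cls u) (- G)"
    using gen_scaleR[OF gen_flow[of "t\<^sup>2" "cls f" m], of "t ^ (2 * m)"] t
    by (simp add: u(2) G_def del: flow.simps)
  then have "div_op_graph A u (rep G)" using gen_iff[OF u(1) rep_L2] by simp
  then have d: "div_op_graph A u (div_op A u)" unfolding div_op_def by (metis someI)
  then have L: "div_op A u \<in> L2" by (simp add: div_op_graph_def)
  have "gen (cls u) (- cls (div_op A u))" using gen_iff[OF u(1) L] d by simp
  from gen_unique[OF this g] have "cls (div_op A u) = G" by simp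
  then have "cls (\<lambda>y. t\<^sup>2 *\<^sub>R div_op A u y) = t\<^sup>2 *\<^sub>R G" by (simp flip: cls_scaleR[OF L])
  moreover have "heat_family A T (Suc m) f t = (\<lambda>y. t\<^sup>2 *\<^sub>R div_op A u y)"
    by (simp add: heat_family_def u_def)
  ultimately show ?case using L2_scaleR[OF L, of "t\<^sup>2"]
    by (simp add: G_def power2_eq_square mult.assoc del: flow.simps)
qed

end



section \<open>Localised energy estimates\<close>

lemma smooth_power: "smooth \<psi> \<Longrightarrow> smooth (\<lambda>x. \<psi> x ^ k)"
  by (induction k) (simp_all add: smooth_mult, simp add: smooth_def C_k_const)

lemma test_functions_power: "\<psi> \<in> test_functions \<Longrightarrow> (\<lambda>x. \<psi> x ^ Suc k) \<in> test_functions"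
  using test_functions_mult[of "\<lambda>x. \<psi> x ^ k" \<psi>] smooth_power[of \<psi> k]
  by (simp add: test_functions_iff mult.commute)

lemma partial_deriv_power:
  assumes "\<psi> differentiable at x"
  shows "partial_deriv i (\<lambda>x. \<psi> x ^ k) x = of_nat k * \<psi> x ^ (k - 1) * partial_deriv i \<psi> x"
proof -
  have "(\<psi> has_derivative frechet_derivative \<psi> (at x)) (at x)"
    using assms frechet_derivative_works by blast
  from partial_derivI[OF has_derivative_power[OF this, of k]] show ?thesis
    by (simp add: partial_deriv_def mult_ac)
qed

text \<open>The derivative of psi^(p+q+1) carries psi^(p+q). Splitting off psi^p lets it move to the
  other argument of the form, while psi^q stays with the error term.\<close>

lemma tensor_grad_power:
  assumes \<psi>: "\<psi> \<in> test_functions"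
  shows "tensor_grad (\<lambda>x. \<psi> x ^ (p + q + 1)) Y =
    cut (\<lambda>x. \<psi> x ^ p) (real (p + q + 1) *\<^sub>R cut (\<lambda>x. \<psi> x ^ q) (tensor_grad \<psi> Y))"
proof -
  note b = bounded_meas_power[OF test_functions_bounded_meas[OF \<psi>]]
  have 1: "AE x in lebesgue. rep (tensor_grad (\<lambda>x. \<psi> x ^ (p + q + 1)) Y) x =
      (\<chi> i. partial_deriv i (\<lambda>x. \<psi> x ^ (p + q + 1)) x *\<^sub>R rep Y x)"
    unfolding tensor_grad_def using test_functions_power[OF \<psi>, of "p + q"]
    by (intro rep_cls L2_tensor rep_L2) simp
  have 2: "AE x in lebesgue. rep (tensor_grad \<psi> Y) x = (\<chi> i. partial_deriv i \<psi> x *\<^sub>R rep Y x)"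
    unfolding tensor_grad_def by (intro rep_cls L2_tensor rep_L2 \<psi>)
  have d: "\<psi> differentiable at x" for x using \<psi> by (simp add: test_functions_iff smooth_differentiable)
  have pd: "partial_deriv i (\<lambda>x. \<psi> x ^ (p + q + 1)) x = \<psi> x ^ p * (real (p + q + 1) * (\<psi> x ^ q * partial_deriv i \<psi> x))" for i x
    unfolding partial_deriv_power[OF d] by (simp add: power_add)
  show ?thesis
    unfolding l2_eq_iff using 1 2 rep_cut[OF b[of p], of "real (p + q + 1) *\<^sub>R cut (\<lambda>x. \<psi> x ^ q) (tensor_grad \<psi> Y)"]
      rep_scaleR[of "real (p + q + 1)" "cut (\<lambda>x. \<psi> x ^ q) (tensor_grad \<psi> Y)"] rep_cut[OF b[of q], of "tensor_grad \<psi> Y"]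
  proof eventually_elim
    case (elim x)
    show ?case unfolding elim(1,3,4,5) elim(2) pd by (simp add: vec_eq_iff)
  qed
qed

lemma norm_cut_tensor:
  assumes \<psi>: "\<psi> \<in> test_functions" and \<phi>: "bounded_meas \<phi>" and \<omega>: "bounded_meas \<omega>" and k: "0 \<le> k"
    and bd: "\<And>x. \<bar>\<phi> x\<bar> * sqrt (\<Sum>i\<in>UNIV. (partial_deriv i \<psi> x)\<^sup>2) \<le> k * \<bar>\<omega> x\<bar>"
  shows "norm (cut \<phi> (tensor_grad \<psi> Y)) \<le> k * norm (cut \<omega> Y)"
proof (rule power2_le_imp_le)
  have 2: "AE x in lebesgue. rep (tensor_grad \<psi> Y) x = (\<chi> i. partial_deriv i \<psi> x *\<^sub>R rep Y x)"
    unfolding tensor_grad_def by (intro rep_cls L2_tensor rep_L2 \<psi>)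
  have "(norm (cut \<phi> (tensor_grad \<psi> Y)))\<^sup>2 \<le> (LINT x|lebesgue. k\<^sup>2 * ((\<omega> x)\<^sup>2 * (norm (rep Y x))\<^sup>2))"
    unfolding norm_cut_sq(1)[OF \<phi>]
  proof (rule integral_mono_AE)
    show "AE x in lebesgue. (\<phi> x)\<^sup>2 * (norm (rep (tensor_grad \<psi> Y) x))\<^sup>2 \<le> k\<^sup>2 * ((\<omega> x)\<^sup>2 * (norm (rep Y x))\<^sup>2)"
      using 2
    proof eventually_elim
      case (elim x)
      have "(\<bar>\<phi> x\<bar> * sqrt (\<Sum>i\<in>UNIV. (partial_deriv i \<psi> x)\<^sup>2))\<^sup>2 \<le> (k * \<bar>\<omega> x\<bar>)\<^sup>2"
        by (intro power_mono bd) (auto intro!: mult_nonneg_nonneg sum_nonneg)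
      from mult_right_mono[OF this, of "(norm (rep Y x))\<^sup>2"] show ?case
        by (simp only: elim norm_tensor power_mult_distrib power2_abs zero_le_power2) (simp add: mult.assoc)
    qed
  qed (use norm_cut_sq(2)[OF \<phi>, of "tensor_grad \<psi> Y"] norm_cut_sq(2)[OF \<omega>, of Y] in auto)
  also have "\<dots> = (k * norm (cut \<omega> Y))\<^sup>2"
    by (simp add: power_mult_distrib norm_cut_sq(1)[OF \<omega>])
  finally show "(norm (cut \<phi> (tensor_grad \<psi> Y)))\<^sup>2 \<le> (k * norm (cut \<omega> Y))\<^sup>2" .
qed (use k in auto)

text \<open>A product of one-dimensional bumps, supported where all coordinates are at most 2 in
  modulus, is rescaled by 1 / (2 r). The support is then a cube of half side 4 r, contained in a
  ball of radius 4 n r. The ball of radius 2 r goes to the unit ball, where each of the 2 n factors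
  is at least exp(-1); a lower bound c there replaces the value 1 of a standard cutoff.\<close>

lemma cutoff_exists:
  "\<exists>k\<ge>0. \<exists>c>0. \<forall>x :: real^'n. \<forall>r>0. \<exists>\<psi>\<in>test_functions.
     (\<forall>y. 0 \<le> \<psi> y \<and> \<psi> y \<le> 1) \<and>
     (\<forall>y. sqrt (\<Sum>i\<in>UNIV. (partial_deriv i \<psi> y)\<^sup>2) \<le> k / r) \<and>
     (\<forall>y\<in>ball x (2 * r). c \<le> \<psi> y) \<and>
     (\<forall>y. y \<notin> cball x (4 * real CARD('n) * r) \<longrightarrow> \<psi> y = 0 \<and> (\<forall>i. partial_deriv i \<psi> y = 0))"
proof -
  define \<Psi> where "\<Psi> z = (\<Prod>i\<in>UNIV. (1 * flat 1 (1 * (z $ i) + 2)) * (1 * flat 1 ((-1) * (z $ i) + 2)))" for z :: "real^'n"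
  have f01: "0 \<le> flat 1 y" "flat 1 y \<le> 1" for y by (auto simp: flat_def)
  have \<Psi>01: "0 \<le> \<Psi> z" "\<Psi> z \<le> 1" for z
    unfolding \<Psi>_def by (simp_all add: prod_nonneg prod_le_1 mult_le_one f01)
  have \<Psi>0: "\<Psi> z = 0" if "2 \<le> \<bar>z $ i\<bar>" for z i
  proof -
    have "flat 1 (1 * (z $ i) + 2) = 0 \<or> flat 1 ((-1) * (z $ i) + 2) = 0"
      using that by (auto simp: flat_def)
    then show ?thesis unfolding \<Psi>_def by (intro prod_zero) auto
  qed
  have \<Psi>s: "smooth \<Psi>" unfolding smooth_def \<Psi>_def by (intro allI C_k_prod C_k_mult C_k_flat)
  have \<Psi>t: "\<Psi> \<in> test_functions"
  proof (rule test_functionsI[OF \<Psi>s, of "cbox (- 2 *\<^sub>R (\<chi> i. 1)) (2 *\<^sub>R (\<chi> i. 1))"])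
    fix z :: "real^'n" assume "z \<notin> cbox (- 2 *\<^sub>R (\<chi> i. 1)) (2 *\<^sub>R (\<chi> i. 1))"
    then obtain i where "z $ i < - 2 \<or> 2 < z $ i" by (auto simp: mem_box_cart not_le)
    then have "2 \<le> \<bar>z $ i\<bar>" by auto
    then show "\<Psi> z = 0" by (rule \<Psi>0)
  qed auto
  define c where "c = exp (- 1 :: real) ^ (2 * CARD('n))"
  have \<Psi>c: "c \<le> \<Psi> z" if "norm z < 1" for z
  proof -
    have "(\<Prod>i\<in>(UNIV :: 'n set). exp (- 1) * exp (- 1 :: real)) \<le> \<Psi> z"
      unfolding \<Psi>_def
    proof (intro prod_mono conjI mult_mono)
      fix i
      have zi: "\<bar>z $ i\<bar> < 1" using component_le_norm_cart[of z i] that by linarith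
      have fl: "exp (- 1) \<le> 1 * flat 1 s" if "1 \<le> s" for s :: real
        using that by (auto simp: flat_def)
      show "exp (- 1) \<le> 1 * flat 1 (1 * z $ i + 2)" "exp (- 1) \<le> 1 * flat 1 (- 1 * z $ i + 2)"
        using zi by (intro fl; simp add: abs_less_iff)+
    qed (auto simp: f01)
    then show ?thesis by (simp add: c_def power_mult power2_eq_square)
  qed
  obtain B where B: "\<And>i x. \<bar>partial_deriv i \<Psi> x\<bar> \<le> B i"
    using test_functions_bounded_meas[OF test_functions_partial_deriv[OF \<Psi>t]]
    unfolding bounded_meas_def by metis
  define k where "k = (\<Sum>i\<in>UNIV. B i) / 2"
  have B0: "0 \<le> B i" for i using B[of i 0] by linarith
  show ?thesis
  proof (rule exI[of _ k], intro exI[of _ c] conjI allI impI)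
    show "0 \<le> k" using B0 by (simp add: k_def sum_nonneg)
    show "0 < c" by (simp add: c_def)
    fix x :: "real^'n" and r :: real assume r: "0 < r"
    define \<psi> where "\<psi> y = \<Psi> ((1 / (2 * r)) *\<^sub>R (y - x))" for y
    have pdc: "partial_deriv i (\<lambda>y. \<phi> ((1 / (2 * r)) *\<^sub>R (y - x))) = (\<lambda>y. (1 / (2 * r)) * partial_deriv i \<phi> ((1 / (2 * r)) *\<^sub>R (y - x)))"
      and dc: "\<And>y. (\<lambda>y. \<phi> ((1 / (2 * r)) *\<^sub>R (y - x))) differentiable at y"
      if \<phi>: "\<And>y. \<phi> differentiable at y" for \<phi> :: "real^'n \<Rightarrow> real" and i
    proof -
      have h: "((\<lambda>y. \<phi> ((1 / (2 * r)) *\<^sub>R (y - x))) has_derivative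
          (\<lambda>h. frechet_derivative \<phi> (at ((1 / (2 * r)) *\<^sub>R (y - x))) ((1 / (2 * r)) *\<^sub>R h))) (at y)" for y
      proof -
        have 1: "((\<lambda>y. (1 / (2 * r)) *\<^sub>R (y - x)) has_derivative (\<lambda>h. (1 / (2 * r)) *\<^sub>R h)) (at y)"
          by (auto intro!: derivative_eq_intros)
        have 2: "(\<phi> has_derivative frechet_derivative \<phi> (at ((1 / (2 * r)) *\<^sub>R (y - x)))) (at ((1 / (2 * r)) *\<^sub>R (y - x)))"
          using \<phi> frechet_derivative_works by blast
        from has_derivative_compose[OF 1 2] show ?thesis .
      qed
      show "(\<lambda>y. \<phi> ((1 / (2 * r)) *\<^sub>R (y - x))) differentiable at y" for y
        using h[of y] by (auto simp: differentiable_def)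
      have "linear (frechet_derivative \<phi> (at y))" for y
        using \<phi> by (rule linear_frechet_derivative)
      then show "partial_deriv i (\<lambda>y. \<phi> ((1 / (2 * r)) *\<^sub>R (y - x))) =
          (\<lambda>y. (1 / (2 * r)) * partial_deriv i \<phi> ((1 / (2 * r)) *\<^sub>R (y - x)))"
        by (intro ext, subst partial_derivI[OF h]) (simp only: partial_deriv_def linear_scale real_scaleR_def)
    qed
    have Ck: "C_k j (\<lambda>y. a * \<phi> ((1 / (2 * r)) *\<^sub>R (y - x)))" if "smooth \<phi>" for j a and \<phi> :: "real^'n \<Rightarrow> real"
      using that
    proof (induction j arbitrary: a \<phi>)
      case 0
      have "continuous_on UNIV (\<lambda>y. \<phi> ((1 / (2 * r)) *\<^sub>R (y - x)))"
        by (rule continuous_on_compose2[OF smooth_continuous[OF 0]]) (auto intro!: continuous_intros)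
      then show ?case by (auto intro!: continuous_intros)
    next
      case (Suc j)
      note d = smooth_differentiable[OF Suc.prems]
      have "partial_deriv i (\<lambda>y. a * \<phi> ((1 / (2 * r)) *\<^sub>R (y - x))) =
          (\<lambda>y. (a * (1 / (2 * r))) * partial_deriv i \<phi> ((1 / (2 * r)) *\<^sub>R (y - x)))" for i
      proof
        fix y
        have "partial_deriv i (\<lambda>y. a * \<phi> ((1 / (2 * r)) *\<^sub>R (y - x))) y =
            a * partial_deriv i (\<lambda>y. \<phi> ((1 / (2 * r)) *\<^sub>R (y - x))) y + partial_deriv i (\<lambda>_. a) y * \<phi> ((1 / (2 * r)) *\<^sub>R (y - x))"
          by (rule partial_deriv_mult[OF differentiable_const dc[OF d]])
        also have "partial_deriv i (\<lambda>_. a) y = 0"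
          by (subst partial_derivI[OF has_derivative_const]) simp
        finally show "partial_deriv i (\<lambda>y. a * \<phi> ((1 / (2 * r)) *\<^sub>R (y - x))) y =
            (a * (1 / (2 * r))) * partial_deriv i \<phi> ((1 / (2 * r)) *\<^sub>R (y - x))"
          by (simp only: pdc[OF d] mult_zero_left add_0_right mult.assoc)
      qed
      moreover have "(\<lambda>y. a * \<phi> ((1 / (2 * r)) *\<^sub>R (y - x))) differentiable at y" for y
        by (rule differentiable_mult[OF differentiable_const dc[OF d]])
      ultimately show ?case
        unfolding C_k.simps by (simp only: Suc.IH[OF smooth_partial_deriv[OF Suc.prems]] simp_thms)
    qed
    have s\<psi>: "smooth \<psi>" unfolding smooth_def \<psi>_def using Ck[OF \<Psi>s, of _ 1] by (simp only: mult_1_left simp_thms)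
    let ?K = "cball x (4 * real CARD('n) * r)"
    have \<psi>0: "\<psi> y = 0" if "y \<notin> ?K" for y
    proof (rule ccontr)
      assume "\<psi> y \<noteq> 0"
      then have "\<not> 2 \<le> \<bar>((1 / (2 * r)) *\<^sub>R (y - x)) $ i\<bar>" for i
        unfolding \<psi>_def using \<Psi>0[of "(1 / (2 * r)) *\<^sub>R (y - x)" i] by blast
      moreover have "\<bar>((1 / (2 * r)) *\<^sub>R (y - x)) $ i\<bar> = \<bar>(y - x) $ i\<bar> / (2 * r)" for i
        using r by (simp add: abs_mult)
      ultimately have *: "\<bar>(y - x) $ i\<bar> \<le> 4 * r" for i
        using r by (simp only: pos_le_divide_eq) (simp add: not_le less_imp_le)
      have "norm (y - x) \<le> (\<Sum>i\<in>UNIV. \<bar>(y - x) $ i\<bar>)" by (rule norm_le_l1_cart)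
      also have "\<dots> \<le> (\<Sum>i\<in>(UNIV :: 'n set). 4 * r)" by (intro sum_mono *)
      finally show False using that by (simp add: dist_norm norm_minus_commute mult_ac)
    qed
    have t\<psi>: "\<psi> \<in> test_functions" by (rule test_functionsI[OF s\<psi> compact_cball \<psi>0])
    show "\<exists>\<psi>\<in>test_functions.
     (\<forall>y. 0 \<le> \<psi> y \<and> \<psi> y \<le> 1) \<and>
     (\<forall>y. sqrt (\<Sum>i\<in>UNIV. (partial_deriv i \<psi> y)\<^sup>2) \<le> k / r) \<and>
     (\<forall>y\<in>ball x (2 * r). c \<le> \<psi> y) \<and>
     (\<forall>y. y \<notin> ?K \<longrightarrow> \<psi> y = 0 \<and> (\<forall>i. partial_deriv i \<psi> y = 0))"
    proof (intro bexI[OF _ t\<psi>] conjI allI ballI impI)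
      fix y
      show "0 \<le> \<psi> y" "\<psi> y \<le> 1" by (auto simp: \<psi>_def \<Psi>01)
      have pd: "\<bar>partial_deriv i \<psi> y\<bar> \<le> (1 / (2 * r)) * B i" for i
      proof -
        have "partial_deriv i \<psi> y = (1 / (2 * r)) * partial_deriv i \<Psi> ((1 / (2 * r)) *\<^sub>R (y - x))"
          unfolding \<psi>_def[abs_def] by (simp only: pdc[OF smooth_differentiable[OF \<Psi>s]])
        moreover have "\<bar>(1 / (2 * r)) * partial_deriv i \<Psi> ((1 / (2 * r)) *\<^sub>R (y - x))\<bar> \<le> (1 / (2 * r)) * B i"
          unfolding abs_mult using r B by (intro mult_mono) auto
        ultimately show ?thesis by simp
      qed
      have "sqrt (\<Sum>i\<in>UNIV. (partial_deriv i \<psi> y)\<^sup>2) \<le> (\<Sum>i\<in>UNIV. \<bar>partial_deriv i \<psi> y\<bar>)"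
        using L2_set_le_sum_abs[of "\<lambda>i. partial_deriv i \<psi> y" UNIV] by (simp add: L2_set_def)
      also have "\<dots> \<le> (\<Sum>i\<in>UNIV. (1 / (2 * r)) * B i)" by (intro sum_mono pd)
      also have "\<dots> = k / r" by (simp add: k_def sum_distrib_left[symmetric] sum_divide_distrib[symmetric])
      finally show "sqrt (\<Sum>i\<in>UNIV. (partial_deriv i \<psi> y)\<^sup>2) \<le> k / r" .
    next
      fix y assume "y \<in> ball x (2 * r)"
      then have "norm ((1 / (2 * r)) *\<^sub>R (y - x)) < 1"
        using r by (simp add: dist_norm norm_minus_commute)
      then show "c \<le> \<psi> y" unfolding \<psi>_def by (rule \<Psi>c)
    next
      fix y i assume y: "y \<notin> ?K"
      then show "\<psi> y = 0" by (rule \<psi>0)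
      have "(\<psi> has_derivative (\<lambda>_. 0)) (at y)"
        by (rule has_derivative_transform_within_open[of "\<lambda>_. 0" _ _ _ "- ?K"])
           (use y in \<open>simp_all add: \<psi>0 open_Compl del: mem_cball\<close>)
      then show "partial_deriv i \<psi> y = 0" by (simp add: partial_derivI)
    qed
  qed
qed

text \<open>The integral of |U|^2 over S (see \<open>nn_integral_mass\<close>), written as a squared
  norm so that it is continuous in U.\<close>

definition mass :: "(real^'n) set \<Rightarrow> ('n::finite, 'b::euclidean_space) l2 \<Rightarrow> real" where
  "mass S U = (norm (cut (indicat_real S) U))\<^sup>2"

lemma bounded_meas_indicator: "S \<in> sets lebesgue \<Longrightarrow> bounded_meas (indicat_real S)"
  by (auto simp: bounded_meas_def indicator_def intro!: exI[of _ 1])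

lemma nn_integral_mass:
  assumes "S \<in> sets lebesgue"
  shows "(\<integral>\<^sup>+x\<in>S. ennreal ((norm (rep U x))\<^sup>2) \<partial>lebesgue) = ennreal (mass S U)"
proof -
  note b = bounded_meas_indicator[OF assms]
  have "ennreal (mass S U) = (\<integral>\<^sup>+x. ennreal ((indicat_real S x)\<^sup>2 * (norm (rep U x))\<^sup>2) \<partial>lebesgue)"
    unfolding mass_def norm_cut_sq(1)[OF b]
    by (rule nn_integral_eq_integral[symmetric]) (use norm_cut_sq(2)[OF b] in auto)
  also have "\<dots> = (\<integral>\<^sup>+x\<in>S. ennreal ((norm (rep U x))\<^sup>2) \<partial>lebesgue)"
    by (intro nn_integral_cong) (auto simp: indicator_def)
  finally show ?thesis ..
qed

text \<open>The absorption scheme as real arithmetic. In the application U and V are the flows of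
  levels m and m + 1; X1, y2 and X3 are the norms of psi grad U, psi^2 V and psi^3 grad V, and b0 is
  the norm of U on the support set. e0 and e1 are the time derivatives of theta^2 a0 and theta^6 a1.
  The powers of theta imitate those of psi: g, p and q carry theta, theta^2 and theta^3.\<close>

lemma energy_algebra:
  fixes r t \<theta> lam M k X1 X3 y2 b0 a0 s0 e0 a1 s1 e1 :: real
  defines "C1 \<equiv> 3 + 144 * M\<^sup>2 * k\<^sup>2 / lam" and "C2 \<equiv> 9 + 1296 * M\<^sup>2 * k\<^sup>2 / lam"
  defines "C3 \<equiv> 2 * M\<^sup>2 * C2 / lam + 36 * M\<^sup>2 * k\<^sup>2"
  assumes r: "0 < r" and lam: "0 < lam" and M: "0 \<le> M" and k: "0 \<le> k"
    and t: "r / 2 \<le> t" "t \<le> 2 * r" and \<theta>: "\<theta> = t / r - 1 / 2"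
    and nn: "0 \<le> X1" "0 \<le> X3" "0 \<le> y2" "0 \<le> b0"
    and a0: "a0 \<le> b0\<^sup>2" and e0: "e0 = 2 * \<theta> / r * a0 - 4 * t * \<theta>\<^sup>2 * s0"
    and s0: "lam * X1\<^sup>2 - 2 * M * X1 * (k / r) * b0 \<le> s0"
    and a1: "a1 \<le> y2\<^sup>2" and e1: "e1 = 6 * \<theta> ^ 5 / r * a1 - 4 * t * \<theta> ^ 6 * s1"
    and s1: "lam * X3\<^sup>2 - 6 * M * X3 * (k / r) * y2 \<le> s1"
    and h: "y2\<^sup>2 \<le> M * X1 * X3 + 4 * M * X1 * (k / r) * y2"
  shows "r ^ 4 * (\<theta> ^ 4 * y2\<^sup>2) + r\<^sup>2 * (\<theta>\<^sup>2 * X1\<^sup>2) \<le>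
    (2 * C3 + 1) / lam * C1 * b0\<^sup>2 - r * ((2 * C3 + 1) / lam) * e0 - r ^ 5 / C2 * e1"
proof -
  define g where "g = \<theta> * X1"
  define q where "q = \<theta> ^ 3 * X3"
  define p where "p = \<theta>\<^sup>2 * y2"
  have \<theta>0: "0 \<le> \<theta>" "\<theta> \<le> 3 / 2" using t r by (auto simp: \<theta> field_simps)
  have tr: "1 / 2 \<le> t / r" "t / r \<le> 2" "0 \<le> t" using t r by (auto simp: field_simps)
  have gqp: "0 \<le> g" "0 \<le> q" "0 \<le> p" using nn \<theta>0 by (auto simp: g_def q_def p_def)
  have C2: "0 < C2" using lam M k by (auto simp: C2_def intro!: add_pos_nonneg)
  have C3: "0 \<le> C3" using lam C2 by (auto simp: C3_def)
  \<comment> \<open>From t at least r/2 the good terms come with 2 r: one r absorbs the error from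
    Young's inequality, the other remains.\<close>
  have lower: "4 * t * (lam * g\<^sup>2) \<ge> 2 * r * (lam * g\<^sup>2)" "4 * t * (lam * q\<^sup>2) \<ge> 2 * r * (lam * q\<^sup>2)"
    using t lam by (intro mult_right_mono; simp)+
  have t\<theta>: "t / r * \<theta> \<le> 3" using mult_mono[OF tr(2) \<theta>0(2)] \<theta>0 tr by simp
  have young: "2 * a * b \<le> z * a\<^sup>2 + b\<^sup>2 / z" if "0 < z" for a b z :: real
  proof -
    have "0 \<le> (z * a - b)\<^sup>2 / z" using that by simp
    also have "(z * a - b)\<^sup>2 / z = z * a\<^sup>2 + b\<^sup>2 / z - 2 * a * b"
      using that by (simp add: power2_diff power_mult_distrib field_simps power2_eq_square)
    finally show ?thesis by simp
  qed
  \<comment> \<open>The energy inequality of level m. The 3 is twice the maximum 3/2 of theta; the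
    12 is half of 8 times 3, with 3 the bound of theta t / r.\<close>
  have I: "lam * r\<^sup>2 * g\<^sup>2 \<le> C1 * b0\<^sup>2 - r * e0"
  proof -
    have "2 * \<theta> / r * a0 \<le> 3 / r * b0\<^sup>2"
    proof -
      have "2 * \<theta> / r * a0 \<le> 2 * \<theta> / r * b0\<^sup>2" using \<theta>0 r by (intro mult_left_mono a0) auto
      also have "\<dots> \<le> 3 / r * b0\<^sup>2" using \<theta>0 r by (intro mult_right_mono divide_right_mono) auto
      finally show ?thesis .
    qed
    moreover have "- (4 * t * \<theta>\<^sup>2 * s0) \<le> - (4 * t * (lam * g\<^sup>2)) + 8 * (t / r * \<theta>) * (M * k * g * b0)"
    proof -
      have "4 * t * \<theta>\<^sup>2 * (lam * X1\<^sup>2 - 2 * M * X1 * (k / r) * b0) \<le> 4 * t * \<theta>\<^sup>2 * s0"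
        using tr by (intro mult_left_mono s0) auto
      moreover have "4 * t * \<theta>\<^sup>2 * (lam * X1\<^sup>2 - 2 * M * X1 * (k / r) * b0) =
          4 * t * (lam * g\<^sup>2) - 8 * (t / r * \<theta>) * (M * k * g * b0)"
        by (simp add: g_def power2_eq_square algebra_simps)
      ultimately show ?thesis by linarith
    qed
    moreover have "8 * (t / r * \<theta>) * (M * k * g * b0) \<le> 24 * (M * k * g * b0)"
      using t\<theta> M k gqp nn by (intro mult_right_mono) auto
    moreover have "24 * (M * k * g * b0) \<le> (r * lam) * g\<^sup>2 + (12 * M * k * b0)\<^sup>2 / (r * lam)"
      using young[of "r * lam" g "12 * M * k * b0"] r lam by (simp add: mult_ac)
    ultimately have "e0 \<le> 3 / r * b0\<^sup>2 - r * (lam * g\<^sup>2) + (12 * M * k * b0)\<^sup>2 / (r * lam)"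
      using lower unfolding e0 by linarith
    from mult_left_mono[OF this less_imp_le[OF r]]
    have "r * e0 \<le> r * (3 / r * b0\<^sup>2 - r * (lam * g\<^sup>2) + (12 * M * k * b0)\<^sup>2 / (r * lam))" .
    also have "\<dots> = C1 * b0\<^sup>2 - lam * r\<^sup>2 * g\<^sup>2"
      using r lam by (simp add: C1_def field_simps power2_eq_square)
    finally show ?thesis by simp
  qed
  \<comment> \<open>The same for level m + 1, where the error is controlled by p instead of b0; 9 is
    6 times 3/2, and 36 is half of 24 times 3.\<close>
  have II: "lam * r\<^sup>2 * q\<^sup>2 \<le> C2 * p\<^sup>2 - r * e1"
  proof -
    have "6 * \<theta> ^ 5 / r * a1 \<le> 9 / r * p\<^sup>2"
    proof -
      have "6 * \<theta> ^ 5 / r * a1 \<le> 6 * \<theta> ^ 5 / r * y2\<^sup>2" using \<theta>0 r by (intro mult_left_mono a1) auto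
      also have "\<dots> = (6 * \<theta>) / r * p\<^sup>2" by (simp add: p_def power_mult_distrib eval_nat_numeral)
      also have "\<dots> \<le> 9 / r * p\<^sup>2" using \<theta>0 r by (intro mult_right_mono divide_right_mono) auto
      finally show ?thesis .
    qed
    moreover have "- (4 * t * \<theta> ^ 6 * s1) \<le> - (4 * t * (lam * q\<^sup>2)) + 24 * (t / r * \<theta>) * (M * k * q * p)"
    proof -
      have "4 * t * \<theta> ^ 6 * (lam * X3\<^sup>2 - 6 * M * X3 * (k / r) * y2) \<le> 4 * t * \<theta> ^ 6 * s1"
        using tr by (intro mult_left_mono s1) auto
      moreover have "4 * t * \<theta> ^ 6 * (lam * X3\<^sup>2 - 6 * M * X3 * (k / r) * y2) =
          4 * t * (lam * q\<^sup>2) - 24 * (t / r * \<theta>) * (M * k * q * p)"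
        by (simp add: q_def p_def power2_eq_square eval_nat_numeral algebra_simps)
      ultimately show ?thesis by linarith
    qed
    moreover have "24 * (t / r * \<theta>) * (M * k * q * p) \<le> 72 * (M * k * q * p)"
      using t\<theta> M k gqp nn by (intro mult_right_mono) auto
    moreover have "72 * (M * k * q * p) \<le> (r * lam) * q\<^sup>2 + (36 * M * k * p)\<^sup>2 / (r * lam)"
      using young[of "r * lam" q "36 * M * k * p"] r lam by (simp add: mult_ac)
    ultimately have "e1 \<le> 9 / r * p\<^sup>2 - r * (lam * q\<^sup>2) + (36 * M * k * p)\<^sup>2 / (r * lam)"
      using lower unfolding e1 by linarith
    from mult_left_mono[OF this less_imp_le[OF r]]
    have "r * e1 \<le> r * (9 / r * p\<^sup>2 - r * (lam * q\<^sup>2) + (36 * M * k * p)\<^sup>2 / (r * lam))" .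
    also have "\<dots> = C2 * p\<^sup>2 - lam * r\<^sup>2 * q\<^sup>2"
      using r lam by (simp add: C2_def field_simps power2_eq_square)
    finally show ?thesis by simp
  qed
  \<comment> \<open>Interpolation: p^2 is bounded by the product g q of the two gradients, after
    half of p^2 has been absorbed.\<close>
  have III: "p\<^sup>2 \<le> 2 * M * g * q + 36 * M\<^sup>2 * k\<^sup>2 / r\<^sup>2 * g\<^sup>2"
  proof -
    have "p\<^sup>2 = \<theta> ^ 4 * y2\<^sup>2" by (simp add: p_def power_mult_distrib eval_nat_numeral)
    also have "\<dots> \<le> \<theta> ^ 4 * (M * X1 * X3 + 4 * M * X1 * (k / r) * y2)"
      using \<theta>0 by (intro mult_left_mono h) auto
    also have "\<dots> = M * g * q + \<theta> * (4 * M * (k / r) * g * p)"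
      by (simp add: g_def p_def q_def power2_eq_square eval_nat_numeral algebra_simps)
    also have "\<dots> \<le> M * g * q + (3 / 2) * (4 * M * (k / r) * g * p)"
      using \<theta>0 M k r gqp by (intro add_left_mono mult_right_mono) auto
    also have "(3 / 2) * (4 * M * (k / r) * g * p) = 2 * p * (3 * M * (k / r) * g)" by simp
    also have "\<dots> \<le> (1 / 2) * p\<^sup>2 + (3 * M * (k / r) * g)\<^sup>2 / (1 / 2)"
      by (rule young) simp
    finally have "p\<^sup>2 \<le> M * g * q + (1 / 2 * p\<^sup>2 + (3 * M * (k / r) * g)\<^sup>2 / (1 / 2))" by simp
    also have "(3 * M * (k / r) * g)\<^sup>2 / (1 / 2) = 18 * M\<^sup>2 * k\<^sup>2 / r\<^sup>2 * g\<^sup>2"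
      by (simp add: power_mult_distrib power_divide)
    finally have "2 * p\<^sup>2 \<le> 2 * (M * g * q) + p\<^sup>2 + 2 * (18 * M\<^sup>2 * k\<^sup>2 / r\<^sup>2 * g\<^sup>2)" by linarith
    then show ?thesis by simp
  qed
  have IV: "r\<^sup>2 * p\<^sup>2 \<le> 2 * C3 * g\<^sup>2 - r ^ 3 / C2 * e1"
  proof -
    \<comment> \<open>With this weight II turns the q-part of Young's inequality into p^2 / 2, so
      that II and III close without q.\<close>
    define z where "z = lam * r\<^sup>2 / (2 * C2)"
    have z: "0 < z" using lam r C2 by (simp add: z_def)
    have "2 * M * g * q = 2 * q * (M * g)" by simp
    also have "\<dots> \<le> z * q\<^sup>2 + (M * g)\<^sup>2 / z" by (rule young[OF z])
    also have "z * q\<^sup>2 = lam * r\<^sup>2 * q\<^sup>2 / (2 * C2)" by (simp add: z_def)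
    also have "\<dots> \<le> (C2 * p\<^sup>2 - r * e1) / (2 * C2)" using C2 by (intro divide_right_mono II) auto
    also have "\<dots> = p\<^sup>2 / 2 - r * e1 / (2 * C2)" using C2 by (simp add: diff_divide_distrib)
    finally have "p\<^sup>2 \<le> p\<^sup>2 / 2 - r * e1 / (2 * C2) + (M * g)\<^sup>2 / z + 36 * M\<^sup>2 * k\<^sup>2 / r\<^sup>2 * g\<^sup>2"
      using III by linarith
    also have "(M * g)\<^sup>2 / z = (2 * M\<^sup>2 * C2 / lam) / r\<^sup>2 * g\<^sup>2"
      by (simp add: z_def power_mult_distrib)
    finally have "p\<^sup>2 \<le> p\<^sup>2 / 2 - r * e1 / (2 * C2) + (2 * M\<^sup>2 * C2 / lam) / r\<^sup>2 * g\<^sup>2 + 36 * M\<^sup>2 * k\<^sup>2 / r\<^sup>2 * g\<^sup>2" .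
    moreover have "C3 / r\<^sup>2 * g\<^sup>2 = (2 * M\<^sup>2 * C2 / lam) / r\<^sup>2 * g\<^sup>2 + 36 * M\<^sup>2 * k\<^sup>2 / r\<^sup>2 * g\<^sup>2"
      by (simp add: C3_def add_divide_distrib distrib_right)
    ultimately have "p\<^sup>2 / 2 \<le> C3 / r\<^sup>2 * g\<^sup>2 - r * e1 / (2 * C2)" by linarith
    from mult_left_mono[OF this, of "2 * r\<^sup>2"]
    have "r\<^sup>2 * p\<^sup>2 \<le> 2 * r\<^sup>2 * (C3 / r\<^sup>2 * g\<^sup>2 - r * e1 / (2 * C2))" by simp
    also have "\<dots> = 2 * C3 * g\<^sup>2 - r ^ 3 / C2 * e1"
      using r C2 by (simp add: field_simps power2_eq_square eval_nat_numeral)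
    finally show ?thesis .
  qed
  have p2: "p\<^sup>2 = \<theta> ^ 4 * y2\<^sup>2" by (simp add: p_def power_mult_distrib eval_nat_numeral)
  have g2: "g\<^sup>2 = \<theta>\<^sup>2 * X1\<^sup>2" by (simp add: g_def power_mult_distrib)
  have "r ^ 4 * p\<^sup>2 = r\<^sup>2 * (r\<^sup>2 * p\<^sup>2)" by (simp add: eval_nat_numeral)
  also have "\<dots> \<le> r\<^sup>2 * (2 * C3 * g\<^sup>2 - r ^ 3 / C2 * e1)" by (intro mult_left_mono IV) auto
  also have "\<dots> = 2 * C3 * (r\<^sup>2 * g\<^sup>2) - r ^ 5 / C2 * e1" by (simp add: eval_nat_numeral algebra_simps)
  finally have "r ^ 4 * p\<^sup>2 + r\<^sup>2 * g\<^sup>2 \<le> (2 * C3 + 1) * (r\<^sup>2 * g\<^sup>2) - r ^ 5 / C2 * e1"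
    by (simp add: algebra_simps)
  also have "(2 * C3 + 1) * (r\<^sup>2 * g\<^sup>2) = (2 * C3 + 1) / lam * (lam * r\<^sup>2 * g\<^sup>2)"
    using lam by simp
  also have "\<dots> \<le> (2 * C3 + 1) / lam * (C1 * b0\<^sup>2 - r * e0)"
    using lam C3 by (intro mult_left_mono I) auto
  finally show ?thesis by (simp only: p2 g2) (simp add: algebra_simps)
qed

context heat
begin

text \<open>The equation L U = G is tested with psi^(p+q+1) Y. The weight psi^p goes to grad U, and
  psi^(q+1) or psi^q to the two terms of the product rule for Y; p and q are chosen so that each
  factor is one of the weighted norms of \<open>energy_algebra\<close>.\<close>

lemma test_identity:
  assumes \<psi>: "\<psi> \<in> test_functions" and U: "U \<in> form_domain" and Y: "Y \<in> form_domain"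
    and G: "\<And>V. V \<in> form_domain \<Longrightarrow> bform (grad U) (grad V) = G \<bullet> V"
  shows "G \<bullet> cut (\<lambda>x. \<psi> x ^ (p + q + 1)) Y =
    bform (cut (\<lambda>x. \<psi> x ^ p) (grad U)) (cut (\<lambda>x. \<psi> x ^ (q + 1)) (grad Y)) +
    real (p + q + 1) * bform (cut (\<lambda>x. \<psi> x ^ p) (grad U)) (cut (\<lambda>x. \<psi> x ^ q) (tensor_grad \<psi> Y))"
proof -
  note b = bounded_meas_power[OF test_functions_bounded_meas[OF \<psi>]]
  have t: "(\<lambda>x. \<psi> x ^ (p + q + 1)) \<in> test_functions" using test_functions_power[OF \<psi>, of "p + q"] by simp
  have split: "cut (\<lambda>x. \<psi> x ^ (p + q + 1)) (grad Y) = cut (\<lambda>x. \<psi> x ^ p) (cut (\<lambda>x. \<psi> x ^ (q + 1)) (grad Y))"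
    by (subst cut_cut[OF b b]) (simp add: power_add mult_ac)
  have "G \<bullet> cut (\<lambda>x. \<psi> x ^ (p + q + 1)) Y = bform (grad U) (grad (cut (\<lambda>x. \<psi> x ^ (p + q + 1)) Y))"
    by (rule G[symmetric]) (rule grad_cut(1)[OF Y t])
  also have "\<dots> = bform (grad U) (cut (\<lambda>x. \<psi> x ^ p) (cut (\<lambda>x. \<psi> x ^ (q + 1)) (grad Y)))
      + bform (grad U) (cut (\<lambda>x. \<psi> x ^ p) (real (p + q + 1) *\<^sub>R cut (\<lambda>x. \<psi> x ^ q) (tensor_grad \<psi> Y)))"
    unfolding grad_cut(2)[OF Y t] bform_add_right split tensor_grad_power[OF \<psi>] ..
  also have "\<dots> = bform (cut (\<lambda>x. \<psi> x ^ p) (grad U)) (cut (\<lambda>x. \<psi> x ^ (q + 1)) (grad Y)) +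
      real (p + q + 1) * bform (cut (\<lambda>x. \<psi> x ^ p) (grad U)) (cut (\<lambda>x. \<psi> x ^ q) (tensor_grad \<psi> Y))"
    unfolding bform_cut[OF b[of p]] by (simp add: bform_def)
  finally show ?thesis .
qed

definition sflow :: "('n, complex) l2 \<Rightarrow> nat \<Rightarrow> real \<Rightarrow> ('n, complex) l2" where
  "sflow F m t = flow F m (t\<^sup>2)"

lemma has_vector_derivative_sflow:
  assumes "0 < t" shows "(sflow F m has_vector_derivative - (2 * t) *\<^sub>R sflow F (Suc m) t) (at t)"
proof -
  have "(flow F m \<circ> (\<lambda>t. t\<^sup>2) has_vector_derivative (2 * t) *\<^sub>R (- flow F (Suc m) (t\<^sup>2))) (at t)"
    using assms by (intro vector_diff_chain_at has_vector_derivative_flow)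
      (auto intro!: derivative_eq_intros simp flip: has_real_derivative_iff_has_vector_derivative)
  then show ?thesis by (simp add: sflow_def[abs_def] o_def del: flow.simps)
qed

lemma sflow_form:
  assumes "0 < t" shows "sflow F m t \<in> form_domain"
    "V \<in> form_domain \<Longrightarrow> bform (grad (sflow F m t)) (grad V) = sflow F (Suc m) t \<bullet> V"
  using flow_form(1)[of "t\<^sup>2" F m] flow_form(2)[of "t\<^sup>2" V F m] assms by (simp_all add: sflow_def del: flow.simps)

lemma continuous_sflow: "continuous_on {0<..} (sflow F m)"
  unfolding sflow_def by (rule continuous_on_compose2[OF continuous_flow]) (auto intro!: continuous_intros)

lemma continuous_grad_sflow: "continuous_on {0<..} (\<lambda>t. grad (sflow F m t))"
  unfolding sflow_def by (rule continuous_on_compose2[OF continuous_D_flow]) (auto intro!: continuous_intros)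

text \<open>The time weight \<open>t / r - 1/2\<close> vanishes at \<open>t = r / 2\<close>, so the energies integrated there leave no
  initial term. The cutoffs \<open>\<psi>\<^sup>2\<close> for level \<open>m\<close> and \<open>\<psi>\<^sup>6\<close> for level \<open>m + 1\<close> are matched so that every
  error term can be absorbed.\<close>

lemma local_energy:
  assumes \<psi>: "\<psi> \<in> test_functions" and \<psi>01: "\<And>x. 0 \<le> \<psi> x" "\<And>x. \<psi> x \<le> 1"
    and r: "0 < r" and k: "0 \<le> k"
    and gr: "\<And>x. sqrt (\<Sum>i\<in>UNIV. (partial_deriv i \<psi> x)\<^sup>2) \<le> k / r"
    and K: "K \<in> sets lebesgue" and \<psi>K: "\<And>x. x \<notin> K \<Longrightarrow> \<psi> x = 0" "\<And>x i. x \<notin> K \<Longrightarrow> partial_deriv i \<psi> x = 0"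
  defines "C2 \<equiv> 9 + 1296 * M\<^sup>2 * k\<^sup>2 / l"
  defines "C0 \<equiv> (2 * (2 * M\<^sup>2 * C2 / l + 36 * M\<^sup>2 * k\<^sup>2) + 1) / l"
  shows "integral {r/2..2*r} (\<lambda>t. r ^ 4 * ((t / r - 1 / 2) ^ 4 * (norm (cut (\<lambda>x. \<psi> x ^ 2) (sflow F (Suc m) t)))\<^sup>2)
         + r\<^sup>2 * ((t / r - 1 / 2)\<^sup>2 * (norm (cut (\<lambda>x. \<psi> x ^ 1) (grad (sflow F m t))))\<^sup>2))
    \<le> C0 * (3 + 144 * M\<^sup>2 * k\<^sup>2 / l) * integral {r/2..2*r} (\<lambda>t. mass K (sflow F m t))"
proof -
  note b = bounded_meas_power[OF test_functions_bounded_meas[OF \<psi>]]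
  note bK = bounded_meas_indicator[OF K]
  define U where "U = sflow F m"
  define V where "V = sflow F (Suc m)"
  define W where "W = sflow F (Suc (Suc m))"
  define \<theta> where "\<theta> t = t / r - 1 / 2" for t
  define X1 where "X1 t = norm (cut (\<lambda>x. \<psi> x ^ 1) (grad (U t)))" for t
  define X3 where "X3 t = norm (cut (\<lambda>x. \<psi> x ^ 3) (grad (V t)))" for t
  define y2 where "y2 t = norm (cut (\<lambda>x. \<psi> x ^ 2) (V t))" for t
  define b0 where "b0 t = norm (cut (indicat_real K) (U t))" for t
  define e0 where "e0 t = 2 * \<theta> t / r * (cut (\<lambda>x. \<psi> x ^ 2) (U t) \<bullet> U t) -
     4 * t * (\<theta> t)\<^sup>2 * (V t \<bullet> cut (\<lambda>x. \<psi> x ^ 2) (U t))" for t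
  define e1 where "e1 t = 6 * \<theta> t ^ 5 / r * (cut (\<lambda>x. \<psi> x ^ 6) (V t) \<bullet> V t) -
     4 * t * \<theta> t ^ 6 * (W t \<bullet> cut (\<lambda>x. \<psi> x ^ 6) (V t))" for t
  define E0 where "E0 t = (\<theta> t)\<^sup>2 * (cut (\<lambda>x. \<psi> x ^ 2) (U t) \<bullet> U t)" for t
  define E1 where "E1 t = \<theta> t ^ 6 * (cut (\<lambda>x. \<psi> x ^ 6) (V t) \<bullet> V t)" for t
  have sq: "cut (\<lambda>x. \<psi> x ^ (j + j)) Z \<bullet> Z = (norm (cut (\<lambda>x. \<psi> x ^ j) Z))\<^sup>2" for j and Z :: "('n, complex) l2"
    using inner_cut[OF b[of j], of "cut (\<lambda>x. \<psi> x ^ j) Z" Z]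
    by (simp add: cut_cut[OF b b] power_add power2_norm_eq_inner)
  \<comment> \<open>The factor 4 t is the 2 t of the substitution t^2, doubled by the symmetry of
    the cut-off inner product.\<close>
  have dE: "((\<lambda>t. \<theta> t ^ j * (cut (\<lambda>x. \<psi> x ^ i) (sflow F n t) \<bullet> sflow F n t)) has_real_derivative
      (real j * \<theta> t ^ (j - 1) / r * (cut (\<lambda>x. \<psi> x ^ i) (sflow F n t) \<bullet> sflow F n t) -
      4 * t * \<theta> t ^ j * (sflow F (Suc n) t \<bullet> cut (\<lambda>x. \<psi> x ^ i) (sflow F n t)))) (at t)"
    if t: "0 < t" for i j n t
  proof -
    note d = has_vector_derivative_sflow[OF t, of F n]
    have 1: "((\<lambda>t. cut (\<lambda>x. \<psi> x ^ i) (sflow F n t)) has_vector_derivative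
        cut (\<lambda>x. \<psi> x ^ i) (- (2 * t) *\<^sub>R sflow F (Suc n) t)) (at t)"
      by (rule bounded_linear.has_vector_derivative[OF bounded_linear_cut[OF b] d])
    have 2: "((\<lambda>t. cut (\<lambda>x. \<psi> x ^ i) (sflow F n t) \<bullet> sflow F n t) has_real_derivative
       cut (\<lambda>x. \<psi> x ^ i) (sflow F n t) \<bullet> (- (2 * t) *\<^sub>R sflow F (Suc n) t) +
       cut (\<lambda>x. \<psi> x ^ i) (- (2 * t) *\<^sub>R sflow F (Suc n) t) \<bullet> sflow F n t) (at t)"
      using bounded_bilinear.has_vector_derivative[OF bounded_bilinear_inner 1 d]
      by (simp only: has_real_derivative_iff_has_vector_derivative)
    have 3: "cut (\<lambda>x. \<psi> x ^ i) (sflow F n t) \<bullet> (- (2 * t) *\<^sub>R sflow F (Suc n) t) +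
       cut (\<lambda>x. \<psi> x ^ i) (- (2 * t) *\<^sub>R sflow F (Suc n) t) \<bullet> sflow F n t =
       - (4 * t) * (sflow F (Suc n) t \<bullet> cut (\<lambda>x. \<psi> x ^ i) (sflow F n t))"
      unfolding inner_cut[OF b[of i], of "- (2 * t) *\<^sub>R sflow F (Suc n) t"]
      by (simp add: inner_commute)
    have 4: "((\<lambda>t. \<theta> t ^ j) has_real_derivative real j * \<theta> t ^ (j - 1) / r) (at t)"
      unfolding \<theta>_def using r by (auto intro!: derivative_eq_intros)
    from DERIV_mult[OF 4 2[unfolded 3]] show ?thesis by (simp add: mult_ac)
  qed
  have key: "r ^ 4 * (\<theta> t ^ 4 * (y2 t)\<^sup>2) + r\<^sup>2 * ((\<theta> t)\<^sup>2 * (X1 t)\<^sup>2)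
      \<le> C0 * (3 + 144 * M\<^sup>2 * k\<^sup>2 / l) * (b0 t)\<^sup>2 - r * C0 * e0 t - r ^ 5 / C2 * e1 t"
    if t: "r / 2 \<le> t" "t \<le> 2 * r" for t
    unfolding C0_def C2_def
  proof (rule energy_algebra[OF r l_M(1) _ k t \<theta>_def _ _ _ _ _ e0_def _ _ e1_def])
    have t0: "0 < t" using t r by linarith
    note fU = sflow_form(1)[OF t0, of F m, folded U_def V_def] sflow_form(2)[OF t0, where F = F and m = m, folded U_def V_def]
    note fV = sflow_form(1)[OF t0, of F "Suc m", folded V_def W_def] sflow_form(2)[OF t0, where F = F and m = "Suc m", folded V_def W_def]
    have abs\<psi>: "\<bar>\<psi> x\<bar> = \<psi> x" for x using \<psi>01 by simp
    \<comment> \<open>With psi^0 only the support set bounds the gradient of the cutoff, and the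
      error lands on U over K. In \<open>T2\<close> the weight psi^2 survives, so the error is again
      y2 and can be absorbed.\<close>
    have T0: "norm (cut (\<lambda>x. \<psi> x ^ 0) (tensor_grad \<psi> Z)) \<le> k / r * norm (cut (indicat_real K) Z)" for Z
    proof (rule norm_cut_tensor[OF \<psi> b bK])
      show "\<bar>\<psi> x ^ 0\<bar> * sqrt (\<Sum>i\<in>UNIV. (partial_deriv i \<psi> x)\<^sup>2) \<le> k / r * \<bar>indicat_real K x\<bar>" for x
        using gr[of x] \<psi>K(2)[of x] by (cases "x \<in> K") auto
    qed (use r k in auto)
    have T2: "norm (cut (\<lambda>x. \<psi> x ^ 2) (tensor_grad \<psi> Z)) \<le> k / r * norm (cut (\<lambda>x. \<psi> x ^ 2) Z)" for Z
    proof (rule norm_cut_tensor[OF \<psi> b b])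
      show "\<bar>(\<psi> x)\<^sup>2\<bar> * sqrt (\<Sum>i\<in>UNIV. (partial_deriv i \<psi> x)\<^sup>2) \<le> k / r * \<bar>(\<psi> x)\<^sup>2\<bar>" for x
        using mult_left_mono[OF gr[of x], of "\<bar>(\<psi> x)\<^sup>2\<bar>"] by (simp add: mult.commute)
    qed (use r k in auto)
    show "0 \<le> M" using l_M by simp
    show "0 \<le> X1 t" "0 \<le> X3 t" "0 \<le> y2 t" "0 \<le> b0 t"
      by (auto simp: X1_def X3_def y2_def b0_def)
    have "norm (cut (\<lambda>x. \<psi> x ^ 1) (U t)) \<le> 1 * b0 t"
      unfolding b0_def
    proof (rule norm_cut_mono[OF b bK])
      show "\<bar>\<psi> x ^ 1\<bar> \<le> 1 * \<bar>indicat_real K x\<bar>" for x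
        using \<psi>01(2)[of x] \<psi>K(1)[of x] by (cases "x \<in> K") (auto simp: abs\<psi>)
    qed simp
    then show "cut (\<lambda>x. (\<psi> x)\<^sup>2) (U t) \<bullet> U t \<le> (b0 t)\<^sup>2"
      using sq[of 1 "U t"] power_mono[of "norm (cut (\<lambda>x. \<psi> x ^ 1) (U t))" "b0 t" 2] by (simp add: numeral_2_eq_2)
    have "norm (cut (\<lambda>x. \<psi> x ^ 3) (V t)) \<le> 1 * y2 t"
      unfolding y2_def
    proof (rule norm_cut_mono[OF b b])
      show "\<bar>\<psi> x ^ 3\<bar> \<le> 1 * \<bar>\<psi> x ^ 2\<bar>" for x
        using power_decreasing[of 2 3 "\<psi> x"] \<psi>01 by simp
    qed simp
    then show "cut (\<lambda>x. \<psi> x ^ 6) (V t) \<bullet> V t \<le> (y2 t)\<^sup>2"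
      using sq[of 3 "V t"] power_mono[of "norm (cut (\<lambda>x. \<psi> x ^ 3) (V t))" "y2 t" 2] by simp
    show "l * (X1 t)\<^sup>2 - 2 * M * X1 t * (k / r) * b0 t \<le> V t \<bullet> cut (\<lambda>x. (\<psi> x)\<^sup>2) (U t)"
    proof -
      have id: "V t \<bullet> cut (\<lambda>x. (\<psi> x)\<^sup>2) (U t) =
        bform (cut (\<lambda>x. \<psi> x ^ 1) (grad (U t))) (cut (\<lambda>x. \<psi> x ^ 1) (grad (U t))) +
        2 * bform (cut (\<lambda>x. \<psi> x ^ 1) (grad (U t))) (cut (\<lambda>x. \<psi> x ^ 0) (tensor_grad \<psi> (U t)))"
        using test_identity[OF \<psi> fU(1) fU(1) fU(2), of 1 0] by (simp add: numeral_2_eq_2)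
      have "\<bar>bform (cut (\<lambda>x. \<psi> x ^ 1) (grad (U t))) (cut (\<lambda>x. \<psi> x ^ 0) (tensor_grad \<psi> (U t)))\<bar>
          \<le> M * X1 t * norm (cut (\<lambda>x. \<psi> x ^ 0) (tensor_grad \<psi> (U t)))"
        unfolding X1_def by (rule bform_bound)
      also have "\<dots> \<le> M * X1 t * (k / r * b0 t)"
        unfolding b0_def X1_def using l_M by (intro mult_left_mono T0) auto
      finally have "\<bar>bform (cut (\<lambda>x. \<psi> x ^ 1) (grad (U t))) (cut (\<lambda>x. \<psi> x ^ 0) (tensor_grad \<psi> (U t)))\<bar>
          \<le> M * X1 t * (k / r) * b0 t" by simp
      moreover have "l * (X1 t)\<^sup>2 \<le> bform (cut (\<lambda>x. \<psi> x ^ 1) (grad (U t))) (cut (\<lambda>x. \<psi> x ^ 1) (grad (U t)))"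
        unfolding X1_def by (rule bform_coercive)
      ultimately show ?thesis unfolding id by linarith
    qed
    show "l * (X3 t)\<^sup>2 - 6 * M * X3 t * (k / r) * y2 t \<le> W t \<bullet> cut (\<lambda>x. \<psi> x ^ 6) (V t)"
    proof -
      have id: "W t \<bullet> cut (\<lambda>x. \<psi> x ^ 6) (V t) =
        bform (cut (\<lambda>x. \<psi> x ^ 3) (grad (V t))) (cut (\<lambda>x. \<psi> x ^ 3) (grad (V t))) +
        6 * bform (cut (\<lambda>x. \<psi> x ^ 3) (grad (V t))) (cut (\<lambda>x. \<psi> x ^ 2) (tensor_grad \<psi> (V t)))"
        using test_identity[OF \<psi> fV(1) fV(1) fV(2), of 3 2] by simp
      have "\<bar>bform (cut (\<lambda>x. \<psi> x ^ 3) (grad (V t))) (cut (\<lambda>x. \<psi> x ^ 2) (tensor_grad \<psi> (V t)))\<bar>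
          \<le> M * X3 t * norm (cut (\<lambda>x. \<psi> x ^ 2) (tensor_grad \<psi> (V t)))"
        unfolding X3_def by (rule bform_bound)
      also have "\<dots> \<le> M * X3 t * (k / r * y2 t)"
        unfolding y2_def X3_def using l_M by (intro mult_left_mono T2) auto
      finally have "\<bar>bform (cut (\<lambda>x. \<psi> x ^ 3) (grad (V t))) (cut (\<lambda>x. \<psi> x ^ 2) (tensor_grad \<psi> (V t)))\<bar>
          \<le> M * X3 t * (k / r) * y2 t" by simp
      moreover have "l * (X3 t)\<^sup>2 \<le> bform (cut (\<lambda>x. \<psi> x ^ 3) (grad (V t))) (cut (\<lambda>x. \<psi> x ^ 3) (grad (V t)))"
        unfolding X3_def by (rule bform_coercive)
      ultimately show ?thesis unfolding id by linarith
    qed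
    show "(y2 t)\<^sup>2 \<le> M * X1 t * X3 t + 4 * M * X1 t * (k / r) * y2 t"
    proof -
      \<comment> \<open>Since V = L U, testing the equation of U with psi^4 V exchanges |psi^2 V|^2
        for the gradients of U and V, with weights psi and psi^3.\<close>
      have "(y2 t)\<^sup>2 = V t \<bullet> cut (\<lambda>x. \<psi> x ^ 4) (V t)"
        using sq[of 2 "V t"] by (simp add: y2_def inner_commute)
      also have "\<dots> =
        bform (cut (\<lambda>x. \<psi> x ^ 1) (grad (U t))) (cut (\<lambda>x. \<psi> x ^ 3) (grad (V t))) +
        4 * bform (cut (\<lambda>x. \<psi> x ^ 1) (grad (U t))) (cut (\<lambda>x. \<psi> x ^ 2) (tensor_grad \<psi> (V t)))"
        using test_identity[OF \<psi> fU(1) fV(1) fU(2), of 1 2] by (simp add: power4_eq_xxxx mult.assoc)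
      finally have id: "(y2 t)\<^sup>2 = bform (cut (\<lambda>x. \<psi> x ^ 1) (grad (U t))) (cut (\<lambda>x. \<psi> x ^ 3) (grad (V t))) +
        4 * bform (cut (\<lambda>x. \<psi> x ^ 1) (grad (U t))) (cut (\<lambda>x. \<psi> x ^ 2) (tensor_grad \<psi> (V t)))" .
      have "\<bar>bform (cut (\<lambda>x. \<psi> x ^ 1) (grad (U t))) (cut (\<lambda>x. \<psi> x ^ 2) (tensor_grad \<psi> (V t)))\<bar>
          \<le> M * X1 t * norm (cut (\<lambda>x. \<psi> x ^ 2) (tensor_grad \<psi> (V t)))"
        unfolding X1_def by (rule bform_bound)
      also have "\<dots> \<le> M * X1 t * (k / r * y2 t)"
        unfolding y2_def X1_def using l_M by (intro mult_left_mono T2) auto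
      finally have "\<bar>bform (cut (\<lambda>x. \<psi> x ^ 1) (grad (U t))) (cut (\<lambda>x. \<psi> x ^ 2) (tensor_grad \<psi> (V t)))\<bar>
          \<le> M * X1 t * (k / r) * y2 t" by simp
      moreover have "\<bar>bform (cut (\<lambda>x. \<psi> x ^ 1) (grad (U t))) (cut (\<lambda>x. \<psi> x ^ 3) (grad (V t)))\<bar> \<le> M * X1 t * X3 t"
        unfolding X1_def X3_def by (rule bform_bound)
      ultimately show ?thesis unfolding id by linarith
    qed
  qed
  have cU: "continuous_on {r/2..2*r} (sflow F n)" for n
    by (rule continuous_on_subset[OF continuous_sflow]) (use r in auto)
  have cD: "continuous_on {r/2..2*r} (\<lambda>t. grad (sflow F n t))" for n
    by (rule continuous_on_subset[OF continuous_grad_sflow]) (use r in auto)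
  have cc: "continuous_on {r/2..2*r} (\<lambda>t. cut \<phi> (f t))" if "bounded_meas \<phi>" "continuous_on {r/2..2*r} f"
    for \<phi> and f :: "real \<Rightarrow> ('n, 'b::euclidean_space) l2"
    by (rule bounded_linear.continuous_on[OF bounded_linear_cut that(2)]) (rule that)
  have int1: "(\<lambda>t. r ^ 4 * (\<theta> t ^ 4 * (y2 t)\<^sup>2) + r\<^sup>2 * ((\<theta> t)\<^sup>2 * (X1 t)\<^sup>2)) integrable_on {r/2..2*r}"
    unfolding \<theta>_def y2_def X1_def U_def V_def
    using r by (intro integrable_continuous_real continuous_intros cc cD cU b) auto
  have int2: "(\<lambda>t. (b0 t)\<^sup>2) integrable_on {r/2..2*r}"
    unfolding b0_def U_def by (intro integrable_continuous_real continuous_intros cc cU bK)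
  have d0: "(e0 has_integral (E0 (2 * r) - E0 (r / 2))) {r/2..2*r}"
    and d1: "(e1 has_integral (E1 (2 * r) - E1 (r / 2))) {r/2..2*r}"
  proof -
    show "(e0 has_integral (E0 (2 * r) - E0 (r / 2))) {r/2..2*r}"
    proof (rule fundamental_theorem_of_calculus)
      fix t assume "t \<in> {r / 2..2 * r}"
      then have "0 < t" using r by simp
      from dE[OF this, of 2 2 m] have "(E0 has_real_derivative e0 t) (at t)"
        unfolding E0_def[abs_def] e0_def U_def V_def by simp
      then show "(E0 has_vector_derivative e0 t) (at t within {r / 2..2 * r})"
        by (simp add: has_real_derivative_iff_has_vector_derivative has_vector_derivative_at_within)
    qed (use r in auto)
    show "(e1 has_integral (E1 (2 * r) - E1 (r / 2))) {r/2..2*r}"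
    proof (rule fundamental_theorem_of_calculus)
      fix t assume "t \<in> {r / 2..2 * r}"
      then have "0 < t" using r by simp
      from dE[OF this, of 6 6 "Suc m"] have "(E1 has_real_derivative e1 t) (at t)"
        unfolding E1_def[abs_def] e1_def W_def V_def by simp
      then show "(E1 has_vector_derivative e1 t) (at t within {r / 2..2 * r})"
        by (simp add: has_real_derivative_iff_has_vector_derivative has_vector_derivative_at_within)
    qed (use r in auto)
  qed
  have C2: "0 < C2" using l_M by (auto simp: C2_def intro!: add_pos_nonneg)
  have C0: "0 \<le> C0" using l_M C2 by (auto simp: C0_def)
  \<comment> \<open>At r/2 the time weight vanishes; at 2 r the boundary energies are nonnegative
    and enter with a minus sign, so they may be dropped.\<close>
  have E_start: "E0 (r / 2) = 0" "E1 (r / 2) = 0" using r by (auto simp: E0_def E1_def \<theta>_def)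
  have E_end: "0 \<le> E0 (2 * r)" "0 \<le> E1 (2 * r)"
    using sq[of 1 "U (2 * r)"] sq[of 3 "V (2 * r)"] r
    by (auto simp: E0_def E1_def \<theta>_def numeral_2_eq_2)
  let ?C = "C0 * (3 + 144 * M\<^sup>2 * k\<^sup>2 / l)"
  have "((\<lambda>t. ?C * (b0 t)\<^sup>2 - r * C0 * e0 t - r ^ 5 / C2 * e1 t) has_integral
      (?C * integral {r/2..2*r} (\<lambda>t. (b0 t)\<^sup>2) - r * C0 * (E0 (2 * r) - E0 (r / 2)) - r ^ 5 / C2 * (E1 (2 * r) - E1 (r / 2)))) {r/2..2*r}"
    by (intro has_integral_diff has_integral_mult_right d0 d1 integrable_integral int2)
  from has_integral_le[OF integrable_integral[OF int1] this]
  have "integral {r/2..2*r} (\<lambda>t. r ^ 4 * (\<theta> t ^ 4 * (y2 t)\<^sup>2) + r\<^sup>2 * ((\<theta> t)\<^sup>2 * (X1 t)\<^sup>2))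
     \<le> ?C * integral {r/2..2*r} (\<lambda>t. (b0 t)\<^sup>2) - r * C0 * (E0 (2 * r) - E0 (r / 2)) - r ^ 5 / C2 * (E1 (2 * r) - E1 (r / 2))"
    using key by auto
  also have "\<dots> \<le> ?C * integral {r/2..2*r} (\<lambda>t. (b0 t)\<^sup>2)"
    using E_start mult_nonneg_nonneg[OF mult_nonneg_nonneg[OF less_imp_le[OF r] C0] E_end(1)]
      mult_nonneg_nonneg[OF divide_nonneg_pos[OF zero_le_power[OF less_imp_le[OF r], of 5] C2] E_end(2)]
    by simp
  finally show ?thesis
    unfolding \<theta>_def y2_def X1_def b0_def U_def V_def mass_def .
qed

text \<open>Strips the weights from \<open>local_energy\<close>: on [r, 2 r] the time weight is at
  least 1/2 and on the smaller ball the cutoff is at least c, both uniformly in r.\<close>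

lemma local_estimate:
  "\<exists>C\<ge>0. \<forall>F m (x :: real^'n) r. 0 < r \<longrightarrow>
    integral {r..2*r} (\<lambda>t. r ^ 4 * mass (ball x (2 * r)) (sflow F (Suc m) t) + r\<^sup>2 * mass (ball x (2 * r)) (grad (sflow F m t)))
    \<le> C * integral {r/2..2*r} (\<lambda>t. mass (cball x (4 * real CARD('n) * r)) (sflow F m t))"
proof -
  obtain k c where k: "0 \<le> k" and c: "0 < c" and ctf: "\<And>(x :: real^'n) r. 0 < r \<Longrightarrow> \<exists>\<psi>\<in>test_functions.
     (\<forall>y. 0 \<le> \<psi> y \<and> \<psi> y \<le> 1) \<and>
     (\<forall>y. sqrt (\<Sum>i\<in>UNIV. (partial_deriv i \<psi> y)\<^sup>2) \<le> k / r) \<and>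
     (\<forall>y\<in>ball x (2 * r). c \<le> \<psi> y) \<and>
     (\<forall>y. y \<notin> cball x (4 * real CARD('n) * r) \<longrightarrow> \<psi> y = 0 \<and> (\<forall>i. partial_deriv i \<psi> y = 0))"
    using cutoff_exists[where 'n = 'n] by metis
  define C2 where "C2 = 9 + 1296 * M\<^sup>2 * k\<^sup>2 / l"
  define C0 where "C0 = (2 * (2 * M\<^sup>2 * C2 / l + 36 * M\<^sup>2 * k\<^sup>2) + 1) / l"
  define C where "C = C0 * (3 + 144 * M\<^sup>2 * k\<^sup>2 / l)"
  \<comment> \<open>16 and 4 undo theta^4 and theta^2 for theta at least 1/2; the powers of 1/c undo
    psi^2 and psi under the squared norms.\<close>
  define c' where "c' = 16 * (1 / c\<^sup>2)\<^sup>2 + 4 * (1 / c)\<^sup>2"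
  have C2: "0 < C2" using l_M by (auto simp: C2_def intro!: add_pos_nonneg)
  have C: "0 \<le> C" using l_M C2 by (auto simp: C_def C0_def)
  have c': "0 \<le> c'" by (auto simp: c'_def)
  show ?thesis
  proof (intro exI[of _ "c' * C"] conjI allI impI)
    show "0 \<le> c' * C" using C c' by simp
    fix F :: "('n, complex) l2" and m and x :: "real^'n" and r :: real assume r: "0 < r"
    let ?K = "cball x (4 * real CARD('n) * r)" and ?B = "ball x (2 * r)"
    obtain \<psi> where \<psi>: "\<psi> \<in> test_functions" "\<And>y. 0 \<le> \<psi> y" "\<And>y. \<psi> y \<le> 1"
      "\<And>y. sqrt (\<Sum>i\<in>UNIV. (partial_deriv i \<psi> y)\<^sup>2) \<le> k / r"
      "\<And>y. y \<in> ?B \<Longrightarrow> c \<le> \<psi> y"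
      "\<And>y. y \<notin> ?K \<Longrightarrow> \<psi> y = 0" "\<And>y i. y \<notin> ?K \<Longrightarrow> partial_deriv i \<psi> y = 0"
      using ctf[OF r, of x] by metis
    note b = bounded_meas_power[OF test_functions_bounded_meas[OF \<psi>(1)]]
    have bB: "bounded_meas (indicat_real ?B)" by (rule bounded_meas_indicator) auto
    define h where "h t = r ^ 4 * ((t / r - 1 / 2) ^ 4 * (norm (cut (\<lambda>x. \<psi> x ^ 2) (sflow F (Suc m) t)))\<^sup>2)
         + r\<^sup>2 * ((t / r - 1 / 2)\<^sup>2 * (norm (cut (\<lambda>x. \<psi> x ^ 1) (grad (sflow F m t))))\<^sup>2)" for t
    define h' where "h' t = r ^ 4 * mass ?B (sflow F (Suc m) t) + r\<^sup>2 * mass ?B (grad (sflow F m t))" for t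
    have cU: "continuous_on {r/2..2*r} (sflow F n)" for n
      by (rule continuous_on_subset[OF continuous_sflow]) (use r in auto)
    have cD: "continuous_on {r/2..2*r} (\<lambda>t. grad (sflow F n t))" for n
      by (rule continuous_on_subset[OF continuous_grad_sflow]) (use r in auto)
    have cc: "continuous_on {r/2..2*r} (\<lambda>t. cut \<phi> (f t))" if "bounded_meas \<phi>" "continuous_on {r/2..2*r} f"
      for \<phi> and f :: "real \<Rightarrow> ('n, 'b::euclidean_space) l2"
      by (rule bounded_linear.continuous_on[OF bounded_linear_cut that(2)]) (rule that)
    have ch: "continuous_on {r/2..2*r} h"
      unfolding h_def using r by (intro continuous_intros cc cD cU b) auto
    have ch': "continuous_on {r/2..2*r} h'"
      unfolding h'_def mass_def by (intro continuous_intros cc cD cU bB)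
    have hh: "h' t \<le> c' * h t" if t: "r \<le> t" for t
    proof -
      define \<theta> where "\<theta> = t / r - 1 / 2"
      have \<theta>: "1 / 2 \<le> \<theta>" using t r by (simp add: \<theta>_def field_simps)
      have "norm (cut (indicat_real ?B) (sflow F (Suc m) t)) \<le> 1 / c\<^sup>2 * norm (cut (\<lambda>x. \<psi> x ^ 2) (sflow F (Suc m) t))"
      proof (rule norm_cut_mono[OF bB b])
        show "\<bar>indicat_real ?B y\<bar> \<le> 1 / c\<^sup>2 * \<bar>\<psi> y ^ 2\<bar>" for y
          using \<psi>(5)[of y] c power_mono[of c "\<psi> y" 2] by (cases "y \<in> ?B") (auto simp: field_simps)
      qed (use c in auto)
      then have "mass ?B (sflow F (Suc m) t) \<le> (1 / c\<^sup>2 * norm (cut (\<lambda>x. \<psi> x ^ 2) (sflow F (Suc m) t)))\<^sup>2"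
        unfolding mass_def by (intro power_mono) auto
      also have "\<dots> = (1 / c\<^sup>2)\<^sup>2 * (norm (cut (\<lambda>x. \<psi> x ^ 2) (sflow F (Suc m) t)))\<^sup>2"
        by (simp add: power_mult_distrib power_divide)
      also have "\<dots> \<le> (16 * (1 / c\<^sup>2)\<^sup>2) * (\<theta> ^ 4 * (norm (cut (\<lambda>x. \<psi> x ^ 2) (sflow F (Suc m) t)))\<^sup>2)"
      proof -
        have "1 \<le> 16 * \<theta> ^ 4" using power_mono[OF \<theta>, of 4] by (simp add: power_divide)
        from mult_right_mono[OF this, of "(1 / c\<^sup>2)\<^sup>2 * (norm (cut (\<lambda>x. \<psi> x ^ 2) (sflow F (Suc m) t)))\<^sup>2"]
        show ?thesis by (simp add: mult_ac)
      qed
      finally have 1: "mass ?B (sflow F (Suc m) t) \<le> (16 * (1 / c\<^sup>2)\<^sup>2) * (\<theta> ^ 4 * (norm (cut (\<lambda>x. \<psi> x ^ 2) (sflow F (Suc m) t)))\<^sup>2)" .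
      have "norm (cut (indicat_real ?B) (grad (sflow F m t))) \<le> 1 / c * norm (cut (\<lambda>x. \<psi> x ^ 1) (grad (sflow F m t)))"
      proof (rule norm_cut_mono[OF bB b])
        show "\<bar>indicat_real ?B y\<bar> \<le> 1 / c * \<bar>\<psi> y ^ 1\<bar>" for y
          using \<psi>(5)[of y] c by (cases "y \<in> ?B") (auto simp: field_simps)
      qed (use c in auto)
      then have "mass ?B (grad (sflow F m t)) \<le> (1 / c * norm (cut (\<lambda>x. \<psi> x ^ 1) (grad (sflow F m t))))\<^sup>2"
        unfolding mass_def by (intro power_mono) auto
      also have "\<dots> = (1 / c)\<^sup>2 * (norm (cut (\<lambda>x. \<psi> x ^ 1) (grad (sflow F m t))))\<^sup>2"
        by (simp add: power_mult_distrib power_divide)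
      also have "\<dots> \<le> (4 * (1 / c)\<^sup>2) * (\<theta>\<^sup>2 * (norm (cut (\<lambda>x. \<psi> x ^ 1) (grad (sflow F m t))))\<^sup>2)"
      proof -
        have "1 \<le> 4 * \<theta>\<^sup>2" using power_mono[OF \<theta>, of 2] by (simp add: power_divide)
        from mult_right_mono[OF this, of "(1 / c)\<^sup>2 * (norm (cut (\<lambda>x. \<psi> x ^ 1) (grad (sflow F m t))))\<^sup>2"]
        show ?thesis by (simp add: mult_ac)
      qed
      finally have 2: "mass ?B (grad (sflow F m t)) \<le> (4 * (1 / c)\<^sup>2) * (\<theta>\<^sup>2 * (norm (cut (\<lambda>x. \<psi> x ^ 1) (grad (sflow F m t))))\<^sup>2)" .
      have 3: "16 * (1 / c\<^sup>2)\<^sup>2 \<le> c'" "4 * (1 / c)\<^sup>2 \<le> c'" by (auto simp: c'_def)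
      have "h' t \<le> r ^ 4 * (c' * (\<theta> ^ 4 * (norm (cut (\<lambda>x. \<psi> x ^ 2) (sflow F (Suc m) t)))\<^sup>2))
         + r\<^sup>2 * (c' * (\<theta>\<^sup>2 * (norm (cut (\<lambda>x. \<psi> x ^ 1) (grad (sflow F m t))))\<^sup>2))"
        unfolding h'_def using \<theta>
        by (intro add_mono mult_left_mono order_trans[OF 1] order_trans[OF 2] mult_right_mono 3) auto
      also have "\<dots> = c' * h t" by (simp add: h_def \<theta>_def algebra_simps)
      finally show ?thesis .
    qed
    have h0: "0 \<le> h t" for t by (auto simp: h_def)
    have "integral {r..2*r} h' \<le> integral {r..2*r} (\<lambda>t. c' * h t)"
      using r hh by (intro integral_le integrable_continuous_real continuous_intros
          continuous_on_subset[OF ch] continuous_on_subset[OF ch']) auto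
    also have "\<dots> \<le> integral {r/2..2*r} (\<lambda>t. c' * h t)"
      using r h0 c' by (intro integral_subset_le integrable_continuous_real continuous_intros
          continuous_on_subset[OF ch]) auto
    also have "\<dots> = c' * integral {r/2..2*r} h" by simp
    also have "integral {r/2..2*r} h \<le> C * integral {r/2..2*r} (\<lambda>t. mass ?K (sflow F m t))"
      unfolding h_def C_def C0_def C2_def
      by (rule local_energy[OF \<psi>(1-3) r k \<psi>(4) _ \<psi>(6,7)]) auto
    finally show "integral {r..2*r} (\<lambda>t. r ^ 4 * mass ?B (sflow F (Suc m) t) + r\<^sup>2 * mass ?B (grad (sflow F m t)))
      \<le> c' * C * integral {r/2..2*r} (\<lambda>t. mass ?K (sflow F m t))"
      using c' by (simp add: h'_def[abs_def] mult_left_mono mult.assoc)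
  qed
qed

end



section \<open>Powers of extended nonnegative numbers and the layer cake formula\<close>

lemma ennreal_powr_ennreal: "0 \<le> x \<Longrightarrow> ennreal_powr (ennreal x) q = ennreal (x powr q)"
  by (simp add: ennreal_powr_def)

lemma ennreal_powr_top [simp]: "ennreal_powr \<infinity> q = \<infinity>" "ennreal_powr top q = top"
  by (simp_all add: ennreal_powr_def)

lemma ennreal_powr_0 [simp]: "ennreal_powr 0 q = 0"
  by (simp add: ennreal_powr_def)

lemma ennreal_powr_one [simp]: "ennreal_powr a 1 = a"
  by (cases a) (simp_all add: ennreal_powr_ennreal)

lemma ennreal_powr_mono: "a \<le> b \<Longrightarrow> 0 \<le> q \<Longrightarrow> ennreal_powr a q \<le> ennreal_powr b q"
  by (cases a; cases b) (auto simp: ennreal_powr_ennreal top_unique intro!: ennreal_leI powr_mono2)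

lemma ennreal_powr_measurable [measurable]:
  assumes [measurable]: "f \<in> borel_measurable N" shows "(\<lambda>x. ennreal_powr (f x) q) \<in> borel_measurable N"
  unfolding ennreal_powr_def by measurable

lemma ennreal_powr_cmult:
  assumes "0 < c" shows "ennreal_powr (ennreal c * a) q = ennreal (c powr q) * ennreal_powr a q"
proof (cases a)
  case (real x)
  then show ?thesis using assms by (simp add: ennreal_powr_ennreal powr_mult flip: ennreal_mult)
next
  case top
  then show ?thesis using assms by (simp add: ennreal_mult_top)
qed

lemma ennreal_powr_powr: "ennreal_powr (ennreal_powr a p) q = ennreal_powr a (p * q)"
  by (cases a) (simp_all add: ennreal_powr_ennreal powr_powr)

lemma ennreal_powr_mult_self:
  assumes "0 < q" shows "a * ennreal_powr a q = ennreal_powr a (q + 1)"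
proof (cases a)
  case (real x)
  then show ?thesis
    by (cases "x = 0") (auto simp: ennreal_powr_ennreal powr_add mult.commute simp flip: ennreal_mult)
qed (use assms in \<open>simp add: ennreal_top_mult\<close>)

lemma nn_integral_powr_layer:
  assumes q: "0 < q"
  shows "(\<integral>\<^sup>+s. (if 0 < s \<and> ennreal s < a then ennreal (q * s powr (q - 1)) else 0) \<partial>lborel) = ennreal_powr a q"
proof -
  have fin: "(\<integral>\<^sup>+s. (if 0 < s \<and> ennreal s < ennreal x then ennreal (q * s powr (q - 1)) else 0) \<partial>lborel) = ennreal (x powr q)"
    if x: "0 \<le> x" for x
  proof -
    have "((\<lambda>s. q * s powr (q - 1)) has_integral q * (x powr (q - 1 + 1) / (q - 1 + 1))) {0..x}"
      by (intro has_integral_mult_right has_integral_powr_from_0) (use q x in auto)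
    then have hi: "((\<lambda>s. q * s powr (q - 1)) has_integral x powr q) {0..x}" using q by simp
    have "(\<integral>\<^sup>+s. ennreal (q * s powr (q - 1)) * indicator {0..x} s \<partial>lborel) = ennreal (x powr q)"
      by (rule nn_integral_has_integral_lebesgue'[OF _ hi]) (use q in auto)
    moreover have "(\<integral>\<^sup>+s. (if 0 < s \<and> ennreal s < ennreal x then ennreal (q * s powr (q - 1)) else 0) \<partial>lborel)
        = (\<integral>\<^sup>+s. ennreal (q * s powr (q - 1)) * indicator {0..x} s \<partial>lborel)"
    proof (rule nn_integral_cong_AE)
      show "AE s in lborel. (if 0 < s \<and> ennreal s < ennreal x then ennreal (q * s powr (q - 1)) else 0) =
          ennreal (q * s powr (q - 1)) * indicator {0..x} s"
        using AE_lborel_singleton[of 0] AE_lborel_singleton[of x]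
        by eventually_elim (use x in \<open>auto simp: indicator_def ennreal_less_iff\<close>)
    qed
    ultimately show ?thesis by simp
  qed
  show ?thesis
  proof (cases a)
    case (real x)
    then show ?thesis using fin[of x] by (simp add: ennreal_powr_ennreal)
  next
    case top
    \<comment> \<open>For an infinite argument, the finite case at height n^(1/q) shows that the
      integral exceeds every n.\<close>
    have "of_nat n \<le> (\<integral>\<^sup>+s. (if 0 < s \<and> ennreal s < a then ennreal (q * s powr (q - 1)) else 0) \<partial>lborel)" for n
    proof -
      have "of_nat n = ennreal ((real n powr (1 / q)) powr q)"
        using q by (simp add: powr_powr ennreal_of_nat_eq_real_of_nat)
      also have "\<dots> \<le> (\<integral>\<^sup>+s. (if 0 < s \<and> ennreal s < a then ennreal (q * s powr (q - 1)) else 0) \<partial>lborel)"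
        unfolding fin[OF powr_ge_zero, symmetric] top by (intro nn_integral_mono) auto
      finally show ?thesis .
    qed
    then have "(SUP n. of_nat n :: ennreal) \<le> (\<integral>\<^sup>+s. (if 0 < s \<and> ennreal s < a then ennreal (q * s powr (q - 1)) else 0) \<partial>lborel)"
      by (intro SUP_least)
    then have "(\<integral>\<^sup>+s. (if 0 < s \<and> ennreal s < a then ennreal (q * s powr (q - 1)) else 0) \<partial>lborel) = top"
      unfolding ennreal_SUP_of_nat_eq_top by (simp add: top_unique)
    then show ?thesis using top by simp
  qed
qed

text \<open>The tail of s^(q-2) is integrable exactly because q < 1; this is the dual of the layer
  formula and handles the part of a function below the level s.\<close>

lemma nn_integral_powr_tail:
  assumes q: "0 < q" "q < 1"
  shows "a * (\<integral>\<^sup>+s. (if 0 < s \<and> a \<le> ennreal s then ennreal (q * s powr (q - 2)) else 0) \<partial>lborel)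
    \<le> ennreal (q / (1 - q)) * ennreal_powr a q"
proof (cases a)
  case top
  then show ?thesis by (simp add: ennreal_mult_top q top_unique)
next
  case (real x)
  show ?thesis
  proof (cases "x = 0")
    case True then show ?thesis using real by simp
  next
    case False
    then have x: "0 < x" using real by simp
    have "((\<lambda>s. q * s powr (q - 2)) has_integral q * (- (x powr (q - 2 + 1)) / (q - 2 + 1))) {x..}"
      by (intro has_integral_mult_right has_integral_powr_to_inf) (use q x in auto)
    moreover have "q * (- (x powr (q - 2 + 1)) / (q - 2 + 1)) = q / (1 - q) * x powr (q - 1)"
    proof -
      have e: "q - 2 + 1 = - (1 - q)" by simp
      show ?thesis unfolding e minus_divide_divide by simp
    qed
    ultimately have hi: "((\<lambda>s. q * s powr (q - 2)) has_integral q / (1 - q) * x powr (q - 1)) {x..}" by simp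
    have "(\<integral>\<^sup>+s. ennreal (q * s powr (q - 2)) * indicator {x..} s \<partial>lborel) = ennreal (q / (1 - q) * x powr (q - 1))"
      by (rule nn_integral_has_integral_lebesgue'[OF _ hi]) (use q in auto)
    moreover have "(\<integral>\<^sup>+s. (if 0 < s \<and> a \<le> ennreal s then ennreal (q * s powr (q - 2)) else 0) \<partial>lborel)
        = (\<integral>\<^sup>+s. ennreal (q * s powr (q - 2)) * indicator {x..} s \<partial>lborel)"
    proof (rule nn_integral_cong)
      fix s :: real
      show "(if 0 < s \<and> a \<le> ennreal s then ennreal (q * s powr (q - 2)) else 0) =
          ennreal (q * s powr (q - 2)) * indicator {x..} s"
        using x real by (cases "0 < s") (auto simp: indicator_def)
    qed
    ultimately have "a * (\<integral>\<^sup>+s. (if 0 < s \<and> a \<le> ennreal s then ennreal (q * s powr (q - 2)) else 0) \<partial>lborel)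
        = ennreal (x * (q / (1 - q) * x powr (q - 1)))"
      using real q ennreal_mult[of x "q / (1 - q) * x powr (q - 1)"] by simp
    also have "x * (q / (1 - q) * x powr (q - 1)) = q / (1 - q) * x powr q"
      using x by (simp add: powr_diff)
    finally show ?thesis
      using real q ennreal_mult[of "q / (1 - q)" "x powr q"] by (simp add: ennreal_powr_ennreal)
  qed
qed

lemma (in sigma_finite_measure) nn_integral_powr_layer_cake:
  assumes [measurable]: "f \<in> borel_measurable M" and q: "0 < q"
  shows "(\<integral>\<^sup>+x. ennreal_powr (f x) q \<partial>M) =
    (\<integral>\<^sup>+s. (if 0 < s then ennreal (q * s powr (q - 1)) * emeasure M {x \<in> space M. ennreal s < f x} else 0) \<partial>lborel)"
proof -
  interpret pair_sigma_finite lborel M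
    by (intro pair_sigma_finite.intro lborel.sigma_finite_measure_axioms sigma_finite_measure_axioms)
  have "(\<integral>\<^sup>+x. ennreal_powr (f x) q \<partial>M) =
      (\<integral>\<^sup>+x. (\<integral>\<^sup>+s. (if 0 < s \<and> ennreal s < f x then ennreal (q * s powr (q - 1)) else 0) \<partial>lborel) \<partial>M)"
    by (simp add: nn_integral_powr_layer[OF q])
  also have "\<dots> = (\<integral>\<^sup>+s. (\<integral>\<^sup>+x. (if 0 < s \<and> ennreal s < f x then ennreal (q * s powr (q - 1)) else 0) \<partial>M) \<partial>lborel)"
    by (rule Fubini') measurable
  also have "\<dots> = (\<integral>\<^sup>+s. (if 0 < s then ennreal (q * s powr (q - 1)) * emeasure M {x \<in> space M. ennreal s < f x} else 0) \<partial>lborel)"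
  proof (rule nn_integral_cong)
    fix s :: real
    show "(\<integral>\<^sup>+x. (if 0 < s \<and> ennreal s < f x then ennreal (q * s powr (q - 1)) else 0) \<partial>M) =
       (if 0 < s then ennreal (q * s powr (q - 1)) * emeasure M {x \<in> space M. ennreal s < f x} else 0)"
    proof (cases "0 < s")
      case True
      have "(\<integral>\<^sup>+x. (if 0 < s \<and> ennreal s < f x then ennreal (q * s powr (q - 1)) else 0) \<partial>M) =
          (\<integral>\<^sup>+x. ennreal (q * s powr (q - 1)) * indicator {x \<in> space M. ennreal s < f x} x \<partial>M)"
        using True by (intro nn_integral_cong) (auto simp: indicator_def)
      then show ?thesis using True by (simp add: nn_integral_cmult_indicator)
    qed simp
  qed
  finally show ?thesis .
qed

text \<open>The factors 1/p and 1/q are at most 1 and are dropped. The parameter e makes the second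
  term small enough for absorption.\<close>

lemma ennreal_Young:
  fixes a b :: ennreal
  assumes p: "1 < p" "1 / p + 1 / q = 1" and e: "0 < e"
  shows "a * b \<le> ennreal (e powr - q) * ennreal_powr a q + ennreal (e powr p) * ennreal_powr b p"
proof (cases a; cases b)
  have q: "1 < q"
  proof -
    have "1 / p < 1" "0 < 1 / p" using p by auto
    then have "0 < 1 / q" "1 / q < 1" using p(2) by linarith+
    then show ?thesis by (simp add: divide_less_eq_1_pos)
  qed
  fix x y assume a: "a = ennreal x" "0 \<le> x" and b: "b = ennreal y" "0 \<le> y"
  have "x * y = (e * y) * (x / e)" using e by simp
  also have "\<dots> \<le> (e * y) powr p / p + (x / e) powr q / q"
    using a b e p q by (intro Youngs_inequality) auto
  also have "\<dots> \<le> (e * y) powr p + (x / e) powr q"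
    using p q divide_left_mono[of 1 p "(e * y) powr p"] divide_left_mono[of 1 q "(x / e) powr q"]
    by (intro add_mono) auto
  also have "\<dots> = e powr - q * x powr q + e powr p * y powr p"
    using e a b by (simp add: powr_mult powr_divide powr_minus_divide)
  finally show ?thesis
    using a b by (simp add: ennreal_powr_ennreal flip: ennreal_mult ennreal_plus)
qed (use e in \<open>auto simp: ennreal_mult_top top_add\<close>)

section \<open>Maximal functions for doubling measures\<close>

locale doubling_measure =
  fixes \<mu> :: "'a::euclidean_space measure" and D :: real
  assumes sets_mu [measurable_cong]: "sets \<mu> = sets borel"
    and D_ge: "1 \<le> D"
    and ball_finite: "emeasure \<mu> (ball x r) < \<infinity>"
    and ball_pos: "0 < r \<Longrightarrow> 0 < emeasure \<mu> (ball x r)"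
    and doubling: "0 < r \<Longrightarrow> emeasure \<mu> (ball x (2 * r)) \<le> ennreal D * emeasure \<mu> (ball x r)"
begin

lemma space_mu [simp]: "space \<mu> = UNIV"
  using sets_eq_imp_space_eq[OF sets_mu] by simp

sublocale sigma_finite_measure \<mu>
proof
  show "\<exists>A. countable A \<and> A \<subseteq> sets \<mu> \<and> \<Union>A = space \<mu> \<and> (\<forall>a\<in>A. emeasure \<mu> a \<noteq> \<infinity>)"
  proof (intro exI[of _ "range (\<lambda>n::nat. ball 0 (real n))"] conjI)
    show "\<Union>(range (\<lambda>n::nat. ball 0 (real n))) = space \<mu>"
      using reals_Archimedean2 by auto
  qed (use ball_finite in \<open>auto simp: sets_mu less_top\<close>)
qed

lemma doubling_pow: "0 < r \<Longrightarrow> emeasure \<mu> (ball x (2 ^ k * r)) \<le> ennreal (D ^ k) * emeasure \<mu> (ball x r)"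
proof (induction k)
  case (Suc k)
  have "emeasure \<mu> (ball x (2 ^ Suc k * r)) = emeasure \<mu> (ball x (2 * (2 ^ k * r)))" by (simp add: mult.assoc)
  also have "\<dots> \<le> ennreal D * emeasure \<mu> (ball x (2 ^ k * r))" using Suc.prems by (intro doubling) auto
  also have "\<dots> \<le> ennreal D * (ennreal (D ^ k) * emeasure \<mu> (ball x r))" by (intro mult_left_mono Suc) auto
  also have "\<dots> = ennreal (D ^ Suc k) * emeasure \<mu> (ball x r)"
    using D_ge by (simp add: ennreal_mult mult.assoc)
  finally show ?case .
qed simp

section \<open>The uncentred maximal function: weak and strong type\<close>

definition avg :: "('a \<Rightarrow> ennreal) \<Rightarrow> 'a \<Rightarrow> real \<Rightarrow> ennreal" where
  "avg h z r = (\<integral>\<^sup>+y\<in>ball z r. h y \<partial>\<mu>) / emeasure \<mu> (ball z r)"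

text \<open>Uncentred, over all open balls containing x: the superlevel sets are then unions of
  balls, hence open, so measurability is immediate for any h.\<close>

definition maximal :: "('a \<Rightarrow> ennreal) \<Rightarrow> 'a \<Rightarrow> ennreal" where
  "maximal h x = (SUP p\<in>{p. 0 < snd p \<and> x \<in> ball (fst p) (snd p)}. avg h (fst p) (snd p))"

lemma avg_mult: "0 < r \<Longrightarrow> avg h z r * emeasure \<mu> (ball z r) = (\<integral>\<^sup>+y\<in>ball z r. h y \<partial>\<mu>)"
  unfolding avg_def ennreal_divide_times using ball_finite[of z r] ball_pos[of r z]
  by (simp add: ennreal_divide_self less_top)

lemma less_avgD:
  assumes "0 < r" "s < avg h z r" shows "s * emeasure \<mu> (ball z r) \<le> (\<integral>\<^sup>+y\<in>ball z r. h y \<partial>\<mu>)"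
  unfolding avg_mult[OF assms(1), symmetric] using assms(2) by (intro mult_right_mono) auto

lemma avg_le_maximal: "x \<in> ball z r \<Longrightarrow> 0 < r \<Longrightarrow> avg h z r \<le> maximal h x"
  unfolding maximal_def by (rule SUP_upper2[of "(z, r)"]) auto

lemma less_maximal_iff: "s < maximal h x \<longleftrightarrow> (\<exists>z r. 0 < r \<and> x \<in> ball z r \<and> s < avg h z r)"
  unfolding maximal_def by (auto simp: less_SUP_iff)

lemma open_maximal: "open {x. s < maximal h x}"
proof -
  have "{x. s < maximal h x} = (\<Union>p\<in>{p. 0 < snd p \<and> s < avg h (fst p) (snd p)}. ball (fst p) (snd p))"
    by (auto simp: less_maximal_iff; blast)
  then show ?thesis by auto
qed

lemma maximal_measurable [measurable]: "maximal h \<in> borel_measurable borel"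
  by (rule borel_measurableI_greater) (simp add: open_maximal)

text \<open>Vitali's covering lemma needs bounded radii, so balls of radius at most R are treated
  first and R then tends to infinity. The selected disjoint balls are dilated by 5, which is below
  2^3, whence D^3.\<close>

lemma weak_type:
  assumes [measurable]: "h \<in> borel_measurable borel" and s: "0 < s"
  shows "emeasure \<mu> {x. ennreal s < maximal h x} \<le> ennreal (D ^ 3 / s) * (\<integral>\<^sup>+x. h x \<partial>\<mu>)"
proof -
  define K where "K R = {p :: 'a \<times> real. 0 < snd p \<and> snd p \<le> R \<and> ennreal s < avg h (fst p) (snd p)}" for R
  define E where "E R = (\<Union>p\<in>K R. ball (fst p) (snd p))" for R
  have E_meas: "E R \<in> sets \<mu>" for R
    unfolding E_def sets_mu by (rule borel_open) auto
  have bound: "emeasure \<mu> (E R) \<le> ennreal (D ^ 3 / s) * (\<integral>\<^sup>+x. h x \<partial>\<mu>)" for R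
  proof -
    obtain C where C: "countable C" "C \<subseteq> K R"
      "pairwise (\<lambda>i j. disjnt (ball (fst i) (snd i)) (ball (fst j) (snd j))) C"
      "E R \<subseteq> (\<Union>i\<in>C. ball (fst i) (5 * snd i))"
      using Vitali_covering_lemma_balls[where S = "E R" and K = "K R" and a = fst and r = snd and B = R]
      unfolding E_def K_def by (metis (no_types, lifting) mem_Collect_eq order_refl)
    \<comment> \<open>The selected balls, dilated by c and numbered by all naturals with empty sets
      as padding, so that countable additivity applies to sequences.\<close>
    define B where "B c n = (if n \<in> to_nat_on C ` C then ball (fst (from_nat_into C n)) (c * snd (from_nat_into C n)) else {})"
      for c :: real and n
    have inC: "from_nat_into C n \<in> C" if "n \<in> to_nat_on C ` C" for n
      using that C(1) by auto
    have B_meas: "range (B c) \<subseteq> sets \<mu>" for c by (auto simp: B_def sets_mu)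
    have disj: "disjoint_family (B 1)"
      unfolding disjoint_family_on_def
    proof (intro ballI impI)
      fix m n :: nat assume "m \<noteq> n"
      show "B 1 m \<inter> B 1 n = {}"
      proof (cases "m \<in> to_nat_on C ` C \<and> n \<in> to_nat_on C ` C")
        case True
        then have "from_nat_into C m \<noteq> from_nat_into C n"
          using \<open>m \<noteq> n\<close> C(1) by auto
        then have "disjnt (ball (fst (from_nat_into C m)) (snd (from_nat_into C m)))
            (ball (fst (from_nat_into C n)) (snd (from_nat_into C n)))"
          using pairwiseD[OF C(3)] inC True by blast
        then show ?thesis using True by (simp add: B_def disjnt_def)
      qed (auto simp: B_def)
    qed
    have cover: "E R \<subseteq> (\<Union>n. B 5 n)"
    proof
      fix x assume "x \<in> E R"
      then obtain i where i: "i \<in> C" "x \<in> ball (fst i) (5 * snd i)" using C(4) by blast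
      then have "x \<in> B 5 (to_nat_on C i)" using C(1) by (simp add: B_def)
      then show "x \<in> (\<Union>n. B 5 n)" by blast
    qed
    have each: "emeasure \<mu> (B 5 n) \<le> ennreal (D ^ 3 / s) * emeasure (density \<mu> h) (B 1 n)" for n
    proof (cases "n \<in> to_nat_on C ` C")
      case True
      define z where "z = fst (from_nat_into C n)"
      define r where "r = snd (from_nat_into C n)"
      have zr: "0 < r" "ennreal s < avg h z r"
        using inC[OF True] C(2) by (auto simp: K_def z_def r_def)
      have "emeasure \<mu> (ball z (5 * r)) \<le> emeasure \<mu> (ball z (2 ^ 3 * r))"
        using zr by (intro emeasure_mono) (auto simp: sets_mu)
      also have "\<dots> \<le> ennreal (D ^ 3) * emeasure \<mu> (ball z r)" by (rule doubling_pow[OF zr(1)])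
      also have "\<dots> = ennreal (D ^ 3 / s) * (ennreal s * emeasure \<mu> (ball z r))"
        using s D_ge by (simp add: mult.assoc[symmetric] flip: ennreal_mult)
      also have "\<dots> \<le> ennreal (D ^ 3 / s) * (\<integral>\<^sup>+y\<in>ball z r. h y \<partial>\<mu>)"
        by (intro mult_left_mono less_avgD zr) auto
      also have "(\<integral>\<^sup>+y\<in>ball z r. h y \<partial>\<mu>) = emeasure (density \<mu> h) (ball z r)"
        by (subst emeasure_density) (auto simp: sets_mu)
      finally show ?thesis using True by (simp add: B_def z_def r_def)
    qed (simp add: B_def)
    have "emeasure \<mu> (E R) \<le> emeasure \<mu> (\<Union>n. B 5 n)"
      using cover B_meas by (intro emeasure_mono sets.countable_UN) auto
    also have "\<dots> \<le> (\<Sum>n. emeasure \<mu> (B 5 n))"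
      by (rule emeasure_subadditive_countably[OF B_meas])
    also have "\<dots> \<le> (\<Sum>n. ennreal (D ^ 3 / s) * emeasure (density \<mu> h) (B 1 n))"
      by (intro suminf_le each) auto
    also have "\<dots> = ennreal (D ^ 3 / s) * (\<Sum>n. emeasure (density \<mu> h) (B 1 n))" by simp
    also have "(\<Sum>n. emeasure (density \<mu> h) (B 1 n)) = emeasure (density \<mu> h) (\<Union>n. B 1 n)"
      using B_meas disj by (intro suminf_emeasure) auto
    also have "\<dots> \<le> emeasure (density \<mu> h) (space (density \<mu> h))"
      by (rule emeasure_space)
    also have "\<dots> = (\<integral>\<^sup>+x. h x \<partial>\<mu>)"
      by (subst emeasure_density) (auto simp: sets_mu)
    finally show ?thesis by (auto simp: mult_left_mono)
  qed
  have "{x. ennreal s < maximal h x} = (\<Union>n::nat. E (real n))"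
  proof (intro set_eqI iffI)
    fix x assume "x \<in> {x. ennreal s < maximal h x}"
    then obtain z r where zr: "0 < r" "x \<in> ball z r" "ennreal s < avg h z r"
      by (auto simp: less_maximal_iff)
    obtain n :: nat where "r \<le> real n" using real_arch_simple by blast
    then have "(z, r) \<in> K (real n)" using zr by (simp add: K_def)
    then have "x \<in> E (real n)" unfolding E_def using zr by (intro UN_I[of "(z, r)"]) auto
    then show "x \<in> (\<Union>n::nat. E (real n))" by blast
  next
    fix x assume "x \<in> (\<Union>n::nat. E (real n))"
    then show "x \<in> {x. ennreal s < maximal h x}"
      by (auto simp: E_def K_def less_maximal_iff)
  qed
  moreover have "emeasure \<mu> (\<Union>n::nat. E (real n)) = (SUP n. emeasure \<mu> (E (real n)))"
  proof (rule SUP_emeasure_incseq[symmetric])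
    show "range (\<lambda>n::nat. E (real n)) \<subseteq> sets \<mu>" using E_meas by auto
    show "incseq (\<lambda>n::nat. E (real n))"
      unfolding incseq_def E_def K_def by force
  qed
  ultimately show ?thesis using bound by (auto intro!: SUP_least)
qed

text \<open>Interpolation between weak type 1 and the trivial bound for bounded functions: at level
  s only the part of h above s/2 matters, and integrating the weak bound over s gives p / (p -
  1).\<close>

lemma strong_type:
  assumes [measurable]: "h \<in> borel_measurable borel" and p: "1 < p"
  shows "(\<integral>\<^sup>+x. ennreal_powr (maximal h x) p \<partial>\<mu>)
    \<le> ennreal (2 * D ^ 3 * (p / (p - 1)) * 2 powr (p - 1)) * (\<integral>\<^sup>+x. ennreal_powr (h x) p \<partial>\<mu>)"
proof -
  interpret P: pair_sigma_finite lborel \<mu>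
    by (intro pair_sigma_finite.intro lborel.sigma_finite_measure_axioms sigma_finite_measure_axioms)
  have level: "emeasure \<mu> {x. ennreal s < maximal h x}
      \<le> ennreal (2 * D ^ 3 / s) * (\<integral>\<^sup>+x. (if ennreal s < 2 * h x then h x else 0) \<partial>\<mu>)" if s: "0 < s" for s
  proof -
    \<comment> \<open>What is cut away is at most s/2 and so contributes at most s/2 to any average;
      an average of h above s forces one of k above s/2.\<close>
    define k where "k x = (if ennreal s < 2 * h x then h x else 0)" for x
    have [measurable]: "k \<in> borel_measurable borel" unfolding k_def by measurable
    have hk: "h x \<le> k x + ennreal (s / 2)" for x
    proof (cases "ennreal s < 2 * h x")
      case False
      then have "2 * h x \<le> 2 * ennreal (s / 2)"
        using s by (simp add: not_less ennreal_mult[symmetric] flip: ennreal_numeral)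
      then have "h x \<le> ennreal (s / 2)"
        by (subst (asm) ennreal_mult_le_mult_iff) auto
      then show ?thesis by (simp add: add_increasing)
    qed (simp add: k_def)
    have sub: "{x. ennreal s < maximal h x} \<subseteq> {x. ennreal (s / 2) < maximal k x}"
    proof
      fix x assume "x \<in> {x. ennreal s < maximal h x}"
      then obtain z r where zr: "0 < r" "x \<in> ball z r" "ennreal s < avg h z r"
        by (auto simp: less_maximal_iff)
      let ?m = "emeasure \<mu> (ball z r)"
      have m: "0 < ?m" "?m < top" using ball_pos[OF zr(1)] ball_finite by auto
      have "(\<integral>\<^sup>+y\<in>ball z r. h y \<partial>\<mu>) \<le> (\<integral>\<^sup>+y. (k y + ennreal (s / 2)) * indicator (ball z r) y \<partial>\<mu>)"
        by (intro nn_integral_mono mult_right_mono hk) auto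
      also have "\<dots> = (\<integral>\<^sup>+y\<in>ball z r. k y \<partial>\<mu>) + ennreal (s / 2) * ?m"
      proof -
        have [measurable]: "ball z r \<in> sets \<mu>" by (simp add: sets_mu)
        have "(\<integral>\<^sup>+y. (k y + ennreal (s / 2)) * indicator (ball z r) y \<partial>\<mu>) =
            (\<integral>\<^sup>+y. k y * indicator (ball z r) y + ennreal (s / 2) * indicator (ball z r) y \<partial>\<mu>)"
          by (simp only: distrib_right)
        also have "\<dots> = (\<integral>\<^sup>+y\<in>ball z r. k y \<partial>\<mu>) + (\<integral>\<^sup>+y. ennreal (s / 2) * indicator (ball z r) y \<partial>\<mu>)"
          by (rule nn_integral_add) measurable
        finally show ?thesis by (simp add: nn_integral_cmult_indicator)
      qed
      finally have "avg h z r \<le> ((\<integral>\<^sup>+y\<in>ball z r. k y \<partial>\<mu>) + ennreal (s / 2) * ?m) / ?m"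
        unfolding avg_def by (rule divide_right_mono_ennreal)
      also have "\<dots> = avg k z r + ennreal (s / 2)"
        unfolding avg_def using m by (simp add: add_divide_distrib_ennreal ennreal_mult_divide_eq less_top)
      finally have "ennreal (s / 2) + ennreal (s / 2) < avg k z r + ennreal (s / 2)"
        using zr(3) s by (simp flip: ennreal_plus)
      then have "ennreal (s / 2) < avg k z r" by (simp add: ennreal_add_left_cancel_less add.commute)
      then show "x \<in> {x. ennreal (s / 2) < maximal k x}" using zr by (auto simp: less_maximal_iff)
    qed
    have "emeasure \<mu> {x. ennreal s < maximal h x} \<le> emeasure \<mu> {x. ennreal (s / 2) < maximal k x}"
      by (rule emeasure_mono[OF sub]) (simp add: sets_mu open_maximal)
    also have "\<dots> \<le> ennreal (D ^ 3 / (s / 2)) * (\<integral>\<^sup>+x. k x \<partial>\<mu>)"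
      using s by (intro weak_type) auto
    finally show ?thesis by (simp add: k_def mult.commute)
  qed
  have "(\<integral>\<^sup>+x. ennreal_powr (maximal h x) p \<partial>\<mu>) =
     (\<integral>\<^sup>+s. (if 0 < s then ennreal (p * s powr (p - 1)) * emeasure \<mu> {x. ennreal s < maximal h x} else 0) \<partial>lborel)"
    using p by (subst nn_integral_powr_layer_cake) (auto cong: if_cong)
  also have "\<dots> \<le> (\<integral>\<^sup>+s. (\<integral>\<^sup>+x. (if 0 < s \<and> ennreal s < 2 * h x then ennreal (2 * D ^ 3 * p * s powr (p - 2)) * h x else 0) \<partial>\<mu>) \<partial>lborel)"
  proof (rule nn_integral_mono)
    fix s :: real
    show "(if 0 < s then ennreal (p * s powr (p - 1)) * emeasure \<mu> {x. ennreal s < maximal h x} else 0) \<le>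
       (\<integral>\<^sup>+x. (if 0 < s \<and> ennreal s < 2 * h x then ennreal (2 * D ^ 3 * p * s powr (p - 2)) * h x else 0) \<partial>\<mu>)"
    proof (cases "0 < s")
      case True
      have "ennreal (p * s powr (p - 1)) * emeasure \<mu> {x. ennreal s < maximal h x} \<le>
          ennreal (p * s powr (p - 1)) * (ennreal (2 * D ^ 3 / s) * (\<integral>\<^sup>+x. (if ennreal s < 2 * h x then h x else 0) \<partial>\<mu>))"
        by (intro mult_left_mono level True) auto
      also have "\<dots> = ennreal (p * s powr (p - 1) * (2 * D ^ 3 / s)) * (\<integral>\<^sup>+x. (if ennreal s < 2 * h x then h x else 0) \<partial>\<mu>)"
      proof -
        have "ennreal (p * s powr (p - 1) * (2 * D ^ 3 / s)) = ennreal (p * s powr (p - 1)) * ennreal (2 * D ^ 3 / s)"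
          using True p D_ge by (intro ennreal_mult) auto
        then show ?thesis by (simp only: mult.assoc)
      qed
      also have "p * s powr (p - 1) * (2 * D ^ 3 / s) = 2 * D ^ 3 * p * s powr (p - 2)"
        using True by (simp add: powr_diff power2_eq_square)
      also have "ennreal (2 * D ^ 3 * p * s powr (p - 2)) * (\<integral>\<^sup>+x. (if ennreal s < 2 * h x then h x else 0) \<partial>\<mu>)
          = (\<integral>\<^sup>+x. ennreal (2 * D ^ 3 * p * s powr (p - 2)) * (if ennreal s < 2 * h x then h x else 0) \<partial>\<mu>)"
        by (rule nn_integral_cmult[symmetric]) measurable
      also have "\<dots> = (\<integral>\<^sup>+x. (if 0 < s \<and> ennreal s < 2 * h x then ennreal (2 * D ^ 3 * p * s powr (p - 2)) * h x else 0) \<partial>\<mu>)"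
        using True by (intro nn_integral_cong) auto
      finally show ?thesis using True by simp
    qed simp
  qed
  also have "\<dots> = (\<integral>\<^sup>+x. (\<integral>\<^sup>+s. (if 0 < s \<and> ennreal s < 2 * h x then ennreal (2 * D ^ 3 * p * s powr (p - 2)) * h x else 0) \<partial>lborel) \<partial>\<mu>)"
    by (rule P.Fubini'[symmetric]) measurable
  also have "\<dots> = (\<integral>\<^sup>+x. ennreal (2 * D ^ 3 * (p / (p - 1)) * 2 powr (p - 1)) * ennreal_powr (h x) p \<partial>\<mu>)"
  proof (rule nn_integral_cong)
    fix x
    let ?c = "2 * D ^ 3 * (p / (p - 1))"
    have c: "0 \<le> ?c" using p D_ge by simp
    have "(\<integral>\<^sup>+s. (if 0 < s \<and> ennreal s < 2 * h x then ennreal (2 * D ^ 3 * p * s powr (p - 2)) * h x else 0) \<partial>lborel)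
       = (\<integral>\<^sup>+s. (ennreal ?c * h x) * (if 0 < s \<and> ennreal s < 2 * h x then ennreal ((p - 1) * s powr (p - 1 - 1)) else 0) \<partial>lborel)"
    proof (rule nn_integral_cong)
      fix s :: real
      have "2 * D ^ 3 * p * s powr (p - 2) = ?c * ((p - 1) * s powr (p - 1 - 1))" using p by simp
      then have "ennreal (2 * D ^ 3 * p * s powr (p - 2)) = ennreal ?c * ennreal ((p - 1) * s powr (p - 1 - 1))"
        using c p by (simp only: ennreal_mult mult_nonneg_nonneg powr_ge_zero)
      then show "(if 0 < s \<and> ennreal s < 2 * h x then ennreal (2 * D ^ 3 * p * s powr (p - 2)) * h x else 0) =
         (ennreal ?c * h x) * (if 0 < s \<and> ennreal s < 2 * h x then ennreal ((p - 1) * s powr (p - 1 - 1)) else 0)"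
        by (simp add: mult_ac)
    qed
    also have "\<dots> = (ennreal ?c * h x) * ennreal_powr (2 * h x) (p - 1)"
      using p by (subst nn_integral_cmult) (auto simp: nn_integral_powr_layer)
    also have "ennreal_powr (2 * h x) (p - 1) = ennreal (2 powr (p - 1)) * ennreal_powr (h x) (p - 1)"
      using ennreal_powr_cmult[of 2 "h x" "p - 1"] by simp
    also have "(ennreal ?c * h x) * (ennreal (2 powr (p - 1)) * ennreal_powr (h x) (p - 1)) =
        ennreal (?c * 2 powr (p - 1)) * (h x * ennreal_powr (h x) (p - 1))"
    proof -
      have "ennreal (?c * 2 powr (p - 1)) = ennreal ?c * ennreal (2 powr (p - 1))"
        using c by (intro ennreal_mult) auto
      then show ?thesis by (simp only: mult_ac)
    qed
    also have "h x * ennreal_powr (h x) (p - 1) = ennreal_powr (h x) p"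
      using ennreal_powr_mult_self[of "p - 1" "h x"] p by simp
    finally show "(\<integral>\<^sup>+s. (if 0 < s \<and> ennreal s < 2 * h x then ennreal (2 * D ^ 3 * p * s powr (p - 2)) * h x else 0) \<partial>lborel)
       = ennreal (?c * 2 powr (p - 1)) * ennreal_powr (h x) p" .
  qed
  also have "\<dots> = ennreal (2 * D ^ 3 * (p / (p - 1)) * 2 powr (p - 1)) * (\<integral>\<^sup>+x. ennreal_powr (h x) p \<partial>\<mu>)"
    by (rule nn_integral_cmult) measurable
  finally show ?thesis .
qed

lemma dilation:
  assumes "0 < t" "a \<le> 2 ^ n" shows "emeasure \<mu> (ball y (a * t)) \<le> ennreal (D ^ n) * emeasure \<mu> (ball y t)"
proof -
  have "emeasure \<mu> (ball y (a * t)) \<le> emeasure \<mu> (ball y (2 ^ n * t))"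
    using assms by (intro emeasure_mono subset_ball mult_right_mono) (auto simp: sets_mu)
  also have "\<dots> \<le> ennreal (D ^ n) * emeasure \<mu> (ball y t)" by (rule doubling_pow[OF assms(1)])
  finally show ?thesis .
qed

end

section \<open>Change of aperture\<close>

text \<open>Measurability of g is asked in space for each fixed time, and jointly only for integrals
  over balls: this is what survives when a representative is chosen separately for each t.\<close>

locale tent = doubling_measure \<mu> D for \<mu> :: "'a::euclidean_space measure" and D +
  fixes g :: "real \<Rightarrow> 'a \<Rightarrow> ennreal"
  assumes g_meas [measurable]: "g t \<in> borel_measurable borel"
    and cone_meas: "0 < a \<Longrightarrow> (\<lambda>p. \<integral>\<^sup>+y\<in>ball (snd p) (a * fst p). g (fst p) y \<partial>lborel) \<in> borel_measurable (borel \<Otimes>\<^sub>M borel)"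
begin

definition J :: "real \<Rightarrow> real \<Rightarrow> 'a \<Rightarrow> ennreal" where
  "J a t x = (\<integral>\<^sup>+y\<in>ball x (a * t). g t y \<partial>lborel)"

text \<open>The square of a conical square function of aperture a, with the power of t contained in
  g; hence an L^p norm corresponds to the exponent q = p/2.\<close>

definition N :: "real \<Rightarrow> 'a \<Rightarrow> ennreal" where
  "N a x = (\<integral>\<^sup>+t\<in>{0<..}. J a t x \<partial>lborel)"

lemma J_meas:
  assumes "0 < a" "f \<in> borel_measurable K" "k \<in> borel_measurable K"
  shows "(\<lambda>z. J a (f z) (k z)) \<in> borel_measurable K"
  using measurable_compose[OF measurable_Pair[OF assms(2,3)] cone_meas[OF assms(1)]] by (simp add: J_def)

lemma N_meas: "0 < a \<Longrightarrow> N a \<in> borel_measurable borel"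
proof -
  assume a: "0 < a"
  have [measurable]: "(\<lambda>p. J a (snd p) (fst p)) \<in> borel_measurable (borel \<Otimes>\<^sub>M lborel)"
    by (rule J_meas[OF a]) measurable
  show ?thesis unfolding N_def by measurable
qed

text \<open>Fubini in two stages, since g is not jointly measurable: first x and t are exchanged for
  the ball integral J, then x and y at fixed t.\<close>

lemma nn_integral_mult_N:
  assumes [measurable]: "h \<in> borel_measurable borel" and a: "0 < a"
  shows "(\<integral>\<^sup>+x. h x * N a x \<partial>\<mu>) =
    (\<integral>\<^sup>+t. (\<integral>\<^sup>+y. g t y * (\<integral>\<^sup>+x\<in>ball y (a * t). h x \<partial>\<mu>) \<partial>lborel) * indicator {0<..} t \<partial>lborel)"
proof -
  interpret P: pair_sigma_finite lborel \<mu>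
    by (intro pair_sigma_finite.intro lborel.sigma_finite_measure_axioms sigma_finite_measure_axioms)
  interpret Q: pair_sigma_finite \<mu> "lborel :: 'a measure"
    by (intro pair_sigma_finite.intro lborel.sigma_finite_measure_axioms sigma_finite_measure_axioms)
  have [measurable]: "(\<lambda>p. J a (fst p) (snd p)) \<in> borel_measurable (lborel \<Otimes>\<^sub>M \<mu>)"
    by (rule J_meas[OF a]) measurable
  have [measurable]: "(\<lambda>t. J a t x) \<in> borel_measurable lborel" for x
    by (rule J_meas[OF a]) measurable
  have "(\<integral>\<^sup>+x. h x * N a x \<partial>\<mu>) = (\<integral>\<^sup>+x. (\<integral>\<^sup>+t. h x * (J a t x * indicator {0<..} t) \<partial>lborel) \<partial>\<mu>)"
    unfolding N_def by (intro nn_integral_cong nn_integral_cmult[symmetric]) measurable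
  also have "\<dots> = (\<integral>\<^sup>+t. (\<integral>\<^sup>+x. h x * (J a t x * indicator {0<..} t) \<partial>\<mu>) \<partial>lborel)"
    by (rule P.Fubini') measurable
  also have "\<dots> = (\<integral>\<^sup>+t. (\<integral>\<^sup>+y. g t y * (\<integral>\<^sup>+x\<in>ball y (a * t). h x \<partial>\<mu>) \<partial>lborel) * indicator {0<..} t \<partial>lborel)"
  proof (rule nn_integral_cong)
    fix t :: real
    have [measurable]: "(\<lambda>x. J a t x) \<in> borel_measurable \<mu>" by (rule J_meas[OF a]) measurable
    have "(\<integral>\<^sup>+x. h x * (J a t x * indicator {0<..} t) \<partial>\<mu>) = (\<integral>\<^sup>+x. (h x * J a t x) * indicator {0<..} t \<partial>\<mu>)"
      by (simp add: mult.assoc)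
    also have "\<dots> = (\<integral>\<^sup>+x. h x * J a t x \<partial>\<mu>) * indicator {0<..} t"
      by (rule nn_integral_multc) measurable
    also have "(\<integral>\<^sup>+x. h x * J a t x \<partial>\<mu>) = (\<integral>\<^sup>+x. (\<integral>\<^sup>+y. h x * (g t y * (if dist x y < a * t then 1 else 0)) \<partial>lborel) \<partial>\<mu>)"
    proof (rule nn_integral_cong)
      fix x
      have "J a t x = (\<integral>\<^sup>+y. g t y * (if dist x y < a * t then 1 else 0) \<partial>lborel)"
        unfolding J_def by (intro nn_integral_cong) (auto simp: indicator_def)
      also have "h x * \<dots> = (\<integral>\<^sup>+y. h x * (g t y * (if dist x y < a * t then 1 else 0)) \<partial>lborel)"
        by (rule nn_integral_cmult[symmetric]) measurable
      finally show "h x * J a t x = (\<integral>\<^sup>+y. h x * (g t y * (if dist x y < a * t then 1 else 0)) \<partial>lborel)" .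
    qed
    also have "\<dots> = (\<integral>\<^sup>+y. (\<integral>\<^sup>+x. h x * (g t y * (if dist x y < a * t then 1 else 0)) \<partial>\<mu>) \<partial>lborel)"
      by (rule Q.Fubini'[symmetric]) measurable
    also have "\<dots> = (\<integral>\<^sup>+y. g t y * (\<integral>\<^sup>+x\<in>ball y (a * t). h x \<partial>\<mu>) \<partial>lborel)"
    proof (rule nn_integral_cong)
      fix y
      have "(\<integral>\<^sup>+x. h x * (g t y * (if dist x y < a * t then 1 else 0)) \<partial>\<mu>) =
          (\<integral>\<^sup>+x. g t y * (h x * indicator (ball y (a * t)) x) \<partial>\<mu>)"
        by (intro nn_integral_cong) (auto simp: indicator_def dist_commute mult_ac)
      also have "\<dots> = g t y * (\<integral>\<^sup>+x\<in>ball y (a * t). h x \<partial>\<mu>)"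
      proof (rule nn_integral_cmult)
        have [measurable]: "ball y (a * t) \<in> sets \<mu>" by (simp add: sets_mu)
        show "(\<lambda>x. h x * indicator (ball y (a * t)) x) \<in> borel_measurable \<mu>" by measurable
      qed
      finally show "(\<integral>\<^sup>+x. h x * (g t y * (if dist x y < a * t then 1 else 0)) \<partial>\<mu>) = g t y * (\<integral>\<^sup>+x\<in>ball y (a * t). h x \<partial>\<mu>)" .
    qed
    finally show "(\<integral>\<^sup>+x. h x * (J a t x * indicator {0<..} t) \<partial>\<mu>) =
       (\<integral>\<^sup>+y. g t y * (\<integral>\<^sup>+x\<in>ball y (a * t). h x \<partial>\<mu>) \<partial>lborel) * indicator {0<..} t" .
  qed
  finally show ?thesis .
qed

text \<open>After Fubini the aperture appears only in the balls over which the weights h and k are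
  integrated, so apertures are compared separately at each (y, t), with g as a common
  factor.\<close>

lemma compare:
  assumes h: "h \<in> borel_measurable borel" and k: "k \<in> borel_measurable borel" and a: "0 < a"
    and le: "\<And>y t. 0 < t \<Longrightarrow> (\<integral>\<^sup>+x\<in>ball y (a * t). h x \<partial>\<mu>) \<le> (\<integral>\<^sup>+x\<in>ball y t. k x \<partial>\<mu>)"
  shows "(\<integral>\<^sup>+x. h x * N a x \<partial>\<mu>) \<le> (\<integral>\<^sup>+x. k x * N 1 x \<partial>\<mu>)"
  unfolding nn_integral_mult_N[OF h a] nn_integral_mult_N[OF k zero_less_one]
proof (rule nn_integral_mono)
  fix t :: real
  show "(\<integral>\<^sup>+y. g t y * (\<integral>\<^sup>+x\<in>ball y (a * t). h x \<partial>\<mu>) \<partial>lborel) * indicator {0<..} t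
    \<le> (\<integral>\<^sup>+y. g t y * (\<integral>\<^sup>+x\<in>ball y (1 * t). k x \<partial>\<mu>) \<partial>lborel) * indicator {0<..} t"
  proof (cases "0 < t")
    case True
    have "(\<integral>\<^sup>+y. g t y * (\<integral>\<^sup>+x\<in>ball y (a * t). h x \<partial>\<mu>) \<partial>lborel)
      \<le> (\<integral>\<^sup>+y. g t y * (\<integral>\<^sup>+x\<in>ball y (1 * t). k x \<partial>\<mu>) \<partial>lborel)"
      by (rule nn_integral_mono, rule mult_left_mono) (simp_all add: le[OF True])
    then show ?thesis using True by simp
  qed simp
qed

lemma change_of_aperture_1:
  assumes a: "1 \<le> a" "a \<le> 2 ^ n"
  shows "(\<integral>\<^sup>+x. N a x \<partial>\<mu>) \<le> ennreal (D ^ n) * (\<integral>\<^sup>+x. N 1 x \<partial>\<mu>)"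
proof -
  have [measurable]: "N 1 \<in> borel_measurable borel" by (rule N_meas) simp
  have "(\<integral>\<^sup>+x. 1 * N a x \<partial>\<mu>) \<le> (\<integral>\<^sup>+x. ennreal (D ^ n) * N 1 x \<partial>\<mu>)"
  proof (rule compare)
    fix y :: 'a and t :: real assume t: "0 < t"
    show "(\<integral>\<^sup>+x\<in>ball y (a * t). 1 \<partial>\<mu>) \<le> (\<integral>\<^sup>+x\<in>ball y t. ennreal (D ^ n) \<partial>\<mu>)"
      using dilation[OF t a(2), of y] by (simp add: nn_integral_cmult_indicator sets_mu)
  qed (use a in auto)
  also have "\<dots> = ennreal (D ^ n) * (\<integral>\<^sup>+x. N 1 x \<partial>\<mu>)"
    by (rule nn_integral_cmult) measurable
  finally show ?thesis by simp
qed

text \<open>Good-\<open>\<lambda>\<close> argument: if \<open>ball y (a t)\<close> is not contained in the set where the maximal function of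
  the indicator of \<open>{N 1 > s}\<close> exceeds \<open>1 / (2 D\<^sup>n)\<close>, then at least half of \<open>ball y t\<close> lies outside
  \<open>{N 1 > s}\<close>.\<close>

lemma change_of_aperture_small:
  assumes a: "1 \<le> a" "a \<le> 2 ^ n" and q: "0 < q" "q < 1"
  shows "(\<integral>\<^sup>+x. ennreal_powr (N a x) q \<partial>\<mu>) \<le>
    ennreal (2 * D ^ (n + 3) + 2 * D ^ n * (q / (1 - q))) * (\<integral>\<^sup>+x. ennreal_powr (N 1 x) q \<partial>\<mu>)"
proof -
  have [measurable]: "N 1 \<in> borel_measurable borel" "N a \<in> borel_measurable borel"
    using a by (auto intro: N_meas)
  interpret P: pair_sigma_finite lborel \<mu>
    by (intro pair_sigma_finite.intro lborel.sigma_finite_measure_axioms sigma_finite_measure_axioms)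
  have Dn: "0 < D ^ n" "0 < D" using D_ge by auto
  have level: "emeasure \<mu> {x. ennreal s < N a x} \<le>
      ennreal (2 * D ^ (n + 3)) * emeasure \<mu> {x. ennreal s < N 1 x} +
      ennreal (2 * D ^ n / s) * (\<integral>\<^sup>+x. (if N 1 x \<le> ennreal s then N 1 x else 0) \<partial>\<mu>)" if s: "0 < s" for s
  proof -
    define O1 where "O1 = {x. ennreal s < N 1 x}"
    \<comment> \<open>c times the measure of the dilated ball is at most half the measure of the
      ball of radius t, by n doublings.\<close>
    define c where "c = 1 / (2 * D ^ n)"
    define O2 where "O2 = {x. ennreal c < maximal (indicator O1) x}"
    have c: "0 < c" using Dn by (simp add: c_def)
    have [measurable]: "O1 \<in> sets borel" unfolding O1_def by measurable
    have [measurable]: "O2 \<in> sets borel" unfolding O2_def using open_maximal by auto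
    have O2: "emeasure \<mu> O2 \<le> ennreal (2 * D ^ (n + 3)) * emeasure \<mu> O1"
    proof -
      have "emeasure \<mu> O2 \<le> ennreal (D ^ 3 / c) * (\<integral>\<^sup>+x. indicator O1 x \<partial>\<mu>)"
        unfolding O2_def using c by (intro weak_type) auto
      then show ?thesis by (simp add: c_def power_add mult_ac sets_mu)
    qed
    have "(\<integral>\<^sup>+x. indicator (- O2) x * N a x \<partial>\<mu>) \<le> (\<integral>\<^sup>+x. (ennreal (2 * D ^ n) * indicator (- O1) x) * N 1 x \<partial>\<mu>)"
    proof (rule compare)
      fix y :: 'a and t :: real assume t: "0 < t"
      let ?B = "ball y (a * t)"
      have at: "0 < a * t" using a t by simp
      have rhs: "(\<integral>\<^sup>+x\<in>ball y t. ennreal (2 * D ^ n) * indicator (- O1) x \<partial>\<mu>) = ennreal (2 * D ^ n) * emeasure \<mu> (ball y t - O1)"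
      proof -
        have "(\<integral>\<^sup>+x\<in>ball y t. ennreal (2 * D ^ n) * indicator (- O1) x \<partial>\<mu>) =
            (\<integral>\<^sup>+x. ennreal (2 * D ^ n) * indicator (ball y t - O1) x \<partial>\<mu>)"
          by (intro nn_integral_cong) (auto simp: indicator_def)
        then show ?thesis by (simp add: nn_integral_cmult_indicator sets_mu)
      qed
      have lhs: "(\<integral>\<^sup>+x\<in>?B. indicator (- O2) x \<partial>\<mu>) = emeasure \<mu> (?B - O2)"
      proof -
        have "(\<integral>\<^sup>+x\<in>?B. indicator (- O2) x \<partial>\<mu>) = (\<integral>\<^sup>+x. indicator (?B - O2) x \<partial>\<mu>)"
          by (intro nn_integral_cong) (auto simp: indicator_def)
        then show ?thesis by (simp add: sets_mu)
      qed
      show "(\<integral>\<^sup>+x\<in>?B. indicator (- O2) x \<partial>\<mu>) \<le> (\<integral>\<^sup>+x\<in>ball y t. ennreal (2 * D ^ n) * indicator (- O1) x \<partial>\<mu>)"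
      proof (cases "?B \<subseteq> O2")
        case True
        then have e: "?B - O2 = {}" by auto
        show ?thesis unfolding lhs e by simp
      next
        case False
        then obtain x0 where x0: "x0 \<in> ?B" "x0 \<notin> O2" by blast
        have m: "emeasure \<mu> (ball y t) < top" using ball_finite by simp
        have "avg (indicator O1) y (a * t) \<le> ennreal c"
          using avg_le_maximal[OF x0(1) at, of "indicator O1"] x0(2) by (auto simp: O2_def not_less)
        then have "(\<integral>\<^sup>+x\<in>?B. indicator O1 x \<partial>\<mu>) \<le> ennreal c * emeasure \<mu> ?B"
          unfolding avg_mult[OF at, symmetric] by (intro mult_right_mono) auto
        also have "\<dots> \<le> ennreal c * (ennreal (D ^ n) * emeasure \<mu> (ball y t))"
          by (intro mult_left_mono dilation t a) auto
        also have "\<dots> = ennreal (1 / 2) * emeasure \<mu> (ball y t)"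
          using Dn c by (simp add: c_def mult.assoc[symmetric] flip: ennreal_mult)
        also have "(\<integral>\<^sup>+x\<in>?B. indicator O1 x \<partial>\<mu>) = emeasure \<mu> (?B \<inter> O1)"
        proof -
          have "(\<integral>\<^sup>+x\<in>?B. indicator O1 x \<partial>\<mu>) = (\<integral>\<^sup>+x. indicator (?B \<inter> O1) x \<partial>\<mu>)"
            by (intro nn_integral_cong) (auto simp: indicator_def)
          then show ?thesis by (simp add: sets_mu)
        qed
        finally have half: "emeasure \<mu> (?B \<inter> O1) \<le> ennreal (1 / 2) * emeasure \<mu> (ball y t)" .
        have sub: "ball y t \<subseteq> ?B" using a t by (intro subset_ball) simp
        have "emeasure \<mu> ((ball y t \<inter> O1) \<union> (ball y t - O1)) \<le> emeasure \<mu> (ball y t \<inter> O1) + emeasure \<mu> (ball y t - O1)"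
          by (rule emeasure_subadditive) (auto simp: sets_mu)
        moreover have "(ball y t \<inter> O1) \<union> (ball y t - O1) = ball y t" by blast
        ultimately have h1: "emeasure \<mu> (ball y t) \<le> emeasure \<mu> (ball y t \<inter> O1) + emeasure \<mu> (ball y t - O1)"
          by simp
        have "emeasure \<mu> (ball y t \<inter> O1) \<le> emeasure \<mu> (?B \<inter> O1)"
        proof (rule emeasure_mono)
          show "ball y t \<inter> O1 \<subseteq> ?B \<inter> O1" using sub by blast
        qed (simp add: sets_mu)
        from order_trans[OF this half]
        have *: "emeasure \<mu> (ball y t) \<le> ennreal (1 / 2) * emeasure \<mu> (ball y t) + emeasure \<mu> (ball y t - O1)"
          by (intro order_trans[OF h1] add_right_mono)
        \<comment> \<open>Subtracting the half needs finite measures, hence the passage to real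
          numbers.\<close>
        have **: "emeasure \<mu> (ball y t) \<le> ennreal 2 * emeasure \<mu> (ball y t - O1)"
        proof -
          define v where "v = enn2real (emeasure \<mu> (ball y t))"
          define w where "w = enn2real (emeasure \<mu> (ball y t - O1))"
          have "emeasure \<mu> (ball y t - O1) \<le> emeasure \<mu> (ball y t)"
            by (rule emeasure_mono) (auto simp: sets_mu)
          from order.strict_trans1[OF this m] have m': "emeasure \<mu> (ball y t - O1) < top" .
          have v: "emeasure \<mu> (ball y t) = ennreal v" "0 \<le> v"
            unfolding v_def using m by (simp_all only: ennreal_enn2real enn2real_nonneg)
          have w: "emeasure \<mu> (ball y t - O1) = ennreal w" "0 \<le> w"
            unfolding w_def using m' by (simp_all only: ennreal_enn2real enn2real_nonneg)
          have "ennreal (1 / 2 * v + w) = ennreal (1 / 2 * v) + ennreal w"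
            using v w by (intro ennreal_plus) auto
          also have "ennreal (1 / 2 * v) = ennreal (1 / 2) * ennreal v"
            using v by (intro ennreal_mult) auto
          finally have "ennreal v \<le> ennreal (1 / 2 * v + w)" using * by (simp only: v w)
          then have "v \<le> 1 / 2 * v + w" using v w by (subst (asm) ennreal_le_iff) auto
          then have "ennreal v \<le> ennreal (2 * w)" by (intro ennreal_leI) simp
          also have "\<dots> = ennreal 2 * ennreal w" using w by (intro ennreal_mult) auto
          finally show ?thesis by (simp only: v w)
        qed
        have "emeasure \<mu> (?B - O2) \<le> emeasure \<mu> ?B"
          by (intro emeasure_mono) (auto simp: sets_mu)
        also have "\<dots> \<le> ennreal (D ^ n) * emeasure \<mu> (ball y t)" by (intro dilation t a)
        also have "\<dots> \<le> ennreal (D ^ n) * (ennreal 2 * emeasure \<mu> (ball y t - O1))"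
          by (intro mult_left_mono **) auto
        also have "\<dots> = ennreal (2 * D ^ n) * emeasure \<mu> (ball y t - O1)"
        proof -
          have "ennreal (2 * D ^ n) = ennreal (D ^ n) * ennreal 2"
            using Dn by (subst mult.commute, intro ennreal_mult) auto
          then show ?thesis by (simp only: mult.assoc)
        qed
        finally show ?thesis unfolding lhs rhs .
      qed
    qed (use a in auto)
    also have "\<dots> = (\<integral>\<^sup>+x. ennreal (2 * D ^ n) * (if N 1 x \<le> ennreal s then N 1 x else 0) \<partial>\<mu>)"
      by (intro nn_integral_cong) (auto simp: O1_def indicator_def not_less)
    also have "\<dots> = ennreal (2 * D ^ n) * (\<integral>\<^sup>+x. (if N 1 x \<le> ennreal s then N 1 x else 0) \<partial>\<mu>)"
      by (rule nn_integral_cmult) measurable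
    finally have out: "(\<integral>\<^sup>+x. indicator (- O2) x * N a x \<partial>\<mu>) \<le>
        ennreal (2 * D ^ n) * (\<integral>\<^sup>+x. (if N 1 x \<le> ennreal s then N 1 x else 0) \<partial>\<mu>)" .
    have "ennreal s * emeasure \<mu> ({x. ennreal s < N a x} - O2) = (\<integral>\<^sup>+x. ennreal s * indicator ({x. ennreal s < N a x} - O2) x \<partial>\<mu>)"
      by (subst nn_integral_cmult_indicator) (auto simp: sets_mu)
    also have "\<dots> \<le> (\<integral>\<^sup>+x. indicator (- O2) x * N a x \<partial>\<mu>)"
      by (intro nn_integral_mono) (auto simp: indicator_def)
    also note out
    finally have "ennreal (1 / s) * (ennreal s * emeasure \<mu> ({x. ennreal s < N a x} - O2)) \<le>
        ennreal (1 / s) * (ennreal (2 * D ^ n) * (\<integral>\<^sup>+x. (if N 1 x \<le> ennreal s then N 1 x else 0) \<partial>\<mu>))"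
      by (intro mult_left_mono) auto
    then have diff: "emeasure \<mu> ({x. ennreal s < N a x} - O2) \<le>
        ennreal (2 * D ^ n / s) * (\<integral>\<^sup>+x. (if N 1 x \<le> ennreal s then N 1 x else 0) \<partial>\<mu>)"
      using s Dn by (simp add: mult.assoc[symmetric] ennreal_mult[symmetric])
    have "emeasure \<mu> {x. ennreal s < N a x} \<le> emeasure \<mu> (O2 \<union> ({x. ennreal s < N a x} - O2))"
      by (intro emeasure_mono) (auto simp: sets_mu)
    also have "\<dots> \<le> emeasure \<mu> O2 + emeasure \<mu> ({x. ennreal s < N a x} - O2)"
      by (rule emeasure_subadditive) (auto simp: sets_mu)
    also have "\<dots> \<le> ennreal (2 * D ^ (n + 3)) * emeasure \<mu> O1 +
        ennreal (2 * D ^ n / s) * (\<integral>\<^sup>+x. (if N 1 x \<le> ennreal s then N 1 x else 0) \<partial>\<mu>)"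
      by (intro add_mono O2 diff)
    finally show ?thesis by (simp add: O1_def)
  qed
  have "(\<integral>\<^sup>+x. ennreal_powr (N a x) q \<partial>\<mu>) =
     (\<integral>\<^sup>+s. (if 0 < s then ennreal (q * s powr (q - 1)) * emeasure \<mu> {x. ennreal s < N a x} else 0) \<partial>lborel)"
    using q by (subst nn_integral_powr_layer_cake) (auto cong: if_cong)
  also have "\<dots> \<le> (\<integral>\<^sup>+s. ennreal (2 * D ^ (n + 3)) * (if 0 < s then ennreal (q * s powr (q - 1)) * emeasure \<mu> {x. ennreal s < N 1 x} else 0) +
      ennreal (2 * D ^ n) * (\<integral>\<^sup>+x. N 1 x * (if 0 < s \<and> N 1 x \<le> ennreal s then ennreal (q * s powr (q - 2)) else 0) \<partial>\<mu>) \<partial>lborel)"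
  proof (rule nn_integral_mono)
    fix s :: real
    show "(if 0 < s then ennreal (q * s powr (q - 1)) * emeasure \<mu> {x. ennreal s < N a x} else 0) \<le>
      ennreal (2 * D ^ (n + 3)) * (if 0 < s then ennreal (q * s powr (q - 1)) * emeasure \<mu> {x. ennreal s < N 1 x} else 0) +
      ennreal (2 * D ^ n) * (\<integral>\<^sup>+x. N 1 x * (if 0 < s \<and> N 1 x \<le> ennreal s then ennreal (q * s powr (q - 2)) else 0) \<partial>\<mu>)"
    proof (cases "0 < s")
      case True
      let ?w = "ennreal (q * s powr (q - 1))"
      let ?I = "\<integral>\<^sup>+x. (if N 1 x \<le> ennreal s then N 1 x else 0) \<partial>\<mu>"
      have "?w * emeasure \<mu> {x. ennreal s < N a x} \<le>
        ?w * (ennreal (2 * D ^ (n + 3)) * emeasure \<mu> {x. ennreal s < N 1 x} + ennreal (2 * D ^ n / s) * ?I)"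
        by (intro mult_left_mono level True) auto
      also have "\<dots> = ennreal (2 * D ^ (n + 3)) * (?w * emeasure \<mu> {x. ennreal s < N 1 x}) + (?w * ennreal (2 * D ^ n / s)) * ?I"
        by (simp only: distrib_left mult_ac)
      also have "?w * ennreal (2 * D ^ n / s) = ennreal (2 * D ^ n) * ennreal (q * s powr (q - 2))"
      proof -
        have "?w * ennreal (2 * D ^ n / s) = ennreal (q * s powr (q - 1) * (2 * D ^ n / s))"
          using True q Dn by (intro ennreal_mult[symmetric]) auto
        also have "q * s powr (q - 1) * (2 * D ^ n / s) = 2 * D ^ n * (q * s powr (q - 2))"
          using True by (simp add: powr_diff power2_eq_square)
        also have "ennreal \<dots> = ennreal (2 * D ^ n) * ennreal (q * s powr (q - 2))"
          using q Dn by (intro ennreal_mult) auto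
        finally show ?thesis .
      qed
      also have "ennreal (2 * D ^ n) * ennreal (q * s powr (q - 2)) * ?I =
          ennreal (2 * D ^ n) * (\<integral>\<^sup>+x. ennreal (q * s powr (q - 2)) * (if N 1 x \<le> ennreal s then N 1 x else 0) \<partial>\<mu>)"
        by (subst nn_integral_cmult) (measurable, simp only: mult.assoc)
      also have "(\<integral>\<^sup>+x. ennreal (q * s powr (q - 2)) * (if N 1 x \<le> ennreal s then N 1 x else 0) \<partial>\<mu>) =
          (\<integral>\<^sup>+x. N 1 x * (if 0 < s \<and> N 1 x \<le> ennreal s then ennreal (q * s powr (q - 2)) else 0) \<partial>\<mu>)"
        using True by (intro nn_integral_cong) (auto simp: mult.commute)
      finally show ?thesis using True by simp
    qed simp
  qed
  also have "\<dots> = ennreal (2 * D ^ (n + 3)) * (\<integral>\<^sup>+s. (if 0 < s then ennreal (q * s powr (q - 1)) * emeasure \<mu> {x. ennreal s < N 1 x} else 0) \<partial>lborel) +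
      ennreal (2 * D ^ n) * (\<integral>\<^sup>+s. (\<integral>\<^sup>+x. N 1 x * (if 0 < s \<and> N 1 x \<le> ennreal s then ennreal (q * s powr (q - 2)) else 0) \<partial>\<mu>) \<partial>lborel)"
  proof -
    have [measurable]: "(\<lambda>s. emeasure \<mu> {x. ennreal s < N 1 x}) \<in> borel_measurable borel"
    proof -
      have "(\<lambda>s :: real. emeasure \<mu> {x. ennreal s < N 1 x}) = (\<lambda>s. \<integral>\<^sup>+x. (if ennreal s < N 1 x then 1 else 0) \<partial>\<mu>)"
      proof
        fix s :: real
        have "emeasure \<mu> {x. ennreal s < N 1 x} = (\<integral>\<^sup>+x. indicator {x. ennreal s < N 1 x} x \<partial>\<mu>)"
          by (rule nn_integral_indicator[symmetric]) (simp add: sets_mu)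
        then show "emeasure \<mu> {x. ennreal s < N 1 x} = (\<integral>\<^sup>+x. (if ennreal s < N 1 x then 1 else 0) \<partial>\<mu>)"
          by (simp add: indicator_def of_bool_def)
      qed
      then show ?thesis by simp
    qed
    define P where "P s = (if 0 < s then ennreal (q * s powr (q - 1)) * emeasure \<mu> {x. ennreal s < N 1 x} else 0)" for s
    define Q where "Q s = (\<integral>\<^sup>+x. N 1 x * (if 0 < s \<and> N 1 x \<le> ennreal s then ennreal (q * s powr (q - 2)) else 0) \<partial>\<mu>)" for s
    have [measurable]: "P \<in> borel_measurable borel" "Q \<in> borel_measurable borel"
      unfolding P_def Q_def by measurable
    have "(\<integral>\<^sup>+s. ennreal (2 * D ^ (n + 3)) * P s + ennreal (2 * D ^ n) * Q s \<partial>lborel) =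
        (\<integral>\<^sup>+s. ennreal (2 * D ^ (n + 3)) * P s \<partial>lborel) + (\<integral>\<^sup>+s. ennreal (2 * D ^ n) * Q s \<partial>lborel)"
      by (rule nn_integral_add) measurable
    also have "(\<integral>\<^sup>+s. ennreal (2 * D ^ (n + 3)) * P s \<partial>lborel) = ennreal (2 * D ^ (n + 3)) * (\<integral>\<^sup>+s. P s \<partial>lborel)"
      by (rule nn_integral_cmult) measurable
    also have "(\<integral>\<^sup>+s. ennreal (2 * D ^ n) * Q s \<partial>lborel) = ennreal (2 * D ^ n) * (\<integral>\<^sup>+s. Q s \<partial>lborel)"
      by (rule nn_integral_cmult) measurable
    finally show ?thesis unfolding P_def Q_def .
  qed
  also have "(\<integral>\<^sup>+s. (if 0 < s then ennreal (q * s powr (q - 1)) * emeasure \<mu> {x. ennreal s < N 1 x} else 0) \<partial>lborel) =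
     (\<integral>\<^sup>+x. ennreal_powr (N 1 x) q \<partial>\<mu>)"
    using q by (subst nn_integral_powr_layer_cake) (auto cong: if_cong)
  also have "(\<integral>\<^sup>+s. (\<integral>\<^sup>+x. N 1 x * (if 0 < s \<and> N 1 x \<le> ennreal s then ennreal (q * s powr (q - 2)) else 0) \<partial>\<mu>) \<partial>lborel) =
     (\<integral>\<^sup>+x. (\<integral>\<^sup>+s. N 1 x * (if 0 < s \<and> N 1 x \<le> ennreal s then ennreal (q * s powr (q - 2)) else 0) \<partial>lborel) \<partial>\<mu>)"
    by (rule P.Fubini'[symmetric]) measurable
  \<comment> \<open>Here q < 1 is essential: the part of N 1 below s, weighted by s^(q-2), has to be
    integrable up to infinity.\<close>
  also have "\<dots> \<le> (\<integral>\<^sup>+x. ennreal (q / (1 - q)) * ennreal_powr (N 1 x) q \<partial>\<mu>)"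
  proof (rule nn_integral_mono)
    fix x
    have "(\<integral>\<^sup>+s. N 1 x * (if 0 < s \<and> N 1 x \<le> ennreal s then ennreal (q * s powr (q - 2)) else 0) \<partial>lborel) =
        N 1 x * (\<integral>\<^sup>+s. (if 0 < s \<and> N 1 x \<le> ennreal s then ennreal (q * s powr (q - 2)) else 0) \<partial>lborel)"
      by (rule nn_integral_cmult) measurable
    also have "\<dots> \<le> ennreal (q / (1 - q)) * ennreal_powr (N 1 x) q"
      by (rule nn_integral_powr_tail[OF q])
    finally show "(\<integral>\<^sup>+s. N 1 x * (if 0 < s \<and> N 1 x \<le> ennreal s then ennreal (q * s powr (q - 2)) else 0) \<partial>lborel)
        \<le> ennreal (q / (1 - q)) * ennreal_powr (N 1 x) q" .
  qed
  also have "\<dots> = ennreal (q / (1 - q)) * (\<integral>\<^sup>+x. ennreal_powr (N 1 x) q \<partial>\<mu>)"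
    by (rule nn_integral_cmult) measurable
  finally have "(\<integral>\<^sup>+x. ennreal_powr (N a x) q \<partial>\<mu>) \<le> ennreal (2 * D ^ (n + 3)) * (\<integral>\<^sup>+x. ennreal_powr (N 1 x) q \<partial>\<mu>) +
      ennreal (2 * D ^ n) * (ennreal (q / (1 - q)) * (\<integral>\<^sup>+x. ennreal_powr (N 1 x) q \<partial>\<mu>))"
    by (auto simp: add_left_mono mult_left_mono)
  also have "\<dots> = (ennreal (2 * D ^ (n + 3)) + ennreal (2 * D ^ n) * ennreal (q / (1 - q))) * (\<integral>\<^sup>+x. ennreal_powr (N 1 x) q \<partial>\<mu>)"
    by (simp only: distrib_right mult.assoc)
  also have "ennreal (2 * D ^ (n + 3)) + ennreal (2 * D ^ n) * ennreal (q / (1 - q)) =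
      ennreal (2 * D ^ (n + 3) + 2 * D ^ n * (q / (1 - q)))"
  proof -
    have e: "ennreal (2 * D ^ n * (q / (1 - q))) = ennreal (2 * D ^ n) * ennreal (q / (1 - q))"
      using q Dn by (intro ennreal_mult) auto
    have "ennreal (2 * D ^ (n + 3) + 2 * D ^ n * (q / (1 - q))) = ennreal (2 * D ^ (n + 3)) + ennreal (2 * D ^ n * (q / (1 - q)))"
      using q Dn by (intro ennreal_plus mult_nonneg_nonneg) auto
    then show ?thesis by (simp only: e)
  qed
  finally show ?thesis .
qed

text \<open>Each x in the ball of radius t also lies in the dilated ball, so the average over the
  latter is below the maximal function at x. This supplies the weight k for
  \<open>compare\<close>.\<close>

lemma maximal_dominates:
  assumes t: "0 < t" and a: "1 \<le> a" "a \<le> 2 ^ n"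
  shows "(\<integral>\<^sup>+x\<in>ball y (a * t). h x \<partial>\<mu>) \<le> (\<integral>\<^sup>+x\<in>ball y t. ennreal (D ^ n) * maximal h x \<partial>\<mu>)"
proof -
  have at: "0 < a * t" and sub: "ball y t \<subseteq> ball y (a * t)" using a t by (auto intro!: subset_ball)
  have "(\<integral>\<^sup>+x\<in>ball y (a * t). h x \<partial>\<mu>) = avg h y (a * t) * emeasure \<mu> (ball y (a * t))"
    by (rule avg_mult[OF at, symmetric])
  also have "\<dots> \<le> avg h y (a * t) * (ennreal (D ^ n) * emeasure \<mu> (ball y t))"
    by (intro mult_left_mono dilation t a) auto
  also have "\<dots> = (ennreal (D ^ n) * avg h y (a * t)) * emeasure \<mu> (ball y t)"
    by (simp only: mult_ac)
  also have "\<dots> = (\<integral>\<^sup>+x. (ennreal (D ^ n) * avg h y (a * t)) * indicator (ball y t) x \<partial>\<mu>)"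
    by (rule nn_integral_cmult_indicator[symmetric]) (simp add: sets_mu)
  also have "\<dots> \<le> (\<integral>\<^sup>+x\<in>ball y t. ennreal (D ^ n) * maximal h x \<partial>\<mu>)"
  proof (rule nn_integral_mono)
    fix x
    show "(ennreal (D ^ n) * avg h y (a * t)) * indicator (ball y t) x \<le> ennreal (D ^ n) * maximal h x * indicator (ball y t) x"
    proof (cases "x \<in> ball y t")
      case True
      then have "avg h y (a * t) \<le> maximal h x" using sub at by (intro avg_le_maximal) auto
      then show ?thesis by (intro mult_right_mono mult_left_mono) auto
    qed simp
  qed
  finally show ?thesis .
qed

text \<open>Duality: \<open>N a\<close> is tested against a truncation of \<open>(N a)\<^bsup>q-1\<^esup>\<close>, and the maximal theorem and Young's
  inequality allow half of the left side to be absorbed; the truncation keeps it finite.\<close>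

lemma change_of_aperture_large:
  assumes a: "1 \<le> a" "a \<le> 2 ^ n" and q: "1 < q"
  defines "p \<equiv> q / (q - 1)"
  defines "Cp \<equiv> 2 * D ^ 3 * (p / (p - 1)) * 2 powr (p - 1)"
  defines "e \<equiv> (1 / (2 * D ^ n * Cp)) powr (1 / p)"
  shows "(\<integral>\<^sup>+x. ennreal_powr (N a x) q \<partial>\<mu>) \<le> ennreal (2 * (D ^ n * e powr - q)) * (\<integral>\<^sup>+x. ennreal_powr (N 1 x) q \<partial>\<mu>)"
proof -
  have a0: "0 < a" using a by simp
  have [measurable]: "N 1 \<in> borel_measurable borel" "N a \<in> borel_measurable borel"
    using a0 by (auto intro: N_meas)
  have p: "1 < p" using q by (simp add: p_def)
  have pq: "1 / p + 1 / q = 1" using q by (simp add: p_def field_simps)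
  have qp: "(q - 1) * p = q" using q by (simp add: p_def)
  have Dn: "0 < D ^ n" "0 < D" using D_ge by auto
  have Cp: "0 < Cp" using p Dn unfolding Cp_def by auto
  have e: "0 < e" using Dn Cp by (simp add: e_def)
  \<comment> \<open>e was chosen for this: Young's weight, the maximal theorem and the n doublings
    together leave the factor 1/2 to absorb.\<close>
  have ep: "D ^ n * e powr p * Cp = 1 / 2"
    using Dn Cp p by (simp add: e_def powr_powr)
  define X where "X = (\<integral>\<^sup>+x. ennreal_powr (N 1 x) q \<partial>\<mu>)"
  define m where "m k x = min (N a x) (of_nat k)" for k :: nat and x
  define f where "f k x = ennreal_powr (m k x) q * indicator (ball 0 (real k)) x" for k :: nat and x
  define h where "h k x = ennreal_powr (m k x) (q - 1) * indicator (ball 0 (real k)) x" for k :: nat and x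
  have [measurable]: "ball 0 (real k) \<in> sets borel" for k :: nat by simp
  have [measurable]: "m k \<in> borel_measurable borel" "f k \<in> borel_measurable borel" "h k \<in> borel_measurable borel" for k
    unfolding m_def f_def h_def by measurable
  have bound: "(\<integral>\<^sup>+x. f k x \<partial>\<mu>) \<le> ennreal (2 * (D ^ n * e powr - q)) * X" for k
  proof -
    define A where "A = (\<integral>\<^sup>+x. f k x \<partial>\<mu>)"
    \<comment> \<open>As (q - 1) p = q, the p-th power of the test weight is the truncated q-th
      power again, which is why the maximal term returns A.\<close>
    have hp: "ennreal_powr (h k x) p = f k x" for x
      by (cases "x \<in> ball 0 (real k)") (simp_all add: h_def f_def ennreal_powr_powr qp)
    have "A \<le> (\<integral>\<^sup>+x. h k x * N a x \<partial>\<mu>)"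
      unfolding A_def
    proof (rule nn_integral_mono)
      fix x
      have "f k x = (m k x * ennreal_powr (m k x) (q - 1)) * indicator (ball 0 (real k)) x"
        using ennreal_powr_mult_self[of "q - 1" "m k x"] q by (simp add: f_def)
      also have "\<dots> \<le> (N a x * ennreal_powr (m k x) (q - 1)) * indicator (ball 0 (real k)) x"
        by (intro mult_right_mono) (auto simp: m_def)
      also have "\<dots> = h k x * N a x" by (simp only: h_def mult_ac)
      finally show "f k x \<le> h k x * N a x" .
    qed
    also have "\<dots> \<le> (\<integral>\<^sup>+x. (ennreal (D ^ n) * maximal (h k) x) * N 1 x \<partial>\<mu>)"
      by (rule compare) (use a0 maximal_dominates[OF _ a] in auto)
    also have "\<dots> \<le> (\<integral>\<^sup>+x. ennreal (D ^ n) * (ennreal (e powr - q) * ennreal_powr (N 1 x) q) +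
        ennreal (D ^ n) * (ennreal (e powr p) * ennreal_powr (maximal (h k) x) p) \<partial>\<mu>)"
    proof (rule nn_integral_mono)
      fix x
      have "(ennreal (D ^ n) * maximal (h k) x) * N 1 x = ennreal (D ^ n) * (N 1 x * maximal (h k) x)"
        by (simp only: mult_ac)
      also have "\<dots> \<le> ennreal (D ^ n) * (ennreal (e powr - q) * ennreal_powr (N 1 x) q + ennreal (e powr p) * ennreal_powr (maximal (h k) x) p)"
        by (intro mult_left_mono ennreal_Young p pq e) auto
      finally show "(ennreal (D ^ n) * maximal (h k) x) * N 1 x \<le> ennreal (D ^ n) * (ennreal (e powr - q) * ennreal_powr (N 1 x) q) +
        ennreal (D ^ n) * (ennreal (e powr p) * ennreal_powr (maximal (h k) x) p)"
        by (simp only: distrib_left)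
    qed
    also have "\<dots> = ennreal (D ^ n) * (ennreal (e powr - q) * X) + ennreal (D ^ n) * (ennreal (e powr p) * (\<integral>\<^sup>+x. ennreal_powr (maximal (h k) x) p \<partial>\<mu>))"
      unfolding X_def by (subst nn_integral_add; (measurable)?) (simp add: nn_integral_cmult)
    also have "\<dots> \<le> ennreal (D ^ n) * (ennreal (e powr - q) * X) + ennreal (D ^ n) * (ennreal (e powr p) * (ennreal Cp * A))"
    proof -
      have "(\<integral>\<^sup>+x. ennreal_powr (maximal (h k) x) p \<partial>\<mu>) \<le> ennreal Cp * A"
        using strong_type[of "h k" p] p by (simp add: Cp_def A_def hp)
      then show ?thesis by (intro add_left_mono mult_left_mono) auto
    qed
    also have "ennreal (D ^ n) * (ennreal (e powr p) * (ennreal Cp * A)) = ennreal (1 / 2) * A"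
    proof -
      have "ennreal (D ^ n) * (ennreal (e powr p) * (ennreal Cp * A)) = ennreal (D ^ n * e powr p * Cp) * A"
        using Dn Cp by (simp add: ennreal_mult mult.assoc)
      then show ?thesis by (simp only: ep)
    qed
    also have "ennreal (D ^ n) * (ennreal (e powr - q) * X) = ennreal (D ^ n * e powr - q) * X"
      using Dn by (simp add: ennreal_mult mult.assoc)
    finally have main: "A \<le> ennreal (D ^ n * e powr - q) * X + ennreal (1 / 2) * A" .
    have "A \<le> (\<integral>\<^sup>+x. ennreal (real k powr q) * indicator (ball 0 (real k)) x \<partial>\<mu>)"
      unfolding A_def f_def
    proof (intro nn_integral_mono mult_right_mono)
      fix x
      have "ennreal_powr (m k x) q \<le> ennreal_powr (of_nat k) q"
        using q by (intro ennreal_powr_mono) (auto simp: m_def)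
      then show "ennreal_powr (m k x) q \<le> ennreal (real k powr q)"
        by (simp add: ennreal_of_nat_eq_real_of_nat ennreal_powr_ennreal)
    qed simp
    also have "\<dots> = ennreal (real k powr q) * emeasure \<mu> (ball 0 (real k))"
      by (rule nn_integral_cmult_indicator) (simp add: sets_mu)
    also have "\<dots> < top" using ball_finite[of 0 "real k"] by (simp add: ennreal_mult_less_top)
    finally obtain v where v: "A = ennreal v" "0 \<le> v" by (cases A) auto
    show ?thesis
    proof (cases "X = top")
      case True
      then show ?thesis using Dn e by (simp add: ennreal_mult_top)
    next
      case False
      then obtain w where w: "X = ennreal w" "0 \<le> w" by (cases X) auto
      have "ennreal (D ^ n * e powr - q * w + 1 / 2 * v) = ennreal (D ^ n * e powr - q * w) + ennreal (1 / 2 * v)"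
        using v w Dn by (intro ennreal_plus) auto
      also have "ennreal (D ^ n * e powr - q * w) = ennreal (D ^ n * e powr - q) * ennreal w"
        using w Dn by (intro ennreal_mult) auto
      also have "ennreal (1 / 2 * v) = ennreal (1 / 2) * ennreal v"
        using v by (intro ennreal_mult) auto
      finally have "ennreal v \<le> ennreal (D ^ n * e powr - q * w + 1 / 2 * v)" using main by (simp only: v w)
      then have "v \<le> D ^ n * e powr - q * w + 1 / 2 * v" using v w Dn by (subst (asm) ennreal_le_iff) auto
      then have "v \<le> 2 * (D ^ n * e powr - q) * w" by simp
      then have "ennreal v \<le> ennreal (2 * (D ^ n * e powr - q) * w)" by (rule ennreal_leI)
      also have "\<dots> = ennreal (2 * (D ^ n * e powr - q)) * ennreal w"
        using Dn w by (intro ennreal_mult) auto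
      finally show ?thesis using v w by (simp add: A_def)
    qed
  qed
  \<comment> \<open>Where N a x is finite both truncations are eventually inactive; where it is
    infinite the truncated values k^q are unbounded in k.\<close>
  have ptw: "ennreal_powr (N a x) q \<le> (SUP k. f k x)" for x
  proof (cases "N a x")
    case (real r)
    obtain k :: nat where k: "r + norm x < real k" using reals_Archimedean2 by blast
    have "r \<le> real k" using k norm_ge_zero[of x] by linarith
    then have "m k x = N a x"
      using real by (simp add: m_def min_def ennreal_of_nat_eq_real_of_nat)
    moreover have "x \<in> ball 0 (real k)" using k real by (simp add: dist_norm)
    ultimately have "ennreal_powr (N a x) q = f k x" by (simp add: f_def)
    then show ?thesis by (auto intro: SUP_upper2)
  next
    case top
    have "of_nat j \<le> (SUP k. f k x)" for j :: nat
    proof -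
      obtain k :: nat where k: "real j powr (1 / q) + norm x < real k" using reals_Archimedean2 by blast
      have "real j = (real j powr (1 / q)) powr q" using q by (simp add: powr_powr)
      also have "\<dots> \<le> real k powr q"
      proof (rule powr_mono2)
        show "real j powr (1 / q) \<le> real k" using k norm_ge_zero[of x] by linarith
      qed (use q in auto)
      finally have "of_nat j \<le> ennreal (real k powr q)"
        by (simp add: ennreal_of_nat_eq_real_of_nat)
      also have "\<dots> = ennreal_powr (m k x) q"
        using top by (simp add: m_def ennreal_of_nat_eq_real_of_nat ennreal_powr_ennreal min_def top_unique)
      also have "\<dots> = f k x"
      proof -
        have "norm x < real k" using k powr_ge_zero[of "real j" "1 / q"] by linarith
        then show ?thesis by (simp add: f_def dist_norm)
      qed
      finally show ?thesis by (rule SUP_upper2[OF UNIV_I])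
    qed
    then have "(SUP j. of_nat j :: ennreal) \<le> (SUP k. f k x)" by (intro SUP_least)
    then have "(SUP k. f k x) = top" unfolding ennreal_SUP_of_nat_eq_top by (rule top_unique[THEN iffD1])
    then show ?thesis by (simp only: top_greatest)
  qed
  have inc: "incseq f"
    unfolding incseq_def le_fun_def f_def m_def using q
    by (auto intro!: mult_mono ennreal_powr_mono min.mono simp: indicator_def)
  have "(\<integral>\<^sup>+x. ennreal_powr (N a x) q \<partial>\<mu>) \<le> (\<integral>\<^sup>+x. (SUP k. f k x) \<partial>\<mu>)"
    by (intro nn_integral_mono ptw)
  also have "\<dots> = (SUP k. \<integral>\<^sup>+x. f k x \<partial>\<mu>)"
    by (rule nn_integral_monotone_convergence_SUP[OF inc]) measurable
  also have "\<dots> \<le> ennreal (2 * (D ^ n * e powr - q)) * X"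
    by (intro SUP_least bound)
  finally show ?thesis by (simp add: X_def)
qed

end

text \<open>The constant is obtained before g is fixed: later g depends on the function f, and the
  final constant must not.\<close>

lemma (in doubling_measure) change_of_aperture:
  assumes a: "1 \<le> a" and q: "0 < q"
  obtains C where "0 < C" "\<And>g. tent \<mu> D g \<Longrightarrow>
    (\<integral>\<^sup>+x. ennreal_powr (tent.N g a x) q \<partial>\<mu>) \<le> ennreal C * (\<integral>\<^sup>+x. ennreal_powr (tent.N g 1 x) q \<partial>\<mu>)"
proof -
  obtain n :: nat where "a \<le> real n" using real_arch_simple by blast
  moreover have "real n \<le> 2 ^ n" using of_nat_less_two_power[of n] less_imp_le by blast
  ultimately have an: "a \<le> 2 ^ n" by linarith
  have D: "0 < D" using D_ge by simp
  consider "q < 1" | "q = 1" | "1 < q" by linarith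
  then show ?thesis
  proof cases
    case 1
    show ?thesis
    proof (rule that)
      show "0 < 2 * D ^ (n + 3) + 2 * D ^ n * (q / (1 - q))"
        using D q 1 by (intro add_pos_pos mult_pos_pos) auto
    qed (rule tent.change_of_aperture_small[OF _ a an q 1])
  next
    case 2
    show ?thesis
    proof (rule that)
      show "0 < D ^ n" using D by simp
      show "(\<integral>\<^sup>+x. ennreal_powr (tent.N g a x) q \<partial>\<mu>) \<le> ennreal (D ^ n) * (\<integral>\<^sup>+x. ennreal_powr (tent.N g 1 x) q \<partial>\<mu>)"
        if "tent \<mu> D g" for g
        using tent.change_of_aperture_1[OF that a an] 2 by simp
    qed
  next
    case 3
    have pos: "0 < 2 * (D ^ n * (z powr b) powr - q)" if "0 < z" for z b
      using D that by (intro mult_pos_pos) auto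
    show ?thesis
    proof (rule that)
      define p where "p = q / (q - 1)"
      have "1 < p" using 3 by (simp add: p_def)
      then have "0 < 1 / (2 * D ^ n * (2 * D ^ 3 * (p / (p - 1)) * 2 powr (p - 1)))" using D by auto
      then show "0 < 2 * (D ^ n * ((1 / (2 * D ^ n * (2 * D ^ 3 * (q / (q - 1) / (q / (q - 1) - 1)) * 2 powr (q / (q - 1) - 1)))) powr (1 / (q / (q - 1)))) powr - q)"
        by (intro pos) (simp only: p_def)
    qed (rule tent.change_of_aperture_large[OF _ a an 3])
  qed
qed


section \<open>Conical square functions of families of classes\<close>

text \<open>A Borel version of the squared modulus; Fubini on \<open>borel \<Otimes>\<^sub>M lborel\<close> does not accept Lebesgue
  measurable representatives.\<close>

definition sqdens :: "('n::finite, 'b::euclidean_space) l2 \<Rightarrow> real^'n \<Rightarrow> ennreal" where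
  "sqdens U = (SOME g. g \<in> borel_measurable borel \<and> (AE x in lborel. ennreal ((norm (rep U x))\<^sup>2) = g x))"

lemma sqdens:
  shows sqdens_measurable [measurable]: "sqdens U \<in> borel_measurable borel"
    and sqdens_AE: "AE x in lborel. ennreal ((norm (rep U x))\<^sup>2) = sqdens U x"
proof -
  have "(\<lambda>x. ennreal ((norm (rep U x))\<^sup>2)) \<in> borel_measurable (completion lborel)" by measurable
  from completion_ex_borel_measurable[OF this]
  have "\<exists>g. g \<in> borel_measurable borel \<and> (AE x in lborel. ennreal ((norm (rep U x))\<^sup>2) = g x)" by auto
  from someI_ex[OF this] show "sqdens U \<in> borel_measurable borel"
    "AE x in lborel. ennreal ((norm (rep U x))\<^sup>2) = sqdens U x"
    unfolding sqdens_def by auto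
qed

lemma nn_integral_sqdens:
  assumes S: "S \<in> sets lebesgue" shows "(\<integral>\<^sup>+y\<in>S. sqdens U y \<partial>lborel) = ennreal (mass S U)"
proof -
  have "(\<integral>\<^sup>+y\<in>S. sqdens U y \<partial>lborel) = (\<integral>\<^sup>+y\<in>S. ennreal ((norm (rep U y))\<^sup>2) \<partial>lborel)"
    using sqdens_AE[of U] by (intro nn_integral_cong_AE) (elim eventually_mono, simp)
  also have "\<dots> = ennreal (mass S U)"
    using nn_integral_mass[OF S, of U] by (simp only: nn_integral_completion)
  finally show ?thesis .
qed

lemma mass_nonneg [simp]: "0 \<le> mass S U"
  by (simp add: mass_def)

lemma mass_empty [simp]: "mass {} U = 0"
proof -
  have "ennreal (mass {} U) = 0" using nn_integral_mass[of "{}" U] by simp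
  then show ?thesis by (metis ennreal_eq_0_iff mass_nonneg order_antisym)
qed

lemma mass_mono:
  assumes "S \<subseteq> S'" "S \<in> sets lebesgue" "S' \<in> sets lebesgue" shows "mass S U \<le> mass S' U"
proof -
  have "ennreal (mass S U) \<le> ennreal (mass S' U)"
    unfolding nn_integral_mass[OF assms(2), symmetric] nn_integral_mass[OF assms(3), symmetric]
    using assms(1) by (intro nn_integral_mono) (auto simp: indicator_def)
  then show ?thesis by (subst (asm) ennreal_le_iff) auto
qed

lemma mass_scaleR:
  assumes "S \<in> sets lebesgue" shows "mass S (c *\<^sub>R U) = c\<^sup>2 * mass S U"
  unfolding mass_def linear_scale[OF bounded_linear.linear[OF bounded_linear_cut[OF bounded_meas_indicator[OF assms]]]]
  by (simp add: power_mult_distrib)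

lemma mass_diff_le:
  assumes "S \<in> sets lebesgue" shows "mass S (U - V) \<le> 2 * mass S U + 2 * mass S V"
proof -
  let ?c = "cut (indicat_real S)"
  have "norm (?c (U - V)) \<le> norm (?c U) + norm (?c V)"
    unfolding linear_diff[OF bounded_linear.linear[OF bounded_linear_cut[OF bounded_meas_indicator[OF assms]]]]
    by (rule norm_triangle_ineq4)
  then have "(norm (?c (U - V)))\<^sup>2 \<le> (norm (?c U) + norm (?c V))\<^sup>2" by (intro power_mono) auto
  also have "\<dots> \<le> 2 * (norm (?c U))\<^sup>2 + 2 * (norm (?c V))\<^sup>2"
    using sum_squares_bound[of "norm (?c U)" "norm (?c V)"] by (simp add: power2_sum)
  finally show ?thesis by (simp add: mass_def)
qed

lemma mass_tendsto:
  assumes S: "\<And>k. S \<in> sets lebesgue" and U: "(\<lambda>k. U k) \<longlonglongrightarrow> V"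
  shows "(\<lambda>k. mass S (U k)) \<longlonglongrightarrow> mass S V"
  unfolding mass_def
  by (intro tendsto_intros bounded_linear.tendsto[OF bounded_linear_cut[OF bounded_meas_indicator[OF S]]] U)

lemma mass_ball_measurable:
  fixes U :: "('n::finite, 'b::euclidean_space) l2"
  shows "(\<lambda>p. mass (ball (snd p :: real^'n) (fst p)) U) \<in> borel_measurable (borel \<Otimes>\<^sub>M borel)"
proof -
  have "(\<lambda>p :: real \<times> (real^'n). \<integral>\<^sup>+y. sqdens U y * (if dist (snd p) y < fst p then 1 else 0) \<partial>lborel)
      \<in> borel_measurable (borel \<Otimes>\<^sub>M borel)"
    by measurable
  also have "(\<lambda>p :: real \<times> (real^'n). \<integral>\<^sup>+y. sqdens U y * (if dist (snd p) y < fst p then 1 else 0) \<partial>lborel) =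
      (\<lambda>p. ennreal (mass (ball (snd p) (fst p)) U))"
  proof
    fix p :: "real \<times> (real^'n)"
    have "(\<integral>\<^sup>+y. sqdens U y * (if dist (snd p) y < fst p then 1 else 0) \<partial>lborel) =
        (\<integral>\<^sup>+y\<in>ball (snd p) (fst p). sqdens U y \<partial>lborel)"
      by (intro nn_integral_cong) (auto simp: indicator_def)
    then show "(\<integral>\<^sup>+y. sqdens U y * (if dist (snd p) y < fst p then 1 else 0) \<partial>lborel) =
        ennreal (mass (ball (snd p) (fst p)) U)"
      by (simp add: nn_integral_sqdens)
  qed
  finally have "(\<lambda>p :: real \<times> (real^'n). ennreal (mass (ball (snd p) (fst p)) U)) \<in> borel_measurable (borel \<Otimes>\<^sub>M borel)" .
  from borel_measurable_enn2real[OF this] show ?thesis by simp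
qed

text \<open>Rounding \<open>t\<close> up to a grid of mesh \<open>1 / (k + 1)\<close> reduces joint measurability to countably many fixed classes.\<close>

lemma cone_mass_measurable:
  fixes H :: "real \<Rightarrow> ('n::finite, 'b::euclidean_space) l2"
  assumes H: "continuous_on {0<..} H" and a: "0 < a"
  shows "(\<lambda>p. mass (ball (snd p :: real^'n) (a * fst p)) (H (fst p))) \<in> borel_measurable (borel \<Otimes>\<^sub>M borel)"
proof -
  define q where "q k t = of_int \<lceil>real (Suc k) * t\<rceil> / real (Suc k)" for k :: nat and t
  have q: "t \<le> q k t" "q k t \<le> t + 1 / real (Suc k)" for k t
  proof -
    have "real (Suc k) * t \<le> of_int \<lceil>real (Suc k) * t\<rceil>" by (rule le_of_int_ceiling)
    then show "t \<le> q k t" by (simp add: q_def pos_le_divide_eq mult.commute)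
    have "of_int \<lceil>real (Suc k) * t\<rceil> \<le> real (Suc k) * t + 1" by (rule of_int_ceiling_le_add_one)
    then have "q k t \<le> (real (Suc k) * t + 1) / real (Suc k)" unfolding q_def by (intro divide_right_mono) auto
    then show "q k t \<le> t + 1 / real (Suc k)" by (simp add: add_divide_distrib)
  qed
  have qlim: "(\<lambda>k. q k t) \<longlonglongrightarrow> t" for t
  proof (rule tendsto_sandwich[OF _ _ tendsto_const])
    have "(\<lambda>k. t + 1 / real (Suc k)) \<longlonglongrightarrow> t + 0"
      by (intro tendsto_intros LIMSEQ_Suc[OF lim_1_over_n])
    then show "(\<lambda>k. t + 1 / real (Suc k)) \<longlonglongrightarrow> t" by simp
  qed (rule always_eventually, rule allI, rule q)+
  show ?thesis
  proof (rule borel_measurable_LIMSEQ_real)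
    fix p :: "real \<times> (real^'n)"
    show "(\<lambda>k. mass (ball (snd p) (a * fst p)) (H (q k (fst p)))) \<longlonglongrightarrow> mass (ball (snd p) (a * fst p)) (H (fst p))"
    proof (cases "0 < fst p")
      case True
      have "(\<lambda>k. H (q k (fst p))) \<longlonglongrightarrow> H (fst p)"
        by (rule continuous_on_tendsto_compose[OF H qlim])
           (use True less_le_trans[OF True q(1)] in auto)
      then show ?thesis by (intro mass_tendsto) auto
    next
      case False
      then have e: "ball (snd p) (a * fst p) = {}" using a by (simp add: ball_eq_empty mult_nonneg_nonpos not_less)
      show ?thesis unfolding e by simp
    qed
  next
    fix k
    have "(\<lambda>p :: real \<times> (real^'n). mass (ball (snd p) (a * fst p)) (H (of_int i / real (Suc k)))) \<in> borel_measurable (borel \<Otimes>\<^sub>M borel)" for i :: int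
    proof -
      have "(\<lambda>p :: real \<times> (real^'n). (a * fst p, snd p)) \<in> borel \<Otimes>\<^sub>M borel \<rightarrow>\<^sub>M borel \<Otimes>\<^sub>M borel" by measurable
      from measurable_compose[OF this mass_ball_measurable] show ?thesis by simp
    qed
    moreover have "(\<lambda>p :: real \<times> (real^'n). \<lceil>real (Suc k) * fst p\<rceil>) \<in> borel \<Otimes>\<^sub>M borel \<rightarrow>\<^sub>M count_space UNIV" by measurable
    ultimately show "(\<lambda>p :: real \<times> (real^'n). mass (ball (snd p) (a * fst p)) (H (q k (fst p)))) \<in> borel_measurable (borel \<Otimes>\<^sub>M borel)"
      unfolding q_def by (rule measurable_compose_countable)
  qed
qed

lemma mass_line_measurable:
  fixes x :: "real^'n"
  assumes "continuous_on {0<..} H" "0 < a"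
  shows "(\<lambda>t. mass (ball x (a * t)) (H t)) \<in> borel_measurable borel"
proof -
  have "(\<lambda>t :: real. (t, x)) \<in> borel \<rightarrow>\<^sub>M borel \<Otimes>\<^sub>M borel" by measurable
  from measurable_compose[OF this cone_mass_measurable[OF assms]] show ?thesis by simp
qed

text \<open>The square of the conical square function of aperture a, expressed through classes; the
  square root is taken only in \<open>conical\<close>.\<close>

definition area :: "real \<Rightarrow> (real \<Rightarrow> ('n::finite, 'b::euclidean_space) l2) \<Rightarrow> real^'n \<Rightarrow> ennreal" where
  "area a H x = (\<integral>\<^sup>+t\<in>{0<..}. ennreal (mass (ball x (a * t)) (H t) / t ^ (CARD('n) + 1)) \<partial>lborel)"

lemma tent_area:
  fixes H :: "real \<Rightarrow> ('n::finite, 'b::euclidean_space) l2"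
  assumes H: "continuous_on {0<..} H" and D: "doubling_measure \<mu> D"
  defines "g \<equiv> (\<lambda>t y. ennreal (1 / t ^ (CARD('n) + 1)) * sqdens (H t) y)"
  shows "tent \<mu> D g" and "0 < a \<Longrightarrow> tent.N g a = area a H"
proof -
  have J: "(\<integral>\<^sup>+y\<in>ball x r. g t y \<partial>lborel) = ennreal (1 / t ^ (CARD('n) + 1)) * ennreal (mass (ball x r) (H t))" for t r x
  proof -
    have "(\<integral>\<^sup>+y\<in>ball x r. g t y \<partial>lborel) = (\<integral>\<^sup>+y. ennreal (1 / t ^ (CARD('n) + 1)) * (sqdens (H t) y * indicator (ball x r) y) \<partial>lborel)"
      by (simp add: g_def mult.assoc)
    also have "\<dots> = ennreal (1 / t ^ (CARD('n) + 1)) * (\<integral>\<^sup>+y\<in>ball x r. sqdens (H t) y \<partial>lborel)"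
    proof (rule nn_integral_cmult)
      have [measurable]: "ball x r \<in> sets borel" by simp
      show "(\<lambda>y. sqdens (H t) y * indicator (ball x r) y) \<in> borel_measurable lborel" by measurable
    qed
    finally show ?thesis by (simp add: nn_integral_sqdens)
  qed
  show t: "tent \<mu> D g"
  proof (intro tent.intro D tent_axioms.intro)
    show "g t \<in> borel_measurable borel" for t unfolding g_def by measurable
    show "(\<lambda>p. \<integral>\<^sup>+y\<in>ball (snd p) (a * fst p). g (fst p) y \<partial>lborel) \<in> borel_measurable (borel \<Otimes>\<^sub>M borel)" if "0 < a" for a
    proof -
      note [measurable] = cone_mass_measurable[OF H that]
      show ?thesis unfolding J by measurable
    qed
  qed
  show "tent.N g a = area a H" if "0 < a"
  proof
    fix x
    show "tent.N g a x = area a H x"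
      unfolding tent.N_def[OF t] tent.J_def[OF t] area_def J
      by (intro nn_integral_cong) (auto simp: indicator_def ennreal_mult'[symmetric])
  qed
qed

text \<open>Representatives enter only the inner integral at a fixed t, where they may be changed on
  a null set.\<close>

lemma conical_eq_area:
  fixes F :: "real \<Rightarrow> real^'n \<Rightarrow> 'b::euclidean_space"
  assumes F: "\<And>t. 0 < t \<Longrightarrow> F t \<in> L2" and H: "\<And>t. 0 < t \<Longrightarrow> cls (F t) = H t"
  shows "conical F x = ennreal_powr (area 1 H x) (1 / 2)"
proof -
  have "(\<integral>\<^sup>+t\<in>{0<..}. (\<integral>\<^sup>+y\<in>{y. (y, t) \<in> cone x}. ennreal ((norm (F t y))\<^sup>2 / t ^ (CARD('n) + 1)) \<partial>lebesgue) \<partial>lebesgue) = area 1 H x"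
    unfolding area_def nn_integral_completion[of lborel "\<lambda>t. _ t * indicator {0<..} t"]
  proof (rule nn_integral_cong)
    fix t :: real
    show "(\<integral>\<^sup>+y\<in>{y. (y, t) \<in> cone x}. ennreal ((norm (F t y))\<^sup>2 / t ^ (CARD('n) + 1)) \<partial>lebesgue) * indicator {0<..} t =
      ennreal (mass (ball x (1 * t)) (H t) / t ^ (CARD('n) + 1)) * indicator {0<..} t"
    proof (cases "0 < t")
      case t: True
      have cone: "{y. (y, t) \<in> cone x} = ball x t" using t by (auto simp: cone_def dist_norm)
      have "(\<integral>\<^sup>+y\<in>ball x t. ennreal ((norm (F t y))\<^sup>2 / t ^ (CARD('n) + 1)) \<partial>lebesgue) =
          (\<integral>\<^sup>+y. ennreal (1 / t ^ (CARD('n) + 1)) * (ennreal ((norm (rep (H t) y))\<^sup>2) * indicator (ball x t) y) \<partial>lebesgue)"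
      proof (rule nn_integral_cong_AE)
        have "AE y in lebesgue. rep (H t) y = F t y" using rep_cls[OF F[OF t]] H[OF t] by simp
        then show "AE y in lebesgue. ennreal ((norm (F t y))\<^sup>2 / t ^ (CARD('n) + 1)) * indicator (ball x t) y =
            ennreal (1 / t ^ (CARD('n) + 1)) * (ennreal ((norm (rep (H t) y))\<^sup>2) * indicator (ball x t) y)"
          by eventually_elim (use t in \<open>auto simp: indicator_def ennreal_mult'[symmetric]\<close>)
      qed
      also have "\<dots> = ennreal (1 / t ^ (CARD('n) + 1)) * (\<integral>\<^sup>+y\<in>ball x t. ennreal ((norm (rep (H t) y))\<^sup>2) \<partial>lebesgue)"
      proof (rule nn_integral_cmult)
        have [measurable]: "ball x t \<in> sets lebesgue" by simp
        show "(\<lambda>y. ennreal ((norm (rep (H t) y))\<^sup>2) * indicator (ball x t) y) \<in> borel_measurable lebesgue" by measurable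
      qed
      also have "(\<integral>\<^sup>+y\<in>ball x t. ennreal ((norm (rep (H t) y))\<^sup>2) \<partial>lebesgue) = ennreal (mass (ball x t) (H t))"
        by (rule nn_integral_mass) simp
      finally show ?thesis using t by (simp add: cone ennreal_mult'[symmetric])
    qed simp
  qed
  then show ?thesis by (simp add: conical_def)
qed

lemma area_mono_aperture:
  assumes "a \<le> b" shows "area a H x \<le> area b H x"
  unfolding area_def
proof (rule nn_integral_mono)
  fix t :: real
  show "ennreal (mass (ball x (a * t)) (H t) / t ^ (CARD('a) + 1)) * indicator {0<..} t
     \<le> ennreal (mass (ball x (b * t)) (H t) / t ^ (CARD('a) + 1)) * indicator {0<..} t"
  proof (cases "0 < t")
    case True
    then have "ball x (a * t) \<subseteq> ball x (b * t)" using assms by (intro subset_ball mult_right_mono) auto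
    then show ?thesis using True by (auto intro!: ennreal_leI divide_right_mono mass_mono)
  qed simp
qed

text \<open>The enumeration of the dyadic scales is an arbitrary bijection because it is used twice,
  for the scales themselves and for the scales shifted by one.\<close>

lemma nn_integral_dyadic:
  fixes \<pi> :: "nat \<Rightarrow> int" and f :: "real \<Rightarrow> ennreal"
  assumes [measurable]: "f \<in> borel_measurable borel" and \<pi>: "bij \<pi>"
  shows "(\<integral>\<^sup>+t\<in>{0<..}. f t \<partial>lborel) = (\<Sum>i. \<integral>\<^sup>+t\<in>{2 powr of_int (\<pi> i)..<2 powr (of_int (\<pi> i) + 1)}. f t \<partial>lborel)"
proof -
  define B where "B i = {2 powr of_int (\<pi> i)..<2 powr (of_int (\<pi> i) + 1 :: real)}" for i
  have mem: "t \<in> B i \<longleftrightarrow> 0 < t \<and> \<lfloor>log 2 t\<rfloor> = \<pi> i" for t i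
  proof (cases "0 < t")
    case True
    then show ?thesis
      by (auto simp: B_def floor_eq_iff powr_le_iff less_powr_iff)
  next
    case False
    have "0 < 2 powr (of_int (\<pi> i) :: real)" by simp
    then have "t \<notin> B i" using False unfolding B_def by (meson atLeastLessThan_iff less_le_trans)
    then show ?thesis using False by simp
  qed
  have un: "(\<Union>i. B i) = {0<..}"
  proof (intro set_eqI iffI)
    fix t :: real assume "t \<in> {0<..}"
    obtain i where "\<pi> i = \<lfloor>log 2 t\<rfloor>" using \<pi> by (metis bij_pointE)
    then have "t \<in> B i" using mem[of t i] \<open>t \<in> {0<..}\<close> by simp
    then show "t \<in> (\<Union>i. B i)" by blast
  qed (auto simp: mem)
  have disj: "disjoint_family B"
    unfolding disjoint_family_on_def
  proof (intro ballI impI)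
    fix i j :: nat assume "i \<noteq> j"
    then have "\<pi> i \<noteq> \<pi> j" using \<pi> by (metis bij_is_inj injD)
    then show "B i \<inter> B j = {}" using mem by fastforce
  qed
  have Bs: "range B \<subseteq> sets (density lborel f)" by (auto simp: B_def)
  have "(\<integral>\<^sup>+t\<in>{0<..}. f t \<partial>lborel) = emeasure (density lborel f) (\<Union>i. B i)"
    unfolding un by (subst emeasure_density) auto
  also have "\<dots> = (\<Sum>i. emeasure (density lborel f) (B i))"
    by (rule suminf_emeasure[OF Bs disj, symmetric])
  also have "\<dots> = (\<Sum>i. \<integral>\<^sup>+t\<in>B i. f t \<partial>lborel)"
    by (intro suminf_cong emeasure_density) (auto simp: B_def)
  finally show ?thesis by (simp add: B_def)
qed

lemma nn_integral_continuous_interval: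
  fixes h :: "real \<Rightarrow> real"
  assumes "continuous_on {c..d} h" "\<And>t. t \<in> {c..d} \<Longrightarrow> 0 \<le> h t"
  shows "(\<integral>\<^sup>+t\<in>{c..d}. ennreal (h t) \<partial>lborel) = ennreal (integral {c..d} h)"
  by (rule nn_integral_has_integral_lebesgue'[OF assms(2)])
     (auto intro!: integrable_integral integrable_continuous_real assms(1))

context heat
begin

text \<open>On \<open>[r, 2r]\<close> all powers of \<open>t\<close> are comparable to powers of \<open>r\<close>, so \<open>local_estimate\<close> passes to the
  conical weights.\<close>

lemma dyadic_estimate:
  "\<exists>C>0. \<forall>F (x :: real^'n) r. 0 < r \<longrightarrow>
    (\<integral>\<^sup>+t\<in>{r..<2*r}. ennreal ((t ^ (4 * m + 4) * mass (ball x t) (sflow F (Suc m) t)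
        + t ^ (4 * m + 2) * mass (ball x t) (grad (sflow F m t))) / t ^ (CARD('n) + 1)) \<partial>lborel)
    \<le> ennreal C * (\<integral>\<^sup>+t\<in>{r/2..2*r}. ennreal (t ^ (4 * m) * mass (ball x (9 * real CARD('n) * t)) (sflow F m t) / t ^ (CARD('n) + 1)) \<partial>lborel)"
proof -
  let ?n = "CARD('n)"
  obtain C where C: "0 \<le> C" and est: "\<And>F m (x :: real^'n) r. 0 < r \<Longrightarrow>
    integral {r..2*r} (\<lambda>t. r ^ 4 * mass (ball x (2 * r)) (sflow F (Suc m) t) + r\<^sup>2 * mass (ball x (2 * r)) (grad (sflow F m t)))
    \<le> C * integral {r/2..2*r} (\<lambda>t. mass (cball x (4 * real ?n * r)) (sflow F m t))"
    using local_estimate by blast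
  \<comment> \<open>The first power of 2 comes from t at most 2 r, the last two from r at most 2 t
    and t at most 2 r; C + 1 keeps K positive.\<close>
  define K where "K = 2 ^ (4 * m + 4) * (C + 1) * (2 ^ (4 * m) * 2 ^ (?n + 1))"
  have K: "0 < K" using C by (simp add: K_def)
  show ?thesis
  proof (rule exI[of _ K], intro conjI allI impI K)
    fix F :: "('n, complex) l2" and x :: "real^'n" and r :: real assume r: "0 < r"
    define w where "w t = t ^ (4 * m) * mass (ball x (9 * real ?n * t)) (sflow F m t) / t ^ (?n + 1)" for t
    define h where "h t = r ^ 4 * mass (ball x (2 * r)) (sflow F (Suc m) t) + r\<^sup>2 * mass (ball x (2 * r)) (grad (sflow F m t))" for t
    define v where "v t = mass (cball x (4 * real ?n * r)) (sflow F m t)" for t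
    define \<kappa> where "\<kappa> = r ^ (4 * m) / r ^ (?n + 1)"
    have \<kappa>: "0 < \<kappa>" using r by (simp add: \<kappa>_def)
    have cU: "continuous_on {r/2..2*r} (sflow F n)" for n
      by (rule continuous_on_subset[OF continuous_sflow]) (use r in auto)
    have cD: "continuous_on {r/2..2*r} (\<lambda>t. grad (sflow F n t))" for n
      by (rule continuous_on_subset[OF continuous_grad_sflow]) (use r in auto)
    have cm: "continuous_on {r/2..2*r} (\<lambda>t. mass S (f t))"
      if "S \<in> sets lebesgue" "continuous_on {r/2..2*r} f" for S and f :: "real \<Rightarrow> ('n, 'b::euclidean_space) l2"
      unfolding mass_def
      by (intro continuous_intros bounded_linear.continuous_on[OF bounded_linear_cut[OF bounded_meas_indicator[OF that(1)]] that(2)])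
    have ch: "continuous_on {r/2..2*r} h" and cv: "continuous_on {r/2..2*r} v"
      unfolding h_def v_def by (intro continuous_intros cm cU cD; simp)+
    have h0: "0 \<le> h t" and v0: "0 \<le> v t" for t using r by (auto simp: h_def v_def)
    have 1: "(t ^ (4 * m + 4) * mass (ball x t) (sflow F (Suc m) t) + t ^ (4 * m + 2) * mass (ball x t) (grad (sflow F m t))) / t ^ (?n + 1)
        \<le> 2 ^ (4 * m + 4) * \<kappa> * h t" if t: "r \<le> t" "t \<le> 2 * r" for t
    proof -
      have sub: "ball x t \<subseteq> ball x (2 * r)" using t by (intro subset_ball) auto
      have p: "t ^ (4 * m + 4) \<le> (2 * r) ^ (4 * m + 4)" "t ^ (4 * m + 2) \<le> (2 * r) ^ (4 * m + 2)"
        by (rule power_mono; use t r in simp)+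
      have p2: "(2 * r) ^ (4 * m + 2) \<le> 2 ^ (4 * m + 4) * (r ^ (4 * m) * r\<^sup>2)"
      proof -
        have "(2 * r) ^ (4 * m + 2) = 2 ^ (4 * m + 2) * (r ^ (4 * m) * r\<^sup>2)" by (simp add: power_mult_distrib power_add power2_eq_square)
        also have "\<dots> \<le> 2 ^ (4 * m + 4) * (r ^ (4 * m) * r\<^sup>2)"
          using r by (intro mult_right_mono power_increasing) auto
        finally show ?thesis .
      qed
      have p4: "(2 * r) ^ (4 * m + 4) = 2 ^ (4 * m + 4) * (r ^ (4 * m) * r ^ 4)" by (simp add: power_mult_distrib power_add)
      have "t ^ (4 * m + 4) * mass (ball x t) (sflow F (Suc m) t) + t ^ (4 * m + 2) * mass (ball x t) (grad (sflow F m t))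
         \<le> (2 ^ (4 * m + 4) * (r ^ (4 * m) * r ^ 4)) * mass (ball x (2 * r)) (sflow F (Suc m) t)
         + (2 ^ (4 * m + 4) * (r ^ (4 * m) * r\<^sup>2)) * mass (ball x (2 * r)) (grad (sflow F m t))"
        using t r sub by (intro add_mono mult_mono mass_mono p(1)[unfolded p4] order_trans[OF p(2) p2]) auto
      also have "\<dots> = 2 ^ (4 * m + 4) * r ^ (4 * m) * h t" by (simp add: h_def algebra_simps)
      finally have "(t ^ (4 * m + 4) * mass (ball x t) (sflow F (Suc m) t) + t ^ (4 * m + 2) * mass (ball x t) (grad (sflow F m t))) / t ^ (?n + 1)
        \<le> (2 ^ (4 * m + 4) * r ^ (4 * m) * h t) / r ^ (?n + 1)"
        using t r h0[of t] by (intro frac_le power_mono) auto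
      then show ?thesis by (simp add: \<kappa>_def)
    qed
    \<comment> \<open>From t at least r/2 one has 4 n r at most 8 n t, and the ninth multiple makes
      room for a closed ball inside an open one. This fixes the aperture 9 n.\<close>
    have 2: "\<kappa> * v t \<le> (2 ^ (4 * m) * 2 ^ (?n + 1)) * w t" if t: "r / 2 \<le> t" "t \<le> 2 * r" for t
    proof -
      have t0: "0 < t" using t r by linarith
      have lt: "4 * real ?n * r < 9 * real ?n * t"
      proof -
        have "4 * real ?n * r \<le> 8 * real ?n * t" using t mult_left_mono[of "r / 2" t "8 * real ?n"] by simp
        also have "\<dots> < 9 * real ?n * t" using t0 by (intro mult_strict_right_mono) auto
        finally show ?thesis .
      qed
      have "cball x (4 * real ?n * r) \<subseteq> ball x (9 * real ?n * t)"
      proof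
        fix z assume z: "z \<in> cball x (4 * real ?n * r)"
        show "z \<in> ball x (9 * real ?n * t)"
          unfolding mem_ball by (rule le_less_trans[OF _ lt]) (use z in \<open>simp only: mem_cball\<close>)
      qed
      then have "v t \<le> mass (ball x (9 * real ?n * t)) (sflow F m t)"
        unfolding v_def by (intro mass_mono) auto
      moreover have "r ^ (4 * m) \<le> 2 ^ (4 * m) * t ^ (4 * m)"
        using t r power_mono[of r "2 * t" "4 * m"] by (simp add: power_mult_distrib)
      moreover have "1 / r ^ (?n + 1) \<le> 2 ^ (?n + 1) / t ^ (?n + 1)"
      proof -
        have "t ^ (?n + 1) \<le> 2 ^ (?n + 1) * r ^ (?n + 1)"
          using t t0 power_mono[of t "2 * r" "?n + 1"] by (simp only: power_mult_distrib)
        then show ?thesis using t0 r by (simp add: divide_simps mult_ac)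
      qed
      ultimately have "r ^ (4 * m) * (1 / r ^ (?n + 1)) * v t \<le>
          (2 ^ (4 * m) * t ^ (4 * m)) * (2 ^ (?n + 1) / t ^ (?n + 1)) * mass (ball x (9 * real ?n * t)) (sflow F m t)"
        using r t0 v0[of t] by (intro mult_mono) auto
      then show ?thesis by (simp add: \<kappa>_def w_def mult_ac)
    qed
    have w0: "0 \<le> w t" if "0 < t" for t using that by (simp add: w_def)
    have "(\<integral>\<^sup>+t\<in>{r..<2*r}. ennreal ((t ^ (4 * m + 4) * mass (ball x t) (sflow F (Suc m) t)
        + t ^ (4 * m + 2) * mass (ball x t) (grad (sflow F m t))) / t ^ (?n + 1)) \<partial>lborel)
      \<le> (\<integral>\<^sup>+t\<in>{r..2*r}. ennreal (2 ^ (4 * m + 4) * \<kappa> * h t) \<partial>lborel)"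
    proof (rule nn_integral_mono)
      fix t
      show "ennreal ((t ^ (4 * m + 4) * mass (ball x t) (sflow F (Suc m) t)
        + t ^ (4 * m + 2) * mass (ball x t) (grad (sflow F m t))) / t ^ (?n + 1)) * indicator {r..<2*r} t
        \<le> ennreal (2 ^ (4 * m + 4) * \<kappa> * h t) * indicator {r..2*r} t"
        using 1[of t] by (cases "t \<in> {r..<2*r}") (auto intro!: ennreal_leI)
    qed
    also have "\<dots> = ennreal (integral {r..2*r} (\<lambda>t. 2 ^ (4 * m + 4) * \<kappa> * h t))"
      using r \<kappa> h0 by (intro nn_integral_continuous_interval continuous_intros continuous_on_subset[OF ch]) auto
    also have "\<dots> \<le> ennreal (2 ^ (4 * m + 4) * (C + 1) * integral {r/2..2*r} (\<lambda>t. \<kappa> * v t))"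
    proof (rule ennreal_leI)
      have iv: "0 \<le> integral {r/2..2*r} v"
        using v0 by (intro integral_nonneg integrable_continuous_real cv) auto
      have "integral {r..2*r} (\<lambda>t. 2 ^ (4 * m + 4) * \<kappa> * h t) = 2 ^ (4 * m + 4) * \<kappa> * integral {r..2*r} h" by simp
      also have "\<dots> \<le> 2 ^ (4 * m + 4) * \<kappa> * (C * integral {r/2..2*r} v)"
        unfolding h_def v_def using \<kappa> by (intro mult_left_mono est r) auto
      also have "\<dots> \<le> 2 ^ (4 * m + 4) * \<kappa> * ((C + 1) * integral {r/2..2*r} v)"
        using \<kappa> iv by (intro mult_left_mono mult_right_mono) auto
      finally show "integral {r..2*r} (\<lambda>t. 2 ^ (4 * m + 4) * \<kappa> * h t) \<le> 2 ^ (4 * m + 4) * (C + 1) * integral {r/2..2*r} (\<lambda>t. \<kappa> * v t)"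
        by (simp add: mult_ac)
    qed
    also have "\<dots> = ennreal (2 ^ (4 * m + 4) * (C + 1)) * (\<integral>\<^sup>+t\<in>{r/2..2*r}. ennreal (\<kappa> * v t) \<partial>lborel)"
    proof -
      have "(\<integral>\<^sup>+t\<in>{r/2..2*r}. ennreal (\<kappa> * v t) \<partial>lborel) = ennreal (integral {r/2..2*r} (\<lambda>t. \<kappa> * v t))"
        using \<kappa> v0 by (intro nn_integral_continuous_interval continuous_intros cv) auto
      moreover have "0 \<le> integral {r/2..2*r} (\<lambda>t. \<kappa> * v t)"
        using \<kappa> v0 by (intro integral_nonneg integrable_continuous_real continuous_intros cv) auto
      ultimately show ?thesis using C by (subst ennreal_mult) auto
    qed
    also have "(\<integral>\<^sup>+t\<in>{r/2..2*r}. ennreal (\<kappa> * v t) \<partial>lborel)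
      \<le> (\<integral>\<^sup>+t. ennreal (2 ^ (4 * m) * 2 ^ (?n + 1)) * (ennreal (w t) * indicator {r/2..2*r} t) \<partial>lborel)"
    proof (rule nn_integral_mono)
      fix t
      show "ennreal (\<kappa> * v t) * indicator {r/2..2*r} t \<le> ennreal (2 ^ (4 * m) * 2 ^ (?n + 1)) * (ennreal (w t) * indicator {r/2..2*r} t)"
      proof (cases "t \<in> {r/2..2*r}")
        case True
        then have "0 < t" using r by auto
        have "ennreal (\<kappa> * v t) \<le> ennreal ((2 ^ (4 * m) * 2 ^ (?n + 1)) * w t)"
          using 2[of t] True by (intro ennreal_leI) auto
        also have "\<dots> = ennreal (2 ^ (4 * m) * 2 ^ (?n + 1)) * ennreal (w t)"
          using w0[OF \<open>0 < t\<close>] by (intro ennreal_mult) auto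
        finally show ?thesis using True by simp
      qed simp
    qed
    also have "\<dots> = ennreal (2 ^ (4 * m) * 2 ^ (?n + 1)) * (\<integral>\<^sup>+t\<in>{r/2..2*r}. ennreal (w t) \<partial>lborel)"
    proof (rule nn_integral_cmult)
      have [measurable]: "(\<lambda>t. mass (ball x (9 * real ?n * t)) (sflow F m t)) \<in> borel_measurable borel"
        by (rule mass_line_measurable[OF continuous_sflow]) simp
      show "(\<lambda>t. ennreal (w t) * indicator {r/2..2*r} t) \<in> borel_measurable lborel"
        unfolding w_def by measurable
    qed
    finally have "(\<integral>\<^sup>+t\<in>{r..<2*r}. ennreal ((t ^ (4 * m + 4) * mass (ball x t) (sflow F (Suc m) t)
        + t ^ (4 * m + 2) * mass (ball x t) (grad (sflow F m t))) / t ^ (?n + 1)) \<partial>lborel)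
      \<le> ennreal (2 ^ (4 * m + 4) * (C + 1)) * (ennreal (2 ^ (4 * m) * 2 ^ (?n + 1)) * (\<integral>\<^sup>+t\<in>{r/2..2*r}. ennreal (w t) \<partial>lborel))"
      by (auto simp: mult_left_mono)
    also have "\<dots> = ennreal K * (\<integral>\<^sup>+t\<in>{r/2..2*r}. ennreal (w t) \<partial>lborel)"
    proof -
      have "ennreal K = ennreal (2 ^ (4 * m + 4) * (C + 1)) * ennreal (2 ^ (4 * m) * 2 ^ (?n + 1))"
        unfolding K_def using C by (intro ennreal_mult) auto
      then show ?thesis by (simp only: mult.assoc)
    qed
    finally show "(\<integral>\<^sup>+t\<in>{r..<2*r}. ennreal ((t ^ (4 * m + 4) * mass (ball x t) (sflow F (Suc m) t)
        + t ^ (4 * m + 2) * mass (ball x t) (grad (sflow F m t))) / t ^ (?n + 1)) \<partial>lborel)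
      \<le> ennreal K * (\<integral>\<^sup>+t\<in>{r/2..2*r}. ennreal (t ^ (4 * m) * mass (ball x (9 * real ?n * t)) (sflow F m t) / t ^ (?n + 1)) \<partial>lborel)"
      by (simp only: w_def)
  qed
qed

text \<open>For dyadic r the interval [r/2, 2 r] consists of two adjacent dyadic intervals, so
  summing over all scales counts the right side twice; hence the factor 2.\<close>

lemma cone_estimate:
  "\<exists>C>0. \<forall>F (x :: real^'n).
    (\<integral>\<^sup>+t\<in>{0<..}. ennreal ((t ^ (4 * m + 4) * mass (ball x t) (sflow F (Suc m) t)
        + t ^ (4 * m + 2) * mass (ball x t) (grad (sflow F m t))) / t ^ (CARD('n) + 1)) \<partial>lborel)
    \<le> ennreal C * area (9 * real CARD('n)) (\<lambda>t. t ^ (2 * m) *\<^sub>R sflow F m t) x"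
proof -
  let ?n = "CARD('n)"
  obtain C where C: "0 < C" and est: "\<And>F (x :: real^'n) r. 0 < r \<Longrightarrow>
    (\<integral>\<^sup>+t\<in>{r..<2*r}. ennreal ((t ^ (4 * m + 4) * mass (ball x t) (sflow F (Suc m) t)
        + t ^ (4 * m + 2) * mass (ball x t) (grad (sflow F m t))) / t ^ (?n + 1)) \<partial>lborel)
    \<le> ennreal C * (\<integral>\<^sup>+t\<in>{r/2..2*r}. ennreal (t ^ (4 * m) * mass (ball x (9 * real ?n * t)) (sflow F m t) / t ^ (?n + 1)) \<partial>lborel)"
    using dyadic_estimate[of m] by blast
  show ?thesis
  proof (rule exI[of _ "C * 2"], intro conjI allI)
    show "0 < C * 2" using C by simp
    fix F :: "('n, complex) l2" and x :: "real^'n"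
    define w where "w t = ennreal (t ^ (4 * m) * mass (ball x (9 * real ?n * t)) (sflow F m t) / t ^ (?n + 1))" for t
    define W where "W t = ennreal ((t ^ (4 * m + 4) * mass (ball x t) (sflow F (Suc m) t)
        + t ^ (4 * m + 2) * mass (ball x t) (grad (sflow F m t))) / t ^ (?n + 1))" for t
    have [measurable]: "w \<in> borel_measurable borel"
    proof -
      have [measurable]: "(\<lambda>t. mass (ball x (9 * real ?n * t)) (sflow F m t)) \<in> borel_measurable borel"
        by (rule mass_line_measurable[OF continuous_sflow]) simp
      show ?thesis unfolding w_def by measurable
    qed
    have [measurable]: "W \<in> borel_measurable borel"
    proof -
      have [measurable]: "(\<lambda>t. mass (ball x t) (sflow F (Suc m) t)) \<in> borel_measurable borel"
        using mass_line_measurable[OF continuous_sflow[of F "Suc m"], of 1 x] by simp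
      have [measurable]: "(\<lambda>t. mass (ball x t) (grad (sflow F m t))) \<in> borel_measurable borel"
        using mass_line_measurable[OF continuous_grad_sflow[of F m], of 1 x] by simp
      show ?thesis unfolding W_def by measurable
    qed
    have b1: "bij int_decode" by (rule bij_int_decode)
    have b2: "bij (\<lambda>i. int_decode i - 1)"
      using bij_comp[OF b1, of "\<lambda>k. k - 1"] bij_diff_right[of "1 :: int"] by (simp add: o_def)
    have split: "(\<integral>\<^sup>+t\<in>{2 powr real_of_int k / 2..2 * 2 powr real_of_int k}. w t \<partial>lborel) \<le>
        (\<integral>\<^sup>+t\<in>{2 powr real_of_int (k - 1)..<2 powr (real_of_int (k - 1) + 1)}. w t \<partial>lborel) +
        (\<integral>\<^sup>+t\<in>{2 powr real_of_int k..<2 powr (real_of_int k + 1)}. w t \<partial>lborel)" for k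
    proof -
      have e: "2 powr real_of_int k / 2 = 2 powr real_of_int (k - 1)" "2 powr (real_of_int (k - 1) + 1) = 2 powr real_of_int k"
        "2 * 2 powr real_of_int k = 2 powr (real_of_int k + 1)"
        by (simp_all add: powr_diff powr_add)
      let ?a = "2 powr real_of_int (k - 1)" and ?b = "2 powr real_of_int k" and ?c = "2 powr (real_of_int k + 1)"
      have "(\<integral>\<^sup>+t\<in>{?a..?c}. w t \<partial>lborel) \<le> (\<integral>\<^sup>+t. w t * indicator {?a..<?b} t + w t * indicator {?b..<?c} t \<partial>lborel)"
      proof (rule nn_integral_mono_AE)
        show "AE t in lborel. w t * indicator {?a..?c} t \<le> w t * indicator {?a..<?b} t + w t * indicator {?b..<?c} t"
          using AE_lborel_singleton[of ?c]
        proof eventually_elim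
          case (elim t)
          then show ?case by (cases "t < ?b") (auto simp: indicator_def)
        qed
      qed
      also have "\<dots> = (\<integral>\<^sup>+t\<in>{?a..<?b}. w t \<partial>lborel) + (\<integral>\<^sup>+t\<in>{?b..<?c}. w t \<partial>lborel)"
        by (rule nn_integral_add) measurable
      finally show ?thesis unfolding e .
    qed
    have "(\<integral>\<^sup>+t\<in>{0<..}. W t \<partial>lborel) = (\<Sum>i. \<integral>\<^sup>+t\<in>{2 powr of_int (int_decode i)..<2 powr (of_int (int_decode i) + 1)}. W t \<partial>lborel)"
      by (rule nn_integral_dyadic[OF _ b1]) measurable
    also have "\<dots> \<le> (\<Sum>i. ennreal C * ((\<integral>\<^sup>+t\<in>{2 powr of_int (int_decode i - 1)..<2 powr (of_int (int_decode i - 1) + 1)}. w t \<partial>lborel) +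
        (\<integral>\<^sup>+t\<in>{2 powr of_int (int_decode i)..<2 powr (of_int (int_decode i) + 1)}. w t \<partial>lborel)))"
    proof (rule suminf_le)
      fix i
      have e: "2 powr (real_of_int (int_decode i) + 1) = 2 * 2 powr real_of_int (int_decode i)" by (simp add: powr_add)
      have "(\<integral>\<^sup>+t\<in>{2 powr of_int (int_decode i)..<2 powr (of_int (int_decode i) + 1)}. W t \<partial>lborel) \<le>
          ennreal C * (\<integral>\<^sup>+t\<in>{2 powr of_int (int_decode i) / 2..2 * 2 powr of_int (int_decode i)}. w t \<partial>lborel)"
        unfolding e W_def w_def by (rule est) simp
      also have "\<dots> \<le> ennreal C * ((\<integral>\<^sup>+t\<in>{2 powr of_int (int_decode i - 1)..<2 powr (of_int (int_decode i - 1) + 1)}. w t \<partial>lborel) +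
        (\<integral>\<^sup>+t\<in>{2 powr of_int (int_decode i)..<2 powr (of_int (int_decode i) + 1)}. w t \<partial>lborel))"
        by (intro mult_left_mono split) simp
      finally show "(\<integral>\<^sup>+t\<in>{2 powr of_int (int_decode i)..<2 powr (of_int (int_decode i) + 1)}. W t \<partial>lborel) \<le>
          ennreal C * ((\<integral>\<^sup>+t\<in>{2 powr of_int (int_decode i - 1)..<2 powr (of_int (int_decode i - 1) + 1)}. w t \<partial>lborel) +
        (\<integral>\<^sup>+t\<in>{2 powr of_int (int_decode i)..<2 powr (of_int (int_decode i) + 1)}. w t \<partial>lborel))" .
    qed auto
    also have "\<dots> = ennreal C * ((\<Sum>i. \<integral>\<^sup>+t\<in>{2 powr of_int (int_decode i - 1)..<2 powr (of_int (int_decode i - 1) + 1)}. w t \<partial>lborel) +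
        (\<Sum>i. \<integral>\<^sup>+t\<in>{2 powr of_int (int_decode i)..<2 powr (of_int (int_decode i) + 1)}. w t \<partial>lborel))"
      unfolding ennreal_suminf_cmult by (subst suminf_add) auto
    also have "\<dots> = ennreal C * ((\<integral>\<^sup>+t\<in>{0<..}. w t \<partial>lborel) + (\<integral>\<^sup>+t\<in>{0<..}. w t \<partial>lborel))"
    proof -
      have "(\<integral>\<^sup>+t\<in>{0<..}. w t \<partial>lborel) = (\<Sum>i. \<integral>\<^sup>+t\<in>{2 powr of_int (int_decode i - 1)..<2 powr (of_int (int_decode i - 1) + 1)}. w t \<partial>lborel)"
        by (rule nn_integral_dyadic[OF _ b2]) measurable
      moreover have "(\<integral>\<^sup>+t\<in>{0<..}. w t \<partial>lborel) = (\<Sum>i. \<integral>\<^sup>+t\<in>{2 powr of_int (int_decode i)..<2 powr (of_int (int_decode i) + 1)}. w t \<partial>lborel)"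
        by (rule nn_integral_dyadic[OF _ b1]) measurable
      ultimately show ?thesis by (simp only:)
    qed
    also have "\<dots> = ennreal (C * 2) * (\<integral>\<^sup>+t\<in>{0<..}. w t \<partial>lborel)"
      using C by (simp add: ennreal_mult mult.assoc flip: mult_2)
    also have "(\<integral>\<^sup>+t\<in>{0<..}. w t \<partial>lborel) = area (9 * real ?n) (\<lambda>t. t ^ (2 * m) *\<^sub>R sflow F m t) x"
      unfolding area_def w_def
      by (intro nn_integral_cong) (simp add: mass_scaleR power_mult[symmetric] mult.commute)
    finally show "(\<integral>\<^sup>+t\<in>{0<..}. ennreal ((t ^ (4 * m + 4) * mass (ball x t) (sflow F (Suc m) t)
        + t ^ (4 * m + 2) * mass (ball x t) (grad (sflow F m t))) / t ^ (?n + 1)) \<partial>lborel)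
      \<le> ennreal (C * 2) * area (9 * real ?n) (\<lambda>t. t ^ (2 * m) *\<^sub>R sflow F m t) x"
      by (simp only: W_def)
  qed
qed

end


section \<open>Muckenhoupt weights define doubling measures\<close>

text \<open>Integrability is given on compact sets only; the weight is the pointwise limit of its
  restrictions to growing balls.\<close>

lemma weight_measurable:
  fixes w :: "real^'n \<Rightarrow> real"
  assumes "weight w" shows "w \<in> borel_measurable lebesgue"
proof (rule borel_measurable_LIMSEQ_real)
  fix k :: nat
  have "w absolutely_integrable_on cball 0 (real k)" using assms by (simp add: weight_def)
  then show "(\<lambda>x. indicat_real (cball 0 (real k)) x *\<^sub>R w x) \<in> borel_measurable lebesgue"
    unfolding set_integrable_def by (rule borel_measurable_integrable)
next
  fix x :: "real^'n"
  obtain N :: nat where N: "norm x \<le> real N" using real_arch_simple by blast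
  have "\<forall>\<^sub>F k in sequentially. indicat_real (cball 0 (real k)) x *\<^sub>R w x = w x"
    using eventually_ge_at_top[of N] by (rule eventually_mono) (use N in \<open>simp add: indicator_def\<close>)
  then show "(\<lambda>k. indicat_real (cball 0 (real k)) x *\<^sub>R w x) \<longlonglongrightarrow> w x"
    by (rule tendsto_eventually)
qed

lemma weight_finite:
  fixes w :: "real^'n \<Rightarrow> real"
  assumes "weight w" shows "(\<integral>\<^sup>+x\<in>ball z r. ennreal (w x) \<partial>lebesgue) < \<infinity>"
proof -
  have "integrable lebesgue (\<lambda>x. indicat_real (cball z r) x *\<^sub>R w x)"
    using assms unfolding weight_def set_integrable_def by (metis compact_cball)
  then have "(\<integral>\<^sup>+x. ennreal (norm (indicat_real (cball z r) x *\<^sub>R w x)) \<partial>lebesgue) < \<infinity>"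
    by (simp only: integrable_iff_bounded)
  moreover have "(\<integral>\<^sup>+x\<in>ball z r. ennreal (w x) \<partial>lebesgue) \<le>
      (\<integral>\<^sup>+x. ennreal (norm (indicat_real (cball z r) x *\<^sub>R w x)) \<partial>lebesgue)"
    by (intro nn_integral_mono) (auto simp: indicator_def intro: ennreal_leI)
  ultimately show ?thesis by (rule le_less_trans[rotated])
qed

lemma emeasure_lebesgue_ball:
  fixes z :: "real^'n"
  assumes "0 < r"
  obtains b where "0 < b" "emeasure lebesgue (ball z r) = ennreal b"
    "emeasure lebesgue (ball z (2 * r)) = ennreal (2 ^ CARD('n) * b)"
proof (rule that[of "measure lborel (ball z r)"])
  show "0 < measure lborel (ball z r)" using assms by (rule content_ball_pos)
  have f: "emeasure lebesgue (ball z s) = ennreal (measure lborel (ball z s))" for s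
    using emeasure_lborel_ball_finite[of z s] by (simp add: emeasure_eq_ennreal_measure)
  show "emeasure lebesgue (ball z r) = ennreal (measure lborel (ball z r))" by (rule f)
  have "measure lborel (ball z (2 * r)) = 2 ^ CARD('n) * measure lborel (ball z r)"
    using assms content_ball_conv_unit_ball[of "2 * r" z] content_ball_conv_unit_ball[of r z]
    by (simp add: power_mult_distrib)
  then show "emeasure lebesgue (ball z (2 * r)) = ennreal (2 ^ CARD('n) * measure lborel (ball z r))" by (simp add: f)
qed

lemma nn_integral_ball_pos:
  fixes g :: "real^'n \<Rightarrow> real"
  assumes r: "0 < r" and [measurable]: "g \<in> borel_measurable lebesgue" and g: "AE x in lebesgue. 0 < g x"
  shows "0 < (\<integral>\<^sup>+x\<in>ball z r. ennreal (g x) \<partial>lebesgue)"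
proof (rule ccontr)
  have [measurable]: "ball z r \<in> sets lebesgue" by simp
  assume "\<not> 0 < (\<integral>\<^sup>+x\<in>ball z r. ennreal (g x) \<partial>lebesgue)"
  then have "(\<integral>\<^sup>+x\<in>ball z r. ennreal (g x) \<partial>lebesgue) = 0" by (simp add: not_gr_zero)
  then have "AE x in lebesgue. ennreal (g x) * indicator (ball z r) x = 0"
    by (subst (asm) nn_integral_0_iff_AE) measurable
  with g have "AE x in lebesgue. x \<notin> ball z r"
    by eventually_elim (auto simp: indicator_def split: if_splits)
  then have "emeasure lebesgue (ball z r) = 0"
    by (subst (asm) AE_iff_measurable[of "ball z r"]) auto
  moreover obtain b where "0 < b" "emeasure lebesgue (ball z r) = ennreal b"
    using emeasure_lebesgue_ball[OF r] by metis
  ultimately show False by simp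
qed

text \<open>In place of Hoelder's inequality: \<open>1 \<le> \<tau> w + (\<tau> w)\<^bsup>-1/(p-1)\<^esup>\<close> for every \<open>\<tau> > 0\<close>.\<close>

lemma A_p_doubling:
  fixes w :: "real^'n \<Rightarrow> real"
  assumes w: "w \<in> A_p p" and p: "1 \<le> p"
  obtains D where "1 \<le> D" "\<And>z r. 0 < r \<Longrightarrow> (\<integral>\<^sup>+x\<in>ball z (2 * r). ennreal (w x) \<partial>lebesgue) \<le>
    ennreal D * (\<integral>\<^sup>+x\<in>ball z r. ennreal (w x) \<partial>lebesgue)"
proof -
  let ?n = "CARD('n)"
  obtain C0 :: real where wt: "weight w" and C0: "\<And>z r. 0 < r \<Longrightarrow>
     (if p = 1
      then (AE x in lebesgue. x \<in> ball z r \<longrightarrow> average (ball z r) w \<le> ennreal (C0 * w x))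
      else average (ball z r) w
             * ennreal_powr (average (ball z r) (\<lambda>x. w x powr (- 1 / (p - 1)))) (p - 1)
           \<le> ennreal C0)"
    using w unfolding A_p_def by blast
  \<comment> \<open>The constant in the definition of A_p is an arbitrary real, so a positive one is
    taken above it.\<close>
  define C where "C = \<bar>C0\<bar> + 1"
  have C: "0 < C" "C0 \<le> C" by (auto simp: C_def)
  have [measurable]: "w \<in> borel_measurable lebesgue" using wt by (rule weight_measurable)
  have [measurable]: "ball z r \<in> sets lebesgue" for z :: "real^'n" and r by simp
  have pos: "AE x in lebesgue. 0 < w x" using wt by (simp add: weight_def)
  define D where "D = C * 2 ^ (?n + 1) * (2 ^ (?n + 1)) powr (p - 1) + 1"
  have D: "1 \<le> D" using C by (simp add: D_def)
  show thesis
  proof (rule that[OF D])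
    fix z :: "real^'n" and r :: real assume r: "0 < r"
    obtain b where b: "0 < b" "emeasure lebesgue (ball z r) = ennreal b"
      "emeasure lebesgue (ball z (2 * r)) = ennreal (2 ^ ?n * b)"
      using emeasure_lebesgue_ball[OF r] by metis
    obtain \<beta> where \<beta>: "0 \<le> \<beta>" "(\<integral>\<^sup>+x\<in>ball z r. ennreal (w x) \<partial>lebesgue) = ennreal \<beta>"
      using weight_finite[OF wt, of z r] by (cases "\<integral>\<^sup>+x\<in>ball z r. ennreal (w x) \<partial>lebesgue") auto
    obtain \<gamma> where \<gamma>: "0 \<le> \<gamma>" "(\<integral>\<^sup>+x\<in>ball z (2 * r). ennreal (w x) \<partial>lebesgue) = ennreal \<gamma>"
      using weight_finite[OF wt, of z "2 * r"] by (cases "\<integral>\<^sup>+x\<in>ball z (2 * r). ennreal (w x) \<partial>lebesgue") auto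
    have \<gamma>_pos: "0 < \<gamma>" using nn_integral_ball_pos[of "2 * r" w z] r pos \<gamma> by simp
    have av: "average (ball z (2 * r)) w = ennreal (\<gamma> / (2 ^ ?n * b))"
      using b \<gamma> by (simp add: average_def divide_ennreal)
    have "\<gamma> \<le> D * \<beta>"
    proof (cases "p = 1")
      case True
      \<comment> \<open>For p = 1 the condition on the doubled ball bounds its average by C w almost
        everywhere; integrating this over the smaller ball gives doubling.\<close>
      have "ennreal (\<gamma> / (2 ^ ?n * b) * b) = (\<integral>\<^sup>+x\<in>ball z r. ennreal (\<gamma> / (2 ^ ?n * b)) \<partial>lebesgue)"
      proof -
        have "(\<integral>\<^sup>+x\<in>ball z r. ennreal (\<gamma> / (2 ^ ?n * b)) \<partial>lebesgue) = ennreal (\<gamma> / (2 ^ ?n * b)) * ennreal b"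
          unfolding b(2)[symmetric] by (rule nn_integral_cmult_indicator) simp
        moreover have "ennreal (\<gamma> / (2 ^ ?n * b) * b) = ennreal (\<gamma> / (2 ^ ?n * b)) * ennreal b"
          using b \<gamma> by (intro ennreal_mult) auto
        ultimately show ?thesis by (simp only:)
      qed
      also have "\<dots> \<le> (\<integral>\<^sup>+x. ennreal C * (ennreal (w x) * indicator (ball z r) x) \<partial>lebesgue)"
      proof (rule nn_integral_mono_AE)
        have "AE x in lebesgue. x \<in> ball z (2 * r) \<longrightarrow> average (ball z (2 * r)) w \<le> ennreal (C0 * w x)"
          using C0[of "2 * r" z] r True by simp
        with pos show "AE x in lebesgue. ennreal (\<gamma> / (2 ^ ?n * b)) * indicator (ball z r) x \<le>
            ennreal C * (ennreal (w x) * indicator (ball z r) x)"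
        proof eventually_elim
          case (elim x)
          show ?case
          proof (cases "x \<in> ball z r")
            case x: True
            then have "x \<in> ball z (2 * r)" using r by simp
            then have "ennreal (\<gamma> / (2 ^ ?n * b)) \<le> ennreal (C0 * w x)" using elim av by simp
            also have "\<dots> \<le> ennreal (C * w x)" using C elim by (intro ennreal_leI mult_right_mono) auto
            also have "\<dots> = ennreal C * ennreal (w x)" using C elim by (intro ennreal_mult) auto
            finally show ?thesis using x by simp
          qed simp
        qed
      qed
      also have "\<dots> = ennreal C * ennreal \<beta>"
        unfolding \<beta>(2)[symmetric] by (rule nn_integral_cmult) measurable
      also have "\<dots> = ennreal (C * \<beta>)" using C \<beta> by (simp add: ennreal_mult)
      finally have "\<gamma> / (2 ^ ?n * b) * b \<le> C * \<beta>" using C \<beta> by (simp add: ennreal_le_iff)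
      then have "\<gamma> \<le> C * 2 ^ ?n * \<beta>" using b by (simp add: field_simps)
      also have "\<dots> \<le> C * 2 ^ (?n + 1) * \<beta>" using C \<beta> by (intro mult_right_mono mult_left_mono power_increasing) auto
      also have "\<dots> \<le> D * \<beta>" using \<beta> True by (intro mult_right_mono) (auto simp: D_def)
      finally show ?thesis .
    next
      case False
      then have p1: "1 < p" using p by simp
      define \<sigma> where "\<sigma> x = w x powr (- 1 / (p - 1))" for x
      have [measurable]: "\<sigma> \<in> borel_measurable lebesgue" unfolding \<sigma>_def by measurable
      have s_pos: "0 < (\<integral>\<^sup>+x\<in>ball z (2 * r). ennreal (\<sigma> x) \<partial>lebesgue)"
      proof (rule nn_integral_ball_pos)
        show "AE x in lebesgue. 0 < \<sigma> x" using pos by eventually_elim (simp add: \<sigma>_def)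
      qed (use r in auto)
      have Ap: "ennreal (\<gamma> / (2 ^ ?n * b)) * ennreal_powr ((\<integral>\<^sup>+x\<in>ball z (2 * r). ennreal (\<sigma> x) \<partial>lebesgue) / ennreal (2 ^ ?n * b)) (p - 1)
          \<le> ennreal C0"
        using C0[of "2 * r" z] r False by (simp add: av[symmetric] b(3)[symmetric] average_def[of _ "\<lambda>x. w x powr _"] \<sigma>_def)
      \<comment> \<open>The dual weight has a finite integral: otherwise the left side of
        \<open>Ap\<close> would be infinite, as gamma is positive.\<close>
      obtain s where s: "0 < s" "(\<integral>\<^sup>+x\<in>ball z (2 * r). ennreal (\<sigma> x) \<partial>lebesgue) = ennreal s"
      proof (cases "\<integral>\<^sup>+x\<in>ball z (2 * r). ennreal (\<sigma> x) \<partial>lebesgue")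
        case (real s)
        then show thesis using s_pos by (intro that[of s]) auto
      next
        case top
        have False using Ap \<gamma>_pos b(1) unfolding top by (simp add: ennreal_mult_top ennreal_top_divide top_unique)
        then show thesis ..
      qed
      define X where "X = (s / (2 ^ ?n * b)) powr (p - 1)"
      have X: "0 < X" using s b by (simp add: X_def)
      have "ennreal s / ennreal (2 ^ ?n * b) = ennreal (s / (2 ^ ?n * b))"
        using s b by (intro divide_ennreal) auto
      then have "ennreal_powr (ennreal s / ennreal (2 ^ ?n * b)) (p - 1) = ennreal X"
        using s b by (simp only: X_def) (rule ennreal_powr_ennreal, simp)
      then have "ennreal (\<gamma> / (2 ^ ?n * b)) * ennreal X \<le> ennreal C0"
        using Ap by (simp only: s(2))
      moreover have "ennreal (\<gamma> / (2 ^ ?n * b) * X) = ennreal (\<gamma> / (2 ^ ?n * b)) * ennreal X"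
        using b \<gamma> X by (intro ennreal_mult) auto
      ultimately have "ennreal (\<gamma> / (2 ^ ?n * b) * X) \<le> ennreal C0" by (simp only:)
      also have "\<dots> \<le> ennreal C" using C by (intro ennreal_leI) auto
      finally have "\<gamma> / (2 ^ ?n * b) * X \<le> C" using C by (simp add: ennreal_le_iff)
      then have 1: "\<gamma> * X \<le> C * 2 ^ ?n * b" using b by (simp add: field_simps)
      \<comment> \<open>Chosen so that tau^(-1/(p-1)) times the integral s of the dual weight equals
        b/2, half of the Lebesgue measure of the ball; the other half must then come from tau
        w.\<close>
      define \<tau> where "\<tau> = (2 * s / b) powr (p - 1)"
      have \<tau>: "0 < \<tau>" using s b by (simp add: \<tau>_def)
      have \<tau>X: "\<tau> = (2 ^ (?n + 1)) powr (p - 1) * X"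
      proof -
        have e: "2 * s / b = 2 ^ (?n + 1) * (s / (2 ^ ?n * b))" using b by (simp add: field_simps)
        show ?thesis unfolding \<tau>_def X_def e by (rule powr_mult)
      qed
      have \<tau>s: "\<tau> powr (- 1 / (p - 1)) * s = b / 2"
      proof -
        have "\<tau> powr (- 1 / (p - 1)) = (2 * s / b) powr (- 1)" using p1 by (simp add: \<tau>_def powr_powr)
        also have "\<dots> = b / (2 * s)" using s b by (simp add: powr_minus)
        finally show ?thesis using s by simp
      qed
      have "ennreal b = (\<integral>\<^sup>+x\<in>ball z r. 1 \<partial>lebesgue)" using b by simp
      also have "\<dots> \<le> (\<integral>\<^sup>+x. ennreal \<tau> * (ennreal (w x) * indicator (ball z r) x)
          + ennreal (\<tau> powr (- 1 / (p - 1))) * (ennreal (\<sigma> x) * indicator (ball z (2 * r)) x) \<partial>lebesgue)"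
      proof (rule nn_integral_mono_AE)
        show "AE x in lebesgue. 1 * indicator (ball z r) x \<le> ennreal \<tau> * (ennreal (w x) * indicator (ball z r) x)
          + ennreal (\<tau> powr (- 1 / (p - 1))) * (ennreal (\<sigma> x) * indicator (ball z (2 * r)) x)"
          using pos
        proof eventually_elim
          case (elim x)
          show ?case
          proof (cases "x \<in> ball z r")
            case True
            then have x2: "x \<in> ball z (2 * r)" using r by simp
            have "1 \<le> \<tau> * w x + \<tau> powr (- 1 / (p - 1)) * \<sigma> x"
            proof (cases "1 \<le> \<tau> * w x")
              case True
              then show ?thesis by (simp add: \<sigma>_def add_increasing2)
            next
              case F: False
              have "1 powr (1 / (p - 1)) \<le> (1 / (\<tau> * w x)) powr (1 / (p - 1))"
                using F \<tau> elim p1 by (intro powr_mono2) (auto simp: divide_simps)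
              also have "\<dots> = (\<tau> * w x) powr (- 1 / (p - 1))"
                by (simp add: powr_minus_divide powr_divide)
              also have "\<dots> = \<tau> powr (- 1 / (p - 1)) * \<sigma> x" using \<tau> elim by (simp add: \<sigma>_def powr_mult)
              finally show ?thesis using \<tau> elim by (simp add: add_increasing)
            qed
            then have "ennreal 1 \<le> ennreal (\<tau> * w x + \<tau> powr (- 1 / (p - 1)) * \<sigma> x)" by (rule ennreal_leI)
            also have "\<dots> = ennreal \<tau> * ennreal (w x) + ennreal (\<tau> powr (- 1 / (p - 1))) * ennreal (\<sigma> x)"
              using \<tau> elim by (simp add: ennreal_plus ennreal_mult \<sigma>_def)
            finally show ?thesis using True x2 by simp
          qed simp
        qed
      qed
      also have "\<dots> = ennreal \<tau> * ennreal \<beta> + ennreal (\<tau> powr (- 1 / (p - 1))) * ennreal s"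
        unfolding \<beta>(2)[symmetric] s(2)[symmetric]
        by (subst nn_integral_add) (simp_all add: nn_integral_cmult)
      also have "\<dots> = ennreal (\<tau> * \<beta> + b / 2)"
        using \<tau> \<beta> s b \<tau>s by (simp add: ennreal_mult[symmetric] ennreal_plus[symmetric] del: ennreal_plus)
      finally have "b \<le> \<tau> * \<beta> + b / 2" using b \<tau> \<beta> by (subst (asm) ennreal_le_iff) auto
      then have 2: "b \<le> 2 * \<tau> * \<beta>" by simp
      have "\<gamma> * X \<le> C * 2 ^ ?n * (2 * \<tau> * \<beta>)"
        by (rule order_trans[OF 1 mult_left_mono[OF 2]]) (use C in simp)
      also have "\<dots> = (C * 2 ^ (?n + 1) * (2 ^ (?n + 1)) powr (p - 1) * \<beta>) * X" by (simp add: \<tau>X)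
      finally have "\<gamma> \<le> C * 2 ^ (?n + 1) * (2 ^ (?n + 1)) powr (p - 1) * \<beta>"
        by (rule mult_right_le_imp_le) (rule X)
      also have "\<dots> \<le> D * \<beta>" using \<beta> by (intro mult_right_mono) (auto simp: D_def)
      finally show ?thesis .
    qed
    then show "(\<integral>\<^sup>+x\<in>ball z (2 * r). ennreal (w x) \<partial>lebesgue) \<le> ennreal D * (\<integral>\<^sup>+x\<in>ball z r. ennreal (w x) \<partial>lebesgue)"
      unfolding \<beta>(2) \<gamma>(2) using D \<beta> by (simp add: ennreal_mult[symmetric] ennreal_leI)
  qed
qed

text \<open>The maximal function theory works with Borel sets, so w is replaced by a Borel function
  equal to it almost everywhere. Integrals of Borel functions against w do not change.\<close>

lemma A_infinity_doubling_measure: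
  fixes w :: "real^'n \<Rightarrow> real"
  assumes w: "w \<in> A_infinity"
  obtains \<mu> D where "doubling_measure \<mu> D"
    "\<And>g. g \<in> borel_measurable borel \<Longrightarrow> (\<integral>\<^sup>+x. g x * ennreal (w x) \<partial>lebesgue) = (\<integral>\<^sup>+x. g x \<partial>\<mu>)"
proof -
  obtain p where p: "1 \<le> p" and wp: "w \<in> A_p p" using w by (auto simp: A_infinity_def)
  then have wt: "weight w" by (simp add: A_p_def)
  have wm [measurable]: "w \<in> borel_measurable lebesgue" using wt by (rule weight_measurable)
  have "(\<lambda>x. ennreal (w x)) \<in> borel_measurable (completion lborel)" by measurable
  then obtain h where h [measurable]: "h \<in> borel_measurable lborel" and hw: "AE x in lborel. ennreal (w x) = h x"
    using completion_ex_borel_measurable by blast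
  define \<mu> where "\<mu> = density lborel h"
  have I: "(\<integral>\<^sup>+x. g x * ennreal (w x) \<partial>lebesgue) = (\<integral>\<^sup>+x. g x \<partial>\<mu>)" if [measurable]: "g \<in> borel_measurable borel" for g
  proof -
    have "(\<integral>\<^sup>+x. g x \<partial>\<mu>) = (\<integral>\<^sup>+x. h x * g x \<partial>lborel)"
      unfolding \<mu>_def by (rule nn_integral_density) measurable
    also have "\<dots> = (\<integral>\<^sup>+x. g x * ennreal (w x) \<partial>lborel)"
    proof (rule nn_integral_cong_AE)
      show "AE x in lborel. h x * g x = g x * ennreal (w x)"
        using hw by eventually_elim (simp add: mult.commute)
    qed
    finally show ?thesis by (simp only: nn_integral_completion)
  qed
  have e: "emeasure \<mu> (ball z r) = (\<integral>\<^sup>+x\<in>ball z r. ennreal (w x) \<partial>lebesgue)" for z r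
  proof -
    have "(\<integral>\<^sup>+x. indicator (ball z r) x * ennreal (w x) \<partial>lebesgue) = (\<integral>\<^sup>+x. indicator (ball z r) x \<partial>\<mu>)"
      by (rule I) (auto intro: borel_measurable_indicator)
    then show ?thesis by (simp add: \<mu>_def mult.commute)
  qed
  obtain D where D: "1 \<le> D" and dbl: "\<And>z r. 0 < r \<Longrightarrow> (\<integral>\<^sup>+x\<in>ball z (2 * r). ennreal (w x) \<partial>lebesgue) \<le>
    ennreal D * (\<integral>\<^sup>+x\<in>ball z r. ennreal (w x) \<partial>lebesgue)"
    using A_p_doubling[OF wp p] by blast
  show thesis
  proof (rule that[OF _ I])
    show "doubling_measure \<mu> D"
    proof
      show "sets \<mu> = sets borel" by (simp add: \<mu>_def)
      show "1 \<le> D" by (rule D)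
      show "emeasure \<mu> (ball z r) < \<infinity>" for z r unfolding e by (rule weight_finite[OF wt])
      show "0 < emeasure \<mu> (ball z r)" if "0 < r" for z r
        unfolding e by (rule nn_integral_ball_pos[OF that wm]) (use wt in \<open>simp add: weight_def\<close>)
      show "emeasure \<mu> (ball z (2 * r)) \<le> ennreal D * emeasure \<mu> (ball z r)" if "0 < r" for z r
        unfolding e by (rule dbl[OF that])
    qed
  qed
qed


section \<open>Comparison of the square functions\<close>

lemma nn_integral_mass_cls:
  fixes g :: "real^'n \<Rightarrow> 'b::euclidean_space"
  assumes "S \<in> sets lebesgue" "g \<in> L2"
  shows "(\<integral>\<^sup>+y\<in>S. ennreal ((norm (g y))\<^sup>2) \<partial>lebesgue) = ennreal (mass S (cls g))"
  unfolding nn_integral_mass[OF assms(1), symmetric]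
proof (rule nn_integral_cong_AE)
  show "AE y in lebesgue. ennreal ((norm (g y))\<^sup>2) * indicator S y = ennreal ((norm (rep (cls g) y))\<^sup>2) * indicator S y"
    using rep_cls[OF assms(2)] by eventually_elim simp
qed

lemma weighted_norm_mono:
  assumes "\<And>x. g x \<le> h x" "0 < p" shows "weighted_norm p w g \<le> weighted_norm p w h"
  unfolding weighted_norm_def
  using assms by (intro ennreal_powr_mono nn_integral_mono mult_right_mono) auto

text \<open>\<open>area\<close> is already a square, so the change of aperture is applied with the
  exponent p/2; the root 1/p is taken of the constant as well.\<close>

lemma weighted_area_le:
  fixes w :: "real^'n \<Rightarrow> real"
  assumes w: "w \<in> A_infinity" and p: "0 < p" and a: "1 \<le> a" and K: "0 < K"
  shows "\<exists>C>0. \<forall>H :: real \<Rightarrow> ('n, 'b::euclidean_space) l2. continuous_on {0<..} H \<longrightarrow>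
    weighted_norm p w (\<lambda>x. ennreal_powr (ennreal K * area a H x) (1 / 2))
      \<le> ennreal C * weighted_norm p w (\<lambda>x. ennreal_powr (area 1 H x) (1 / 2))"
proof -
  obtain \<mu> D where dm: "doubling_measure \<mu> D"
    and I: "\<And>g. g \<in> borel_measurable borel \<Longrightarrow> (\<integral>\<^sup>+x. g x * ennreal (w x) \<partial>lebesgue) = (\<integral>\<^sup>+x. g x \<partial>\<mu>)"
    using A_infinity_doubling_measure[OF w] by blast
  interpret doubling_measure \<mu> D by (rule dm)
  have q: "0 < p / 2" using p by simp
  obtain C where C: "0 < C" and ca: "\<And>g. tent \<mu> D g \<Longrightarrow>
    (\<integral>\<^sup>+x. ennreal_powr (tent.N g a x) (p / 2) \<partial>\<mu>) \<le> ennreal C * (\<integral>\<^sup>+x. ennreal_powr (tent.N g 1 x) (p / 2) \<partial>\<mu>)"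
    using change_of_aperture[OF a q] by metis
  define C' where "C' = K powr (p / 2) * C"
  have C': "0 < C'" using K C by (simp add: C'_def)
  show ?thesis
  proof (rule exI[of _ "C' powr (1 / p)"], intro conjI allI impI)
    show "0 < C' powr (1 / p)" using C' by simp
    fix H :: "real \<Rightarrow> ('n, 'b) l2" assume H: "continuous_on {0<..} H"
    note t = tent_area[OF H dm]
    have am: "area b H \<in> borel_measurable borel" if "0 < b" for b
      using tent.N_meas[OF t(1) that] t(2)[OF that] by (simp only:)
    have m [measurable]: "area a H \<in> borel_measurable borel" "area 1 H \<in> borel_measurable borel"
      using a by (auto intro!: am)
    have wn: "weighted_norm p w (\<lambda>x. ennreal_powr (h x) (1 / 2)) = ennreal_powr (\<integral>\<^sup>+x. ennreal_powr (h x) (p / 2) \<partial>\<mu>) (1 / p)"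
      if [measurable]: "h \<in> borel_measurable borel" for h
    proof -
      have "(\<integral>\<^sup>+x. ennreal_powr (h x) (p / 2) * ennreal (w x) \<partial>lebesgue) = (\<integral>\<^sup>+x. ennreal_powr (h x) (p / 2) \<partial>\<mu>)"
        by (rule I) measurable
      then show ?thesis by (simp add: weighted_norm_def ennreal_powr_powr)
    qed
    have "(\<integral>\<^sup>+x. ennreal_powr (ennreal K * area a H x) (p / 2) \<partial>\<mu>) =
        ennreal (K powr (p / 2)) * (\<integral>\<^sup>+x. ennreal_powr (area a H x) (p / 2) \<partial>\<mu>)"
      unfolding ennreal_powr_cmult[OF K] by (rule nn_integral_cmult) measurable
    also have "\<dots> \<le> ennreal (K powr (p / 2)) * (ennreal C * (\<integral>\<^sup>+x. ennreal_powr (area 1 H x) (p / 2) \<partial>\<mu>))"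
    proof (rule mult_left_mono)
      have "0 < a" using a by simp
      then show "(\<integral>\<^sup>+x. ennreal_powr (area a H x) (p / 2) \<partial>\<mu>) \<le> ennreal C * (\<integral>\<^sup>+x. ennreal_powr (area 1 H x) (p / 2) \<partial>\<mu>)"
        using ca[OF t(1)] by (simp only: t(2) zero_less_one)
    qed simp
    also have "\<dots> = ennreal C' * (\<integral>\<^sup>+x. ennreal_powr (area 1 H x) (p / 2) \<partial>\<mu>)"
    proof -
      have "ennreal C' = ennreal (K powr (p / 2)) * ennreal C" unfolding C'_def using C by (intro ennreal_mult) auto
      then show ?thesis by (simp only: mult.assoc)
    qed
    finally have le: "(\<integral>\<^sup>+x. ennreal_powr (ennreal K * area a H x) (p / 2) \<partial>\<mu>) \<le>
        ennreal C' * (\<integral>\<^sup>+x. ennreal_powr (area 1 H x) (p / 2) \<partial>\<mu>)" .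
    have "weighted_norm p w (\<lambda>x. ennreal_powr (ennreal K * area a H x) (1 / 2)) =
        ennreal_powr (\<integral>\<^sup>+x. ennreal_powr (ennreal K * area a H x) (p / 2) \<partial>\<mu>) (1 / p)"
      by (rule wn) measurable
    also have "\<dots> \<le> ennreal_powr (ennreal C' * (\<integral>\<^sup>+x. ennreal_powr (area 1 H x) (p / 2) \<partial>\<mu>)) (1 / p)"
      using p by (intro ennreal_powr_mono le) auto
    also have "\<dots> = ennreal (C' powr (1 / p)) * ennreal_powr (\<integral>\<^sup>+x. ennreal_powr (area 1 H x) (p / 2) \<partial>\<mu>) (1 / p)"
      by (rule ennreal_powr_cmult[OF C'])
    also have "ennreal_powr (\<integral>\<^sup>+x. ennreal_powr (area 1 H x) (p / 2) \<partial>\<mu>) (1 / p) = weighted_norm p w (\<lambda>x. ennreal_powr (area 1 H x) (1 / 2))"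
      by (rule wn[OF m(2), symmetric])
    finally show "weighted_norm p w (\<lambda>x. ennreal_powr (ennreal K * area a H x) (1 / 2))
      \<le> ennreal (C' powr (1 / p)) * weighted_norm p w (\<lambda>x. ennreal_powr (area 1 H x) (1 / 2))" .
  qed
qed

context heat
begin

section \<open>The square functions of the heat semigroup\<close>

definition heat_path :: "('n, complex) l2 \<Rightarrow> nat \<Rightarrow> real \<Rightarrow> ('n, complex) l2" where
  "heat_path F m t = t ^ (2 * m) *\<^sub>R sflow F m t"

lemma heat_family_path:
  assumes "f \<in> L2" "0 < t"
  shows "heat_family A T m f t \<in> L2" "cls (heat_family A T m f t) = heat_path (cls f) m t"
  using heat_family_flow[OF assms, of m] by (simp_all add: heat_path_def sflow_def)

lemma continuous_heat_path: "continuous_on {0<..} (heat_path F m)"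
  unfolding heat_path_def by (intro continuous_intros continuous_sflow)

lemma has_vector_derivative_heat_path:
  assumes "0 < t"
  shows "(heat_path F m has_vector_derivative
    (2 * real m * t ^ (2 * m - 1)) *\<^sub>R sflow F m t - (2 * t ^ (2 * m + 1)) *\<^sub>R sflow F (Suc m) t) (at t)"
proof -
  have "((\<lambda>t. t ^ (2 * m)) has_field_derivative real (2 * m) * t ^ (2 * m - 1)) (at t)"
    using DERIV_pow[of "2 * m" t UNIV] by simp
  from has_vector_derivative_scaleR[OF this has_vector_derivative_sflow[OF assms, of F m]]
  have "(heat_path F m has_vector_derivative
    t ^ (2 * m) *\<^sub>R (- (2 * t) *\<^sub>R sflow F (Suc m) t) + (real (2 * m) * t ^ (2 * m - 1)) *\<^sub>R sflow F m t) (at t)"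
    unfolding heat_path_def[abs_def] .
  then show ?thesis by (simp add: algebra_simps)
qed

text \<open>The quotients in the L2 norm are quotients in the Hilbert space of classes as soon as t
  + h > 0, so the derivative picked by \<open>time_deriv\<close> is unique up to null sets.\<close>

lemma has_time_deriv_heat_family:
  assumes f: "f \<in> L2" and t: "0 < t"
  shows "has_time_deriv (heat_family A T m f) v t \<longleftrightarrow>
    v \<in> L2 \<and> (heat_path (cls f) m has_vector_derivative cls v) (at t)"
proof (cases "v \<in> L2")
  case v: True
  let ?u = "heat_family A T m f" and ?H = "heat_path (cls f) m"
  have ev: "\<forall>\<^sub>F h in at 0. L2_norm (\<lambda>y. (?u (t + h) y - ?u t y) /\<^sub>R h - v y) = norm ((?H (t + h) - ?H t) /\<^sub>R h - cls v)"
    unfolding eventually_at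
  proof (intro exI[of _ t] conjI ballI impI)
    fix h :: real assume "h \<noteq> 0 \<and> dist h 0 < t"
    then have th: "0 < t + h" by (auto simp: dist_real_def)
    have d: "(\<lambda>y. ?u (t + h) y - ?u t y) \<in> L2"
      by (intro L2_diff heat_family_path f t th)
    have e: "cls (\<lambda>y. (?u (t + h) y - ?u t y) /\<^sub>R h - v y) = (?H (t + h) - ?H t) /\<^sub>R h - cls v"
      unfolding heat_family_path(2)[OF f t, symmetric] heat_family_path(2)[OF f th, symmetric]
        cls_diff[OF heat_family_path(1)[OF f th] heat_family_path(1)[OF f t]] cls_scaleR[OF d] cls_diff[OF L2_scaleR[OF d] v] ..
    show "L2_norm (\<lambda>y. (?u (t + h) y - ?u t y) /\<^sub>R h - v y) = norm ((?H (t + h) - ?H t) /\<^sub>R h - cls v)"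
      unfolding e[symmetric] by (rule norm_cls[symmetric]) (intro L2_diff L2_scaleR d v)
  qed (rule t)
  have "has_time_deriv ?u v t \<longleftrightarrow> ((\<lambda>h. norm ((?H (t + h) - ?H t) /\<^sub>R h - cls v)) \<longlongrightarrow> 0) (at 0)"
    unfolding has_time_deriv_def using v tendsto_cong[OF ev] by blast
  also have "\<dots> \<longleftrightarrow> ((\<lambda>h. (?H (t + h) - ?H t) /\<^sub>R h) \<longlongrightarrow> cls v) (at 0)"
    unfolding tendsto_norm_zero_iff LIM_zero_iff ..
  also have "\<dots> \<longleftrightarrow> (?H has_vector_derivative cls v) (at t)"
    by (rule has_vector_derivative_difference_quotient[symmetric])
  finally show ?thesis using v by simp
qed (simp add: has_time_deriv_def)

lemma time_deriv_heat_family: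
  assumes f: "f \<in> L2" and t: "0 < t"
  shows "time_deriv (heat_family A T m f) t \<in> L2"
    "cls (time_deriv (heat_family A T m f) t) =
      (2 * real m * t ^ (2 * m - 1)) *\<^sub>R sflow (cls f) m t - (2 * t ^ (2 * m + 1)) *\<^sub>R sflow (cls f) (Suc m) t"
proof -
  let ?u = "heat_family A T m f"
  have "has_time_deriv ?u (rep ((2 * real m * t ^ (2 * m - 1)) *\<^sub>R sflow (cls f) m t - (2 * t ^ (2 * m + 1)) *\<^sub>R sflow (cls f) (Suc m) t)) t"
    using has_vector_derivative_heat_path[OF t] by (simp add: has_time_deriv_heat_family[OF f t])
  then have "has_time_deriv ?u (time_deriv ?u t) t" unfolding time_deriv_def by (rule someI[where P = "\<lambda>v. has_time_deriv ?u v t"])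
  then have "time_deriv ?u t \<in> L2" "(heat_path (cls f) m has_vector_derivative cls (time_deriv ?u t)) (at t)"
    by (simp_all add: has_time_deriv_heat_family[OF f t])
  then show "time_deriv ?u t \<in> L2" "cls (time_deriv ?u t) =
      (2 * real m * t ^ (2 * m - 1)) *\<^sub>R sflow (cls f) m t - (2 * t ^ (2 * m + 1)) *\<^sub>R sflow (cls f) (Suc m) t"
    using vector_derivative_unique_at[OF _ has_vector_derivative_heat_path[OF t]] by blast+
qed

lemma weak_gradient_heat_family:
  assumes f: "f \<in> L2" and t: "0 < t"
  shows "weak_gradient (heat_family A T m f t) \<in> L2"
    "cls (weak_gradient (heat_family A T m f t)) = t ^ (2 * m) *\<^sub>R grad (sflow (cls f) m t)"
proof -
  let ?u = "heat_family A T m f t"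
  note D = grad_scaleR[OF sflow_form(1)[OF t, of "cls f" m], of "t ^ (2 * m)"]
  have W: "?u \<in> W12"
    using D(1) heat_family_path[OF f t, of m] by (intro form_domain_cong) (simp_all add: heat_path_def)
  show "weak_gradient ?u \<in> L2" using W by (rule weak_gradient_L2)
  show "cls (weak_gradient ?u) = t ^ (2 * m) *\<^sub>R grad (sflow (cls f) m t)"
    using grad_cls(2)[OF W] D(2) heat_family_path(2)[OF f t, of m] by (simp add: heat_path_def)
qed

lemma S_H_area: "f \<in> L2 \<Longrightarrow> S_H A T m f = (\<lambda>x. ennreal_powr (area 1 (heat_path (cls f) m) x) (1 / 2))"
  unfolding S_H_def by (rule ext, rule conical_eq_area) (simp_all add: heat_family_path)

text \<open>Keeps the first summand of \<open>cone_estimate\<close>: the weight t^(4m+4) is the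
  square of the factor t^(2(m+1)) in \<open>heat_path\<close>.\<close>

lemma S_H_Suc_le:
  "\<exists>C>0. \<forall>f\<in>L2. \<forall>x. S_H A T (Suc m) f x \<le>
    ennreal_powr (ennreal C * area (9 * real CARD('n)) (heat_path (cls f) m) x) (1 / 2)"
proof -
  obtain C where C: "0 < C" and est: "\<And>F (x :: real^'n).
    (\<integral>\<^sup>+t\<in>{0<..}. ennreal ((t ^ (4 * m + 4) * mass (ball x t) (sflow F (Suc m) t)
        + t ^ (4 * m + 2) * mass (ball x t) (grad (sflow F m t))) / t ^ (CARD('n) + 1)) \<partial>lborel)
    \<le> ennreal C * area (9 * real CARD('n)) (heat_path F m) x"
    using cone_estimate[of m] unfolding heat_path_def[abs_def] by blast
  show ?thesis
  proof (intro exI[of _ C] conjI C ballI allI)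
    fix f :: "real^'n \<Rightarrow> complex" and x :: "real^'n" assume f: "f \<in> L2"
    let ?F = "cls f"
    have "area 1 (heat_path ?F (Suc m)) x \<le> (\<integral>\<^sup>+t\<in>{0<..}. ennreal ((t ^ (4 * m + 4) * mass (ball x t) (sflow ?F (Suc m) t)
        + t ^ (4 * m + 2) * mass (ball x t) (grad (sflow ?F m t))) / t ^ (CARD('n) + 1)) \<partial>lborel)"
      unfolding area_def
    proof (rule nn_integral_mono)
      fix t :: real
      have "mass (ball x (1 * t)) (heat_path ?F (Suc m) t) = t ^ (4 * m + 4) * mass (ball x t) (sflow ?F (Suc m) t)"
      proof -
        have "(t ^ (2 * Suc m))\<^sup>2 = t ^ (4 * m + 4)"
          unfolding power_mult[symmetric] by (rule arg_cong[where f = "power t"]) simp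
        then show ?thesis unfolding heat_path_def by (subst mass_scaleR) simp_all
      qed
      then show "ennreal (mass (ball x (1 * t)) (heat_path ?F (Suc m) t) / t ^ (CARD('n) + 1)) * indicator {0<..} t \<le>
        ennreal ((t ^ (4 * m + 4) * mass (ball x t) (sflow ?F (Suc m) t)
        + t ^ (4 * m + 2) * mass (ball x t) (grad (sflow ?F m t))) / t ^ (CARD('n) + 1)) * indicator {0<..} t"
        by (auto simp: indicator_def intro!: ennreal_leI divide_right_mono)
    qed
    also have "\<dots> \<le> ennreal C * area (9 * real CARD('n)) (heat_path ?F m) x" by (rule est)
    finally show "S_H A T (Suc m) f x \<le> ennreal_powr (ennreal C * area (9 * real CARD('n)) (heat_path ?F m) x) (1 / 2)"
      unfolding S_H_area[OF f] by (rule ennreal_powr_mono) simp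
  qed
qed

text \<open>The time derivative of t^(2m) u_m, multiplied by t, is 2 m times the path of level m
  minus twice that of level m + 1. The first part is bounded by widening the cone, the second
  together with the gradient by \<open>cone_estimate\<close>. Squaring the difference costs a factor
  2, which gives 8 C and 8 m^2.\<close>

lemma G_full_H_le:
  "\<exists>C>0. \<forall>f\<in>L2. \<forall>x. G_full_H A T m f x \<le>
    ennreal_powr (ennreal C * area (9 * real CARD('n)) (heat_path (cls f) m) x) (1 / 2)"
proof -
  let ?n = "CARD('n)"
  obtain C where C: "0 < C" and est: "\<And>F (x :: real^'n).
    (\<integral>\<^sup>+t\<in>{0<..}. ennreal ((t ^ (4 * m + 4) * mass (ball x t) (sflow F (Suc m) t)
        + t ^ (4 * m + 2) * mass (ball x t) (grad (sflow F m t))) / t ^ (?n + 1)) \<partial>lborel)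
    \<le> ennreal C * area (9 * real ?n) (heat_path F m) x"
    using cone_estimate[of m] unfolding heat_path_def[abs_def] by blast
  define K where "K = 8 * C + 8 * (real m)\<^sup>2"
  have K: "0 < K" using C by (simp add: K_def add_pos_nonneg)
  show ?thesis
  proof (intro exI[of _ K] conjI K ballI allI)
    fix f :: "real^'n \<Rightarrow> complex" and x :: "real^'n" assume f: "f \<in> L2"
    let ?F = "cls f"
    define W where "W t = (t ^ (4 * m + 4) * mass (ball x t) (sflow ?F (Suc m) t)
        + t ^ (4 * m + 2) * mass (ball x t) (grad (sflow ?F m t))) / t ^ (?n + 1)" for t
    define w where "w t = mass (ball x (1 * t)) (heat_path ?F m t) / t ^ (?n + 1)" for t
    have [measurable]: "(\<lambda>t. mass (ball x t) (sflow ?F (Suc m) t)) \<in> borel_measurable borel"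
      "(\<lambda>t. mass (ball x t) (grad (sflow ?F m t))) \<in> borel_measurable borel"
      "(\<lambda>t. mass (ball x t) (heat_path ?F m t)) \<in> borel_measurable borel"
      using mass_line_measurable[OF continuous_sflow, of 1 x ?F "Suc m"] mass_line_measurable[OF continuous_grad_sflow, of 1 x ?F m]
        mass_line_measurable[OF continuous_heat_path, of 1 x ?F m] by simp_all
    have [measurable]: "W \<in> borel_measurable borel" "w \<in> borel_measurable borel"
      unfolding W_def w_def mult_1 by measurable
    have inner: "(\<integral>\<^sup>+y\<in>{y. (y, t) \<in> cone x}. ennreal ((norm (t *\<^sub>R full_gradient (heat_family A T m f) t y))\<^sup>2 / t ^ (?n + 1)) \<partial>lebesgue)
      \<le> ennreal 8 * ennreal (W t) + ennreal (8 * (real m)\<^sup>2) * ennreal (w t)" if t: "0 < t" for t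
    proof -
      let ?u = "heat_family A T m f"
      define k where "k = t\<^sup>2 / t ^ (?n + 1)"
      have k: "0 \<le> k" using t by (simp add: k_def)
      have cone: "{y. (y, t) \<in> cone x} = ball x t" using t by (auto simp: cone_def dist_norm)
      have [measurable]: "ball x t \<in> sets lebesgue" by simp
      note L = weak_gradient_heat_family[OF f t, of m] time_deriv_heat_family[OF f t, of m]
      have [measurable]: "weak_gradient (?u t) \<in> borel_measurable lebesgue" "time_deriv ?u t \<in> borel_measurable lebesgue"
        using L(1,3) by (auto simp: L2_def)
      have "(\<integral>\<^sup>+y\<in>{y. (y, t) \<in> cone x}. ennreal ((norm (t *\<^sub>R full_gradient ?u t y))\<^sup>2 / t ^ (?n + 1)) \<partial>lebesgue) =
        (\<integral>\<^sup>+y. ennreal k * (ennreal ((norm (weak_gradient (?u t) y))\<^sup>2) * indicator (ball x t) y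
          + ennreal ((norm (time_deriv ?u t y))\<^sup>2) * indicator (ball x t) y) \<partial>lebesgue)"
        unfolding cone
      proof (rule nn_integral_cong)
        fix y
        have "(norm (t *\<^sub>R full_gradient ?u t y))\<^sup>2 / t ^ (?n + 1) = k * ((norm (weak_gradient (?u t) y))\<^sup>2 + (norm (time_deriv ?u t y))\<^sup>2)"
          by (simp add: full_gradient_def norm_Pair k_def power_mult_distrib del: scaleR_Pair)
        then show "ennreal ((norm (t *\<^sub>R full_gradient ?u t y))\<^sup>2 / t ^ (?n + 1)) * indicator (ball x t) y =
          ennreal k * (ennreal ((norm (weak_gradient (?u t) y))\<^sup>2) * indicator (ball x t) y
          + ennreal ((norm (time_deriv ?u t y))\<^sup>2) * indicator (ball x t) y)"
          using k by (simp add: ennreal_mult ennreal_plus indicator_def)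
      qed
      also have "\<dots> = ennreal k * (ennreal (mass (ball x t) (cls (weak_gradient (?u t)))) + ennreal (mass (ball x t) (cls (time_deriv ?u t))))"
        by (simp add: nn_integral_cmult nn_integral_add nn_integral_mass_cls[OF _ L(1)] nn_integral_mass_cls[OF _ L(3)])
      also have "\<dots> = ennreal (k * (mass (ball x t) (cls (weak_gradient (?u t))) + mass (ball x t) (cls (time_deriv ?u t))))"
        using k by (simp add: ennreal_mult ennreal_plus)
      also have "\<dots> \<le> ennreal (8 * W t + 8 * (real m)\<^sup>2 * w t)"
      proof (rule ennreal_leI)
        define a where "a = mass (ball x t) (sflow ?F m t)"
        define b where "b = mass (ball x t) (sflow ?F (Suc m) t)"
        define d where "d = mass (ball x t) (grad (sflow ?F m t))"
        have diff: "mass (ball x t) (c *\<^sub>R U - c' *\<^sub>R V) \<le> 2 * (c\<^sup>2 * mass (ball x t) U) + 2 * (c'\<^sup>2 * mass (ball x t) V)"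
          for c c' and U V :: "('n, complex) l2"
          using mass_diff_le[of "ball x t" "c *\<^sub>R U" "c' *\<^sub>R V"] by (simp add: mass_scaleR)
        have "mass (ball x t) (cls (time_deriv ?u t)) \<le> 2 * ((2 * real m * t ^ (2 * m - 1))\<^sup>2 * a) + 2 * ((2 * t ^ (2 * m + 1))\<^sup>2 * b)"
          unfolding L(4) a_def b_def by (rule diff)
        also have "\<dots> = 8 * (real m)\<^sup>2 * (t ^ (2 * m - 1))\<^sup>2 * a + 8 * (t ^ (2 * m + 1))\<^sup>2 * b"
          by (simp add: power_mult_distrib)
        finally have "mass (ball x t) (cls (weak_gradient (?u t))) + mass (ball x t) (cls (time_deriv ?u t))
            \<le> (t ^ (2 * m))\<^sup>2 * d + (8 * (real m)\<^sup>2 * (t ^ (2 * m - 1))\<^sup>2 * a + 8 * (t ^ (2 * m + 1))\<^sup>2 * b)"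
          by (simp add: L(2) mass_scaleR d_def)
        then have "k * (mass (ball x t) (cls (weak_gradient (?u t))) + mass (ball x t) (cls (time_deriv ?u t)))
            \<le> k * ((t ^ (2 * m))\<^sup>2 * d + (8 * (real m)\<^sup>2 * (t ^ (2 * m - 1))\<^sup>2 * a + 8 * (t ^ (2 * m + 1))\<^sup>2 * b))"
          using k by (rule mult_left_mono)
        also have "\<dots> = (t\<^sup>2 * (t ^ (2 * m))\<^sup>2 * d + 8 * ((real m)\<^sup>2 * (t\<^sup>2 * (t ^ (2 * m - 1))\<^sup>2)) * a + 8 * (t\<^sup>2 * (t ^ (2 * m + 1))\<^sup>2) * b) / t ^ (?n + 1)"
          by (simp add: k_def algebra_simps add_divide_distrib)
        \<comment> \<open>For m = 0 the truncated exponent 2 m - 1 is 0 and the powers of t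
          disagree, but the factor m^2 vanishes.\<close>
        also have "(real m)\<^sup>2 * (t\<^sup>2 * (t ^ (2 * m - 1))\<^sup>2) = (real m)\<^sup>2 * (t ^ (2 * m))\<^sup>2"
          by (cases m) (simp_all add: power2_eq_square mult_ac)
        also have "t\<^sup>2 * (t ^ (2 * m + 1))\<^sup>2 = t ^ (4 * m + 4)"
          unfolding power_mult[symmetric] power_add[symmetric] by (rule arg_cong[where f = "power t"]) simp
        also have "t\<^sup>2 * (t ^ (2 * m))\<^sup>2 = t ^ (4 * m + 2)"
          unfolding power_mult[symmetric] power_add[symmetric] by (rule arg_cong[where f = "power t"]) simp
        also have "(t ^ (4 * m + 2) * d + 8 * ((real m)\<^sup>2 * (t ^ (2 * m))\<^sup>2) * a + 8 * t ^ (4 * m + 4) * b) / t ^ (?n + 1)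
            \<le> (8 * (t ^ (4 * m + 4) * b + t ^ (4 * m + 2) * d) + 8 * (real m)\<^sup>2 * ((t ^ (2 * m))\<^sup>2 * a)) / t ^ (?n + 1)"
        proof (rule divide_right_mono)
          have "0 \<le> t ^ (4 * m + 2) * d" using t by (simp add: d_def)
          then show "t ^ (4 * m + 2) * d + 8 * ((real m)\<^sup>2 * (t ^ (2 * m))\<^sup>2) * a + 8 * t ^ (4 * m + 4) * b
            \<le> 8 * (t ^ (4 * m + 4) * b + t ^ (4 * m + 2) * d) + 8 * (real m)\<^sup>2 * ((t ^ (2 * m))\<^sup>2 * a)"
            by (simp only: distrib_left mult.assoc)
        qed (use t in simp)
        also have "\<dots> = 8 * W t + 8 * (real m)\<^sup>2 * w t"
        proof -
          have "mass (ball x (1 * t)) (heat_path ?F m t) = (t ^ (2 * m))\<^sup>2 * a"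
            unfolding heat_path_def a_def by (subst mass_scaleR) simp_all
          then show ?thesis
            unfolding W_def w_def a_def b_def d_def by (simp only: add_divide_distrib distrib_left times_divide_eq_right)
        qed
        finally show "k * (mass (ball x t) (cls (weak_gradient (?u t))) + mass (ball x t) (cls (time_deriv ?u t)))
            \<le> 8 * W t + 8 * (real m)\<^sup>2 * w t" .
      qed
      also have "\<dots> = ennreal 8 * ennreal (W t) + ennreal (8 * (real m)\<^sup>2) * ennreal (w t)"
      proof -
        have "0 \<le> W t" "0 \<le> w t" using t by (auto simp: W_def w_def)
        then show ?thesis by (simp add: ennreal_plus ennreal_mult)
      qed
      finally show ?thesis .
    qed
    \<comment> \<open>Monotonicity requires no measurability in t of the left side, where
      representatives are chosen for each t; the majorant is Borel, so additivity and constants are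
      handled there.\<close>
    have "(\<integral>\<^sup>+t\<in>{0<..}. (\<integral>\<^sup>+y\<in>{y. (y, t) \<in> cone x}.
          ennreal ((norm (t *\<^sub>R full_gradient (heat_family A T m f) t y))\<^sup>2 / t ^ (?n + 1)) \<partial>lebesgue) \<partial>lebesgue)
      \<le> (\<integral>\<^sup>+t. ennreal 8 * (ennreal (W t) * indicator {0<..} t) + ennreal (8 * (real m)\<^sup>2) * (ennreal (w t) * indicator {0<..} t) \<partial>lebesgue)"
    proof (rule nn_integral_mono)
      fix t :: real
      show "(\<integral>\<^sup>+y\<in>{y. (y, t) \<in> cone x}. ennreal ((norm (t *\<^sub>R full_gradient (heat_family A T m f) t y))\<^sup>2 / t ^ (?n + 1)) \<partial>lebesgue) * indicator {0<..} t
        \<le> ennreal 8 * (ennreal (W t) * indicator {0<..} t) + ennreal (8 * (real m)\<^sup>2) * (ennreal (w t) * indicator {0<..} t)"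
        using inner[of t] by (cases "0 < t") simp_all
    qed
    also have "\<dots> = (\<integral>\<^sup>+t. ennreal 8 * (ennreal (W t) * indicator {0<..} t) + ennreal (8 * (real m)\<^sup>2) * (ennreal (w t) * indicator {0<..} t) \<partial>lborel)"
      by (rule nn_integral_completion)
    also have "\<dots> = ennreal 8 * (\<integral>\<^sup>+t\<in>{0<..}. ennreal (W t) \<partial>lborel) + ennreal (8 * (real m)\<^sup>2) * (\<integral>\<^sup>+t\<in>{0<..}. ennreal (w t) \<partial>lborel)"
      by (subst nn_integral_add) (simp_all add: nn_integral_cmult)
    also have "\<dots> \<le> ennreal 8 * (ennreal C * area (9 * real ?n) (heat_path ?F m) x) + ennreal (8 * (real m)\<^sup>2) * area (9 * real ?n) (heat_path ?F m) x"
    proof (intro add_mono mult_left_mono)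
      show "(\<integral>\<^sup>+t\<in>{0<..}. ennreal (W t) \<partial>lborel) \<le> ennreal C * area (9 * real ?n) (heat_path ?F m) x"
        unfolding W_def by (rule est)
      have "1 \<le> 9 * real ?n" using zero_less_card_finite[where 'a='n] by linarith
      from area_mono_aperture[OF this, of "heat_path ?F m" x]
      show "(\<integral>\<^sup>+t\<in>{0<..}. ennreal (w t) \<partial>lborel) \<le> area (9 * real ?n) (heat_path ?F m) x"
        by (simp only: w_def area_def[of 1])
    qed auto
    also have "\<dots> = ennreal K * area (9 * real ?n) (heat_path ?F m) x"
    proof -
      have "ennreal K = ennreal 8 * ennreal C + ennreal (8 * (real m)\<^sup>2)"
        unfolding K_def using C ennreal_mult[of 8 C] by (simp add: ennreal_plus)
      then show ?thesis by (simp only: distrib_right mult.assoc)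
    qed
    finally show "G_full_H A T m f x \<le> ennreal_powr (ennreal K * area (9 * real ?n) (heat_path ?F m) x) (1 / 2)"
      unfolding G_full_H_def conical_def by (rule ennreal_powr_mono) simp
  qed
qed

text \<open>Shared by both norm inequalities: Q is the square function of level m + 1 in one case
  and the full gradient one of level m in the other.\<close>

lemma weighted_step:
  assumes w: "w \<in> A_infinity" and p: "0 < p"
    and Q: "\<exists>C>0. \<forall>f\<in>L2. \<forall>x. Q f x \<le> ennreal_powr (ennreal C * area (9 * real CARD('n)) (heat_path (cls f) m) x) (1 / 2)"
  shows "\<exists>C>0. \<forall>f\<in>L2. weighted_norm p w (Q f) \<le> ennreal C * weighted_norm p w (S_H A T m f)"
proof -
  obtain K where K: "0 < K"
    and le: "\<And>f x. f \<in> L2 \<Longrightarrow> Q f x \<le> ennreal_powr (ennreal K * area (9 * real CARD('n)) (heat_path (cls f) m) x) (1 / 2)"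
    using Q by blast
  have "1 \<le> 9 * real CARD('n)" using zero_less_card_finite[where 'a='n] by linarith
  from weighted_area_le[OF w p this K] obtain C where C: "0 < C"
    and wa: "\<And>H :: real \<Rightarrow> ('n, complex) l2. continuous_on {0<..} H \<Longrightarrow>
    weighted_norm p w (\<lambda>x. ennreal_powr (ennreal K * area (9 * real CARD('n)) H x) (1 / 2))
      \<le> ennreal C * weighted_norm p w (\<lambda>x. ennreal_powr (area 1 H x) (1 / 2))" by blast
  show ?thesis
  proof (intro exI[of _ C] conjI C ballI)
    fix f :: "real^'n \<Rightarrow> complex" assume f: "f \<in> L2"
    have "weighted_norm p w (Q f) \<le> weighted_norm p w (\<lambda>x. ennreal_powr (ennreal K * area (9 * real CARD('n)) (heat_path (cls f) m) x) (1 / 2))"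
      by (rule weighted_norm_mono[OF le[OF f] p])
    also have "\<dots> \<le> ennreal C * weighted_norm p w (\<lambda>x. ennreal_powr (area 1 (heat_path (cls f) m) x) (1 / 2))"
      by (rule wa[OF continuous_heat_path])
    finally show "weighted_norm p w (Q f) \<le> ennreal C * weighted_norm p w (S_H A T m f)"
      by (simp only: S_H_area[OF f])
  qed
qed

lemma weighted_trans:
  assumes "\<exists>C>0. \<forall>f\<in>X. a f \<le> ennreal C * b f" "\<exists>C>0. \<forall>f\<in>X. b f \<le> ennreal C * c f"
  shows "\<exists>C>0. \<forall>f\<in>X. a f \<le> ennreal C * c f"
proof -
  obtain C C' where C: "0 < C" "0 < C'" and ab: "\<And>f. f \<in> X \<Longrightarrow> a f \<le> ennreal C * b f"
    and bc: "\<And>f. f \<in> X \<Longrightarrow> b f \<le> ennreal C' * c f"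
    using assms by blast
  have e: "ennreal (C * C') = ennreal C * ennreal C'" using C by (intro ennreal_mult) auto
  show ?thesis
  proof (intro exI[of _ "C * C'"] conjI ballI)
    fix f assume f: "f \<in> X"
    have "a f \<le> ennreal C * (ennreal C' * c f)"
      by (rule order_trans[OF ab[OF f] mult_left_mono[OF bc[OF f]]]) simp
    then show "a f \<le> ennreal (C * C') * c f" unfolding e by (simp only: mult.assoc)
  qed (use C in simp)
qed

lemma weighted_S_H:
  assumes w: "w \<in> A_infinity" and p: "0 < p" and m: "1 \<le> m"
  shows "\<exists>C>0. \<forall>f\<in>L2. weighted_norm p w (S_H A T m f) \<le> ennreal C * weighted_norm p w (S_H A T 1 f)"
  using m
proof (induction m rule: nat_induct_at_least)
  case base
  show ?case by (rule exI[of _ 1]) simp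
next
  case (Suc m)
  show ?case by (rule weighted_trans[OF weighted_step[OF w p S_H_Suc_le] Suc.IH])
qed

lemma weighted_G_full_H:
  assumes w: "w \<in> A_infinity" and p: "0 < p" and m: "1 \<le> m"
  shows "\<exists>C>0. \<forall>f\<in>L2. weighted_norm p w (G_full_H A T m f) \<le> ennreal C * weighted_norm p w (S_H A T 1 f)"
  by (rule weighted_trans[OF weighted_step[OF w p G_full_H_le] weighted_S_H[OF w p m]])

end

text \<open>For \<open>t \<le> 0\<close> the slice of the cone is empty; there \<open>t ^ (n + 1)\<close> need not be positive.\<close>

lemma G_H_le_G_full_H:
  fixes A :: "real^'n \<Rightarrow> complex^'n^'n"
  shows "G_H A T m f x \<le> G_full_H A T m f x"
  unfolding G_H_def G_full_H_def conical_def
proof (intro ennreal_powr_mono nn_integral_mono)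
  fix t :: real
  let ?g = "\<lambda>y. t *\<^sub>R weak_gradient (heat_family A T m f t) y"
  let ?G = "\<lambda>y. t *\<^sub>R full_gradient (heat_family A T m f) t y"
  show "(\<integral>\<^sup>+y\<in>{y. (y, t) \<in> cone x}. ennreal ((norm (?g y))\<^sup>2 / t ^ (CARD('n) + 1)) \<partial>lebesgue) * indicator {0<..} t
    \<le> (\<integral>\<^sup>+y\<in>{y. (y, t) \<in> cone x}. ennreal ((norm (?G y))\<^sup>2 / t ^ (CARD('n) + 1)) \<partial>lebesgue) * indicator {0<..} t"
  proof (cases "0 < t")
    case True
    have "norm (?g y) \<le> norm (?G y)" for y
      using norm_fst_le[of "?g y" "t *\<^sub>R time_deriv (heat_family A T m f) t y"] by (simp add: full_gradient_def)
    then show ?thesis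
      using True by (intro mult_right_mono nn_integral_mono ennreal_leI divide_right_mono power_mono) auto
  qed simp
qed simp

theorem theorem1p14:
  fixes A :: "real^'n \<Rightarrow> complex^'n^'n"
    and T :: "real \<Rightarrow> (real^'n \<Rightarrow> complex) \<Rightarrow> real^'n \<Rightarrow> complex"
  assumes "elliptic A"
    and "heat_semigroup A T"
  shows "(\<forall>f\<in>L2. \<forall>m x. G_H A T m f x \<le> G_full_H A T m f x) \<and>
    (\<forall>m\<ge>1. \<forall>w\<in>A_infinity. \<forall>p>0. \<exists>C>0. \<forall>f\<in>L2.
       weighted_norm p w (S_H A T m f) \<le> ennreal C * weighted_norm p w (S_H A T 1 f)) \<and>
    (\<forall>m\<ge>1. \<forall>w\<in>A_infinity. \<forall>p>0. \<exists>C>0. \<forall>f\<in>L2.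
       weighted_norm p w (G_full_H A T m f) \<le> ennreal C * weighted_norm p w (S_H A T 1 f))"
proof -
  obtain l M where "heat A T l M" using heat_exists[OF assms] .
  then interpret heat A T l M .
  show ?thesis
    by (intro conjI ballI allI impI G_H_le_G_full_H weighted_S_H weighted_G_full_H)
qed

end
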